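(* Assume the Generalized Riemann Hypothesis (GRH). Fix $\delta\in(0,\frac{1}{100})$. Let $X$ be a sufficiently large number and let $N$ be any positive number satisfying $$\exp\big((\log X)^{\frac12+\delta}\big)\le N\le X^{\frac14-\delta}.$$ Then for all $f\in\mathcal{F}$, $$\max_{\substack{X<|d|\le 2X\\ d\in\mathcal{D}}}\Big|\sum_{n\le N}f(n)\chi_d(n)\Big|\ \ge\ \sqrt{N}\,\exp\left(\Big(\frac{\sqrt2}{2}+o(1)\Big)\sqrt{\frac{\log (X/N^4)}{\log\log (X/N^4)}}\right),$$ where $o(1)$ denotes a quantity tending to $0$ as $X\to\infty$ (with $\delta$ fixed), uniformly in $N$ in the stated range and in $f\in\mathcal{F}$.
   Context: $\mathcal{D}$ is the set of all fundamental discriminants $d\in\mathbb{Z}$ (positive and negative), and for $d\in\mathcal{D}$, $\chi_d=\left(\frac{d}{\cdot}\right)$ is the real primitive character (Kronecker symbol) associated to $d$. $\mathcal{F}$ is the set of all completely multiplicative functions $f:\mathbb{N}\to\mathbb{C}$ such that $|f(k)|=1$ for all $k\in\mathbb{N}$, and $\mathrm{Re}\big(f(n)\overline{f(m)}\big)\ge 0$ for all $m,n\in\mathbb{N}$ whose product $mn$ is a perfect square. GRH is the assertion that, for every Dirichlet character $\chi$, all zeros of the Dirichlet $L$-function $L(s,\chi)$ in the strip $0<\mathrm{Re}(s)<1$ lie on the line $\mathrm{Re}(s)=\frac12$. *)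

theory Defs
  imports
    "HOL-Complex_Analysis.Complex_Analysis"
    "HOL-Number_Theory.Number_Theory"
    "HOL-Computational_Algebra.Squarefree"
    "HOL-Computational_Algebra.Nth_Powers"
begin

(* The trivial discriminant 1 is included. *)
definition fundamental_discriminant :: "int \<Rightarrow> bool" where
  "fundamental_discriminant d \<longleftrightarrow>
     (d mod 4 = 1 \<and> squarefree d) \<or>
     (\<exists>m. d = 4 * m \<and> m mod 4 \<in> {2, 3} \<and> squarefree m)"

definition kronecker_prime :: "int \<Rightarrow> nat \<Rightarrow> int" where
  "kronecker_prime d p =
     (if p = 2 then (if even d then 0 else if d mod 8 \<in> {1, 7} then 1 else -1)
      else Legendre d (int p))"

(* The Kronecker symbol (d/n), for non-negative n only. *)
definition kronecker :: "int \<Rightarrow> nat \<Rightarrow> int" where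
  "kronecker d n =
     (if n = 0 then (if \<bar>d\<bar> = 1 then 1 else 0)
      else (\<Prod>p\<in>prime_factors n. kronecker_prime d p ^ multiplicity p n))"

(* The positive integers are the intended domain of f; the value f 0 is unconstrained. *)
definition completely_multiplicative :: "(nat \<Rightarrow> complex) \<Rightarrow> bool" where
  "completely_multiplicative f \<longleftrightarrow>
     f 1 = 1 \<and> (\<forall>m>0. \<forall>n>0. f (m * n) = f m * f n)"

definition class_F :: "(nat \<Rightarrow> complex) set" where
  "class_F = {f. completely_multiplicative f \<and>
     (\<forall>k>0. cmod (f k) = 1) \<and>
     (\<forall>m>0. \<forall>n>0. is_square (m * n) \<longrightarrow> Re (f n * cnj (f m)) \<ge> 0)}"

definition dirichlet_character :: "nat \<Rightarrow> (nat \<Rightarrow> complex) \<Rightarrow> bool" where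
  "dirichlet_character q chi \<longleftrightarrow> q > 0 \<and>
     (\<forall>n. chi (n + q) = chi n) \<and>
     (\<forall>m n. chi (m * n) = chi m * chi n) \<and>
     (\<forall>n. chi n \<noteq> 0 \<longleftrightarrow> coprime n q)"

definition principal_character :: "nat \<Rightarrow> nat \<Rightarrow> complex" where
  "principal_character q n = (if coprime n q then 1 else 0)"

(* L(s, chi) is the analytic continuation of the Dirichlet series: to the whole plane if chi is
   not principal, and to the plane without the pole s = 1 otherwise.  The identity theorem makes
   it unique, apart from the junk value at s = 1 for principal chi. *)
definition is_dirichlet_L :: "nat \<Rightarrow> (nat \<Rightarrow> complex) \<Rightarrow> (complex \<Rightarrow> complex) \<Rightarrow> bool" where
  "is_dirichlet_L q chi L \<longleftrightarrow>
     L holomorphic_on (if chi = principal_character q then - {1} else UNIV) \<and>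
     (\<forall>s. Re s > 1 \<longrightarrow> (\<lambda>n. chi (Suc n) / of_nat (Suc n) powr s) sums L s)"

definition dirichlet_L :: "nat \<Rightarrow> (nat \<Rightarrow> complex) \<Rightarrow> complex \<Rightarrow> complex" where
  "dirichlet_L q chi = (SOME L. is_dirichlet_L q chi L)"

definition GRH :: bool where
  "GRH \<longleftrightarrow> (\<forall>q chi. dirichlet_character q chi \<longrightarrow>
     (\<forall>s. 0 < Re s \<and> Re s < 1 \<and> dirichlet_L q chi s = 0 \<longrightarrow> Re s = 1 / 2))"

end

theory Submission
  imports Defs "HOL-Real_Asymp.Real_Asymp"
begin

text \<open>
  Resonance over the discriminants \<open>8 p\<close>, \<open>p\<close> a prime in \<open>(X/8, X/4]\<close>. Let \<open>S\<^sub>p\<close> be the character sum and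
  \<open>R\<^sub>p = \<Sum> r(a) f(a) \<chi>\<^sub>8\<^sub>p(a)\<close> a resonator twisted by \<open>f\<close>. With nonnegative weights on the primes, the
  maximum of \<open>\<bar>S\<^sub>p\<bar>\<^sup>2\<close> is at least the ratio of the means of \<open>\<bar>R\<^sub>p S\<^sub>p\<bar>\<^sup>2\<close> and \<open>\<bar>R\<^sub>p\<bar>\<^sup>2\<close>. In both means the terms in which the
  argument of the character is a square survive; by the sign condition in the definition of the class of \<open>f\<close>
  they may be restricted to \<open>a n = b m\<close>, which leaves a GCD sum in \<open>r\<close>. For \<open>r(p) = \<lambda> / (\<surd>p ln p)\<close> this sum has
  the required size.

  The remaining terms are small by GRH. The weight of \<open>p\<close> is \<open>(ln p)\<^sup>k p powr (-\<sigma>)\<close> with \<open>\<sigma>\<close> near \<open>1\<close> and \<open>k\<close> large enough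
  to localise \<open>p\<close> in a dyadic interval: the sum over \<open>p\<close> is then essentially the \<open>k\<close>-th Taylor coefficient of
  \<open>log L(s, \<chi>)\<close> at \<open>\<sigma>\<close>. Under GRH the logarithm is holomorphic in the disc of radius \<open>\<sigma> - 1/2\<close>, so Borel-Caratheodory
  and Cauchy's estimate give square-root cancellation without contour integration.
\<close>

section \<open>Estimates for primes\<close>

text \<open>The nonsquare terms cost \<open>E\<close> M N^2 against a main term of size N, where
  \<open>E\<close>, about X^(-1/2), is the bound from GRH. So M N must stay below X^(1/2 - o(1)),
  and the resonator is given length M = exp l with l close to (1/2) ln (X/N^4). The GCD sum gains
  exp((2 - o(1)) sqrt(l / ln l)) in the mean square. Passing to the maximum halves the exponent, and
  l brings in sqrt(1/2): this is the constant sqrt(2)/2. The factor 8 makes 8p fundamental for every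
  odd p and kills even arguments. Since p exceeds M and N, the symbol at a surviving square is
  exactly 1. The symbol is read as a character of p modulo its odd lower argument, and this modulus
  enters only through its logarithm. The primes of the resonator lie in (l ln l, exp((ln l)^2)],
  where 1/(p ln p) sums to about 1/ln l; \<lambda> = (1 - \<eta>) sqrt(l ln l) puts the typical ln
  a, about \<lambda>^2 / ln l, just below l. Counting solutions of a n = b m in a box is efficient
  only if a and b are of comparable size. Positivity of the GCD kernel allows a restriction to such
  pairs at the price of a factor l.\<close>

definition chebyshev_psi :: "nat \<Rightarrow> real" where "chebyshev_psi n = (\<Sum>d=1..n. mangoldt d)"

lemma ln_fact_mangoldt: "ln (fact n) = (\<Sum>d=1..n. mangoldt d * real (n div d))"
proof (induction n)
  case (Suc n)
  have div_Suc': "real (Suc n div d) = real (n div d) + (if d dvd Suc n then 1 else 0)" if "d \<ge> 1" for d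
    by (simp add: div_Suc dvd_eq_mod_eq_0)
  have "(\<Sum>d=1..Suc n. mangoldt d * real (Suc n div d)) =
        (\<Sum>d=1..Suc n. mangoldt d * real (n div d)) + (\<Sum>d=1..Suc n. if d dvd Suc n then mangoldt d else 0)"
    unfolding sum.distrib[symmetric] by (intro sum.cong refl) (subst div_Suc', auto simp: algebra_simps)
  also have "(\<Sum>d=1..Suc n. mangoldt d * real (n div d)) = ln (fact n)"
    by (simp add: Suc)
  also have "(\<Sum>d=1..Suc n. if d dvd Suc n then mangoldt d else 0) = (\<Sum>d | d dvd Suc n. mangoldt d :: real)"
  proof (intro sum.mono_neutral_cong_right)
    show "{d. d dvd Suc n} \<subseteq> {1..Suc n}" using dvd_imp_le[of _ "Suc n"] by (force intro: Nat.gr0I)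
  qed auto
  also have "\<dots> = ln (real (Suc n))" by (subst mangoldt_sum) auto
  also have "ln (fact n) + ln (real (Suc n)) = ln (fact (Suc n) :: real)"
    by (simp add: ln_mult del: of_nat_Suc)
  finally show ?case by simp
qed simp

lemma ln_fact_mangoldt_le:
  assumes "m \<le> n" shows "ln (fact m) = (\<Sum>d=1..n. mangoldt d * real (m div d))"
  unfolding ln_fact_mangoldt using assms by (intro sum.mono_neutral_left) auto

lemma chebyshev_psi_split: "m \<le> n \<Longrightarrow> chebyshev_psi n = chebyshev_psi m + (\<Sum>d\<in>{m<..n}. mangoldt d)"
  unfolding chebyshev_psi_def
  by (subst sum.union_disjoint[symmetric]) (auto intro!: sum.cong)

lemma fact_double: "(fact (2 * n) :: real) = real ((2 * n) choose n) * (fact n * fact n)"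
proof -
  have "real (fact n * fact (2 * n - n) * ((2 * n) choose n)) = real (fact (2 * n))"
    by (subst binomial_fact_lemma) auto
  moreover have "2 * n - n = n" by simp
  ultimately show ?thesis by (simp only: of_nat_mult of_nat_fact mult_ac)
qed

text \<open>Compare n! with the square of (n div 2)!. In \<open>ln_fact_mangoldt\<close> the
  coefficient n div d - 2 (m div d) is nonnegative, and it is at least 1 for m < d <= n. The
  quotient of the factorials is a central binomial coefficient, times n when n is odd.\<close>

lemma chebyshev_psi_halve:
  assumes "n \<ge> 1"
  shows "chebyshev_psi n - chebyshev_psi (n div 2) \<le> real n * ln 2 + ln (real n)"
proof -
  define m where "m = n div 2"
  have mn: "m \<le> n" by (simp add: m_def)
  have "chebyshev_psi n - chebyshev_psi m = (\<Sum>d\<in>{m<..n}. mangoldt d)" using chebyshev_psi_split[OF mn] by simp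
  also have "\<dots> = (\<Sum>d=1..n. if d > m then mangoldt d else 0)"
    by (intro sum.mono_neutral_cong_left) auto
  also have "\<dots> \<le> (\<Sum>d=1..n. mangoldt d * (real (n div d) - 2 * real (m div d)))"
  proof (intro sum_mono)
    fix d assume d: "d \<in> {1..n}"
    show "(if d > m then mangoldt d else 0) \<le> mangoldt d * (real (n div d) - 2 * real (m div d))"
    proof (cases "d > m")
      case True
      have "n div d \<ge> 1" using d by (simp add: Suc_le_eq div_greater_zero_iff)
      then have "mangoldt d * 1 \<le> mangoldt d * real (n div d)"
        by (intro mult_left_mono mangoldt_nonneg) auto
      then show ?thesis using True by simp
    next
      case False
      have "2 * (m div d) \<le> n div d"
      proof -
        have "m div d * d \<le> m" by simp
        then have "(2 * (m div d)) * d \<le> n" unfolding m_def by linarith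
        then show ?thesis using d by (simp add: less_eq_div_iff_mult_less_eq)
      qed
      then have "real (n div d) - 2 * real (m div d) \<ge> 0" by linarith
      then show ?thesis using False mangoldt_nonneg[of d] by auto
    qed
  qed
  also have "\<dots> = ln (fact n) - 2 * ln (fact m)"
    unfolding ln_fact_mangoldt[of n] ln_fact_mangoldt_le[OF mn]
    by (simp add: algebra_simps sum_subtractf sum_distrib_left)
  also have "\<dots> \<le> real n * ln 2 + ln (real n)"
  proof -
    have "fact n \<le> (2::real) ^ n * real n * (fact m * fact m)"
    proof (cases "even n")
      case True
      then have n: "n = 2 * m" by (simp add: m_def)
      have "(fact n :: real) = real (n choose m) * (fact m * fact m)"
        unfolding n by (rule fact_double)
      also have "\<dots> \<le> (2 ^ n * real n) * (fact m * fact m)"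
      proof (intro mult_right_mono)
        have "real (n choose m) \<le> 2 ^ n" using binomial_le_pow2[of n m] by (metis of_nat_le_iff of_nat_numeral of_nat_power)
        also have "\<dots> \<le> 2 ^ n * real n" using assms by simp
        finally show "real (n choose m) \<le> 2 ^ n * real n" .
      qed auto
      finally show ?thesis .
    next
      case False
      then have n: "n = 2 * m + 1" unfolding m_def by presburger
      have "(fact (2*m) :: real) = real ((2*m) choose m) * (fact m * fact m)"
        by (rule fact_double)
      then have "(fact n :: real) = real n * real ((2*m) choose m) * (fact m * fact m)"
        unfolding n by (simp add: algebra_simps)
      also have "\<dots> \<le> (2 ^ n * real n) * (fact m * fact m)"
      proof (intro mult_right_mono)
        have "real ((2*m) choose m) \<le> 2 ^ (2*m)" using binomial_le_pow2[of "2*m" m] by (metis of_nat_le_iff of_nat_numeral of_nat_power)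
        also have "\<dots> \<le> 2 ^ n" unfolding n by simp
        finally have "real n * real ((2*m) choose m) \<le> real n * 2 ^ n" by (intro mult_left_mono) auto
        then show "real n * real ((2*m) choose m) \<le> 2 ^ n * real n" by (simp add: mult.commute)
      qed auto
      finally show ?thesis .
    qed
    then have "ln (fact n) \<le> ln ((2::real) ^ n * real n * (fact m * fact m))"
      using assms by (subst ln_le_cancel_iff) auto
    also have "\<dots> = real n * ln 2 + ln (real n) + 2 * ln (fact m)"
      using assms by (simp add: ln_mult ln_realpow)
    finally show ?thesis by simp
  qed
  finally show ?thesis unfolding m_def .
qed

text \<open>Iterate the halving step. The linear terms form a geometric series with sum 2 n ln 2,
  and the logarithms, one for each halving, add up to a multiple of (ln n)^2.\<close>

lemma chebyshev_psi_le: "n \<ge> 1 \<Longrightarrow> chebyshev_psi n \<le> 2 * ln 2 * real n + 2 * (ln (real n))\<^sup>2"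
proof (induction n rule: less_induct)
  case (less n)
  show ?case
  proof (cases "n = 1")
    case True
    then show ?thesis by (simp add: chebyshev_psi_def)
  next
    case False
    with less.prems have n: "n \<ge> 2" by simp
    have "n div 2 \<ge> 1" using n by simp
    have l2: "ln (2::real) \<ge> 1/2" using ln2_ge_two_thirds by linarith
    have "chebyshev_psi n \<le> chebyshev_psi (n div 2) + real n * ln 2 + ln (real n)" using chebyshev_psi_halve[of n] n by simp
    also have "chebyshev_psi (n div 2) \<le> 2 * ln 2 * real (n div 2) + 2 * (ln (real (n div 2)))\<^sup>2"
      using less.IH[of "n div 2"] n by auto
    also have "2 * ln 2 * real (n div 2) \<le> ln 2 * real n"
      using l2 by simp
    also have "(ln (real (n div 2)))\<^sup>2 \<le> (ln (real n / 2))\<^sup>2"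
      using n \<open>n div 2 \<ge> 1\<close> by (intro power_mono ln_mono) auto
    also have "ln (real n / 2) = ln (real n) - ln 2" using n by (simp add: ln_div)
    finally have *: "chebyshev_psi n \<le> ln 2 * real n + 2 * (ln (real n) - ln 2)\<^sup>2 + real n * ln 2 + ln (real n)" by simp
    have "ln (real n) \<ge> ln 2" using n by simp
    then have "2 * ln 2 * (2 * ln (real n) - ln 2) \<ge> 2 * (1/2) * ln (real n)"
      using l2 by (intro mult_mono) auto
    then have "2 * (ln (real n) - ln 2)\<^sup>2 + ln (real n) \<le> 2 * (ln (real n))\<^sup>2"
      by (simp add: power2_eq_square algebra_simps)
    with * show ?thesis by (simp add: algebra_simps)
  qed
qed

text \<open>The coefficient (2n) div d - 2 (n div d) is at most 1 and vanishes for 2n/3 < d <= n,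
  where the two quotients are 2 and 1. So the central binomial coefficient is controlled by the
  prime powers above n together with \<open>chebyshev_psi\<close> at 2n/3; the upper bound for the
  latter leaves (2 - 4/3) n ln 2.\<close>

lemma chebyshev_psi_double_lower:
  assumes "n \<ge> 1"
  shows "chebyshev_psi (2 * n) - chebyshev_psi n \<ge> 2 / 3 * ln 2 * real n - ln (2 * real n) - 2 * (ln (2 * real n))\<^sup>2"
proof -
  have "ln (fact (2 * n)) - 2 * ln (fact n) = (\<Sum>d=1..2*n. mangoldt d * (real ((2*n) div d) - 2 * real (n div d)))"
    unfolding ln_fact_mangoldt[of "2*n"] ln_fact_mangoldt_le[of n "2*n", simplified]
    by (simp add: algebra_simps sum_subtractf sum_distrib_left)
  also have "\<dots> \<le> (\<Sum>d=1..2*n. (if d > n then mangoldt d else 0) + (if d \<le> 2 * n div 3 then mangoldt d else 0))"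
  proof (intro sum_mono)
    fix d assume d: "d \<in> {1..2*n}"
    have "(2*n) div d \<le> 2 * (n div d) + 1"
    proof -
      have "n < (n div d) * d + d" using d by (metis atLeastAtMost_iff dividend_less_times_div less_le_trans mult.commute zero_less_one add.commute)
      then have "2 * n < (2 * (n div d) + 2) * d" by (simp add: algebra_simps)
      then show ?thesis using less_mult_imp_div_less[of "2*n" "2 * (n div d) + 2" d] by simp
    qed
    then have le1: "real ((2*n) div d) - 2 * real (n div d) \<le> 1" by linarith
    show "mangoldt d * (real ((2*n) div d) - 2 * real (n div d)) \<le> (if d > n then mangoldt d else 0) + (if d \<le> 2 * n div 3 then mangoldt d else 0)"
    proof (cases "d > n \<or> d \<le> 2 * n div 3")
      case True
      have "mangoldt d * (real ((2*n) div d) - 2 * real (n div d)) \<le> mangoldt d"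
        using le1 mangoldt_nonneg[of d] by (metis mult.right_neutral mult_left_mono)
      then show ?thesis using True mangoldt_nonneg[of d] by auto
    next
      case False
      then have "2 * n < 3 * d" "d \<le> n" by auto
      then have "(2 * n) div d = 2" "n div d = 1"
        by (auto intro!: div_nat_eqI)
      then show ?thesis using False by simp
    qed
  qed
  also have "\<dots> = (\<Sum>d=1..2*n. if d > n then mangoldt d else 0) + (\<Sum>d=1..2*n. if d \<le> 2 * n div 3 then mangoldt d else 0)"
    by (simp add: sum.distrib)
  also have "(\<Sum>d=1..2*n. if d > n then mangoldt d else 0) = (\<Sum>d\<in>{n<..2*n}. mangoldt d :: real)"
    by (intro sum.mono_neutral_cong_right) auto
  also have "\<dots> = chebyshev_psi (2*n) - chebyshev_psi n" using chebyshev_psi_split[of n "2*n"] by simp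
  also have "(\<Sum>d=1..2*n. if d \<le> 2 * n div 3 then mangoldt d else 0) = chebyshev_psi (2 * n div 3)"
    unfolding chebyshev_psi_def by (intro sum.mono_neutral_cong_right) auto
  also have "chebyshev_psi (2 * n div 3) \<le> 4 / 3 * ln 2 * real n + 2 * (ln (2 * real n))\<^sup>2"
  proof (cases "2 * n div 3 \<ge> 1")
    case True
    have "3 * (2 * n div 3) \<le> 2 * n" by simp
    then have div3: "3 * real (2 * n div 3) \<le> 2 * real n"
      by (metis of_nat_le_iff of_nat_mult of_nat_numeral)
    have "chebyshev_psi (2 * n div 3) \<le> 2 * ln 2 * real (2 * n div 3) + 2 * (ln (real (2 * n div 3)))\<^sup>2"
      using chebyshev_psi_le[OF True] .
    also have "2 * ln 2 * real (2 * n div 3) \<le> 2 * ln 2 * (2 * real n / 3)" using div3 by simp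
    also have "(ln (real (2 * n div 3)))\<^sup>2 \<le> (ln (2 * real n))\<^sup>2"
    proof (intro power_mono ln_mono)
      show "real (2 * n div 3) \<le> 2 * real n" using div3 by simp
    qed (use True in auto)
    finally show ?thesis by simp
  next
    case False
    then have "2 * n div 3 = 0" by simp
    then show ?thesis by (simp add: chebyshev_psi_def)
  qed
  finally have 1: "ln (fact (2 * n)) - 2 * ln (fact n) \<le> chebyshev_psi (2*n) - chebyshev_psi n + (4 / 3 * ln 2 * real n + 2 * (ln (2 * real n))\<^sup>2)" by simp
  have "(fact (2*n) :: real) = real ((2*n) choose n) * (fact n * fact n)"
    by (rule fact_double)
  then have "ln (fact (2*n) :: real) = ln (real ((2*n) choose n)) + 2 * ln (fact n)"
    by (simp add: ln_mult)
  moreover have "ln (4 ^ n / (2 * real n)) \<le> ln (real ((2*n) choose n))"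
    using central_binomial_lower_bound[of n] assms by (subst ln_le_cancel_iff) auto
  moreover have "ln (4 ^ n / (2 * real n)) = 2 * ln 2 * real n - ln (2 * real n)"
  proof -
    have "ln (4::real) = 2 * ln 2" using ln_realpow[of 2 2] by simp
    then show ?thesis using assms by (simp add: ln_div ln_realpow)
  qed
  ultimately show ?thesis using 1 by (simp add: algebra_simps)
qed

lemma ln_fact_bounds:
  assumes "n \<ge> 1"
  shows "ln (fact n) \<le> real n * ln (real n)" "ln (fact n) \<ge> real n * ln (real n) - real n"
proof -
  have "(fact n :: real) \<le> real n ^ n" by (metis fact_le_power of_nat_fact of_nat_le_iff of_nat_power order_refl)
  then have "ln (fact n) \<le> ln (real n ^ n)" using assms by (subst ln_le_cancel_iff) auto
  then show "ln (fact n) \<le> real n * ln (real n)" using assms by (simp add: ln_realpow)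
  have "real n ^ n / fact n \<le> exp (real n)"
  proof -
    have "(\<lambda>k. real n ^ k / fact k) sums exp (real n)" using exp_converges[of "real n"] by (simp add: field_simps)
    then have "(\<Sum>k\<in>{n}. real n ^ k / fact k) \<le> exp (real n)"
      using sum_le_suminf[of "\<lambda>k. real n ^ k / fact k" "{n}"] by (simp add: sums_iff)
    then show ?thesis by simp
  qed
  then have "ln (real n ^ n / fact n) \<le> ln (exp (real n))" using assms by (subst ln_le_cancel_iff) auto
  then have "ln (real n ^ n / fact n) \<le> real n" by simp
  then show "ln (fact n) \<ge> real n * ln (real n) - real n" using assms by (simp add: ln_div ln_realpow)
qed

lemma card_nonprime_primepow:
  assumes "N \<ge> 2"
  shows "real (card {d. d \<le> N \<and> primepow d \<and> \<not> prime d}) \<le> sqrt (real N) * (ln (real N) / ln 2)"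
proof -
  define J where "J = nat \<lfloor>ln (real N) / ln 2\<rfloor>"
  define R where "R = nat \<lfloor>sqrt (real N)\<rfloor>"
  have "{d. d \<le> N \<and> primepow d \<and> \<not> prime d} \<subseteq> (\<lambda>(p, j). p ^ j) ` ({1..R} \<times> {1..J})"
  proof
    fix d assume "d \<in> {d. d \<le> N \<and> primepow d \<and> \<not> prime d}"
    then have d: "d \<le> N" "primepow d" "\<not> prime d" by auto
    then obtain p k where pk: "prime p" "k > 0" "d = p ^ k" by (auto simp: primepow_def)
    then have k2: "k \<ge> 2" using d(3) by (cases "k = 1") auto
    have p2: "p \<ge> 2" using pk(1) by (rule prime_ge_2_nat)
    have "p ^ 2 \<le> p ^ k" using p2 k2 by (intro power_increasing) auto
    then have "real (p ^ 2) \<le> real N" using d pk by linarith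
    then have "real p \<le> sqrt (real N)" by (simp add: real_le_rsqrt)
    then have "p \<le> R" unfolding R_def by (simp add: le_nat_floor)
    have "(2::nat) ^ k \<le> p ^ k" using p2 by (intro power_mono) auto
    then have "real (2 ^ k) \<le> real N" using d pk by linarith
    then have "ln (real (2 ^ k)) \<le> ln (real N)" by (intro ln_mono) auto
    then have "real k * ln 2 \<le> ln (real N)" by (simp add: ln_realpow)
    then have "real k \<le> ln (real N) / ln 2" by (simp add: field_simps)
    then have "k \<le> J" unfolding J_def by (simp add: le_nat_floor)
    then show "d \<in> (\<lambda>(p, j). p ^ j) ` ({1..R} \<times> {1..J})"
      using \<open>p \<le> R\<close> pk p2 by (intro image_eqI[of _ _ "(p, k)"]) auto
  qed
  then have "card {d. d \<le> N \<and> primepow d \<and> \<not> prime d} \<le> card ((\<lambda>(p, j). p ^ j :: nat) ` ({1..R} \<times> {1..J}))"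
    by (intro card_mono) auto
  also have "\<dots> \<le> card ({1..R} \<times> {1..J})" by (rule card_image_le) auto
  also have "\<dots> = R * J" by simp
  finally have "real (card {d. d \<le> N \<and> primepow d \<and> \<not> prime d}) \<le> real R * real J"
    by (metis of_nat_le_iff of_nat_mult)
  also have "\<dots> \<le> sqrt (real N) * (ln (real N) / ln 2)"
    unfolding R_def J_def using assms by (intro mult_mono of_nat_floor) auto
  finally show ?thesis .
qed

text \<open>Replacing n div d by n/d in ln n! costs at most \<open>chebyshev_psi n\<close>, which is
  linear in n; division by n turns this into a bounded error.\<close>

lemma mertens_mangoldt:
  "\<exists>C. \<forall>n\<ge>1. \<bar>(\<Sum>d=1..n. mangoldt d / real d) - ln (real n)\<bar> \<le> C"
proof (intro exI allI impI)
  fix n :: nat assume n: "n \<ge> 1"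
  have ln_le: "(ln (real n))\<^sup>2 \<le> 4 * real n"
  proof -
    have "ln (sqrt (real n)) \<le> sqrt (real n)" using n ln_bound[of "sqrt (real n)"] by simp
    then have "ln (real n) \<le> 2 * sqrt (real n)" using n by (simp add: ln_sqrt)
    then have "(ln (real n))\<^sup>2 \<le> (2 * sqrt (real n))\<^sup>2" using n by (intro power_mono) auto
    then show ?thesis by (simp add: power_mult_distrib)
  qed
  let ?S = "\<Sum>d=1..n. mangoldt d / real d"
  have "ln (fact n) \<le> (\<Sum>d=1..n. mangoldt d * (real n / real d))"
    unfolding ln_fact_mangoldt by (intro sum_mono mult_left_mono mangoldt_nonneg of_nat_div_le_of_nat)
  also have "\<dots> = real n * ?S" by (simp add: sum_distrib_left mult.commute)
  finally have 1: "real n * ln (real n) - real n \<le> real n * ?S" using ln_fact_bounds[OF n] by linarith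
  have "real n * ?S - chebyshev_psi n = (\<Sum>d=1..n. mangoldt d * (real n / real d - 1))"
    by (simp add: sum_distrib_left chebyshev_psi_def sum_subtractf algebra_simps)
  also have "\<dots> \<le> ln (fact n)"
    unfolding ln_fact_mangoldt
  proof (intro sum_mono mult_left_mono mangoldt_nonneg)
    fix d assume d: "d \<in> {1..n}"
    have "n < (n div d) * d + d" using d by (metis atLeastAtMost_iff dividend_less_times_div less_le_trans mult.commute zero_less_one add.commute)
    then have "real n \<le> real (n div d) * real d + real d" by (metis less_imp_le of_nat_add of_nat_le_iff of_nat_mult)
    then show "real n / real d - 1 \<le> real (n div d)" using d by (simp add: field_simps)
  qed
  also have "\<dots> \<le> real n * ln (real n)" using ln_fact_bounds[OF n] by simp
  finally have "real n * ?S \<le> real n * ln (real n) + (2 * ln 2 * real n + 2 * (4 * real n))"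
    using chebyshev_psi_le[OF n] ln_le by linarith
  then have 2: "real n * ?S \<le> real n * (ln (real n) + (2 * ln 2 + 8))" by (simp add: algebra_simps)
  have 3: "real n * (ln (real n) - 1) \<le> real n * ?S" using 1 by (simp add: algebra_simps)
  have "?S \<le> ln (real n) + (2 * ln 2 + 8)" "ln (real n) - 1 \<le> ?S"
    using 2 3 n by (simp_all only: mult_le_cancel_left_pos of_nat_0_less_iff Suc_le_eq One_nat_def)
  then show "\<bar>?S - ln (real n)\<bar> \<le> 2 * ln 2 + 8"
    using ln2_ge_two_thirds by linarith
qed

text \<open>For each p the exponents from 2 on form a geometric series, at most 2 ln p / p^2, and ln
  p <= 2 sqrt p makes the sum over p converge.\<close>

lemma sum_prime_power_part_bounded:
  "\<exists>C. \<forall>n. (\<Sum>d | d \<in> {1..n} \<and> primepow d \<and> \<not> prime d. mangoldt d / real d) \<le> (C::real)"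
proof -
  have summ: "summable (\<lambda>n. real n powr (-3/2))" by (subst summable_real_powr_iff) auto
  show ?thesis
  proof (intro exI allI)
    fix n :: nat
    let ?A = "{d. d \<in> {1..n} \<and> primepow d \<and> \<not> prime d}"
    have sub: "?A \<subseteq> (\<lambda>(p, j). p ^ j) ` ({p. prime p \<and> p \<le> n} \<times> {2..<n+2})"
    proof
      fix d assume d: "d \<in> ?A"
      then obtain p k where pk: "prime p" "k > 0" "d = p ^ k" by (auto simp: primepow_def)
      have k2: "k \<ge> 2" using d pk by (cases "k = 1") auto
      have p2: "p \<ge> 2" using pk(1) by (rule prime_ge_2_nat)
      have "k < p ^ k" using p2 by (simp add: power_gt_expt)
      then have "k < n + 2" using d pk by auto
      moreover have "p ^ 1 \<le> p ^ k" using p2 pk by (intro power_increasing) auto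
      then have "p \<le> n" using d pk by auto
      ultimately show "d \<in> (\<lambda>(p, j). p ^ j) ` ({p. prime p \<and> p \<le> n} \<times> {2..<n+2})"
        using pk k2 by (intro image_eqI[of _ _ "(p, k)"]) auto
    qed
    have fin: "finite ({p. prime p \<and> p \<le> n} \<times> {2..<n+2})" by auto
    have "(\<Sum>d\<in>?A. mangoldt d / real d) \<le> (\<Sum>d\<in>(\<lambda>(p, j). p ^ j) ` ({p. prime p \<and> p \<le> n} \<times> {2..<n+2}). mangoldt d / real d)"
      by (intro sum_mono2 finite_imageI fin sub) (auto intro!: divide_nonneg_nonneg mangoldt_nonneg)
    also have "\<dots> \<le> (\<Sum>x\<in>{p. prime p \<and> p \<le> n} \<times> {2..<n+2}. mangoldt (fst x ^ snd x) / real (fst x ^ snd x))"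
      using sum_image_le[OF fin, of "\<lambda>d. mangoldt d / real d" "\<lambda>(p,j). p ^ j"] mangoldt_nonneg
      by (auto simp: case_prod_unfold)
    also have "\<dots> = (\<Sum>p | prime p \<and> p \<le> n. \<Sum>j=2..<n+2. ln (real p) / real p ^ j)"
      by (subst sum.cartesian_product) (auto intro!: sum.cong simp: case_prod_unfold)
    also have "\<dots> \<le> (\<Sum>p | prime p \<and> p \<le> n. 4 * real p powr (-3/2))"
    proof (intro sum_mono)
      fix p assume "p \<in> {p. prime p \<and> p \<le> n}"
      then have p2: "p \<ge> 2" using prime_ge_2_nat by auto
      have l0: "ln (real p) \<ge> 0" using p2 by simp
      have "(\<Sum>j=2..<n+2. ln (real p) / real p ^ j) = ln (real p) / real p ^ 2 * (\<Sum>j<n. (1 / real p) ^ j)"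
      proof -
        have "(\<Sum>j=2..<n+2. ln (real p) / real p ^ j) = (\<Sum>i=0..<n. ln (real p) / real p ^ (i + 2))"
          using sum.shift_bounds_nat_ivl[of "\<lambda>j. ln (real p) / real p ^ j" 0 2 n] by (simp only: add_0)
        also have "\<dots> = ln (real p) / real p ^ 2 * (\<Sum>j<n. (1 / real p) ^ j)"
          unfolding sum_distrib_left lessThan_atLeast0 power_add power_one_over by (intro sum.cong) auto
        finally show ?thesis .
      qed
      also have "\<dots> \<le> ln (real p) / real p ^ 2 * 2"
      proof (intro mult_left_mono)
        have "(\<Sum>j<n. (1 / real p) ^ j) \<le> (\<Sum>j<n. (1 / 2) ^ j)"
          using p2 by (intro sum_mono power_mono) (auto simp: field_simps)
        also have "\<dots> = 2 - 2 * (1/2) ^ n" by (subst sum_gp_strict) (auto simp: field_simps)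
        also have "\<dots> \<le> (2::real)" by simp
        finally show "(\<Sum>j<n. (1 / real p) ^ j) \<le> 2" .
      qed (use l0 in auto)
      also have "ln (real p) / real p ^ 2 * 2 \<le> (2 * sqrt (real p)) / real p ^ 2 * 2"
      proof -
        have "ln (sqrt (real p)) \<le> sqrt (real p)" using p2 ln_bound[of "sqrt (real p)"] by simp
        then have "ln (real p) \<le> 2 * sqrt (real p)" using p2 by (simp add: ln_sqrt)
        then show ?thesis using p2 by (intro mult_right_mono divide_right_mono) auto
      qed
      also have "\<dots> = 4 * (real p powr (1/2) / real p powr 2)" using p2 by (simp add: powr_half_sqrt)
      also have "\<dots> = 4 * real p powr (-3/2)" using p2 by (subst powr_diff[symmetric]) auto
      finally show "(\<Sum>j=2..<n+2. ln (real p) / real p ^ j) \<le> 4 * real p powr (-3/2)" .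
    qed
    also have "\<dots> = 4 * (\<Sum>p | prime p \<and> p \<le> n. real p powr (-3/2))" by (simp add: sum_distrib_left)
    also have "\<dots> \<le> 4 * (\<Sum>p. real p powr (-3/2))"
      by (intro mult_left_mono sum_le_suminf summ) auto
    finally show "(\<Sum>d\<in>?A. mangoldt d / real d) \<le> 4 * (\<Sum>p. real p powr (-3/2))" .
  qed
qed

lemma mertens_first:
  obtains C where "\<And>n. n \<ge> 1 \<Longrightarrow> \<bar>(\<Sum>p | prime p \<and> p \<le> n. ln (real p) / real p) - ln (real n)\<bar> \<le> C"
proof -
  obtain C1 where C1: "\<And>n. n \<ge> 1 \<Longrightarrow> \<bar>(\<Sum>d=1..n. mangoldt d / real d) - ln (real n)\<bar> \<le> C1"
    using mertens_mangoldt by blast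
  obtain C2 where C2: "\<And>n. (\<Sum>d | d \<in> {1..n} \<and> primepow d \<and> \<not> prime d. mangoldt d / real d) \<le> (C2::real)"
    using sum_prime_power_part_bounded by blast
  show ?thesis
  proof (rule that[of "C1 + C2"])
    fix n :: nat assume n: "n \<ge> 1"
    let ?B = "\<Sum>d | d \<in> {1..n} \<and> primepow d \<and> \<not> prime d. mangoldt d / real d"
    have "(\<Sum>d=1..n. mangoldt d / real d) = (\<Sum>d | d \<in> {1..n} \<and> primepow d. mangoldt d / real d)"
      by (intro sum.mono_neutral_right) (auto simp: mangoldt_def)
    also have "{d. d \<in> {1..n} \<and> primepow d} = {p. prime p \<and> p \<le> n} \<union> {d. d \<in> {1..n} \<and> primepow d \<and> \<not> prime d}"
      by (auto simp: prime_ge_1_nat Suc_le_eq prime_gt_0_nat)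
    also have "(\<Sum>d\<in>\<dots>. mangoldt d / real d) = (\<Sum>p | prime p \<and> p \<le> n. mangoldt p / real p) + ?B"
      by (intro sum.union_disjoint) auto
    also have "(\<Sum>p | prime p \<and> p \<le> n. mangoldt p / real p) = (\<Sum>p | prime p \<and> p \<le> n. ln (real p) / real p)"
      by (intro sum.cong) auto
    finally have eq: "(\<Sum>d=1..n. mangoldt d / real d) = (\<Sum>p | prime p \<and> p \<le> n. ln (real p) / real p) + ?B" .
    have "?B \<ge> 0" by (intro sum_nonneg divide_nonneg_nonneg mangoldt_nonneg) auto
    then show "\<bar>(\<Sum>p | prime p \<and> p \<le> n. ln (real p) / real p) - ln (real n)\<bar> \<le> C1 + C2"
      using C1[OF n] C2[of n] eq by linarith
  qed
qed

text \<open>Partial summation of Mertens' estimate: 1/(p ln p) is ln p / p times 1/(ln p)^2, and ln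
  p / p has density 1 with respect to ln. The bound for the sum of 1/p uses ln p >= ln y.\<close>

lemma prime_sum_inverse_p_ln_p:
  obtains C where "C \<ge> 0"
    "\<And>y z. 2 \<le> y \<Longrightarrow> y \<le> z \<Longrightarrow>
       \<bar>(\<Sum>p | prime p \<and> y < p \<and> p \<le> z. 1 / (real p * ln (real p))) - (1 / ln (real y) - 1 / ln (real z))\<bar>
         \<le> C / (ln (real y))\<^sup>2"
    "\<And>y z. 2 \<le> y \<Longrightarrow> y \<le> z \<Longrightarrow>
       (\<Sum>p | prime p \<and> y < p \<and> p \<le> z. 1 / real p) \<le> (ln (real z) + C) / ln (real y)"
proof -
  obtain C0 where C0: "\<And>n. n \<ge> 1 \<Longrightarrow> \<bar>(\<Sum>p | prime p \<and> p \<le> n. ln (real p) / real p) - ln (real n)\<bar> \<le> C0"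
    using mertens_first by blast
  have C0nn: "C0 \<ge> 0" using C0[of 1] by linarith
  define A where "A n = (\<Sum>p | prime p \<and> p \<le> n. ln (real p) / real p)" for n
  define E where "E n = A n - ln (real n)" for n
  define g where "g n = 1 / (ln (real n))\<^sup>2" for n :: nat
  have E: "\<bar>E n\<bar> \<le> C0" if "n \<ge> 1" for n using C0[OF that] unfolding E_def A_def .
  have set_Suc: "{p. prime p \<and> p \<le> Suc z} = {p. prime p \<and> p \<le> z} \<union> (if prime (Suc z) then {Suc z} else {})" for z
    by (auto simp: le_Suc_eq)
  have A_Suc: "A (Suc z) = A z + (if prime (Suc z) then ln (real (Suc z)) / real (Suc z) else 0)" for z
    unfolding A_def set_Suc by (subst sum.union_disjoint) auto
  define S where "S y z = (\<Sum>p | prime p \<and> y < p \<and> p \<le> z. 1 / (real p * ln (real p)))" for y z :: nat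
  \<comment> \<open>Partial summation arranged for induction on z. E z times g z is the boundary
    term at z. C0 (2 g y - g z) collects the boundary at y and the variation of g, and g y - g z is
    the error of the Riemann sum for 1/ln y - 1/ln z.\<close>
  have main: "\<bar>S y z - (1 / ln (real y) - 1 / ln (real z)) - E z * g z\<bar> \<le> C0 * (2 * g y - g z) + (g y - g z)"
    if y: "2 \<le> y" and yz: "y \<le> z" for y z
    using yz
  proof (induction z rule: dec_induct)
    case base
    have "\<bar>E y * g y\<bar> \<le> C0 * g y" unfolding abs_mult using E[of y] y by (intro mult_mono) (auto simp: g_def)
    then show ?case by (simp add: S_def cong: conj_cong)
  next
    case (step z)
    define a b where "a = ln (real z)" and "b = ln (real (Suc z))"
    have a0: "a > 0" and ab: "a \<le> b" unfolding a_def b_def using step y by auto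
    have bma: "b - a \<le> 1"
    proof -
      have "ln (real (Suc z)) - ln (real z) = ln (1 + 1 / real z)"
        using step y ln_div[of "real (Suc z)" "real z"] by (simp add: add_divide_distrib add.commute)
      also have "\<dots> \<le> 1 / real z" by (rule ln_add_one_self_le_self) auto
      also have "\<dots> \<le> 1" using step y by simp
      finally show ?thesis unfolding a_def b_def .
    qed
    have gz: "g z = 1 / a\<^sup>2" "g (Suc z) = 1 / b\<^sup>2" unfolding g_def a_def b_def by auto
    have gmono: "g (Suc z) \<le> g z" unfolding gz using a0 ab by (intro divide_left_mono power_mono) auto
    have setS: "{p. prime p \<and> y < p \<and> p \<le> Suc z} = {p. prime p \<and> y < p \<and> p \<le> z} \<union> (if prime (Suc z) then {Suc z} else {})"
      using step by (auto simp: le_Suc_eq)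
    have S_Suc: "S y (Suc z) = S y z + (if prime (Suc z) then 1 / (real (Suc z) * b) else 0)"
      unfolding S_def setS b_def by (subst sum.union_disjoint) auto
    have "(if prime (Suc z) then 1 / (real (Suc z) * b) else 0) = (A (Suc z) - A z) * g (Suc z)"
      unfolding A_Suc gz b_def[symmetric] using a0 ab by (auto simp: power2_eq_square)
    also have "\<dots> = (b - a) * g (Suc z) + (E (Suc z) - E z) * g (Suc z)"
      unfolding E_def a_def b_def by (simp add: algebra_simps)
    finally have eq: "S y (Suc z) - (1 / ln (real y) - 1 / b) - E (Suc z) * g (Suc z) =
       (S y z - (1 / ln (real y) - 1 / a) - E z * g z) + E z * (g z - g (Suc z)) + ((b - a) * g (Suc z) - (1 / a - 1 / b))"
      unfolding S_Suc by (simp add: algebra_simps)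
    have 1: "\<bar>E z * (g z - g (Suc z))\<bar> \<le> C0 * (g z - g (Suc z))"
      unfolding abs_mult using E[of z] step y gmono by (intro mult_mono) auto
    have 2: "\<bar>(b - a) * g (Suc z) - (1 / a - 1 / b)\<bar> \<le> g z - g (Suc z)"
    proof -
      have "(1 / a - 1 / b) = (b - a) * (1 / (a * b))" using a0 ab by (simp add: field_simps)
      then have *: "(1 / a - 1 / b) - (b - a) * g (Suc z) = (b - a) * (1 / (a * b) - 1 / b\<^sup>2)"
        unfolding gz by (simp add: algebra_simps)
      have "1 / (a * b) \<ge> 1 / b\<^sup>2" using a0 ab by (intro divide_left_mono) (auto simp: power2_eq_square)
      moreover have "1 / (a * b) \<le> 1 / a\<^sup>2" using a0 ab by (intro divide_left_mono) (auto simp: power2_eq_square)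
      ultimately have "0 \<le> (b - a) * (1 / (a * b) - 1 / b\<^sup>2)" "(b - a) * (1 / (a * b) - 1 / b\<^sup>2) \<le> 1 * (1 / a\<^sup>2 - 1 / b\<^sup>2)"
        using bma ab mult_mono[of "b - a" 1 "1 / (a * b) - 1 / b\<^sup>2" "1 / a\<^sup>2 - 1 / b\<^sup>2"] by auto
      moreover have "\<bar>p - w\<bar> \<le> v" if "0 \<le> u" "u \<le> 1 * v" "w - p = u" for p w u v :: real
        using that by linarith
      ultimately show ?thesis using * unfolding gz by blast
    qed
    have "\<bar>S y (Suc z) - (1 / ln (real y) - 1 / b) - E (Suc z) * g (Suc z)\<bar>
        \<le> C0 * (2 * g y - g z) + (g y - g z) + C0 * (g z - g (Suc z)) + (g z - g (Suc z))"
      unfolding eq using step.IH 1 2 unfolding a_def[symmetric] by linarith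
    then show ?case unfolding b_def by (simp add: algebra_simps)
  qed
  show ?thesis
  proof (rule that[of "2 * C0 + 1"])
    fix y z :: nat assume y: "2 \<le> y" and yz: "y \<le> z"
    have "\<bar>E z * g z\<bar> \<le> C0 * g z" unfolding abs_mult using E[of z] y yz by (intro mult_mono) (auto simp: g_def)
    moreover have "g z \<ge> 0" by (simp add: g_def)
    ultimately have "\<bar>S y z - (1 / ln (real y) - 1 / ln (real z))\<bar> \<le> (2 * C0 + 1) * g y"
      using main[OF y yz] by (simp add: algebra_simps)
    then show "\<bar>(\<Sum>p | prime p \<and> y < p \<and> p \<le> z. 1 / (real p * ln (real p))) - (1 / ln (real y) - 1 / ln (real z))\<bar>
         \<le> (2 * C0 + 1) / (ln (real y))\<^sup>2" unfolding S_def g_def by simp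
    have ly: "ln (real y) > 0" using y by simp
    have "(\<Sum>p | prime p \<and> y < p \<and> p \<le> z. 1 / real p) * ln (real y) \<le> (\<Sum>p | prime p \<and> y < p \<and> p \<le> z. ln (real p) / real p)"
      unfolding sum_distrib_right using y by (intro sum_mono) (auto simp: divide_right_mono)
    also have "\<dots> \<le> (\<Sum>p | prime p \<and> p \<le> z. ln (real p) / real p)"
      by (intro sum_mono2) (auto intro!: divide_nonneg_nonneg dest: prime_ge_1_nat)
    also have "\<dots> \<le> ln (real z) + (2 * C0 + 1)" using C0[of z] C0nn y yz by linarith
    finally show "(\<Sum>p | prime p \<and> y < p \<and> p \<le> z. 1 / real p) \<le> (ln (real z) + (2 * C0 + 1)) / ln (real y)"
      using ly by (simp add: field_simps)
  qed (use C0nn in auto)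
qed

lemma chebyshev_dyadic:
  "\<forall>\<^sub>F x :: real in at_top. real (card {p. prime p \<and> x < real p \<and> real p \<le> 2 * x}) \<ge> x / (4 * ln x)"
proof -
  \<comment> \<open>The product 4/9 of the 2/3 in \<open>chebyshev_psi_double_lower\<close> and of
    ln 2 >= 2/3 exceeds the required 1/4; everything subtracted is of lower order.\<close>
  have ev: "\<forall>\<^sub>F x :: real in at_top. 2 / 3 * (2/3) * (x - 1) - ln (2 * x) - 2 * (ln (2 * x))\<^sup>2 - sqrt (2 * x) * (ln (2 * x) / ln 2) * ln (2 * x) \<ge> x / (4 * ln x) * ln (2 * x)"
    by real_asymp
  show ?thesis using ev eventually_gt_at_top[of 2]
  proof eventually_elim
    case (elim x)
    define n where "n = nat \<lfloor>x\<rfloor>"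
    have n: "real n \<le> x" "x < real n + 1" "n \<ge> 2" unfolding n_def using elim by linarith+
    let ?P = "{p. prime p \<and> x < real p \<and> real p \<le> 2 * x}"
    have finP: "finite ?P" by (rule finite_subset[of _ "{..nat \<lfloor>2 * x\<rfloor>}"]) (auto simp: le_nat_floor)
    let ?Q = "{d. d \<le> 2 * n \<and> primepow d \<and> \<not> prime d}"
    have l2: "ln (real (2 * n)) \<le> ln (2 * x)" using n by (intro ln_mono) auto
    have l2': "ln (real (2 * n)) \<ge> 0" using n by simp
    have mle: "mangoldt d \<le> ln (2 * x)" if "d \<le> 2 * n" for d
    proof (cases "d > 0")
      case True
      have "mangoldt d \<le> ln (real d)" using mangoldt_le[OF True] by simp
      also have "\<dots> \<le> ln (2 * x)" using that n True by (intro ln_mono) auto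
      finally show ?thesis .
    qed (use elim in auto)
    have "chebyshev_psi (2 * n) - chebyshev_psi n = (\<Sum>d\<in>{n<..2*n}. mangoldt d)" using chebyshev_psi_split[of n "2*n"] by simp
    also have "\<dots> = (\<Sum>d\<in>{d. d \<in> {n<..2*n} \<and> primepow d}. mangoldt d)"
      by (intro sum.mono_neutral_right) (auto simp: mangoldt_def)
    also have "\<dots> \<le> (\<Sum>d\<in>?P \<union> ?Q. mangoldt d)"
      using n finP by (intro sum_mono2 mangoldt_nonneg finite_UnI) auto
    also have "\<dots> = (\<Sum>d\<in>?P. mangoldt d) + (\<Sum>d\<in>?Q. mangoldt d)"
      using finP by (intro sum.union_disjoint) auto
    also have "(\<Sum>d\<in>?Q. mangoldt d) \<le> real (card ?Q) * ln (2 * x)"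
      using mle by (intro sum_bounded_above) auto
    also have "real (card ?Q) \<le> sqrt (real (2 * n)) * (ln (real (2 * n)) / ln 2)"
      using n by (intro card_nonprime_primepow) auto
    also have "\<dots> \<le> sqrt (2 * x) * (ln (2 * x) / ln 2)"
      using n l2 l2' by (intro mult_mono divide_right_mono) auto
    also have "(\<Sum>d\<in>?P. mangoldt d) \<le> real (card ?P) * ln (2 * x)"
    proof (intro sum_bounded_above)
      fix p assume p: "p \<in> ?P"
      then have "mangoldt p = ln (real p)" by simp
      also have "\<dots> \<le> ln (2 * x)" using p elim by (intro ln_mono) auto
      finally show "mangoldt p \<le> ln (2 * x)" .
    qed
    finally have *: "chebyshev_psi (2 * n) - chebyshev_psi n \<le> real (card ?P) * ln (2 * x) + sqrt (2 * x) * (ln (2 * x) / ln 2) * ln (2 * x)"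
      using elim by (simp add: mult_right_mono)
    have "chebyshev_psi (2 * n) - chebyshev_psi n \<ge> 2 / 3 * ln 2 * real n - ln (2 * real n) - 2 * (ln (2 * real n))\<^sup>2"
      using n by (intro chebyshev_psi_double_lower) auto
    moreover have "2 / 3 * ln 2 * real n \<ge> 2 / 3 * (2/3) * (x - 1)"
      using n elim ln2_ge_two_thirds by (intro mult_mono) auto
    moreover have "(ln (2 * real n))\<^sup>2 \<le> (ln (2 * x))\<^sup>2" using l2 l2' by (intro power_mono) auto
    moreover have "ln (2 * real n) \<le> ln (2 * x)" using l2 by simp
    ultimately have "x / (4 * ln x) * ln (2 * x) \<le> real (card ?P) * ln (2 * x)"
      using * elim(1) by linarith
    moreover have "ln (2 * x) > 0" using elim by simp
    ultimately show ?case by (simp only: mult_le_cancel_right_pos)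
  qed
qed

section \<open>Resonators and GCD sums\<close>

lemma sum_Pow_insert:
  assumes "finite P" "q \<notin> P"
  shows "(\<Sum>A\<in>Pow (insert q P). f A) = (\<Sum>A\<in>Pow P. f A) + (\<Sum>A\<in>Pow P. f (insert q A))"
proof -
  have inj: "inj_on (insert q) (Pow P)"
  proof (rule inj_onI)
    fix A B assume "A \<in> Pow P" "B \<in> Pow P" "insert q A = insert q B"
    then show "A = B" using assms(2) by (metis PowD insert_ident subsetD)
  qed
  have "Pow P \<inter> insert q ` Pow P = {}" using assms(2) by auto
  then have "(\<Sum>A\<in>Pow (insert q P). f A) = (\<Sum>A\<in>Pow P. f A) + (\<Sum>A\<in>insert q ` Pow P. f A)"
    unfolding Pow_insert using assms by (intro sum.union_disjoint) auto
  also have "(\<Sum>A\<in>insert q ` Pow P. f A) = (\<Sum>A\<in>Pow P. f (insert q A))" by (simp add: sum.reindex[OF inj])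
  finally show ?thesis .
qed

lemma sum_Pow_prod:
  fixes g :: "'a \<Rightarrow> bool \<Rightarrow> 'b :: comm_semiring_1"
  assumes "finite P"
  shows "(\<Sum>A\<in>Pow P. \<Prod>p\<in>P. g p (p \<in> A)) = (\<Prod>p\<in>P. g p False + g p True)"
  using assms
proof (induction P rule: finite_induct)
  case (insert q P)
  have 1: "(\<Prod>p\<in>insert q P. g p (p \<in> A)) = g q False * (\<Prod>p\<in>P. g p (p \<in> A))" if "A \<in> Pow P" for A
  proof -
    have "q \<notin> A" using that insert(2) by auto
    then show ?thesis using insert by simp
  qed
  have 2: "(\<Prod>p\<in>insert q P. g p (p \<in> insert q A)) = g q True * (\<Prod>p\<in>P. g p (p \<in> A))" for A
  proof -
    have "(\<Prod>p\<in>P. g p (p \<in> insert q A)) = (\<Prod>p\<in>P. g p (p \<in> A))"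
      using insert(2) by (intro prod.cong refl) (auto intro: arg_cong2[where f=g])
    then show ?thesis using insert by simp
  qed
  have "(\<Sum>A\<in>Pow P. \<Prod>p\<in>insert q P. g p (p \<in> A)) = (\<Sum>A\<in>Pow P. g q False * (\<Prod>p\<in>P. g p (p \<in> A)))"
    by (intro sum.cong refl 1)
  moreover have "(\<Sum>A\<in>Pow P. \<Prod>p\<in>insert q P. g p (p \<in> insert q A)) = (\<Sum>A\<in>Pow P. g q True * (\<Prod>p\<in>P. g p (p \<in> A)))"
    by (intro sum.cong refl 2)
  ultimately show ?case
    unfolding sum_Pow_insert[OF insert(1,2)] sum_distrib_left[symmetric] insert.IH
    using insert(1,2) by (simp add: distrib_right)
qed simp

lemma sum_Pow_Pow_prod:
  fixes g :: "'a \<Rightarrow> bool \<Rightarrow> bool \<Rightarrow> 'b :: comm_semiring_1"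
  assumes "finite P"
  shows "(\<Sum>A\<in>Pow P. \<Sum>B\<in>Pow P. \<Prod>p\<in>P. g p (p \<in> A) (p \<in> B))
     = (\<Prod>p\<in>P. g p False False + g p False True + (g p True False + g p True True))"
proof -
  have "(\<Sum>B\<in>Pow P. \<Prod>p\<in>P. g p (p \<in> A) (p \<in> B)) = (\<Prod>p\<in>P. g p (p \<in> A) False + g p (p \<in> A) True)" for A
    using sum_Pow_prod[OF assms, of "\<lambda>p b. g p (p \<in> A) b"] .
  then show ?thesis using sum_Pow_prod[OF assms, of "\<lambda>p a. g p a False + g p a True"] by simp
qed

lemma sum_square_le_card:
  fixes f :: "'a \<Rightarrow> real"
  assumes "finite J"
  shows "(\<Sum>j\<in>J. f j)\<^sup>2 \<le> real (card J) * (\<Sum>j\<in>J. (f j)\<^sup>2)"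
proof -
  have "0 \<le> (\<Sum>i\<in>J. \<Sum>j\<in>J. (f i - f j)\<^sup>2)" by (intro sum_nonneg) auto
  also have "\<dots> = (\<Sum>i\<in>J. \<Sum>j\<in>J. (f i)\<^sup>2 + (f j)\<^sup>2 - 2 * (f i * f j))"
    by (simp add: power2_diff mult.assoc)
  also have "\<dots> = 2 * real (card J) * (\<Sum>j\<in>J. (f j)\<^sup>2) - 2 * (\<Sum>j\<in>J. f j)\<^sup>2"
    by (simp add: sum.distrib sum_subtractf sum_distrib_left[symmetric] sum_product power2_eq_square[of "sum f J"])
  finally show ?thesis by simp
qed

lemma card_odd_le:
  fixes x :: real
  assumes "x \<ge> 1"
  shows "real (card {h::nat. odd h \<and> real h \<le> x}) \<ge> x / 4"
proof -
  define k where "k = nat \<lfloor>(x + 1) / 2\<rfloor>"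
  have "\<lfloor>(x + 1) / 2\<rfloor> \<ge> 1" using assms by (simp add: le_floor_iff)
  then have "real k \<ge> 1" "real k > (x + 1) / 2 - 1" unfolding k_def by linarith+
  then have k: "real k \<ge> x / 4" by (cases "x < 2") auto
  have "real k \<le> (x + 1) / 2" unfolding k_def using assms by (intro of_nat_floor) auto
  then have kx: "2 * real k \<le> x + 1" by simp
  have "(\<lambda>i. 2 * i + 1) ` {..<k} \<subseteq> {h::nat. odd h \<and> real h \<le> x}"
  proof
    fix h assume "h \<in> (\<lambda>i. 2 * i + 1) ` {..<k}"
    then obtain i where i: "h = 2 * i + 1" "i < k" by auto
    then have "real i + 1 \<le> real k" by linarith
    then have "real h \<le> x" using i kx by simp
    then show "h \<in> {h::nat. odd h \<and> real h \<le> x}" using i by simp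
  qed
  moreover have "finite {h::nat. odd h \<and> real h \<le> x}"
    by (rule finite_subset[of _ "{..nat \<lfloor>x\<rfloor>}"]) (auto simp: le_nat_floor)
  ultimately have "card ((\<lambda>i. 2 * i + 1) ` {..<k}) \<le> card {h::nat. odd h \<and> real h \<le> x}" by (intro card_mono)
  moreover have "card ((\<lambda>i. 2 * i + 1) ` {..<k}) = k" by (subst card_image) (auto simp: inj_on_def)
  ultimately show ?thesis using k by linarith
qed

lemma sqrt_prod: "sqrt (\<Prod>x\<in>A. f x) = (\<Prod>x\<in>A. sqrt (f x))"
  by (induction A rule: infinite_finite_induct) (auto simp: real_sqrt_mult)

text \<open>A subset A of P stands for the odd squarefree number \<Prod>A. Quotients by the gcd
  become set differences, and sums over numbers factor into products over P.\<close>

locale resonator =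
  fixes P :: "nat set" and \<rho> :: "nat \<Rightarrow> real"
  assumes finP: "finite P" and primeP: "p \<in> P \<Longrightarrow> prime p" and oddP: "p \<in> P \<Longrightarrow> odd p"
    and \<rho>nn: "p \<in> P \<Longrightarrow> \<rho> p \<ge> 0"
begin

definition v :: "nat set \<Rightarrow> real" where "v A = (\<Prod>p\<in>A. \<rho> p)"

text \<open>For the numbers a, b of A, B this is \<open>v A\<close> \<open>v B\<close> gcd(a,b) /
  sqrt(a b), the kernel of a GCD sum.\<close>

definition K :: "nat set \<Rightarrow> nat set \<Rightarrow> real" where
  "K A B = v A * v B / sqrt (real (\<Prod>(A - B)) * real (\<Prod>(B - A)))"

definition kp :: "nat \<Rightarrow> bool \<Rightarrow> bool \<Rightarrow> real" where
  "kp p a b = (if a then \<rho> p else 1) * (if b then \<rho> p else 1) * (if a = b then 1 else 1 / sqrt (real p))"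

lemma Ppos: "p \<in> P \<Longrightarrow> p > 0" using primeP prime_gt_0_nat by blast

lemma prod_if_subset: "A \<subseteq> P \<Longrightarrow> (\<Prod>p\<in>P. if p \<in> A then f p else 1) = (\<Prod>p\<in>A. f p)"
  using finP by (simp add: prod.If_cases Int_absorb1)

lemma K_prod:
  assumes "A \<subseteq> P" "B \<subseteq> P"
  shows "K A B = (\<Prod>p\<in>P. kp p (p \<in> A) (p \<in> B))"
proof -
  have fin: "finite A" "finite B" using assms finP by (auto intro: finite_subset)
  have "(\<Prod>p\<in>P. kp p (p \<in> A) (p \<in> B)) = (\<Prod>p\<in>P. if p \<in> A then \<rho> p else 1) * (\<Prod>p\<in>P. if p \<in> B then \<rho> p else 1)
     * (\<Prod>p\<in>P. if p \<in> (A - B) \<union> (B - A) then 1 / sqrt (real p) else 1)"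
    unfolding kp_def prod.distrib[symmetric] by (intro prod.cong refl) auto
  also have "\<dots> = v A * v B * (\<Prod>p\<in>(A - B) \<union> (B - A). 1 / sqrt (real p))"
    using assms by (subst (1 2 3) prod_if_subset) (auto simp: v_def)
  also have "(\<Prod>p\<in>(A - B) \<union> (B - A). 1 / sqrt (real p)) = 1 / sqrt (real (\<Prod>((A - B) \<union> (B - A))))"
    by (simp add: prod_dividef sqrt_prod)
  also have "\<Prod>((A - B) \<union> (B - A)) = \<Prod>(A - B) * \<Prod>(B - A)" using fin by (intro prod.union_disjoint) auto
  finally show ?thesis unfolding K_def by simp
qed

lemma v_nonneg: "A \<subseteq> P \<Longrightarrow> v A \<ge> 0"
  unfolding v_def using \<rho>nn by (intro prod_nonneg) auto

lemma K_nonneg: "A \<subseteq> P \<Longrightarrow> B \<subseteq> P \<Longrightarrow> K A B \<ge> 0"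
  unfolding K_def using v_nonneg[of A] v_nonneg[of B] by (simp del: of_nat_prod)

lemma K_sym: "K A B = K B A" unfolding K_def by (simp add: mult.commute)

text \<open>Euler product of the full GCD sum: 1, \<rho>^2 and 2 \<rho> / sqrt p belong to the cases
  that p divides neither number, both, or exactly one.\<close>

definition total :: real where "total = (\<Prod>p\<in>P. 1 + (\<rho> p)\<^sup>2 + 2 * \<rho> p / sqrt (real p))"

lemma sum_K: "(\<Sum>A\<in>Pow P. \<Sum>B\<in>Pow P. K A B) = total"
proof -
  have "(\<Sum>A\<in>Pow P. \<Sum>B\<in>Pow P. K A B) = (\<Sum>A\<in>Pow P. \<Sum>B\<in>Pow P. \<Prod>p\<in>P. kp p (p \<in> A) (p \<in> B))"
    by (intro sum.cong refl K_prod) auto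
  also have "\<dots> = total" unfolding sum_Pow_Pow_prod[OF finP] total_def
    by (intro prod.cong refl) (simp add: kp_def power2_eq_square)
  finally show ?thesis .
qed

lemma sum_v2: "(\<Sum>A\<in>Pow P. (v A)\<^sup>2) = (\<Prod>p\<in>P. 1 + (\<rho> p)\<^sup>2)"
proof -
  have "(\<Sum>A\<in>Pow P. (v A)\<^sup>2) = (\<Sum>A\<in>Pow P. \<Prod>p\<in>P. if p \<in> A then (\<rho> p)\<^sup>2 else 1)"
    by (intro sum.cong refl) (auto simp: prod_if_subset v_def prod_power_distrib)
  then show ?thesis using sum_Pow_prod[OF finP, of "\<lambda>p a. if a then (\<rho> p)\<^sup>2 else 1"] by simp
qed

lemma prod_powr:
  assumes "A \<subseteq> P" shows "real (\<Prod>A) powr \<alpha> = (\<Prod>p\<in>A. real p powr \<alpha>)"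
proof -
  have "finite A" using assms finP by (rule finite_subset)
  then show ?thesis using assms
  proof (induction A rule: finite_induct)
    case (insert p A)
    then show ?case by (simp add: powr_mult)
  qed simp
qed

text \<open>Rankin's trick: on the range of summation (\<Prod>A / M)^\<alpha> >= 1. After inserting
  this weight the sum may be extended to all pairs, where it factors, with p^\<alpha> at the primes
  of A.\<close>

lemma rankin_size:
  assumes "M > 0" "\<alpha> > 0"
  shows "(\<Sum>A\<in>{A\<in>Pow P. real (\<Prod>A) > M}. \<Sum>B\<in>Pow P. K A B)
     \<le> M powr (-\<alpha>) * (\<Prod>p\<in>P. 1 + (\<rho> p)\<^sup>2 * real p powr \<alpha> + \<rho> p / sqrt (real p) * (1 + real p powr \<alpha>))"
proof -
  let ?g = "\<lambda>p a b. kp p a b * (if a then real p powr \<alpha> else 1)"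
  have "(\<Sum>A\<in>{A\<in>Pow P. real (\<Prod>A) > M}. \<Sum>B\<in>Pow P. K A B)
     \<le> (\<Sum>A\<in>{A\<in>Pow P. real (\<Prod>A) > M}. \<Sum>B\<in>Pow P. M powr (-\<alpha>) * (K A B * real (\<Prod>A) powr \<alpha>))"
  proof (intro sum_mono)
    fix A B assume A: "A \<in> {A\<in>Pow P. real (\<Prod>A) > M}" and B: "B \<in> Pow P"
    have "1 = M powr (-\<alpha>) * M powr \<alpha>" using assms by (simp flip: powr_add)
    also have "\<dots> \<le> M powr (-\<alpha>) * real (\<Prod>A) powr \<alpha>" using A assms by (intro mult_left_mono powr_mono2) auto
    finally have "K A B * 1 \<le> K A B * (M powr (-\<alpha>) * real (\<Prod>A) powr \<alpha>)" using K_nonneg[of A B] A B by (intro mult_left_mono) auto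
    then show "K A B \<le> M powr (-\<alpha>) * (K A B * real (\<Prod>A) powr \<alpha>)" by (simp add: mult_ac)
  qed
  also have "\<dots> \<le> (\<Sum>A\<in>Pow P. \<Sum>B\<in>Pow P. M powr (-\<alpha>) * (K A B * real (\<Prod>A) powr \<alpha>))"
    using finP K_nonneg by (intro sum_mono2 sum_nonneg mult_nonneg_nonneg) auto
  also have "\<dots> = M powr (-\<alpha>) * (\<Sum>A\<in>Pow P. \<Sum>B\<in>Pow P. K A B * real (\<Prod>A) powr \<alpha>)"
    by (simp add: sum_distrib_left)
  also have "(\<Sum>A\<in>Pow P. \<Sum>B\<in>Pow P. K A B * real (\<Prod>A) powr \<alpha>) = (\<Sum>A\<in>Pow P. \<Sum>B\<in>Pow P. \<Prod>p\<in>P. ?g p (p \<in> A) (p \<in> B))"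
  proof (intro sum.cong refl)
    fix A B assume "A \<in> Pow P" "B \<in> Pow P"
    then show "K A B * real (\<Prod>A) powr \<alpha> = (\<Prod>p\<in>P. ?g p (p \<in> A) (p \<in> B))"
      by (simp add: K_prod prod_powr prod.distrib prod_if_subset del: of_nat_prod)
  qed
  also have "\<dots> = (\<Prod>p\<in>P. ?g p False False + ?g p False True + (?g p True False + ?g p True True))"
    by (rule sum_Pow_Pow_prod[OF finP])
  also have "\<dots> = (\<Prod>p\<in>P. 1 + (\<rho> p)\<^sup>2 * real p powr \<alpha> + \<rho> p / sqrt (real p) * (1 + real p powr \<alpha>))"
    by (intro prod.cong refl) (simp add: kp_def power2_eq_square algebra_simps add_divide_distrib)
  finally show ?thesis .
qed

text \<open>Rankin's trick for a b / gcd(a,b)^2: here p^\<alpha> sits at the primes in exactly one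
  of A and B.\<close>

lemma rankin_quotient:
  assumes "N > 0" "\<alpha> > 0"
  shows "(\<Sum>A\<in>Pow P. \<Sum>B\<in>{B\<in>Pow P. real (\<Prod>(A - B)) * real (\<Prod>(B - A)) > N}. K A B)
     \<le> N powr (-\<alpha>) * (\<Prod>p\<in>P. 1 + (\<rho> p)\<^sup>2 + 2 * \<rho> p * real p powr \<alpha> / sqrt (real p))"
proof -
  let ?g = "\<lambda>p a b. kp p a b * (if a \<noteq> b then real p powr \<alpha> else 1)"
  let ?q = "\<lambda>A B. real (\<Prod>(A - B)) * real (\<Prod>(B - A))"
  have "(\<Sum>A\<in>Pow P. \<Sum>B\<in>{B\<in>Pow P. ?q A B > N}. K A B)
     \<le> (\<Sum>A\<in>Pow P. \<Sum>B\<in>{B\<in>Pow P. ?q A B > N}. N powr (-\<alpha>) * (K A B * ?q A B powr \<alpha>))"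
  proof (intro sum_mono)
    fix A B assume A: "A \<in> Pow P" and B: "B \<in> {B\<in>Pow P. ?q A B > N}"
    have "1 = N powr (-\<alpha>) * N powr \<alpha>" using assms by (simp flip: powr_add)
    also have "\<dots> \<le> N powr (-\<alpha>) * ?q A B powr \<alpha>" using B assms by (intro mult_left_mono powr_mono2) auto
    finally have "K A B * 1 \<le> K A B * (N powr (-\<alpha>) * ?q A B powr \<alpha>)" using K_nonneg[of A B] A B by (intro mult_left_mono) auto
    then show "K A B \<le> N powr (-\<alpha>) * (K A B * ?q A B powr \<alpha>)" by (simp add: mult_ac)
  qed
  also have "\<dots> \<le> (\<Sum>A\<in>Pow P. \<Sum>B\<in>Pow P. N powr (-\<alpha>) * (K A B * ?q A B powr \<alpha>))"
    using finP K_nonneg by (intro sum_mono sum_mono2 mult_nonneg_nonneg) auto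
  also have "\<dots> = N powr (-\<alpha>) * (\<Sum>A\<in>Pow P. \<Sum>B\<in>Pow P. K A B * ?q A B powr \<alpha>)"
    by (simp add: sum_distrib_left)
  also have "(\<Sum>A\<in>Pow P. \<Sum>B\<in>Pow P. K A B * ?q A B powr \<alpha>) = (\<Sum>A\<in>Pow P. \<Sum>B\<in>Pow P. \<Prod>p\<in>P. ?g p (p \<in> A) (p \<in> B))"
  proof (intro sum.cong refl)
    fix A B assume AB: "A \<in> Pow P" "B \<in> Pow P"
    have fin: "finite A" "finite B" using AB finP by (auto intro: finite_subset)
    have "?q A B = real (\<Prod>((A - B) \<union> (B - A)))" using fin by (subst prod.union_disjoint) auto
    then have "?q A B powr \<alpha> = (\<Prod>p\<in>(A - B) \<union> (B - A). real p powr \<alpha>)" using AB by (subst prod_powr[symmetric]) auto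
    also have "\<dots> = (\<Prod>p\<in>P. if p \<in> (A - B) \<union> (B - A) then real p powr \<alpha> else 1)" using AB by (subst prod_if_subset) auto
    also have "\<dots> = (\<Prod>p\<in>P. if (p \<in> A) \<noteq> (p \<in> B) then real p powr \<alpha> else 1)" by (intro prod.cong refl) auto
    finally show "K A B * ?q A B powr \<alpha> = (\<Prod>p\<in>P. ?g p (p \<in> A) (p \<in> B))"
      using AB by (simp only: K_prod PowD prod.distrib)
  qed
  also have "\<dots> = (\<Prod>p\<in>P. ?g p False False + ?g p False True + (?g p True False + ?g p True True))"
    by (rule sum_Pow_Pow_prod[OF finP])
  also have "\<dots> = (\<Prod>p\<in>P. 1 + (\<rho> p)\<^sup>2 + 2 * \<rho> p * real p powr \<alpha> / sqrt (real p))"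
    by (intro prod.cong refl) (simp add: kp_def power2_eq_square algebra_simps)
  finally show ?thesis .
qed

text \<open>\<open>K\<close> is positive semidefinite, being a product of positive semidefinite \<open>2 \<times> 2\<close> kernels; so restricting to pairs in
  a common window costs at most the number of windows.\<close>

lemma window_restriction:
  fixes win :: "nat set \<Rightarrow> nat"
  assumes "F \<subseteq> Pow P" "finite J" "win ` F \<subseteq> J"
  shows "(\<Sum>A\<in>F. \<Sum>B\<in>F. K A B) \<le> real (card J) * (\<Sum>A\<in>F. \<Sum>B\<in>{B\<in>F. win A = win B}. K A B)"
proof -
  \<comment> \<open>Cholesky factorisation of the local kernel with rows (1, \<rho>/sqrt p) and
    (\<rho>/sqrt p, \<rho>^2). As functions of membership in A, the vectors for d = False and d =
    True are (1, \<rho>/sqrt p) and (0, \<rho> sqrt(1 - 1/p)).\<close>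
  define e where "e p d a = (if d then (if a then \<rho> p * sqrt (1 - 1 / real p) else 0) else (if a then \<rho> p / sqrt (real p) else 1))" for p d a
  define E where "E D A = (\<Prod>p\<in>P. e p (p \<in> D) (p \<in> A))" for D A
  have finF: "finite F" using assms(1) finP by (auto intro: finite_subset)
  have ke: "kp p a b = e p False a * e p False b + e p True a * e p True b" if "p \<in> P" for p a b
  proof -
    have "1 - 1 / real p \<ge> 0" using Ppos[OF that] by (simp add: field_simps)
    then have "sqrt (1 - 1 / real p) * sqrt (1 - 1 / real p) = 1 - 1 / real p" by simp
    moreover have "sqrt (real p) * sqrt (real p) = real p" by simp
    ultimately have "\<rho> p * sqrt (1 - 1 / real p) * (\<rho> p * sqrt (1 - 1 / real p)) = \<rho> p * \<rho> p * (1 - 1 / real p)"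
      "\<rho> p / sqrt (real p) * (\<rho> p / sqrt (real p)) = \<rho> p * \<rho> p / real p"
      by (simp_all add: mult_ac)
    then show ?thesis unfolding kp_def e_def by (cases a; cases b) (simp_all add: algebra_simps)
  qed
  have KE: "K A B = (\<Sum>D\<in>Pow P. E D A * E D B)" if "A \<in> F" "B \<in> F" for A B
  proof -
    have AB: "A \<subseteq> P" "B \<subseteq> P" using that assms(1) by auto
    have "K A B = (\<Prod>p\<in>P. e p False (p \<in> A) * e p False (p \<in> B) + e p True (p \<in> A) * e p True (p \<in> B))"
      unfolding K_prod[OF AB] by (intro prod.cong refl ke)
    also have "\<dots> = (\<Sum>D\<in>Pow P. \<Prod>p\<in>P. e p (p \<in> D) (p \<in> A) * e p (p \<in> D) (p \<in> B))"
      using sum_Pow_prod[OF finP, of "\<lambda>p d. e p d (p \<in> A) * e p d (p \<in> B)"] by simp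
    finally show ?thesis by (simp add: E_def prod.distrib)
  qed
  have group: "(\<Sum>A\<in>F. E D A) = (\<Sum>j\<in>J. \<Sum>A\<in>{A\<in>F. win A = j}. E D A)" for D
    by (rule sum.group[OF finF assms(2,3), symmetric])
  have "(\<Sum>A\<in>F. \<Sum>B\<in>F. K A B) = (\<Sum>A\<in>F. \<Sum>B\<in>F. \<Sum>D\<in>Pow P. E D A * E D B)" by (intro sum.cong refl KE)
  also have "\<dots> = (\<Sum>D\<in>Pow P. (\<Sum>A\<in>F. E D A)\<^sup>2)"
  proof -
    have "(\<Sum>D\<in>Pow P. (\<Sum>A\<in>F. E D A)\<^sup>2) = (\<Sum>A\<in>F. \<Sum>D\<in>Pow P. \<Sum>B\<in>F. E D A * E D B)"
      unfolding power2_eq_square sum_product by (rule sum.swap)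
    also have "\<dots> = (\<Sum>A\<in>F. \<Sum>B\<in>F. \<Sum>D\<in>Pow P. E D A * E D B)"
      by (rule sum.cong[OF refl], rule sum.swap)
    finally show ?thesis by simp
  qed
  \<comment> \<open>Cauchy-Schwarz over the windows, in each square separately.\<close>
  also have "\<dots> \<le> (\<Sum>D\<in>Pow P. real (card J) * (\<Sum>j\<in>J. (\<Sum>A\<in>{A\<in>F. win A = j}. E D A)\<^sup>2))"
    unfolding group by (intro sum_mono sum_square_le_card assms)
  also have "\<dots> = real (card J) * (\<Sum>j\<in>J. \<Sum>A\<in>{A\<in>F. win A = j}. \<Sum>B\<in>{B\<in>F. win B = j}. \<Sum>D\<in>Pow P. E D A * E D B)"
  proof -
    have "(\<Sum>D\<in>Pow P. \<Sum>j\<in>J. (\<Sum>A\<in>{A\<in>F. win A = j}. E D A)\<^sup>2) = (\<Sum>j\<in>J. \<Sum>D\<in>Pow P. \<Sum>A\<in>{A\<in>F. win A = j}. \<Sum>B\<in>{B\<in>F. win B = j}. E D A * E D B)"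
      unfolding power2_eq_square sum_product by (rule sum.swap)
    also have "\<dots> = (\<Sum>j\<in>J. \<Sum>A\<in>{A\<in>F. win A = j}. \<Sum>B\<in>{B\<in>F. win B = j}. \<Sum>D\<in>Pow P. E D A * E D B)"
    proof (rule sum.cong[OF refl])
      fix j
      have "(\<Sum>D\<in>Pow P. \<Sum>A\<in>{A\<in>F. win A = j}. \<Sum>B\<in>{B\<in>F. win B = j}. E D A * E D B) = (\<Sum>A\<in>{A\<in>F. win A = j}. \<Sum>D\<in>Pow P. \<Sum>B\<in>{B\<in>F. win B = j}. E D A * E D B)"
        by (rule sum.swap)
      also have "\<dots> = (\<Sum>A\<in>{A\<in>F. win A = j}. \<Sum>B\<in>{B\<in>F. win B = j}. \<Sum>D\<in>Pow P. E D A * E D B)"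
        by (rule sum.cong[OF refl], rule sum.swap)
      finally show "(\<Sum>D\<in>Pow P. \<Sum>A\<in>{A\<in>F. win A = j}. \<Sum>B\<in>{B\<in>F. win B = j}. E D A * E D B) = (\<Sum>A\<in>{A\<in>F. win A = j}. \<Sum>B\<in>{B\<in>F. win B = j}. \<Sum>D\<in>Pow P. E D A * E D B)" .
    qed
    finally show ?thesis by (simp add: sum_distrib_left[symmetric])
  qed
  also have "(\<Sum>j\<in>J. \<Sum>A\<in>{A\<in>F. win A = j}. \<Sum>B\<in>{B\<in>F. win B = j}. \<Sum>D\<in>Pow P. E D A * E D B)
      = (\<Sum>j\<in>J. \<Sum>A\<in>{A\<in>F. win A = j}. \<Sum>B\<in>{B\<in>F. win A = win B}. K A B)"
    by (intro sum.cong) (auto simp: KE)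
  also have "\<dots> = (\<Sum>A\<in>F. \<Sum>B\<in>{B\<in>F. win A = win B}. K A B)"
    by (rule sum.group[OF finF assms(2,3)])
  finally show ?thesis .
qed

lemma prime_factors_prod:
  assumes "A \<subseteq> P" shows "prime_factors (\<Prod>A) = A"
proof -
  have fin: "finite A" using assms finP by (rule finite_subset)
  have nz: "\<Prod>A \<noteq> 0" using fin assms Ppos by (auto simp: prod_zero_iff)
  show ?thesis
  proof (intro equalityI subsetI)
    fix p assume "p \<in> prime_factors (\<Prod>A)"
    then have p: "prime p" "p dvd \<Prod>A" by auto
    then obtain a where a: "a \<in> A" "p dvd a" using prime_dvd_prod_iff[OF fin p(1), of "\<lambda>x. x"] by auto
    then have "p = a" using p(1) primeP assms by (intro primes_dvd_imp_eq) auto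
    then show "p \<in> A" using a by simp
  next
    fix p assume p: "p \<in> A"
    then have "p dvd \<Prod>A" using fin by (intro dvd_prodI) auto
    then show "p \<in> prime_factors (\<Prod>A)" using nz p primeP assms by (auto simp: prime_factors_dvd)
  qed
qed

lemma Prod_subset_pos: "A \<subseteq> P \<Longrightarrow> \<Prod>A > 0"
  using Ppos by (intro prod_pos) auto

lemma inj_prod: "inj_on (\<lambda>A. \<Prod>A) (Pow P)"
  by (rule inj_onI) (metis PowD prime_factors_prod)

lemma odd_prod: "A \<subseteq> P \<Longrightarrow> odd (\<Prod>A)"
proof -
  assume A: "A \<subseteq> P"
  have "finite A" using A finP by (rule finite_subset)
  then show ?thesis using A by (induction A rule: finite_induct) (auto simp: oddP)
qed

lemma squarefree_prod:
  assumes "A \<subseteq> P" shows "squarefree (\<Prod>A)"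
  by (rule squarefree_prod_coprime) (use assms primeP in \<open>auto intro!: primes_coprime squarefree_prime\<close>)

text \<open>Divide a and b by their gcd to get m' and n'. The pairs (h m', h n') with h odd solve a
  n = b m, and those with h <= N / max m' n' lie in the box. Comparable size of a and b gives max m'
  n' <= 2 sqrt(m' n'), because sqrt e < 2, and m' n' <= N leaves room for h = 1. The 8 is this 2
  times the 4 of \<open>card_odd_le\<close>.\<close>

lemma pair_count:
  assumes AB: "A \<subseteq> P" "B \<subseteq> P" and N: "real (\<Prod>(A - B)) * real (\<Prod>(B - A)) \<le> N"
    and ratio: "real (\<Prod>A) \<le> exp 1 * real (\<Prod>B)" "real (\<Prod>B) \<le> exp 1 * real (\<Prod>A)"
  defines "c \<equiv> card {(m, n). m \<in> {1..nat \<lfloor>N\<rfloor>} \<and> n \<in> {1..nat \<lfloor>N\<rfloor>} \<and> odd m \<and> odd n \<and> \<Prod>A * n = \<Prod>B * m}"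
  shows "v A * v B * real c \<ge> N / 8 * K A B"
proof -
  have fin: "finite A" "finite B" using AB finP by (auto intro: finite_subset)
  define d where "d = \<Prod>(A \<inter> B)"
  define m' where "m' = \<Prod>(A - B)"
  define n' where "n' = \<Prod>(B - A)"
  have sub: "A \<inter> B \<subseteq> P" "A - B \<subseteq> P" "B - A \<subseteq> P" using AB by auto
  have pos: "d > 0" "m' > 0" "n' > 0" unfolding d_def m'_def n'_def using sub by (auto intro!: Prod_subset_pos)
  have odds: "odd m'" "odd n'" unfolding m'_def n'_def using sub by (auto intro!: odd_prod simp del: prod_eq_1_iff)
  have a: "\<Prod>A = d * m'" unfolding d_def m'_def using fin prod.Int_Diff[of A "\<lambda>x. x" B] by simp
  have b: "\<Prod>B = d * n'" unfolding d_def n'_def using fin prod.Int_Diff[of B "\<lambda>x. x" A] by (simp add: Int_commute)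
  define \<mu> where "\<mu> = max m' n'"
  have \<mu>1: "real \<mu> \<ge> 1" using pos by (simp add: \<mu>_def)
  have mn: "real m' * real n' \<le> N" using N by (simp add: m'_def n'_def)
  have "real m' * 1 \<le> real m' * real n'" "1 * real n' \<le> real m' * real n'" using pos by (auto intro!: mult_left_mono mult_right_mono)
  then have \<mu>N: "real \<mu> \<le> N" using mn by (simp add: \<mu>_def max_def)
  have r: "real m' \<le> exp 1 * real n'" "real n' \<le> exp 1 * real m'" using ratio pos unfolding a b by simp_all
  have \<mu>s: "real \<mu> \<le> 2 * sqrt (real m' * real n')"
  proof -
    have "(real \<mu>)\<^sup>2 \<le> exp 1 * (real m' * real n')"
    proof (cases "m' \<le> n'")
      case True
      then show ?thesis using mult_left_mono[OF r(2), of "real n'"] by (simp add: \<mu>_def max_def power2_eq_square mult_ac)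
    next
      case False
      then show ?thesis using mult_left_mono[OF r(1), of "real m'"] by (simp add: \<mu>_def max_def power2_eq_square mult_ac)
    qed
    also have "\<dots> \<le> 4 * (real m' * real n')" using exp_le by (intro mult_right_mono) auto
    finally have "real \<mu> \<le> sqrt (4 * (real m' * real n'))" by (rule real_le_rsqrt)
    then show ?thesis by (simp add: real_sqrt_mult)
  qed
  let ?H = "{h::nat. odd h \<and> real h \<le> N / real \<mu>}"
  let ?C = "{(m, n). m \<in> {1..nat \<lfloor>N\<rfloor>} \<and> n \<in> {1..nat \<lfloor>N\<rfloor>} \<and> odd m \<and> odd n \<and> \<Prod>A * n = \<Prod>B * m}"
  have "(\<lambda>h. (h * m', h * n')) ` ?H \<subseteq> ?C"
  proof (rule image_subsetI)
    fix h assume h: "h \<in> ?H"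
    then have h0: "h > 0" by (auto intro: odd_pos)
    have "real h * real \<mu> \<le> N" using h \<mu>1 by (simp add: pos_le_divide_eq)
    moreover have "real h * real m' \<le> real h * real \<mu>" "real h * real n' \<le> real h * real \<mu>" by (auto intro!: mult_left_mono simp: \<mu>_def)
    ultimately have "real (h * m') \<le> N" "real (h * n') \<le> N" by simp_all
    then have "h * m' \<le> nat \<lfloor>N\<rfloor>" "h * n' \<le> nat \<lfloor>N\<rfloor>" by (simp_all only: le_nat_floor)
    then show "(h * m', h * n') \<in> ?C" using h h0 pos odds unfolding a b by (auto simp: Suc_le_eq)
  qed
  moreover have "finite ?C" by (rule finite_subset[of _ "{1..nat \<lfloor>N\<rfloor>} \<times> {1..nat \<lfloor>N\<rfloor>}"]) auto
  ultimately have "card ((\<lambda>h. (h * m', h * n')) ` ?H) \<le> c" unfolding c_def by (intro card_mono)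
  moreover have "card ((\<lambda>h. (h * m', h * n')) ` ?H) = card ?H" using pos by (intro card_image) (auto simp: inj_on_def)
  moreover have "real (card ?H) \<ge> N / real \<mu> / 4" using \<mu>N \<mu>1 by (intro card_odd_le) (simp add: pos_le_divide_eq)
  ultimately have "N / real \<mu> / 4 \<le> real c" by linarith
  moreover have "N / (2 * sqrt (real m' * real n')) / 4 \<le> N / real \<mu> / 4"
    using \<mu>s \<mu>1 \<mu>N pos by (intro divide_right_mono divide_left_mono mult_pos_pos) auto
  ultimately have "N / 8 / sqrt (real m' * real n') \<le> real c" by simp
  then have "v A * v B * (N / 8 / sqrt (real m' * real n')) \<le> v A * v B * real c"
    using v_nonneg AB by (intro mult_left_mono) auto
  then show ?thesis unfolding K_def m'_def n'_def by (simp add: mult_ac)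
qed

text \<open>Account of the losses: pairs with a above M, and likewise with b above M, cost at most
  total/4. Restriction to a common window divides by the number of windows, at most ln M + 1, and
  the pairs with large quotient take half of what is left. With the N/8 of \<open>pair_count\<close>
  this makes 32 (ln M + 1).\<close>

theorem resonator_sum:
  fixes M N \<alpha> \<beta> :: real
  assumes M: "M \<ge> 1" and N: "N \<ge> 1" and ab: "\<alpha> > 0" "\<beta> > 0"
    and R1: "M powr (-\<alpha>) * (\<Prod>p\<in>P. 1 + (\<rho> p)\<^sup>2 * real p powr \<alpha> + \<rho> p / sqrt (real p) * (1 + real p powr \<alpha>)) \<le> total / 4"
    and R2: "N powr (-\<beta>) * (\<Prod>p\<in>P. 1 + (\<rho> p)\<^sup>2 + 2 * \<rho> p * real p powr \<beta> / sqrt (real p)) \<le> total / (4 * (ln M + 1))"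
  shows "\<exists>r. (\<forall>a. r a \<ge> 0) \<and> r 1 = 1 \<and> (\<forall>a. r a \<noteq> 0 \<longrightarrow> a > 0 \<and> odd a \<and> squarefree a \<and> real a \<le> M) \<and>
    (\<Sum>a=1..nat \<lfloor>M\<rfloor>. (r a)\<^sup>2) \<le> (\<Prod>p\<in>P. 1 + (\<rho> p)\<^sup>2) \<and>
    N / (32 * (ln M + 1)) * total \<le> (\<Sum>a=1..nat \<lfloor>M\<rfloor>. \<Sum>b=1..nat \<lfloor>M\<rfloor>. r a * r b *
       real (card {(m, n). m \<in> {1..nat \<lfloor>N\<rfloor>} \<and> n \<in> {1..nat \<lfloor>N\<rfloor>} \<and> odd m \<and> odd n \<and> a * n = b * m}))"
proof -
  define F where "F = {A\<in>Pow P. real (\<Prod>A) \<le> M}"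
  have FP: "F \<subseteq> Pow P" by (auto simp: F_def)
  have finF: "finite F" using FP finP by (auto intro: finite_subset)
  define r where "r a = (if a \<in> (\<lambda>A. \<Prod>A) ` F then \<Prod>p\<in>prime_factors a. \<rho> p else 0)" for a
  have r_prod: "r (\<Prod>A) = v A" if "A \<in> F" for A
    using that FP prime_factors_prod[of A] by (auto simp: r_def v_def)
  have r0: "r a = 0" if "a \<notin> (\<lambda>A. \<Prod>A) ` F" for a using that by (simp add: r_def)
  have injF: "inj_on (\<lambda>A. \<Prod>A) F" using inj_prod FP by (rule inj_on_subset)
  have img: "(\<lambda>A. \<Prod>A) ` F \<subseteq> {1..nat \<lfloor>M\<rfloor>}"
    using Prod_subset_pos by (force simp: F_def le_nat_floor Suc_le_eq)
  have sum1: "(\<Sum>a=1..nat \<lfloor>M\<rfloor>. f a * r a) = (\<Sum>A\<in>F. f (\<Prod>A) * v A)" for f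
  proof -
    have "(\<Sum>a=1..nat \<lfloor>M\<rfloor>. f a * r a) = (\<Sum>a\<in>(\<lambda>A. \<Prod>A) ` F. f a * r a)"
      using img r0 by (intro sum.mono_neutral_right) auto
    also have "\<dots> = (\<Sum>A\<in>F. f (\<Prod>A) * r (\<Prod>A))" by (simp add: sum.reindex[OF injF])
    finally show ?thesis using r_prod by simp
  qed
  let ?c = "\<lambda>a b. card {(m, n). m \<in> {1..nat \<lfloor>N\<rfloor>} \<and> n \<in> {1..nat \<lfloor>N\<rfloor>} \<and> odd m \<and> odd n \<and> a * n = b * m}"
  \<comment> \<open>Numbers in one window differ by a factor of at most e, the ratio that
    \<open>pair_count\<close> asks for.\<close>
  define win where "win A = nat \<lfloor>ln (real (\<Prod>A))\<rfloor>" for A :: "nat set"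
  define J where "J = {..nat \<lfloor>ln M\<rfloor>}"
  have lnM: "ln M \<ge> 0" using M by simp
  have winJ: "win ` F \<subseteq> J"
  proof (rule image_subsetI)
    fix A assume A: "A \<in> F"
    then have "real (\<Prod>A) > 0" using FP Prod_subset_pos[of A] by (auto simp del: of_nat_prod)
    then have "ln (real (\<Prod>A)) \<le> ln M" using A by (intro ln_mono) (auto simp: F_def)
    then show "win A \<in> J" unfolding win_def J_def by (simp add: nat_mono floor_mono)
  qed
  have cardJ: "real (card J) \<le> ln M + 1" "real (card J) > 0"
    unfolding J_def using lnM by (simp_all only: card_atMost) linarith+
  have same: "real (\<Prod>A) \<le> exp 1 * real (\<Prod>B)" if "A \<in> F" "B \<in> F" "win A = win B" for A B
  proof -
    have p: "real (\<Prod>A) \<ge> 1" "real (\<Prod>B) \<ge> 1" using that FP Prod_subset_pos[of A] Prod_subset_pos[of B] by (auto simp: Suc_le_eq simp del: of_nat_prod)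
    then have "ln (real (\<Prod>A)) \<ge> 0" "ln (real (\<Prod>B)) \<ge> 0" by simp_all
    then have "ln (real (\<Prod>A)) \<le> 1 + ln (real (\<Prod>B))" using that(3) unfolding win_def by linarith
    then have "exp (ln (real (\<Prod>A))) \<le> exp (1 + ln (real (\<Prod>B)))" by simp
    then show ?thesis using p by (simp add: exp_add del: of_nat_prod)
  qed
  let ?q = "\<lambda>A B. real (\<Prod>(A - B)) * real (\<Prod>(B - A))"
  have Knn: "K A B \<ge> 0" if "A \<in> F" "B \<in> F" for A B using that FP by (intro K_nonneg) auto
  have big: "(\<Sum>A\<in>F. \<Sum>B\<in>F. K A B) \<ge> total / 2"
  proof -
    define T where "T = {A\<in>Pow P. real (\<Prod>A) > M}"
    have TF: "Pow P = F \<union> T" "F \<inter> T = {}" "finite T" using finP by (auto simp: F_def T_def)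
    have t: "(\<Sum>A\<in>T. \<Sum>B\<in>Pow P. K A B) \<le> total / 4"
      using rankin_size[of M \<alpha>] M ab R1 unfolding T_def by linarith
    have "total = (\<Sum>A\<in>F. \<Sum>B\<in>Pow P. K A B) + (\<Sum>A\<in>T. \<Sum>B\<in>Pow P. K A B)"
      unfolding sum_K[symmetric] by (subst (1) TF(1)) (intro sum.union_disjoint finF TF)
    moreover have "(\<Sum>A\<in>F. \<Sum>B\<in>Pow P. K A B) = (\<Sum>A\<in>F. \<Sum>B\<in>F. K A B) + (\<Sum>A\<in>F. \<Sum>B\<in>T. K A B)"
      unfolding sum.distrib[symmetric] by (subst TF(1)) (intro sum.cong refl sum.union_disjoint finF TF)
    moreover have "(\<Sum>A\<in>F. \<Sum>B\<in>T. K A B) \<le> (\<Sum>A\<in>T. \<Sum>B\<in>Pow P. K A B)"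
    proof -
      have "(\<Sum>A\<in>F. \<Sum>B\<in>T. K A B) = (\<Sum>B\<in>T. \<Sum>A\<in>F. K B A)"
        using sum.swap[of K T F] K_sym by simp
      also have "\<dots> \<le> (\<Sum>B\<in>T. \<Sum>A\<in>Pow P. K B A)"
        using finP FP K_nonneg by (intro sum_mono sum_mono2) (auto simp: T_def)
      finally show ?thesis .
    qed
    ultimately show ?thesis using t by linarith
  qed
  have "total / 2 \<le> real (card J) * (\<Sum>A\<in>F. \<Sum>B\<in>{B\<in>F. win A = win B}. K A B)"
    using big window_restriction[OF FP _ winJ] by (simp add: J_def)
  then have "total / 2 / real (card J) \<le> (\<Sum>A\<in>F. \<Sum>B\<in>{B\<in>F. win A = win B}. K A B)"
    using cardJ by (simp add: pos_divide_le_eq mult.commute)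
  moreover have "total \<ge> 0" unfolding total_def using \<rho>nn by (intro prod_nonneg) (auto intro!: add_nonneg_nonneg)
  then have "total / 2 / (ln M + 1) \<le> total / 2 / real (card J)" using cardJ by (intro divide_left_mono) auto
  ultimately have w: "total / 2 / (ln M + 1) \<le> (\<Sum>A\<in>F. \<Sum>B\<in>{B\<in>F. win A = win B}. K A B)" by linarith
  have q: "(\<Sum>A\<in>F. \<Sum>B\<in>{B\<in>F. win A = win B \<and> ?q A B > N}. K A B) \<le> total / (4 * (ln M + 1))"
  proof -
    have "(\<Sum>A\<in>F. \<Sum>B\<in>{B\<in>F. win A = win B \<and> ?q A B > N}. K A B) \<le> (\<Sum>A\<in>F. \<Sum>B\<in>{B\<in>Pow P. ?q A B > N}. K A B)"
      using finP FP K_nonneg by (intro sum_mono sum_mono2) auto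
    also have "\<dots> \<le> (\<Sum>A\<in>Pow P. \<Sum>B\<in>{B\<in>Pow P. ?q A B > N}. K A B)"
      using finP FP K_nonneg by (intro sum_mono2 sum_nonneg) auto
    finally show ?thesis using rankin_quotient[of N \<beta>] N ab R2 by linarith
  qed
  have sp: "(\<Sum>A\<in>F. \<Sum>B\<in>{B\<in>F. win A = win B}. K A B) = (\<Sum>A\<in>F. \<Sum>B\<in>{B\<in>F. win A = win B \<and> ?q A B \<le> N}. K A B)
     + (\<Sum>A\<in>F. \<Sum>B\<in>{B\<in>F. win A = win B \<and> ?q A B > N}. K A B)"
    unfolding sum.distrib[symmetric] using finF
    by (intro sum.cong refl, subst sum.union_disjoint[symmetric]) (auto intro!: sum.cong)
  have good: "total / (4 * (ln M + 1)) \<le> (\<Sum>A\<in>F. \<Sum>B\<in>{B\<in>F. win A = win B \<and> ?q A B \<le> N}. K A B)"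
  proof -
    have "total / 2 / (ln M + 1) = 2 * (total / (4 * (ln M + 1)))" using lnM by (simp add: field_simps)
    moreover have "X \<le> a" if "Y \<le> T" "b \<le> X" "T = a + b" "Y = 2 * X" for X Y T a b :: real
      using that by linarith
    ultimately show ?thesis using w q sp by blast
  qed
  have "N / (32 * (ln M + 1)) * total = N / 8 * (total / (4 * (ln M + 1)))" by simp
  also have "\<dots> \<le> N / 8 * (\<Sum>A\<in>F. \<Sum>B\<in>{B\<in>F. win A = win B \<and> ?q A B \<le> N}. K A B)"
    using good N by (intro mult_left_mono) auto
  also have "\<dots> = (\<Sum>A\<in>F. \<Sum>B\<in>{B\<in>F. win A = win B \<and> ?q A B \<le> N}. N / 8 * K A B)" by (simp add: sum_distrib_left)
  also have "\<dots> \<le> (\<Sum>A\<in>F. \<Sum>B\<in>{B\<in>F. win A = win B \<and> ?q A B \<le> N}. v A * v B * real (?c (\<Prod>A) (\<Prod>B)))"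
  proof (intro sum_mono)
    fix A B assume "A \<in> F" "B \<in> {B\<in>F. win A = win B \<and> ?q A B \<le> N}"
    then show "N / 8 * K A B \<le> v A * v B * real (?c (\<Prod>A) (\<Prod>B))"
      using FP same[of A B] same[of B A] by (intro pair_count) auto
  qed
  also have "\<dots> \<le> (\<Sum>A\<in>F. \<Sum>B\<in>F. v A * v B * real (?c (\<Prod>A) (\<Prod>B)))"
    using finF FP v_nonneg by (intro sum_mono sum_mono2) (auto intro!: mult_nonneg_nonneg)
  also have "\<dots> = (\<Sum>a=1..nat \<lfloor>M\<rfloor>. \<Sum>b=1..nat \<lfloor>M\<rfloor>. r a * r b * real (?c a b))"
  proof -
    have "(\<Sum>a=1..nat \<lfloor>M\<rfloor>. \<Sum>b=1..nat \<lfloor>M\<rfloor>. r a * r b * real (?c a b)) = (\<Sum>a=1..nat \<lfloor>M\<rfloor>. (\<Sum>b=1..nat \<lfloor>M\<rfloor>. real (?c a b) * r b) * r a)"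
      by (simp add: sum_distrib_left sum_distrib_right mult_ac)
    also have "\<dots> = (\<Sum>A\<in>F. (\<Sum>B\<in>F. real (?c (\<Prod>A) (\<Prod>B)) * v B) * v A)"
      unfolding sum1 by (rule refl)
    finally show ?thesis by (simp add: sum_distrib_left sum_distrib_right mult_ac)
  qed
  finally have main: "N / (32 * (ln M + 1)) * total \<le> (\<Sum>a=1..nat \<lfloor>M\<rfloor>. \<Sum>b=1..nat \<lfloor>M\<rfloor>. r a * r b * real (?c a b))" .
  have sq: "(\<Sum>a=1..nat \<lfloor>M\<rfloor>. (r a)\<^sup>2) \<le> (\<Prod>p\<in>P. 1 + (\<rho> p)\<^sup>2)"
  proof -
    have "(\<Sum>a=1..nat \<lfloor>M\<rfloor>. (r a)\<^sup>2) = (\<Sum>A\<in>F. r (\<Prod>A) * v A)" unfolding power2_eq_square by (rule sum1)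
    also have "\<dots> = (\<Sum>A\<in>F. (v A)\<^sup>2)" using r_prod by (simp add: power2_eq_square)
    also have "\<dots> \<le> (\<Sum>A\<in>Pow P. (v A)\<^sup>2)" using finP FP by (intro sum_mono2) auto
    finally show ?thesis by (simp add: sum_v2)
  qed
  have "{} \<in> F" using M by (simp add: F_def)
  then have "r 1 = 1" using r_prod[of "{}"] by (simp add: v_def)
  moreover have "r a \<ge> 0" for a
    using r_prod v_nonneg FP r0 by (cases "a \<in> (\<lambda>A. \<Prod>A) ` F") auto
  moreover have "a > 0 \<and> odd a \<and> squarefree a \<and> real a \<le> M" if ra: "r a \<noteq> 0" for a
  proof -
    have "a \<in> (\<lambda>A. \<Prod>A) ` F" using ra r0 by blast
    then obtain A where A: "a = \<Prod>A" "A \<in> F" by (rule imageE)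
    then have "A \<subseteq> P" "real (\<Prod>A) \<le> M" by (auto simp: F_def)
    then show ?thesis unfolding A(1) using Prod_subset_pos[of A] odd_prod[of A] squarefree_prod[of A] by simp
  qed
  ultimately show ?thesis using main sq by blast
qed

end

text \<open>The growth comparisons for \<open>gcd_sum_resonator\<close>, isolated so that they
  concern elementary functions of l only. In the seventh, l^(1/2 + \<delta>) has to beat sqrt(l ln
  l) ln l: there the lower bound for N enters. The last one absorbs the loss 32 (l + 1) into half of
  \<epsilon>.\<close>

lemma real_resonator_bounds:
  fixes \<eta> \<epsilon> \<delta> C :: real
  assumes "0 < \<eta>" "\<eta> < 1" "0 < \<epsilon>" "0 < \<delta>"
  shows "\<forall>\<^sub>F l in at_top. 1 - \<eta> \<le> ln l * (1 / ln (l * ln l + 1) - 1 / ln (exp ((ln l)\<^sup>2) - 1) - C / (ln (l * ln l))\<^sup>2)"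
    "\<forall>\<^sub>F l in at_top. ln l * (1 / ln (l * ln l) + C / (ln (l * ln l))\<^sup>2) \<le> 1 + \<eta>"
    "\<forall>\<^sub>F l in at_top. ((ln l)\<^sup>2 + C) / ln l \<le> 2 * ln l"
    "\<forall>\<^sub>F l in at_top. 1 / (ln l)\<^sup>2 \<le> \<eta>"
    "\<forall>\<^sub>F l in at_top. 4 * sqrt (l * ln l) * ln l \<le> \<eta>\<^sup>2 * l / 2"
    "\<forall>\<^sub>F l in at_top. exp (- (\<eta> ^ 3 * l / (2 * (ln l)\<^sup>2))) \<le> 1 / 4"
    "\<forall>\<^sub>F l in at_top. exp (\<eta> / (ln l)\<^sup>2 * (8 * sqrt (l * ln l) * ln l - l powr (1/2 + \<delta>))) * (4 * (l + 1)) \<le> 1"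
    "\<forall>\<^sub>F l in at_top. 2 * sqrt (l * ln l) / (l * ln l * ln l) \<le> \<eta>"
    "\<forall>\<^sub>F l in at_top. 32 * (l + 1) \<le> exp (\<epsilon> / 2 * sqrt (l / ln l))"
proof -
  have "((\<lambda>l. ln l * (1 / ln (l * ln l + 1) - 1 / ln (exp ((ln l)\<^sup>2) - 1) - C / (ln (l * ln l))\<^sup>2)) \<longlongrightarrow> 1) at_top"
    by real_asymp
  from order_tendstoD(1)[OF this, of "1 - \<eta>"] assms
  show "\<forall>\<^sub>F l in at_top. 1 - \<eta> \<le> ln l * (1 / ln (l * ln l + 1) - 1 / ln (exp ((ln l)\<^sup>2) - 1) - C / (ln (l * ln l))\<^sup>2)"
    by (auto elim: eventually_mono)
  have "((\<lambda>l. ln l * (1 / ln (l * ln l) + C / (ln (l * ln l))\<^sup>2)) \<longlongrightarrow> 1) at_top"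
    by real_asymp
  from order_tendstoD(2)[OF this, of "1 + \<eta>"] assms
  show "\<forall>\<^sub>F l in at_top. ln l * (1 / ln (l * ln l) + C / (ln (l * ln l))\<^sup>2) \<le> 1 + \<eta>"
    by (auto elim: eventually_mono)
  show "\<forall>\<^sub>F l in at_top. ((ln l)\<^sup>2 + C) / ln l \<le> 2 * ln l" by real_asymp
  show "\<forall>\<^sub>F l in at_top. 1 / (ln l)\<^sup>2 \<le> \<eta>" using assms by real_asymp
  show "\<forall>\<^sub>F l in at_top. 4 * sqrt (l * ln l) * ln l \<le> \<eta>\<^sup>2 * l / 2" using assms by real_asymp
  show "\<forall>\<^sub>F l in at_top. exp (- (\<eta> ^ 3 * l / (2 * (ln l)\<^sup>2))) \<le> 1 / 4" using assms by real_asymp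
  show "\<forall>\<^sub>F l in at_top. exp (\<eta> / (ln l)\<^sup>2 * (8 * sqrt (l * ln l) * ln l - l powr (1/2 + \<delta>))) * (4 * (l + 1)) \<le> 1"
    using assms by real_asymp
  show "\<forall>\<^sub>F l in at_top. 2 * sqrt (l * ln l) / (l * ln l * ln l) \<le> \<eta>" using assms by real_asymp
  show "\<forall>\<^sub>F l in at_top. 32 * (l + 1) \<le> exp (\<epsilon> / 2 * sqrt (l / ln l))" using assms by real_asymp
qed

lemma prod_le_exp_sum:
  fixes D e :: "'a \<Rightarrow> real"
  assumes "\<And>p. p \<in> P \<Longrightarrow> D p \<ge> 1" "\<And>p. p \<in> P \<Longrightarrow> e p \<ge> 0" "finite P"
  shows "(\<Prod>p\<in>P. D p + e p) \<le> (\<Prod>p\<in>P. D p) * exp (\<Sum>p\<in>P. e p)"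
proof -
  have "(\<Prod>p\<in>P. D p + e p) \<le> (\<Prod>p\<in>P. D p * exp (e p))"
  proof (rule prod_mono)
    fix p assume p: "p \<in> P"
    have "D p * (1 + e p) \<le> D p * exp (e p)" using assms(1)[OF p] exp_ge_add_one_self[of "e p"] by (intro mult_left_mono) auto
    moreover have "1 * e p \<le> D p * e p" using assms(1,2)[OF p] by (intro mult_right_mono) auto
    ultimately show "0 \<le> D p + e p \<and> D p + e p \<le> D p * exp (e p)"
      using assms(1,2)[OF p] by (simp add: algebra_simps)
  qed
  also have "\<dots> = (\<Prod>p\<in>P. D p) * exp (\<Sum>p\<in>P. e p)" using assms(3) by (simp add: prod.distrib exp_sum)
  finally show ?thesis .
qed

text \<open>Under the weights of the resonator the mean of ln a is about \<theta>^2 S, where S, the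
  sum of 1/(p ln p) over P, is about 1/ln l. For \<theta> slightly below sqrt(l ln l) this mean is
  slightly below l, so truncation at exp l loses little, while \<open>total\<close> exceeds the sum
  of squares by a factor of about exp(2 \<theta> S), and 2 \<theta> S is about 2 sqrt(l / ln
  l).\<close>

theorem gcd_sum_resonator:
  fixes \<epsilon> \<delta> :: real
  assumes "0 < \<epsilon>" "0 < \<delta>"
  shows "\<forall>\<^sub>F l in at_top. \<forall>N. N \<ge> 1 \<and> ln N \<ge> l powr (1/2 + \<delta>) \<longrightarrow>
    (\<exists>r. (\<forall>a. r a \<ge> 0) \<and> r 1 = (1::real) \<and> (\<forall>a. r a \<noteq> 0 \<longrightarrow> a > 0 \<and> odd a \<and> squarefree a \<and> real a \<le> exp l) \<and>
      N * exp ((2 - \<epsilon>) * sqrt (l / ln l)) * (\<Sum>a=1..nat \<lfloor>exp l\<rfloor>. (r a)\<^sup>2) \<le>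
      (\<Sum>a=1..nat \<lfloor>exp l\<rfloor>. \<Sum>b=1..nat \<lfloor>exp l\<rfloor>. r a * r b *
       real (card {(m, n). m \<in> {1..nat \<lfloor>N\<rfloor>} \<and> n \<in> {1..nat \<lfloor>N\<rfloor>} \<and> odd m \<and> odd n \<and> a * n = b * m})))"
proof -
  define \<eta> where "\<eta> = min (\<epsilon> / 16) (1 / 4)"
  have \<eta>: "0 < \<eta>" "\<eta> < 1" "\<eta> \<le> 1 / 4" "16 * \<eta> \<le> \<epsilon>" using assms by (auto simp: \<eta>_def min_def)
  obtain C where C: "C \<ge> 0"
    "\<And>y z. 2 \<le> y \<Longrightarrow> y \<le> z \<Longrightarrow>
       \<bar>(\<Sum>p | prime p \<and> y < p \<and> p \<le> z. 1 / (real p * ln (real p))) - (1 / ln (real y) - 1 / ln (real z))\<bar>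
         \<le> C / (ln (real y))\<^sup>2"
    "\<And>y z. 2 \<le> y \<Longrightarrow> y \<le> z \<Longrightarrow>
       (\<Sum>p | prime p \<and> y < p \<and> p \<le> z. 1 / real p) \<le> (ln (real z) + C) / ln (real y)"
    using prime_sum_inverse_p_ln_p by blast
  have big: "\<forall>\<^sub>F l :: real in at_top. l * ln l + 1 \<le> exp ((ln l)\<^sup>2) - 1" by real_asymp
  show ?thesis
    using real_resonator_bounds(1-3)[OF \<eta>(1,2) assms, of C] real_resonator_bounds(4-9)[OF \<eta>(1,2) assms] big eventually_ge_at_top[of "exp 1"]
  proof eventually_elim
    case (elim l)
    define L where "L = ln l"
    note f = elim(1-9)[folded L_def]
    have l: "l \<ge> exp 1" by fact
    have l0: "l \<ge> 2" using l exp_ge_add_one_self[of 1] by linarith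
    have L1: "L \<ge> 1" unfolding L_def using l l0 by (simp add: ln_ge_iff)
    have "l * 1 \<le> l * L" using l0 L1 by (intro mult_left_mono) auto
    then have lL: "l * L \<ge> l" "l * L \<ge> 2" using l0 by linarith+
    \<comment> \<open>Beyond l ln l the squares \<rho>^2 are at most 1/(ln l)^2, so the factors of
      the products can be linearised. The upper end makes 1/ln z, about 1/(ln l)^2, negligible
      against 1/ln y.\<close>
    define y where "y = nat \<lceil>l * L\<rceil>"
    define z where "z = nat \<lfloor>exp (L\<^sup>2)\<rfloor>"
    have y: "l * L \<le> real y" "real y \<le> l * L + 1" "y \<ge> 2" using lL unfolding y_def by linarith+
    have eb: "l * L + 1 \<le> exp (L\<^sup>2) - 1" using elim(10) unfolding L_def .
    have z: "exp (L\<^sup>2) - 1 \<le> real z" "real z \<le> exp (L\<^sup>2)" using eb lL unfolding z_def by linarith+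
    have yz: "y \<le> z" using y z eb by linarith
    define P where "P = {p. prime p \<and> y < p \<and> p \<le> z}"
    have finP: "finite P" unfolding P_def by (rule finite_subset[of _ "{..z}"]) auto
    have P: "prime p" "l * L < real p" "L \<le> ln (real p)" "ln (real p) \<le> L\<^sup>2" "real p > 0" if "p \<in> P" for p
    proof -
      show "prime p" using that by (simp add: P_def)
      have "real y < real p" using that by (simp add: P_def)
      then show p: "l * L < real p" using y by linarith
      then show pp: "real p > 0" using lL by linarith
      have "l \<le> real p" using p lL by linarith
      then show "L \<le> ln (real p)" unfolding L_def using l0 by (intro ln_mono) auto
      have "real p \<le> real z" using that by (simp add: P_def)
      then have "real p \<le> exp (L\<^sup>2)" using z by linarith
      then have "ln (real p) \<le> ln (exp (L\<^sup>2))" using pp by (intro ln_mono) auto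
      then show "ln (real p) \<le> L\<^sup>2" by simp
    qed
    define S where "S = (\<Sum>p\<in>P. 1 / (real p * ln (real p)))"
    define S1 where "S1 = (\<Sum>p\<in>P. 1 / real p)"
    have lny: "ln (real y) \<ge> ln (l * L)" "ln (real y) \<le> ln (l * L + 1)" using y lL by (auto intro!: ln_mono)
    have lnlL: "ln (l * L) \<ge> L" unfolding L_def using lL[unfolded L_def] l0 by (intro ln_mono) auto
    have lnlL': "ln (l * L) > 0" using lnlL L1 by linarith
    note lnlL = lnlL lnlL'
    have lnz: "ln (real z) \<ge> ln (exp (L\<^sup>2) - 1)" "ln (real z) \<le> L\<^sup>2" "ln (exp (L\<^sup>2) - 1) > 0"
    proof -
      show "ln (real z) \<ge> ln (exp (L\<^sup>2) - 1)" using z eb lL by (intro ln_mono) auto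
      have "ln (real z) \<le> ln (exp (L\<^sup>2))" using z eb lL by (intro ln_mono) linarith+
      then show "ln (real z) \<le> L\<^sup>2" by simp
      show "ln (exp (L\<^sup>2) - 1) > 0" using eb lL by (intro ln_gt_zero) linarith
    qed
    have Sdev: "\<bar>S - (1 / ln (real y) - 1 / ln (real z))\<bar> \<le> C / (ln (real y))\<^sup>2"
      unfolding S_def P_def by (rule C(2)[OF y(3) yz])
    have Cy: "C / (ln (real y))\<^sup>2 \<le> C / (ln (l * L))\<^sup>2"
      using C(1) lny lnlL by (intro divide_left_mono power_mono) auto
    have S_low: "(1 - \<eta>) / L \<le> S"
    proof -
      have "1 / ln (l * L + 1) \<le> 1 / ln (real y)" using lny lnlL by (intro divide_left_mono) auto
      moreover have "1 / ln (real z) \<le> 1 / ln (exp (L\<^sup>2) - 1)" using lnz by (intro divide_left_mono) auto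
      ultimately have "1 / ln (l * L + 1) - 1 / ln (exp (L\<^sup>2) - 1) - C / (ln (l * L))\<^sup>2 \<le> S" using Sdev Cy by linarith
      then have "L * (1 / ln (l * L + 1) - 1 / ln (exp (L\<^sup>2) - 1) - C / (ln (l * L))\<^sup>2) \<le> L * S" using L1 by (intro mult_left_mono) auto
      then have "1 - \<eta> \<le> L * S" using f(1) by linarith
      then show ?thesis using L1 by (simp add: divide_le_eq mult.commute)
    qed
    have S_up: "S \<le> (1 + \<eta>) / L"
    proof -
      have "1 / ln (real y) \<le> 1 / ln (l * L)" using lny lnlL by (intro divide_left_mono) auto
      moreover have "1 / ln (real z) \<ge> 0" using lnz by simp
      ultimately have "S \<le> 1 / ln (l * L) + C / (ln (l * L))\<^sup>2" using Sdev Cy by linarith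
      then have "L * S \<le> L * (1 / ln (l * L) + C / (ln (l * L))\<^sup>2)" using L1 by (intro mult_left_mono) auto
      then have "L * S \<le> 1 + \<eta>" using f(2) by linarith
      then show ?thesis using L1 by (simp add: pos_le_divide_eq mult.commute)
    qed
    have S1_up: "S1 \<le> 2 * L"
    proof -
      have "S1 \<le> (ln (real z) + C) / ln (real y)" unfolding S1_def P_def by (rule C(3)[OF y(3) yz])
      also have "\<dots> \<le> (L\<^sup>2 + C) / L" using lnz lny lnlL L1 C(1) by (intro frac_le) auto
      also have "\<dots> \<le> 2 * L" using f(3) .
      finally show ?thesis .
    qed
    have S0: "S \<ge> 0" "S1 \<ge> 0" unfolding S_def S1_def using order_trans[OF order_trans[OF zero_le_one L1] P(3)] by (auto intro!: sum_nonneg)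
    define \<theta> where "\<theta> = (1 - \<eta>) * sqrt (l * L)"
    have \<theta>0: "\<theta> \<ge> 0" "\<theta> \<le> sqrt (l * L)" using \<eta> lL by (auto simp: \<theta>_def mult_left_le_one_le)
    have \<theta>2: "\<theta>\<^sup>2 = (1 - \<eta>)\<^sup>2 * (l * L)" using lL by (simp add: \<theta>_def power_mult_distrib)
    define \<rho> where "\<rho> p = \<theta> / (sqrt (real p) * ln (real p))" for p
    have \<rho>s: "\<rho> p / sqrt (real p) = \<theta> * (1 / (real p * ln (real p)))" "(\<rho> p)\<^sup>2 * ln (real p) = \<theta>\<^sup>2 * (1 / (real p * ln (real p)))"
       "\<rho> p / sqrt (real p) * ln (real p) = \<theta> * (1 / real p)" "\<rho> p \<ge> 0" "(\<rho> p)\<^sup>2 \<le> \<eta>" "2 * \<rho> p / sqrt (real p) \<le> \<eta>"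
      if p: "p \<in> P" for p
    proof -
      have lp: "ln (real p) > 0" using P(3)[OF p] L1 by linarith
      have sq: "sqrt (real p) * sqrt (real p) = real p" by simp
      have sp: "sqrt (real p) > 0" using P(5)[OF p] by simp
      show 1: "\<rho> p / sqrt (real p) = \<theta> * (1 / (real p * ln (real p)))"
        unfolding \<rho>_def using sq by (simp add: mult_ac)
      have 2: "(\<rho> p)\<^sup>2 = \<theta>\<^sup>2 / (real p * (ln (real p))\<^sup>2)"
        unfolding \<rho>_def using P(5)[OF p] by (simp add: power_divide power_mult_distrib)
      show "(\<rho> p)\<^sup>2 * ln (real p) = \<theta>\<^sup>2 * (1 / (real p * ln (real p)))"
        unfolding 2 using lp by (simp add: power2_eq_square)
      show "\<rho> p / sqrt (real p) * ln (real p) = \<theta> * (1 / real p)" unfolding 1 using lp by simp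
      show "\<rho> p \<ge> 0" unfolding \<rho>_def using \<theta>0 lp by simp
      have "\<theta>\<^sup>2 \<le> l * L" using \<theta>0 lL power_mono[of \<theta> "sqrt (l * L)" 2] by simp
      then have "(\<rho> p)\<^sup>2 \<le> (l * L) / ((l * L) * L\<^sup>2)"
        unfolding 2 using P(2,3)[OF p] lL L1 l0 by (intro frac_le mult_mono power_mono) auto
      also have "\<dots> = 1 / L\<^sup>2" using lL l0 L1 by simp
      also have "\<dots> \<le> \<eta>" by (rule f(4))
      finally show "(\<rho> p)\<^sup>2 \<le> \<eta>" .
      have "2 * \<rho> p / sqrt (real p) = 2 * \<theta> / (real p * ln (real p))" using 1 by simp
      also have "\<dots> \<le> 2 * sqrt (l * L) / (l * L * L)"
        using \<theta>0 P(2,3)[OF p] lL L1 l0 by (intro frac_le mult_mono) auto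
      also have "\<dots> \<le> \<eta>" by (rule f(8))
      finally show "2 * \<rho> p / sqrt (real p) \<le> \<eta>" .
    qed
    interpret resonator P \<rho>
    proof
      fix p assume p: "p \<in> P"
      have "2 < p" using p y by (simp add: P_def)
      then show "odd p" using P(1)[OF p] by (metis prime_odd_nat)
    qed (use finP P \<rho>s in auto)
    \<comment> \<open>With this choice \<alpha> ln p <= \<eta> throughout P, so p^\<alpha> - 1 is at
      most (1 + \<eta>) \<alpha> ln p.\<close>
    define \<alpha> where "\<alpha> = \<eta> / L\<^sup>2"
    have \<alpha>0: "\<alpha> > 0" using \<eta> L1 by (simp add: \<alpha>_def)
    have pa: "0 \<le> real p powr \<alpha> - 1 \<and> real p powr \<alpha> - 1 \<le> (1 + \<eta>) * \<alpha> * ln (real p)" if p: "p \<in> P" for p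
    proof -
      define t where "t = \<alpha> * ln (real p)"
      have t0: "t \<ge> 0" using \<alpha>0 P(3)[OF p] L1 by (simp add: t_def)
      have "t \<le> \<alpha> * L\<^sup>2" unfolding t_def using \<alpha>0 P(4)[OF p] by (intro mult_left_mono) auto
      also have "\<dots> = \<eta>" using L1 by (simp add: \<alpha>_def)
      finally have t1: "t \<le> \<eta>" .
      have e: "real p powr \<alpha> = exp t" using P(5)[OF p] by (simp add: powr_def t_def)
      have "exp t \<le> 1 + t + t\<^sup>2" using t0 t1 \<eta> by (intro exp_bound) auto
      moreover have "t\<^sup>2 \<le> \<eta> * t" using t0 t1 unfolding power2_eq_square by (intro mult_right_mono)
      ultimately have "exp t - 1 \<le> (1 + \<eta>) * t" by (simp add: algebra_simps)
      moreover have "exp t \<ge> 1" using t0 by simp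
      ultimately show ?thesis unfolding e by (simp add: t_def mult.assoc)
    qed
    define D where "D p = 1 + (\<rho> p)\<^sup>2 + 2 * \<rho> p / sqrt (real p)" for p
    have D1: "D p \<ge> 1" if "p \<in> P" for p using \<rho>s(4)[OF that] by (simp add: D_def)
    have totalD: "total = (\<Prod>p\<in>P. D p)" by (simp add: total_def D_def)
    have total0: "total > 0" unfolding totalD by (rule prod_pos) (rule less_le_trans[OF zero_less_one D1])
    have R1: "exp l powr (-\<alpha>) * (\<Prod>p\<in>P. 1 + (\<rho> p)\<^sup>2 * real p powr \<alpha> + \<rho> p / sqrt (real p) * (1 + real p powr \<alpha>)) \<le> total / 4"
    proof -
      define e where "e p = (real p powr \<alpha> - 1) * ((\<rho> p)\<^sup>2 + \<rho> p / sqrt (real p))" for p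
      have e0: "e p \<ge> 0" if "p \<in> P" for p unfolding e_def using pa[OF that] \<rho>s(4)[OF that] by (intro mult_nonneg_nonneg) auto
      have "(\<Prod>p\<in>P. 1 + (\<rho> p)\<^sup>2 * real p powr \<alpha> + \<rho> p / sqrt (real p) * (1 + real p powr \<alpha>)) = (\<Prod>p\<in>P. D p + e p)"
        by (intro prod.cong refl) (simp add: D_def e_def algebra_simps add_divide_distrib diff_divide_distrib)
      also have "\<dots> \<le> total * exp (\<Sum>p\<in>P. e p)" unfolding totalD by (rule prod_le_exp_sum) (use D1 e0 finP in auto)
      finally have 1: "(\<Prod>p\<in>P. 1 + (\<rho> p)\<^sup>2 * real p powr \<alpha> + \<rho> p / sqrt (real p) * (1 + real p powr \<alpha>)) \<le> total * exp (\<Sum>p\<in>P. e p)" .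
      have "(\<Sum>p\<in>P. e p) \<le> (\<Sum>p\<in>P. (1 + \<eta>) * \<alpha> * (\<theta>\<^sup>2 * (1 / (real p * ln (real p))) + \<theta> * (1 / real p)))"
      proof (intro sum_mono)
        fix p assume p: "p \<in> P"
        have "e p \<le> ((1 + \<eta>) * \<alpha> * ln (real p)) * ((\<rho> p)\<^sup>2 + \<rho> p / sqrt (real p))"
          unfolding e_def using pa[OF p] \<rho>s(4)[OF p] by (intro mult_right_mono) auto
        also have "\<dots> = (1 + \<eta>) * \<alpha> * ((\<rho> p)\<^sup>2 * ln (real p) + \<rho> p / sqrt (real p) * ln (real p))" by (simp add: algebra_simps add_divide_distrib)
        finally show "e p \<le> (1 + \<eta>) * \<alpha> * (\<theta>\<^sup>2 * (1 / (real p * ln (real p))) + \<theta> * (1 / real p))"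
          unfolding \<rho>s(2,3)[OF p] .
      qed
      also have "\<dots> = (1 + \<eta>) * \<alpha> * (\<theta>\<^sup>2 * S + \<theta> * S1)"
        unfolding S_def S1_def by (simp only: sum_distrib_left[symmetric] sum.distrib)
      also have "\<dots> \<le> (1 + \<eta>) * \<alpha> * ((1 - \<eta>)\<^sup>2 * (1 + \<eta>) * l + sqrt (l * L) * (2 * L))"
      proof -
        have "\<theta>\<^sup>2 * S \<le> ((1 - \<eta>)\<^sup>2 * (l * L)) * ((1 + \<eta>) / L)" unfolding \<theta>2 using S_up lL by (intro mult_left_mono) auto
        also have "\<dots> = (1 - \<eta>)\<^sup>2 * (1 + \<eta>) * l" using L1 by simp
        finally have "\<theta>\<^sup>2 * S \<le> (1 - \<eta>)\<^sup>2 * (1 + \<eta>) * l" .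
        moreover have "\<theta> * S1 \<le> sqrt (l * L) * (2 * L)" using \<theta>0 S1_up S0 lL by (intro mult_mono) auto
        ultimately show ?thesis using \<alpha>0 \<eta> by (intro mult_left_mono add_mono) auto
      qed
      \<comment> \<open>The factors 1 + \<eta> from linearising, (1 - \<eta>)^2 from \<theta>^2 and
        1 + \<eta> from S combine to (1 - \<eta>^2)^2. This leaves room \<eta>^2 l, half of which
        absorbs the lower order term from \<theta> S1.\<close>
      also have "\<dots> \<le> \<alpha> * (l - \<eta>\<^sup>2 * l / 2)"
      proof -
        have "(1 + \<eta>) * ((1 - \<eta>)\<^sup>2 * (1 + \<eta>) * l) = (1 - \<eta>\<^sup>2)\<^sup>2 * l" by (simp add: power2_eq_square algebra_simps)
        also have "\<dots> \<le> (1 - \<eta>\<^sup>2) * l"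
        proof -
          have "\<eta>\<^sup>2 \<le> 1" using \<eta> by (simp add: power_le_one)
          then have "(1 - \<eta>\<^sup>2)\<^sup>2 \<le> 1 - \<eta>\<^sup>2" unfolding power2_eq_square[of "1 - \<eta>\<^sup>2"] by (intro mult_left_le) auto
          then show ?thesis using l0 by (intro mult_right_mono) auto
        qed
        finally have a: "(1 + \<eta>) * ((1 - \<eta>)\<^sup>2 * (1 + \<eta>) * l) \<le> (1 - \<eta>\<^sup>2) * l" .
        have "(1 + \<eta>) * (sqrt (l * L) * (2 * L)) \<le> 2 * (sqrt (l * L) * (2 * L))" using \<eta> L1 lL by (intro mult_right_mono) auto
        also have "\<dots> = 4 * sqrt (l * L) * L" by simp
        also have "\<dots> \<le> \<eta>\<^sup>2 * l / 2" by (rule f(5))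
        finally have "(1 + \<eta>) * ((1 - \<eta>)\<^sup>2 * (1 + \<eta>) * l + sqrt (l * L) * (2 * L)) \<le> (1 - \<eta>\<^sup>2) * l + \<eta>\<^sup>2 * l / 2"
          unfolding distrib_left[of "1 + \<eta>"] using a by linarith
        then have "\<alpha> * ((1 + \<eta>) * ((1 - \<eta>)\<^sup>2 * (1 + \<eta>) * l + sqrt (l * L) * (2 * L))) \<le> \<alpha> * ((1 - \<eta>\<^sup>2) * l + \<eta>\<^sup>2 * l / 2)"
          using \<alpha>0 by (intro mult_left_mono) auto
        moreover have "(1 - \<eta>\<^sup>2) * l + \<eta>\<^sup>2 * l / 2 = l - \<eta>\<^sup>2 * l / 2" by (simp add: field_simps)
        ultimately show ?thesis by (simp add: mult.assoc mult.left_commute)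
      qed
      finally have "(\<Sum>p\<in>P. e p) \<le> \<alpha> * l - \<eta> ^ 3 * l / (2 * L\<^sup>2)"
        by (simp add: \<alpha>_def right_diff_distrib power3_eq_cube power2_eq_square)
      then have "exp l powr (-\<alpha>) * exp (\<Sum>p\<in>P. e p) \<le> exp (- (\<eta> ^ 3 * l / (2 * L\<^sup>2)))"
        by (simp add: powr_def flip: exp_add)
      also have "\<dots> \<le> 1 / 4" by (rule f(6))
      finally have 2: "exp l powr (-\<alpha>) * exp (\<Sum>p\<in>P. e p) \<le> 1 / 4" .
      have "exp l powr (-\<alpha>) * (\<Prod>p\<in>P. 1 + (\<rho> p)\<^sup>2 * real p powr \<alpha> + \<rho> p / sqrt (real p) * (1 + real p powr \<alpha>))
         \<le> exp l powr (-\<alpha>) * (total * exp (\<Sum>p\<in>P. e p))" using 1 by (intro mult_left_mono) auto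
      also have "\<dots> = total * (exp l powr (-\<alpha>) * exp (\<Sum>p\<in>P. e p))" by simp
      also have "\<dots> \<le> total * (1 / 4)" using 2 total0 by (intro mult_left_mono) auto
      finally show ?thesis by simp
    qed
    show ?case
    proof (intro allI impI)
      fix N :: real assume N: "N \<ge> 1 \<and> ln N \<ge> l powr (1/2 + \<delta>)"
      \<comment> \<open>The exponent added by the weights p^\<alpha> is at most a constant times
        \<alpha> sqrt(l ln l) ln l, while N^(-\<alpha>) saves at least \<alpha> l^(1/2 + \<delta>)
        in the exponent.\<close>
      have R2: "N powr (-\<alpha>) * (\<Prod>p\<in>P. 1 + (\<rho> p)\<^sup>2 + 2 * \<rho> p * real p powr \<alpha> / sqrt (real p)) \<le> total / (4 * (ln (exp l) + 1))"
      proof -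
        define e where "e p = (real p powr \<alpha> - 1) * (2 * (\<rho> p / sqrt (real p)))" for p
        have e0: "e p \<ge> 0" if "p \<in> P" for p unfolding e_def using pa[OF that] \<rho>s(4)[OF that] by (intro mult_nonneg_nonneg) auto
        have "(\<Prod>p\<in>P. 1 + (\<rho> p)\<^sup>2 + 2 * \<rho> p * real p powr \<alpha> / sqrt (real p)) = (\<Prod>p\<in>P. D p + e p)"
          by (intro prod.cong refl) (simp add: D_def e_def algebra_simps add_divide_distrib diff_divide_distrib)
        also have "\<dots> \<le> total * exp (\<Sum>p\<in>P. e p)" unfolding totalD by (rule prod_le_exp_sum) (use D1 e0 finP in auto)
        finally have 1: "(\<Prod>p\<in>P. 1 + (\<rho> p)\<^sup>2 + 2 * \<rho> p * real p powr \<alpha> / sqrt (real p)) \<le> total * exp (\<Sum>p\<in>P. e p)" .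
        have "(\<Sum>p\<in>P. e p) \<le> (\<Sum>p\<in>P. 2 * (1 + \<eta>) * \<alpha> * \<theta> * (1 / real p))"
        proof (intro sum_mono)
          fix p assume p: "p \<in> P"
          have "e p \<le> ((1 + \<eta>) * \<alpha> * ln (real p)) * (2 * (\<rho> p / sqrt (real p)))"
            unfolding e_def using pa[OF p] \<rho>s(4)[OF p] by (intro mult_right_mono) auto
          also have "\<dots> = 2 * (1 + \<eta>) * \<alpha> * (\<rho> p / sqrt (real p) * ln (real p))" by simp
          finally show "e p \<le> 2 * (1 + \<eta>) * \<alpha> * \<theta> * (1 / real p)"
            unfolding \<rho>s(3)[OF p] by (simp add: mult.assoc)
        qed
        also have "\<dots> = 2 * (1 + \<eta>) * \<alpha> * (\<theta> * S1)" unfolding S1_def sum_distrib_left[symmetric] by simp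
        also have "\<dots> \<le> 4 * \<alpha> * (sqrt (l * L) * (2 * L))"
          using \<theta>0 S1_up S0 lL \<eta> \<alpha>0 by (intro mult_mono) auto
        finally have es: "(\<Sum>p\<in>P. e p) \<le> \<alpha> * (8 * sqrt (l * L) * L)" by simp
        have "N powr (-\<alpha>) = exp (- \<alpha> * ln N)" using N by (simp add: powr_def)
        also have "\<dots> \<le> exp (- \<alpha> * l powr (1/2 + \<delta>))" using N \<alpha>0 by simp
        finally have "N powr (-\<alpha>) * exp (\<Sum>p\<in>P. e p) \<le> exp (- \<alpha> * l powr (1/2 + \<delta>)) * exp (\<alpha> * (8 * sqrt (l * L) * L))"
          using es by (intro mult_mono) auto
        also have "\<dots> = exp (\<alpha> * (8 * sqrt (l * L) * L - l powr (1/2 + \<delta>)))" by (simp add: algebra_simps flip: exp_add)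
        also have "\<dots> \<le> 1 / (4 * (l + 1))" using f(7) l0 unfolding \<alpha>_def by (simp add: pos_le_divide_eq)
        finally have 2: "N powr (-\<alpha>) * exp (\<Sum>p\<in>P. e p) \<le> 1 / (4 * (l + 1))" .
        have "N powr (-\<alpha>) * (\<Prod>p\<in>P. 1 + (\<rho> p)\<^sup>2 + 2 * \<rho> p * real p powr \<alpha> / sqrt (real p)) \<le> N powr (-\<alpha>) * (total * exp (\<Sum>p\<in>P. e p))"
          using 1 by (intro mult_left_mono) auto
        also have "\<dots> = total * (N powr (-\<alpha>) * exp (\<Sum>p\<in>P. e p))" by simp
        also have "\<dots> \<le> total * (1 / (4 * (l + 1)))" using 2 total0 by (intro mult_left_mono) auto
        finally show ?thesis by simp
      qed
      \<comment> \<open>With x = 2 \<rho> / sqrt p, the factor D p is at least (1 + \<rho>^2) (1 +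
        (1 - \<eta>) x) because \<rho>^2 <= \<eta>. A second factor 1 - \<eta> passes from 1 + x' to
        an exponential.\<close>
      have main: "(\<Prod>p\<in>P. 1 + (\<rho> p)\<^sup>2) * exp ((2 - \<epsilon> / 2) * sqrt (l / L)) \<le> total"
      proof -
        have "(\<Prod>p\<in>P. (1 + (\<rho> p)\<^sup>2) * exp ((1 - \<eta>)\<^sup>2 * (2 * \<theta> * (1 / (real p * ln (real p)))))) \<le> total"
          unfolding totalD
        proof (rule prod_mono)
          fix p assume p: "p \<in> P"
          define x where "x = 2 * \<rho> p / sqrt (real p)"
          define x' where "x' = (1 - \<eta>) * x"
          have x: "0 \<le> x" "x \<le> \<eta>" using \<rho>s(4,6)[OF p] by (auto simp: x_def)
          have x': "0 \<le> x'" "x' \<le> \<eta>" using x \<eta> mult_left_le_one_le[of x "1 - \<eta>"] by (auto simp: x'_def)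
          have "x' - x'\<^sup>2 \<le> ln (1 + x')" using x' \<eta> by (intro ln_one_plus_pos_lower_bound) auto
          moreover have "x'\<^sup>2 \<le> \<eta> * x'" unfolding power2_eq_square using x' by (intro mult_right_mono) auto
          ultimately have "(1 - \<eta>) * x' \<le> ln (1 + x')" by (simp add: algebra_simps)
          then have "exp ((1 - \<eta>) * x') \<le> exp (ln (1 + x'))" by simp
          then have e: "exp ((1 - \<eta>) * x') \<le> 1 + x'" using x' by simp
          have "(1 + (\<rho> p)\<^sup>2) * (1 - \<eta>) \<le> (1 + \<eta>) * (1 - \<eta>)" using \<rho>s(5)[OF p] \<eta> by (intro mult_right_mono) auto
          also have "\<dots> \<le> 1" by (simp add: algebra_simps)
          finally have "(1 + (\<rho> p)\<^sup>2) * (1 - \<eta>) * x \<le> 1 * x" using x by (intro mult_right_mono) auto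
          then have "(1 + (\<rho> p)\<^sup>2) * (1 + x') \<le> D p" unfolding x'_def D_def x_def[symmetric] by (simp add: algebra_simps)
          moreover have "(1 + (\<rho> p)\<^sup>2) * exp ((1 - \<eta>) * x') \<le> (1 + (\<rho> p)\<^sup>2) * (1 + x')" using e by (intro mult_left_mono) auto
          moreover have "(1 - \<eta>)\<^sup>2 * (2 * \<theta> * (1 / (real p * ln (real p)))) = (1 - \<eta>) * x'"
          proof -
            have "2 * \<theta> * (1 / (real p * ln (real p))) = 2 * (\<rho> p / sqrt (real p))"
              unfolding \<rho>s(1)[OF p] by (rule mult.assoc)
            also have "\<dots> = x" by (simp add: x_def)
            finally show ?thesis by (simp only: x'_def power2_eq_square mult.assoc)
          qed
          ultimately show "0 \<le> (1 + (\<rho> p)\<^sup>2) * exp ((1 - \<eta>)\<^sup>2 * (2 * \<theta> * (1 / (real p * ln (real p))))) \<and>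
            (1 + (\<rho> p)\<^sup>2) * exp ((1 - \<eta>)\<^sup>2 * (2 * \<theta> * (1 / (real p * ln (real p))))) \<le> D p" by simp
        qed
        also have "(\<Prod>p\<in>P. (1 + (\<rho> p)\<^sup>2) * exp ((1 - \<eta>)\<^sup>2 * (2 * \<theta> * (1 / (real p * ln (real p))))))
            = (\<Prod>p\<in>P. 1 + (\<rho> p)\<^sup>2) * exp ((1 - \<eta>)\<^sup>2 * (2 * \<theta> * S))"
          unfolding prod.distrib exp_sum[OF finP, symmetric] S_def sum_distrib_left[symmetric] ..
        finally have 1: "(\<Prod>p\<in>P. 1 + (\<rho> p)\<^sup>2) * exp ((1 - \<eta>)\<^sup>2 * (2 * \<theta> * S)) \<le> total" .
        have "(2 - \<epsilon> / 2) * sqrt (l / L) \<le> (1 - \<eta>)\<^sup>2 * (2 * \<theta> * S)"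
        proof -
          have sl: "sqrt (l * L) / L = sqrt (l / L)"
            using L1 l0 by (simp add: real_sqrt_mult real_sqrt_divide field_simps)
          \<comment> \<open>Of the four factors 1 - \<eta>, two come from linearising, one from
            \<theta> and one from S; with 16 \<eta> <= \<epsilon> they cost at most
            \<epsilon>/2.\<close>
          have "2 - \<epsilon> / 2 \<le> 2 * (1 - \<eta>) ^ 4"
          proof -
            have "1 + real 4 * (- \<eta>) \<le> (1 + (- \<eta>)) ^ 4" using \<eta> by (intro Bernoulli_inequality) auto
            then show ?thesis using \<eta> by simp
          qed
          then have "(2 - \<epsilon> / 2) * sqrt (l / L) \<le> 2 * (1 - \<eta>) ^ 4 * sqrt (l / L)" using l0 L1 by (intro mult_right_mono) auto
          also have "\<dots> = (1 - \<eta>)\<^sup>2 * (2 * \<theta> * ((1 - \<eta>) / L))"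
            unfolding \<theta>_def sl[symmetric] by (simp add: eval_nat_numeral)
          also have "\<dots> \<le> (1 - \<eta>)\<^sup>2 * (2 * \<theta> * S)" using S_low \<theta>0 by (intro mult_left_mono) auto
          finally show ?thesis .
        qed
        then have "(\<Prod>p\<in>P. 1 + (\<rho> p)\<^sup>2) * exp ((2 - \<epsilon> / 2) * sqrt (l / L)) \<le> (\<Prod>p\<in>P. 1 + (\<rho> p)\<^sup>2) * exp ((1 - \<eta>)\<^sup>2 * (2 * \<theta> * S))"
          by (intro mult_left_mono prod_nonneg) auto
        then show ?thesis using 1 by linarith
      qed
      have el: "exp l \<ge> 1" using l0 by simp
      obtain r where r: "\<forall>a. r a \<ge> 0" "r 1 = 1" "\<forall>a. r a \<noteq> 0 \<longrightarrow> a > 0 \<and> odd a \<and> squarefree a \<and> real a \<le> exp l"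
        "(\<Sum>a=1..nat \<lfloor>exp l\<rfloor>. (r a)\<^sup>2) \<le> (\<Prod>p\<in>P. 1 + (\<rho> p)\<^sup>2)"
        "N / (32 * (ln (exp l) + 1)) * total \<le> (\<Sum>a=1..nat \<lfloor>exp l\<rfloor>. \<Sum>b=1..nat \<lfloor>exp l\<rfloor>. r a * r b *
       real (card {(m, n). m \<in> {1..nat \<lfloor>N\<rfloor>} \<and> n \<in> {1..nat \<lfloor>N\<rfloor>} \<and> odd m \<and> odd n \<and> a * n = b * m}))"
        using resonator_sum[OF el _ \<alpha>0 \<alpha>0 R1 R2] N by (elim exE conjE) blast
      have "N * exp ((2 - \<epsilon>) * sqrt (l / L)) * (\<Sum>a=1..nat \<lfloor>exp l\<rfloor>. (r a)\<^sup>2) \<le> N / (32 * (l + 1)) * total"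
      proof -
        have "exp ((2 - \<epsilon>) * sqrt (l / L)) * (32 * (l + 1)) \<le> exp ((2 - \<epsilon>) * sqrt (l / L)) * exp (\<epsilon> / 2 * sqrt (l / L))"
          using f(9) by (intro mult_left_mono) auto
        also have "\<dots> = exp ((2 - \<epsilon> / 2) * sqrt (l / L))" by (simp add: algebra_simps flip: exp_add)
        finally have "exp ((2 - \<epsilon>) * sqrt (l / L)) \<le> exp ((2 - \<epsilon> / 2) * sqrt (l / L)) / (32 * (l + 1))"
          using l0 by (simp add: pos_le_divide_eq)
        then have "N * exp ((2 - \<epsilon>) * sqrt (l / L)) * (\<Sum>a=1..nat \<lfloor>exp l\<rfloor>. (r a)\<^sup>2)
          \<le> N * (exp ((2 - \<epsilon> / 2) * sqrt (l / L)) / (32 * (l + 1))) * (\<Prod>p\<in>P. 1 + (\<rho> p)\<^sup>2)"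
          using r(4) N l0 by (intro mult_mono mult_left_mono) (auto intro!: sum_nonneg)
        also have "\<dots> = N / (32 * (l + 1)) * ((\<Prod>p\<in>P. 1 + (\<rho> p)\<^sup>2) * exp ((2 - \<epsilon> / 2) * sqrt (l / L)))" by simp
        also have "\<dots> \<le> N / (32 * (l + 1)) * total" using main N l0 by (intro mult_left_mono) auto
        finally show ?thesis .
      qed
      then have "N * exp ((2 - \<epsilon>) * sqrt (l / ln l)) * (\<Sum>a=1..nat \<lfloor>exp l\<rfloor>. (r a)\<^sup>2) \<le> (\<Sum>a=1..nat \<lfloor>exp l\<rfloor>. \<Sum>b=1..nat \<lfloor>exp l\<rfloor>. r a * r b *
       real (card {(m, n). m \<in> {1..nat \<lfloor>N\<rfloor>} \<and> n \<in> {1..nat \<lfloor>N\<rfloor>} \<and> odd m \<and> odd n \<and> a * n = b * m}))"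
        using r(5) unfolding L_def by simp
      then show "\<exists>r. (\<forall>a. r a \<ge> 0) \<and> r 1 = (1::real) \<and> (\<forall>a. r a \<noteq> 0 \<longrightarrow> a > 0 \<and> odd a \<and> squarefree a \<and> real a \<le> exp l) \<and>
      N * exp ((2 - \<epsilon>) * sqrt (l / ln l)) * (\<Sum>a=1..nat \<lfloor>exp l\<rfloor>. (r a)\<^sup>2) \<le>
      (\<Sum>a=1..nat \<lfloor>exp l\<rfloor>. \<Sum>b=1..nat \<lfloor>exp l\<rfloor>. r a * r b *
       real (card {(m, n). m \<in> {1..nat \<lfloor>N\<rfloor>} \<and> n \<in> {1..nat \<lfloor>N\<rfloor>} \<and> odd m \<and> odd n \<and> a * n = b * m}))"
        using r(1-3) by blast
    qed
  qed
qed

section \<open>Analytic continuation of Dirichlet L-functions\<close>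

lemma holomorphic_suminf_M_test:
  fixes f :: "nat \<Rightarrow> complex \<Rightarrow> complex"
  assumes "open A" "\<And>n. f n holomorphic_on A"
    and "\<And>x. x \<in> A \<Longrightarrow> \<exists>d M. 0 < d \<and> cball x d \<subseteq> A \<and> summable M \<and> (\<forall>n. \<forall>y\<in>cball x d. norm (f n y) \<le> M n)"
  shows "(\<lambda>s. \<Sum>n. f n s) holomorphic_on A"
proof (rule holomorphic_uniform_sequence[OF \<open>open A\<close>, of "\<lambda>n s. \<Sum>i<n. f i s"])
  show "(\<lambda>s. \<Sum>i<n. f i s) holomorphic_on A" for n
    by (intro holomorphic_on_sum assms(2))
  fix x assume "x \<in> A"
  from assms(3)[OF this] obtain d M where dM: "0 < d" "cball x d \<subseteq> A" "summable M"
      and bound: "\<forall>n. \<forall>y\<in>cball x d. norm (f n y) \<le> M n"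
    by (elim exE conjE)
  have "uniform_limit (cball x d) (\<lambda>n s. \<Sum>i<n. f i s) (\<lambda>s. \<Sum>n. f n s) sequentially"
    using bound by (intro Weierstrass_m_test[OF _ dM(3)]) auto
  with dM(1,2) show "\<exists>d>0. cball x d \<subseteq> A \<and> uniform_limit (cball x d) (\<lambda>n s. \<Sum>i<n. f i s) (\<lambda>s. \<Sum>n. f n s) sequentially"
    by blast
qed

section \<open>Taylor expansion of powers and repeated Abel summation\<close>

lemma norm_nat_powr: "norm (of_nat n powr s :: complex) = (if n = 0 then 0 else real n powr Re s)"
  by (simp add: norm_powr_real_powr)

lemma norm_Suc_powr: "norm ((1 + of_nat n) powr s :: complex) = (1 + real n) powr Re s"
  using norm_nat_powr[of "Suc n" s] by simp

lemma summable_Suc_powr: "a < -1 \<Longrightarrow> summable (\<lambda>n. (1 + real n) powr a)"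
  using summable_Suc_iff[of "\<lambda>n. real n powr a"] by (simp add: summable_real_powr_iff add.commute)

text \<open>Coefficients of the derivatives of x powr (-s) in x: the j-th derivative is
  \<open>falling s j\<close> times x powr (-s - j).\<close>

definition falling :: "complex \<Rightarrow> nat \<Rightarrow> complex" where
  "falling s j = (\<Prod>i<j. - s - of_nat i)"

definition taylor_rem :: "nat \<Rightarrow> nat \<Rightarrow> complex \<Rightarrow> complex" where
  "taylor_rem J n s = of_nat (Suc n) powr (-s) - (\<Sum>j\<le>J. falling s j * of_nat n powr (-s - of_nat j) / fact j)"

lemma taylor_rem_0: "taylor_rem 0 n s = of_nat (Suc n) powr (-s) - of_nat n powr (-s)"
  by (simp add: taylor_rem_def falling_def)

text \<open>The remainder on the segment from n to n + 1 is governed by the next derivative. The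
  hypothesis on Re s makes the bound for it decrease along the segment, so that the value at n
  dominates.\<close>

lemma taylor_rem_bound:
  assumes "n \<ge> 1" "Re s + real J + 1 \<ge> 0"
  shows "norm (taylor_rem J n s) \<le> norm (falling s (Suc J)) * real n powr (-Re s - real J - 1)"
proof -
  define S :: "complex set" where "S = closed_segment (of_nat n) (of_nat (Suc n))"
  have S: "x \<in> \<real> \<and> Re x \<ge> real n" if "x \<in> S" for x
  proof -
    from that obtain u where u: "0 \<le> u" "u \<le> 1" "x = (1 - u) *\<^sub>R of_nat n + u *\<^sub>R of_nat (Suc n)"
      unfolding S_def in_segment(1) by (elim exE conjE)
    then have "x = of_real (real n + u)" by (simp add: scaleR_conv_of_real algebra_simps)
    then show ?thesis using u by auto
  qed
  define f where "f i x = falling s i * x powr (-s - of_nat i)" for i x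
  have "norm (f 0 (of_nat (Suc n)) - (\<Sum>i\<le>J. f i (of_nat n) * (of_nat (Suc n) - of_nat n) ^ i / fact i))
      \<le> (norm (falling s (Suc J)) * real n powr (-Re s - real J - 1)) * norm (of_nat (Suc n) - of_nat n :: complex) ^ Suc J / fact J"
  proof (rule complex_Taylor[of S])
    show "convex S" unfolding S_def by simp
    fix i x assume "x \<in> S" "i \<le> J"
    have "x \<notin> \<real>\<^sub>\<le>\<^sub>0" using S[OF \<open>x \<in> S\<close>] assms by (auto simp: complex_nonpos_Reals_iff)
    then have "((\<lambda>x. falling s i * x powr (-s - of_nat i)) has_field_derivative
        falling s i * ((-s - of_nat i) * x powr (-s - of_nat i - 1))) (at x within S)"
      by (intro DERIV_cmult has_field_derivative_at_within[OF has_field_derivative_powr])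
    moreover have "f (Suc i) x = falling s i * ((-s - of_nat i) * x powr (-s - of_nat i - 1))"
      unfolding f_def falling_def by (simp add: diff_diff_eq add.commute mult.assoc)
    ultimately show "(f i has_field_derivative f (Suc i) x) (at x within S)"
      unfolding f_def by simp
  next
    fix x assume "x \<in> S"
    have "norm (x powr (-s - of_nat (Suc J))) = Re x powr (-Re s - real J - 1)"
      using S[OF \<open>x \<in> S\<close>] by (subst norm_powr_real_powr) (auto simp: algebra_simps)
    also have "\<dots> \<le> real n powr (-Re s - real J - 1)"
      using S[OF \<open>x \<in> S\<close>] assms by (intro powr_mono2') auto
    finally show "norm (f (Suc J) x) \<le> norm (falling s (Suc J)) * real n powr (-Re s - real J - 1)"
      unfolding f_def norm_mult by (intro mult_left_mono) auto
  qed (auto simp: S_def)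
  also have "\<dots> \<le> norm (falling s (Suc J)) * real n powr (-Re s - real J - 1)"
  proof -
    have "x * norm (of_nat (Suc n) - of_nat n :: complex) ^ Suc J / fact J \<le> x" if "x \<ge> 0" for x :: real
      using mult_left_mono[of 1 "fact J" x] that fact_ge_1[of J] by (simp add: divide_le_eq)
    then show ?thesis by simp
  qed
  finally show ?thesis unfolding taylor_rem_def f_def by (simp add: falling_def)
qed

lemma falling_holomorphic: "(\<lambda>s. falling s j) holomorphic_on A"
  unfolding falling_def by (intro holomorphic_intros)

lemma taylor_rem_holomorphic: "n \<ge> 1 \<Longrightarrow> taylor_rem J n holomorphic_on A"
  unfolding taylor_rem_def by (intro holomorphic_intros falling_holomorphic) auto

lemma dirichlet_summable:
  assumes "\<And>n. norm (a n) \<le> B" "Re s > 1"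
  shows "summable (\<lambda>n. norm (a (Suc n) * of_nat (Suc n) powr (-s) :: complex))"
proof (rule summable_comparison_test'[of "\<lambda>n. B * (1 + real n) powr (-Re s)" 0])
  show "summable (\<lambda>n. B * (1 + real n) powr (-Re s))"
    using assms by (intro summable_mult summable_Suc_powr) auto
  show "norm (norm (a (Suc n) * of_nat (Suc n) powr (-s))) \<le> B * (1 + real n) powr (-Re s)" for n
    using assms(1)[of "Suc n"] by (simp add: norm_mult norm_Suc_powr mult_right_mono)
qed

text \<open>The step \<open>J = 0\<close> needs no function \<open>G\<close> and continues the series to the half plane \<open>Re s > 0\<close>.\<close>

lemma dirichlet_abel_step:
  fixes a S :: "nat \<Rightarrow> complex" and G :: "complex \<Rightarrow> complex" and J :: nat
  assumes bd: "\<And>n. norm (S n) \<le> B" and diff: "\<And>n. a (Suc n) = S (Suc n) - S n"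
    and G: "J > 0 \<Longrightarrow> G holomorphic_on {s. Re s > 1 - real J}"
    and Gsum: "\<And>s. J > 0 \<Longrightarrow> Re s > 1 \<Longrightarrow> (\<lambda>n. S (Suc n) * of_nat (Suc n) powr (-s)) sums G s"
  defines "F \<equiv> (\<lambda>s. - S 0 - (\<Sum>j=1..J. falling s j / fact j * G (s + of_nat j)) - (\<Sum>n. S (Suc n) * taylor_rem J (Suc n) s))"
  shows "F holomorphic_on {s. Re s > - real J}"
    and "\<And>s. Re s > 1 \<Longrightarrow> (\<lambda>n. a (Suc n) * of_nat (Suc n) powr (-s)) sums F s"
proof -
  have B0: "B \<ge> 0" using bd[of 0] norm_ge_zero[of "S 0"] by linarith
  let ?H = "{s. Re s > - real J}"
  have opH: "open ?H" by (rule open_halfspace_Re_gt)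
  \<comment> \<open>The remainder is of order n^(-Re s - J - 1), locally uniformly in s, and this is
    summable for Re s > -J.\<close>
  have M: "\<exists>d M. 0 < d \<and> cball x d \<subseteq> ?H \<and> summable M \<and> (\<forall>n. \<forall>y\<in>cball x d. norm (S (Suc n) * taylor_rem J (Suc n) y) \<le> M n)"
    if "x \<in> ?H" for x
  proof -
    define d where "d = (Re x + real J) / 2"
    have d: "d > 0" using that by (simp add: d_def)
    have Rey: "Re y \<ge> - real J + d" if "y \<in> cball x d" for y
    proof -
      have "\<bar>Re x - Re y\<bar> \<le> d" using that abs_Re_le_cmod[of "x - y"] by (simp add: dist_norm)
      then have "Re y \<ge> Re x - d" by linarith
      then show ?thesis unfolding d_def by (simp add: field_simps)
    qed
    have "bounded ((\<lambda>s. falling s (Suc J)) ` cball x d)"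
      by (intro compact_imp_bounded compact_continuous_image holomorphic_on_imp_continuous_on falling_holomorphic) auto
    then obtain K where K: "\<And>y. y \<in> cball x d \<Longrightarrow> norm (falling y (Suc J)) \<le> K"
      unfolding bounded_iff by blast
    have K0: "K \<ge> 0" using K[of x] d norm_ge_zero[of "falling x (Suc J)"] by (simp del: norm_ge_zero)
    have "norm (S (Suc n) * taylor_rem J (Suc n) y) \<le> B * (K * (1 + real n) powr (-1 - d))" if "y \<in> cball x d" for n y
    proof -
      have "norm (taylor_rem J (Suc n) y) \<le> norm (falling y (Suc J)) * real (Suc n) powr (-Re y - real J - 1)"
        using Rey[OF that] d by (intro taylor_rem_bound) auto
      also have "\<dots> \<le> K * (1 + real n) powr (-1 - d)"
      proof (intro mult_mono K that)
        show "real (Suc n) powr (- Re y - real J - 1) \<le> (1 + real n) powr (- 1 - d)"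
          using Rey[OF that] by (auto intro!: powr_mono simp: add.commute)
      qed (use K0 in auto)
      finally show ?thesis unfolding norm_mult using bd[of "Suc n"] B0 by (intro mult_mono) auto
    qed
    moreover have "summable (\<lambda>n. B * (K * (1 + real n) powr (-1 - d)))"
      using d by (intro summable_mult summable_Suc_powr) auto
    moreover have "cball x d \<subseteq> ?H" using Rey d by force
    ultimately show ?thesis using d by blast
  qed
  have hol_rem: "(\<lambda>s. \<Sum>n. S (Suc n) * taylor_rem J (Suc n) s) holomorphic_on ?H"
    by (rule holomorphic_suminf_M_test[OF opH _ M]) (auto intro!: holomorphic_intros taylor_rem_holomorphic)
  have hol_G: "(\<lambda>s. G (s + of_nat j)) holomorphic_on ?H" if "j \<in> {1..J}" for j
  proof -
    have "G \<circ> (\<lambda>s. s + of_nat j) holomorphic_on ?H"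
      using that by (intro holomorphic_on_compose_gen[OF _ G]) (auto intro!: holomorphic_intros)
    then show ?thesis by (simp add: o_def)
  qed
  show "F holomorphic_on ?H"
    unfolding F_def by (intro holomorphic_intros hol_rem hol_G falling_holomorphic) auto
  fix s :: complex assume s: "Re s > 1"
  let ?p = "\<lambda>n. of_nat (Suc n) powr (-s) :: complex"
  have sm: "summable (\<lambda>n. S (Suc n) * ?p n)"
    using summable_norm_cancel[OF dirichlet_summable[of S B s]] bd s by blast
  have sH: "s \<in> ?H" using s by simp
  from M[OF sH] obtain d' M' where dM': "0 < d'" "summable M'"
      and bM': "\<forall>n. \<forall>y\<in>cball s d'. norm (S (Suc n) * taylor_rem J (Suc n) y) \<le> M' n"
    by (elim exE conjE)
  have bM: "norm (S (Suc n) * taylor_rem J (Suc n) s) \<le> M' n" for n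
    using bM' dM'(1) by simp
  have rem: "summable (\<lambda>n. S (Suc n) * taylor_rem J (Suc n) s)"
    by (rule summable_comparison_test'[OF dM'(2), of 0]) (rule bM)
  have shift: "(\<lambda>n. S (Suc n) * (falling s j / fact j * of_nat (Suc n) powr (-(s + of_nat j)))) sums (falling s j / fact j * G (s + of_nat j))"
    if "j \<in> {1..J}" for j
    using sums_mult[OF Gsum[of "s + of_nat j"], of "falling s j / fact j"] that s by (simp add: mult_ac)
  \<comment> \<open>Abel summation replaces a by S, and the shifted power is expanded by Taylor's
    formula. The term j = 0 cancels, the terms j >= 1 are series of S at s + j, where G is
    available, and the remainder converges in the larger half plane.\<close>
  have rem_eq: "of_nat (Suc (Suc n)) powr (-s) = ?p n + (\<Sum>j=1..J. falling s j / fact j * of_nat (Suc n) powr (-(s + of_nat j))) + taylor_rem J (Suc n) s" for n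
  proof -
    have "{..J} = insert 0 {1..J}" by auto
    then have "(\<Sum>j\<le>J. falling s j * of_nat (Suc n) powr (-s - of_nat j) / fact j) = ?p n + (\<Sum>j=1..J. falling s j * of_nat (Suc n) powr (-s - of_nat j) / fact j)"
      by (simp add: falling_def del: of_nat_Suc)
    then show ?thesis unfolding taylor_rem_def by (simp add: algebra_simps del: of_nat_Suc)
  qed
  have "(\<lambda>n. (\<Sum>j=1..J. S (Suc n) * (falling s j / fact j * of_nat (Suc n) powr (-(s + of_nat j)))) + S (Suc n) * taylor_rem J (Suc n) s)
     sums ((\<Sum>j=1..J. falling s j / fact j * G (s + of_nat j)) + (\<Sum>n. S (Suc n) * taylor_rem J (Suc n) s))"
    by (intro sums_add sums_sum shift summable_sums rem)
  then have "(\<lambda>n. S (Suc n) * of_nat (Suc (Suc n)) powr (-s) - S (Suc n) * ?p n)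
     sums ((\<Sum>j=1..J. falling s j / fact j * G (s + of_nat j)) + (\<Sum>n. S (Suc n) * taylor_rem J (Suc n) s))"
    unfolding rem_eq by (simp add: algebra_simps sum_distrib_left del: of_nat_Suc)
  from sums_add[OF this summable_sums[OF sm]]
  have "(\<lambda>n. S (Suc n) * ?p (Suc n)) sums ((\<Sum>j=1..J. falling s j / fact j * G (s + of_nat j)) + (\<Sum>n. S (Suc n) * taylor_rem J (Suc n) s) + (\<Sum>n. S (Suc n) * ?p n))"
    by simp
  then have "(\<lambda>n. S n * ?p n) sums ((\<Sum>j=1..J. falling s j / fact j * G (s + of_nat j)) + (\<Sum>n. S (Suc n) * taylor_rem J (Suc n) s) + (\<Sum>n. S (Suc n) * ?p n) + S 0)"
    by (subst (asm) sums_Suc_iff) simp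
  from sums_diff[OF summable_sums[OF sm] this]
  show "(\<lambda>n. a (Suc n) * ?p n) sums F s"
    unfolding diff F_def by (simp add: algebra_simps del: of_nat_Suc)
qed

lemma periodic_mod:
  fixes a :: "nat \<Rightarrow> 'a"
  assumes "\<And>n. a (n + q) = a n"
  shows "a n = a (n mod q)"
proof -
  have "a (m + k * q) = a m" for m k
  proof (induction k)
    case (Suc k)
    have "m + Suc k * q = (m + k * q) + q" by simp
    then show ?case using assms[of "m + k * q"] Suc by (simp only:)
  qed simp
  from this[of "n mod q" "n div q"] show ?thesis by simp
qed

lemma periodic_bounded:
  fixes a :: "nat \<Rightarrow> complex"
  assumes "\<And>n. a (n + q) = a n" "q > 0"
  obtains B where "\<And>n. norm (a n) \<le> B"
proof (rule that)
  fix n show "norm (a n) \<le> (\<Sum>i<q. norm (a i))"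
    using member_le_sum[of "n mod q" "{..<q}" "\<lambda>i. norm (a i)"] assms(2) periodic_mod[of a q n] assms(1) by simp
qed

lemma periodic_partial_sum:
  fixes a :: "nat \<Rightarrow> complex"
  assumes "\<And>n. a (n + q) = a n" "q > 0" "(\<Sum>i<q. a i) = 0"
  shows "(\<Sum>i\<le>n + q. a i) = (\<Sum>i\<le>n. a i)"
proof (induction n)
  case 0
  have "(\<Sum>i\<le>q. a i) = (\<Sum>i<q. a i) + a q" by (simp add: lessThan_Suc_atMost[symmetric])
  then show ?case using assms(1)[of 0] assms(3) by simp
next
  case (Suc n)
  then show ?case using assms(1)[of "Suc n"] by simp
qed

text \<open>The partial sums of a mean-zero periodic sequence are periodic, and subtracting their
  mean c makes them mean-zero without changing their differences. Hence the induction hypothesis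
  applies to them, and one Abel step moves the half plane for a one unit further to the
  left.\<close>

lemma periodic_continuation_halfplane:
  fixes a :: "nat \<Rightarrow> complex"
  assumes "\<And>n. a (n + q) = a n" "q > 0" "(\<Sum>i<q. a i) = 0"
  shows "\<exists>F. F holomorphic_on {s. Re s > - real J} \<and> (\<forall>s. Re s > 1 \<longrightarrow> (\<lambda>n. a (Suc n) * of_nat (Suc n) powr (-s)) sums F s)"
  using assms
proof (induction J arbitrary: a)
  case (0 a)
  define T where "T n = (\<Sum>i\<le>n. a i)" for n
  have Tper: "T (n + q) = T n" for n unfolding T_def by (rule periodic_partial_sum) (use 0 in auto)
  obtain B where "\<And>n. norm (T n) \<le> B" using periodic_bounded[of T q] Tper 0 by blast
  from dirichlet_abel_step[of T B a 0, OF this] show ?case by (auto simp: T_def)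
next
  case (Suc J a)
  define c where "c = (\<Sum>n<q. \<Sum>i\<le>n. a i) / of_nat q"
  define T where "T n = (\<Sum>i\<le>n. a i) - c" for n
  have Tper: "T (n + q) = T n" for n unfolding T_def using periodic_partial_sum[of a q n] Suc.prems by simp
  have Tmean: "(\<Sum>n<q. T n) = 0" unfolding T_def c_def using Suc.prems by (simp add: sum_subtractf)
  obtain B where B: "\<And>n. norm (T n) \<le> B" using periodic_bounded[of T q] Tper Suc.prems by blast
  obtain G where G: "G holomorphic_on {s. Re s > - real J}" "\<And>s. Re s > 1 \<Longrightarrow> (\<lambda>n. T (Suc n) * of_nat (Suc n) powr (-s)) sums G s"
    using Suc.IH[of T] Tper Tmean Suc.prems by blast
  have diff: "a (Suc n) = T (Suc n) - T n" for n by (simp add: T_def)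
  have G': "G holomorphic_on {s. Re s > 1 - real (Suc J)}" using G(1) by simp
  show ?case using dirichlet_abel_step[of T B a "Suc J" G, OF B diff G' G(2)] by blast
qed

lemma periodic_continuation_entire:
  fixes a :: "nat \<Rightarrow> complex"
  assumes "\<And>n. a (n + q) = a n" "q > 0" "(\<Sum>i<q. a i) = 0"
  shows "\<exists>F. F holomorphic_on UNIV \<and> (\<forall>s. Re s > 1 \<longrightarrow> (\<lambda>n. a (Suc n) * of_nat (Suc n) powr (-s)) sums F s)"
proof -
  have "\<forall>J. \<exists>F. F holomorphic_on {s. Re s > - real J} \<and> (\<forall>s. Re s > 1 \<longrightarrow> (\<lambda>n. a (Suc n) * of_nat (Suc n) powr (-s)) sums F s)"
    using periodic_continuation_halfplane[OF assms] by blast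
  from choice[OF this] obtain F where FF: "\<forall>J. F J holomorphic_on {s. Re s > - real J} \<and>
      (\<forall>s. Re s > 1 \<longrightarrow> (\<lambda>n. a (Suc n) * of_nat (Suc n) powr (-s)) sums F J s)" ..
  have F: "F J holomorphic_on {s. Re s > - real J}" for J using FF by blast
  have Fs: "(\<lambda>n. a (Suc n) * of_nat (Suc n) powr (-s)) sums F J s" if "Re s > 1" for J s
    using FF that by blast
  have agree: "F J s = F K s" if "J \<le> K" "Re s > - real J" for J K s
  proof (rule analytic_continuation_open[of "{s. Re s > 1}" "{s. Re s > - real J}" "F J" "F K"])
    show "{s. Re s > 1} \<noteq> {}" by (auto intro!: exI[of _ 2])
    show "connected {s. Re s > - real J}" by (intro convex_connected convex_halfspace_Re_gt)
    show "F K holomorphic_on {s. Re s > - real J}" by (rule holomorphic_on_subset[OF F]) (use that in auto)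
    show "F J s = F K s" if "s \<in> {s. Re s > 1}" for s using sums_unique2[OF Fs[of s J] Fs[of s K]] that by simp
  qed (use that F in \<open>auto simp: open_halfspace_Re_gt\<close>)
  \<comment> \<open>Each s is assigned a half plane that contains it; by the identity theorem all
    choices agree.\<close>
  define L where "L s = F (nat \<lceil>- Re s\<rceil> + 1) s" for s
  have L: "L s = F J s" if "Re s > - real J" for s J
  proof -
    have "Re s > - real (nat \<lceil>- Re s\<rceil> + 1)" by linarith
    then show ?thesis unfolding L_def using agree[of J "nat \<lceil>- Re s\<rceil> + 1" s] agree[of "nat \<lceil>- Re s\<rceil> + 1" J s] that
      by (metis nat_le_linear)
  qed
  have "L holomorphic_on (\<Union>J. {s. Re s > - real J})"
  proof (rule holomorphic_on_UN_open)
    fix J show "L holomorphic_on {s. Re s > - real J}"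
      by (rule holomorphic_transform[OF F[of J]]) (use L in auto)
  qed (auto simp: open_halfspace_Re_gt)
  moreover have "(\<Union>J. {s. Re s > - real J}) = UNIV"
  proof -
    have "\<exists>J. Re s > - real J" for s using reals_Archimedean2[of "- Re s"] by (auto simp: minus_less_iff)
    then show ?thesis by auto
  qed
  moreover have "(\<lambda>n. a (Suc n) * of_nat (Suc n) powr (-s)) sums L s" if "Re s > 1" for s
    using Fs[OF that, of 0] L[of 0 s] that by simp
  ultimately show ?thesis by auto
qed

lemma dirichlet_character_sum_zero:
  assumes "dirichlet_character q chi" "chi \<noteq> principal_character q"
  shows "(\<Sum>i<q. chi i) = 0"
proof -
  from assms(1) have q: "q > 0" and per: "\<And>n. chi (n + q) = chi n" and mult: "\<And>m n. chi (m * n) = chi m * chi n"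
    and nz: "\<And>n. chi n \<noteq> 0 \<longleftrightarrow> coprime n q" unfolding dirichlet_character_def by auto
  obtain m where m: "chi m \<noteq> principal_character q m" using assms(2) by blast
  then have cop: "coprime m q" using nz[of m] by (auto simp: principal_character_def split: if_splits)
  then have m1: "chi m \<noteq> 1" using m by (simp add: principal_character_def)
  have inj: "inj_on (\<lambda>i. m * i mod q) {..<q}"
  proof (rule inj_onI)
    fix i j assume "i \<in> {..<q}" "j \<in> {..<q}" "m * i mod q = m * j mod q"
    then show "i = j" using cong_mult_lcancel_nat[of m q i j] cop by (simp add: cong_def)
  qed
  then have "(\<lambda>i. m * i mod q) ` {..<q} = {..<q}"
    using q by (intro card_subset_eq) (auto simp: card_image)
  then have "(\<Sum>i<q. chi i) = (\<Sum>i\<in>(\<lambda>i. m * i mod q) ` {..<q}. chi i)" by simp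
  also have "\<dots> = (\<Sum>i<q. chi (m * i mod q))" by (subst sum.reindex[OF inj]) simp
  also have "\<dots> = (\<Sum>i<q. chi m * chi i)"
    using periodic_mod[of chi q] per mult by metis
  also have "\<dots> = chi m * (\<Sum>i<q. chi i)" by (simp add: sum_distrib_left)
  finally show ?thesis using m1 by simp
qed

text \<open>Existence of a continuation turns the \<open>SOME\<close> in \<open>dirichlet_L\<close>
  into a function with the specified properties.\<close>

lemma dirichlet_L_spec:
  assumes "dirichlet_character q chi" "chi \<noteq> principal_character q"
  shows "dirichlet_L q chi holomorphic_on UNIV"
    and "\<And>s. Re s > 1 \<Longrightarrow> (\<lambda>n. chi (Suc n) * of_nat (Suc n) powr (-s)) sums dirichlet_L q chi s"
proof -
  from assms(1) have q: "q > 0" and per: "\<And>n. chi (n + q) = chi n" unfolding dirichlet_character_def by auto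
  obtain F where "F holomorphic_on UNIV" "\<And>s. Re s > 1 \<Longrightarrow> (\<lambda>n. chi (Suc n) * of_nat (Suc n) powr (-s)) sums F s"
    using periodic_continuation_entire[OF per q dirichlet_character_sum_zero[OF assms]] by blast
  then have "is_dirichlet_L q chi F"
    using assms(2) unfolding is_dirichlet_L_def by (simp add: powr_minus divide_inverse)
  then have "is_dirichlet_L q chi (dirichlet_L q chi)"
    unfolding dirichlet_L_def by (rule someI[of "is_dirichlet_L q chi"])
  then show "dirichlet_L q chi holomorphic_on UNIV"
    and "\<And>s. Re s > 1 \<Longrightarrow> (\<lambda>n. chi (Suc n) * of_nat (Suc n) powr (-s)) sums dirichlet_L q chi s"
    using assms(2) unfolding is_dirichlet_L_def by (auto simp: powr_minus divide_inverse)
qed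

text \<open>An explicit series in the half plane Re s > 0, by one Abel step and the identity
  theorem. It yields the growth bound to the left of 1 and the value at s = 1.\<close>

lemma dirichlet_L_abel:
  assumes "dirichlet_character q chi" "chi \<noteq> principal_character q" "Re s > 0"
  defines "T \<equiv> (\<lambda>n. \<Sum>i\<le>n. chi i)"
  shows "(\<lambda>n. T (Suc n) * (of_nat (Suc n) powr (-s) - of_nat (Suc (Suc n)) powr (-s))) sums dirichlet_L q chi s"
    and "\<And>n. norm (T n) \<le> real q"
proof -
  from assms(1) have q: "q > 0" and per: "\<And>n. chi (n + q) = chi n" and mult: "\<And>m n. chi (m * n) = chi m * chi n"
    and nz: "\<And>n. chi n \<noteq> 0 \<longleftrightarrow> coprime n q" unfolding dirichlet_character_def by auto
  \<comment> \<open>For q = 1 every character is principal. Thus q > 1 and chi 0 = 0, so sums may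
    start at 0.\<close>
  have q1: "q \<noteq> 1"
  proof
    assume q1: "q = 1"
    have "chi n = 1" for n
    proof -
      have "chi n = chi 1" using periodic_mod[of chi 1 n] periodic_mod[of chi 1 1] per q1 by simp
      moreover have "chi 1 * chi 1 = chi 1" using mult[of 1 1] by simp
      moreover have "chi 1 \<noteq> 0" using nz[of 1] by simp
      ultimately show ?thesis by simp
    qed
    then have "chi = principal_character q" using q1 by (auto simp: principal_character_def)
    then show False using assms(2) by simp
  qed
  have chi0: "chi 0 = 0" using nz[of 0] q1 by auto
  have Tper: "T (n + q) = T n" for n unfolding T_def
    by (rule periodic_partial_sum[OF per q dirichlet_character_sum_zero[OF assms(1,2)]])
  \<comment> \<open>A value of norm above 1 would have unbounded powers, all of them values of the
    periodic function chi.\<close>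
  have chi_le: "norm (chi n) \<le> 1" for n
  proof (rule ccontr)
    assume *: "\<not> norm (chi n) \<le> 1"
    obtain B where B: "\<And>n. norm (chi n) \<le> B" using periodic_bounded[of chi q] per q by blast
    have "chi (n ^ k) = chi n ^ k" for k
    proof (induction k)
      case 0
      have "chi 1 * chi 1 = chi 1" using mult[of 1 1] by simp
      then show ?case using nz[of 1] by simp
    qed (simp add: mult)
    then have "norm (chi n) ^ k \<le> B" for k using B[of "n ^ k"] by (simp add: norm_power)
    moreover obtain k where "norm (chi n) ^ k > B" using real_arch_pow[of "norm (chi n)" B] * by auto
    ultimately show False by (meson not_le)
  qed
  show Tb: "norm (T n) \<le> real q" for n
  proof -
    have "norm (T n) = norm (T (n mod q))" using periodic_mod[of T q n] Tper by simp
    also have "\<dots> \<le> (\<Sum>i\<le>n mod q. norm (chi i))" unfolding T_def by (rule norm_sum)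
    also have "\<dots> \<le> (\<Sum>i\<le>n mod q. 1)" by (intro sum_mono chi_le)
    also have "\<dots> \<le> real q" using mod_less_divisor[OF q, of n] by simp
    finally show ?thesis .
  qed
  have step: "F holomorphic_on {s. Re s > - real 0}" "\<And>s. Re s > 1 \<Longrightarrow> (\<lambda>n. chi (Suc n) * of_nat (Suc n) powr (-s)) sums F s"
    if "F = (\<lambda>s. - T 0 - (\<Sum>j=1..0. falling s j / fact j * 0) - (\<Sum>n. T (Suc n) * taylor_rem 0 (Suc n) s))" for F
    using dirichlet_abel_step[of T "real q" chi 0 "\<lambda>_. 0", OF Tb] unfolding that by (auto simp: T_def)
  define F where "F s = - (\<Sum>n. T (Suc n) * taylor_rem 0 (Suc n) s)" for s
  have F: "F holomorphic_on {s. Re s > 0}" "\<And>s. Re s > 1 \<Longrightarrow> (\<lambda>n. chi (Suc n) * of_nat (Suc n) powr (-s)) sums F s"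
    using step[of F] by (auto simp: F_def fun_eq_iff T_def chi0)
  have "dirichlet_L q chi s = F s"
  proof (rule analytic_continuation_open[of "{s. Re s > 1}" "{s. Re s > 0}" "dirichlet_L q chi" F])
    show "{s. Re s > 1} \<noteq> {}" by (auto intro!: exI[of _ 2])
    show "connected {s. Re s > 0}" by (intro convex_connected convex_halfspace_Re_gt)
    show "dirichlet_L q chi holomorphic_on {s. Re s > 0}"
      using dirichlet_L_spec(1)[OF assms(1,2)] by (rule holomorphic_on_subset) auto
    show "dirichlet_L q chi s = F s" if "s \<in> {s. Re s > 1}" for s
      using sums_unique2[OF dirichlet_L_spec(2)[OF assms(1,2), of s] F(2)[of s]] that by simp
  qed (use assms(3) F in \<open>auto simp: open_halfspace_Re_gt\<close>)
  moreover have "summable (\<lambda>n. T (Suc n) * taylor_rem 0 (Suc n) s)"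
  proof (rule summable_comparison_test'[of "\<lambda>n. real q * norm s * (1 + real n) powr (-Re s - 1)" 0])
    show "summable (\<lambda>n. real q * norm s * (1 + real n) powr (-Re s - 1))"
      using assms(3) by (intro summable_mult summable_Suc_powr) auto
    show "norm (T (Suc n) * taylor_rem 0 (Suc n) s) \<le> real q * norm s * (1 + real n) powr (-Re s - 1)" for n
      unfolding norm_mult using Tb[of "Suc n"] taylor_rem_bound[of "Suc n" s 0] assms(3)
      by (auto simp: falling_def add.commute mult.assoc intro!: mult_mono)
  qed
  ultimately show "(\<lambda>n. T (Suc n) * (of_nat (Suc n) powr (-s) - of_nat (Suc (Suc n)) powr (-s))) sums dirichlet_L q chi s"
    using sums_minus[OF summable_sums, of "\<lambda>n. T (Suc n) * taylor_rem 0 (Suc n) s"] F_def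
    by (simp add: taylor_rem_0 right_diff_distrib del: of_nat_Suc)
qed

text \<open>Linear growth in q and s is enough for Borel-Caratheodory, which turns it into a bound
  of order ln q for the logarithm. The exponent -3/2 is -Re s - 1 at Re s = 1/2.\<close>

lemma dirichlet_L_bound:
  assumes "dirichlet_character q chi" "chi \<noteq> principal_character q" "Re s \<ge> 1/2"
  shows "norm (dirichlet_L q chi s) \<le> real q * norm s * (\<Sum>n. (1 + real n) powr (-3/2))"
proof -
  define T where "T n = (\<Sum>i\<le>n. chi i)" for n
  note ab = dirichlet_L_abel[OF assms(1,2), of s, folded T_def]
  have sm: "summable (\<lambda>n. real q * norm s * (1 + real n) powr (-3/2))"
    by (intro summable_mult summable_Suc_powr) auto
  have b: "norm (T (Suc n) * (of_nat (Suc n) powr (-s) - of_nat (Suc (Suc n)) powr (-s))) \<le> real q * norm s * (1 + real n) powr (-3/2)" for n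
  proof -
    have "norm (of_nat (Suc n) powr (-s) - of_nat (Suc (Suc n)) powr (-s)) = norm (taylor_rem 0 (Suc n) s)"
      by (simp only: taylor_rem_0 norm_minus_commute)
    also have "\<dots> \<le> norm s * real (Suc n) powr (-Re s - 1)"
      using taylor_rem_bound[of "Suc n" s 0] assms(3) by (simp add: falling_def)
    also have "\<dots> \<le> norm s * (1 + real n) powr (-3/2)"
      using assms(3) by (auto intro!: mult_left_mono powr_mono simp: add.commute)
    finally show ?thesis unfolding norm_mult using ab(2)[of "Suc n"] assms(3)
      by (auto simp: mult.assoc intro!: mult_mono)
  qed
  have "norm (dirichlet_L q chi s) = norm (\<Sum>n. T (Suc n) * (of_nat (Suc n) powr (-s) - of_nat (Suc (Suc n)) powr (-s)))"
    using ab(1) assms(3) sums_unique by fastforce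
  also have "\<dots> \<le> (\<Sum>n. real q * norm s * (1 + real n) powr (-3/2))"
    by (rule norm_suminf_le[OF b sm])
  also have "\<dots> = real q * norm s * (\<Sum>n. (1 + real n) powr (-3/2))"
    by (intro suminf_mult summable_Suc_powr) auto
  finally show ?thesis .
qed

section \<open>Logarithms and nonvanishing of L-functions\<close>

text \<open>Truncations by primes up to K are not initial segments, hence unordered sums. By
  absolute convergence it suffices that the truncation contains {..K}.\<close>

lemma infsum_tail_tendsto:
  fixes f :: "nat \<Rightarrow> complex"
  assumes "summable (\<lambda>n. norm (f n))" "\<And>K. {..K} \<subseteq> B K"
  shows "(\<lambda>K. infsum f (B K)) \<longlonglongrightarrow> infsum f UNIV"
proof -
  have sf: "f summable_on A" for A
    using norm_summable_imp_summable_on[OF assms(1)] by (rule summable_on_subset_banach) auto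
  have sn: "(\<lambda>n. norm (f n)) summable_on A" for A
    using norm_summable_imp_summable_on[of "\<lambda>n. norm (f n)"] assms(1) by (intro summable_on_subset_banach[of _ UNIV A]) auto
  have "(\<lambda>n. norm (f n)) sums infsum (\<lambda>n. norm (f n)) UNIV"
    by (intro has_sum_imp_sums has_sum_infsum sn)
  then have "(\<lambda>K. \<Sum>i\<le>K. norm (f i)) \<longlonglongrightarrow> infsum (\<lambda>n. norm (f n)) UNIV"
    by (simp add: sums_def_le)
  from tendsto_diff[OF tendsto_const[of "infsum (\<lambda>n. norm (f n)) UNIV"] this]
  have lim: "(\<lambda>K. infsum (\<lambda>n. norm (f n)) UNIV - (\<Sum>i\<le>K. norm (f i))) \<longlonglongrightarrow> 0" by simp
  have "norm (infsum f (B K) - infsum f UNIV) \<le> infsum (\<lambda>n. norm (f n)) UNIV - (\<Sum>i\<le>K. norm (f i))" for K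
  proof -
    have "infsum f (B K) - infsum f UNIV = - infsum f (UNIV - B K)" by (subst infsum_Diff[OF sf sf]) auto
    then have "norm (infsum f (B K) - infsum f UNIV) \<le> infsum (\<lambda>n. norm (f n)) (UNIV - B K)"
      using norm_infsum_bound[OF sn[of "UNIV - B K"]] by simp
    also have "\<dots> \<le> infsum (\<lambda>n. norm (f n)) (UNIV - {..K})"
      using assms(2) by (intro infsum_mono2 sn) auto
    also have "\<dots> = infsum (\<lambda>n. norm (f n)) UNIV - infsum (\<lambda>n. norm (f n)) {..K}"
      by (rule infsum_Diff[OF sn sn]) auto
    finally show ?thesis by simp
  qed
  then have "(\<lambda>K. infsum f (B K) - infsum f UNIV) \<longlonglongrightarrow> 0"
    by (intro tendsto_norm_zero_cancel[OF tendsto_sandwich[OF _ _ tendsto_const lim]]) auto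
  then show ?thesis by (simp add: LIM_zero_iff)
qed

text \<open>The coefficients of log zeta: 1/k at a prime power p^k and 0 elsewhere, in particular at
  0 and 1, where \<open>mangoldt\<close> vanishes.\<close>

definition kap :: "nat \<Rightarrow> real" where "kap n = mangoldt n / ln (real n)"

lemma kap_nonneg: "kap n \<ge> 0"
  unfolding kap_def by (cases "n = 0") (auto intro!: divide_nonneg_nonneg mangoldt_nonneg)

lemma kap_le_1: "kap n \<le> 1"
proof (cases "n \<ge> 2")
  case True
  then show ?thesis using mangoldt_le[of n] by (simp add: kap_def divide_le_eq)
next
  case False
  then have "n = 0 \<or> n = 1" by auto
  then show ?thesis by (auto simp: kap_def)
qed

lemma kap_prime: "prime p \<Longrightarrow> kap p = 1"
  using prime_gt_1_nat[of p] by (simp add: kap_def)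

lemma kap_prime_power: "prime p \<Longrightarrow> kap (p ^ Suc j) = 1 / real (Suc j)"
  using prime_gt_1_nat[of p] by (simp add: kap_def ln_realpow del: power_Suc of_nat_Suc)

text \<open>The terms of a Dirichlet series at one fixed s, so that the same Euler product serves
  both zeta and L.\<close>

locale multiplicative_series =
  fixes a :: "nat \<Rightarrow> complex"
  assumes a0: "a 0 = 0" and a1: "a 1 = 1" and amult: "a (m * n) = a m * a n"
    and asum: "summable (\<lambda>n. norm (a n))"
begin

lemma a_summable_on: "a summable_on A"
  using norm_summable_imp_summable_on[OF asum] by (rule summable_on_subset_banach) auto

lemma a_power: "a (m ^ k) = a m ^ k"
  by (induction k) (use a1 in \<open>auto simp: amult\<close>)

lemma norm_a_prime:
  assumes "prime p" shows "norm (a p) < 1"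
proof -
  have inj: "inj (\<lambda>j. p ^ j)" using prime_gt_1_nat[OF assms] by (auto simp: inj_on_def)
  have "(a \<circ> (\<lambda>j. p ^ j)) summable_on UNIV"
    using summable_on_reindex[OF inj, of a] a_summable_on by blast
  then have "(\<lambda>j. a p ^ j) summable_on UNIV" by (simp add: o_def a_power)
  then have "summable (\<lambda>j. a p ^ j)" by (rule summable_on_imp_summable)
  then show ?thesis by (simp add: summable_geometric_iff)
qed

text \<open>Sieve of Eratosthenes: among the numbers still present, those divisible by p have sum a
  p times the sum over all of them, by complete multiplicativity.\<close>

lemma sieve:
  assumes "finite P" "\<And>p. p \<in> P \<Longrightarrow> prime p"
  shows "infsum a {n. n > 0 \<and> (\<forall>p\<in>P. \<not> p dvd n)} = infsum a UNIV * (\<Prod>p\<in>P. 1 - a p)"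
  using assms
proof (induction P rule: finite_induct)
  case empty
  have "infsum a {n. n > 0} = infsum a UNIV" using a0 by (intro infsum_cong_neutral) auto
  then show ?case by simp
next
  case (insert p P)
  let ?C = "\<lambda>P. {n. n > 0 \<and> (\<forall>p\<in>P. \<not> p dvd n)}"
  have p: "prime p" using insert by simp
  have pd: "r dvd p * n \<longleftrightarrow> r dvd n" if "r \<in> P" for r n
  proof -
    have "prime r" "r \<noteq> p" using that insert by auto
    then show ?thesis using p by (metis coprime_dvd_mult_right_iff primes_coprime)
  qed
  have "?C (insert p P) = ?C P - (\<lambda>n. p * n) ` ?C P"
  proof (intro Set.set_eqI iffI)
    fix x assume "x \<in> ?C P - (\<lambda>n. p * n) ` ?C P"
    then have x: "x \<in> ?C P" "x \<notin> (\<lambda>n. p * n) ` ?C P" by auto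
    have "\<not> p dvd x"
    proof
      assume "p dvd x"
      then obtain n where n: "x = p * n" by blast
      then have "n \<in> ?C P" using x(1) pd by auto
      then show False using x(2) n by blast
    qed
    then show "x \<in> ?C (insert p P)" using x by auto
  qed auto
  moreover have sub: "(\<lambda>n. p * n) ` ?C P \<subseteq> ?C P" using pd prime_gt_0_nat[OF p] by auto
  ultimately have "infsum a (?C (insert p P)) = infsum a (?C P) - infsum a ((\<lambda>n. p * n) ` ?C P)"
    using infsum_Diff[OF a_summable_on a_summable_on sub] by simp
  also have "infsum a ((\<lambda>n. p * n) ` ?C P) = infsum (\<lambda>n. a p * a n) (?C P)"
    using prime_gt_0_nat[OF p] by (subst infsum_reindex) (auto simp: inj_on_def o_def amult)
  also have "\<dots> = a p * infsum a (?C P)" by (rule infsum_cmult_right')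
  also have "infsum a (?C P) - a p * infsum a (?C P) = infsum a (?C P) * (1 - a p)" by (simp add: algebra_simps)
  also have "infsum a (?C P) = infsum a UNIV * (\<Prod>p\<in>P. 1 - a p)" using insert by blast
  finally show ?case using insert(1,2) by simp
qed

lemma log_summable: "summable (\<lambda>n. norm (of_real (kap n) * a n))"
proof (rule summable_comparison_test'[OF asum, of 0])
  show "norm (norm (of_real (kap n) * a n)) \<le> norm (a n)" for n
    using kap_nonneg[of n] kap_le_1[of n] by (simp add: norm_mult mult_left_le_one_le)
qed

lemma log_summable_on: "(\<lambda>n. of_real (kap n) * a n) summable_on A"
  using norm_summable_imp_summable_on[OF log_summable] by (rule summable_on_subset_banach) auto

text \<open>The set consists of the powers p^(j + 1), on which \<open>kap\<close> is 1/(j + 1): this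
  is the logarithm series at a p, whose norm is below 1.\<close>

lemma log_single:
  assumes "prime p"
  shows "infsum (\<lambda>n. of_real (kap n) * a n) {n. primepow n \<and> aprimedivisor n = p} = - Ln (1 - a p)"
proof -
  let ?f = "\<lambda>n. of_real (kap n) * a n"
  have inj: "inj (\<lambda>j. p ^ Suc j)" using prime_gt_1_nat[OF assms] by (auto simp: inj_on_def simp del: power_Suc)
  have eq: "{n. primepow n \<and> aprimedivisor n = p} = range (\<lambda>j. p ^ Suc j)"
  proof (intro Set.set_eqI iffI)
    fix n assume "n \<in> {n. primepow n \<and> aprimedivisor n = p}"
    then obtain r k where rk: "prime r" "k > 0" "n = r ^ k" and "aprimedivisor n = p" by (auto simp: primepow_def)
    then have "n = p ^ Suc (k - 1)" by (simp add: aprimedivisor_prime_power)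
    then show "n \<in> range (\<lambda>j. p ^ Suc j)" by blast
  next
    fix n assume "n \<in> range (\<lambda>j. p ^ Suc j)"
    then obtain j where "n = p ^ Suc j" by blast
    then show "n \<in> {n. primepow n \<and> aprimedivisor n = p}"
      using assms aprimedivisor_prime_power[of p "Suc j"] primepow_prime_power[of "Suc j" p] by (simp del: power_Suc)
  qed
  have "(?f \<circ> (\<lambda>j. p ^ Suc j)) summable_on UNIV"
    using summable_on_reindex[OF inj, of ?f] log_summable_on by blast
  then have "(?f \<circ> (\<lambda>j. p ^ Suc j)) sums infsum (?f \<circ> (\<lambda>j. p ^ Suc j)) UNIV"
    by (intro has_sum_imp_sums has_sum_infsum)
  moreover have "?f \<circ> (\<lambda>j. p ^ Suc j) = (\<lambda>j. a p ^ Suc j / of_nat (Suc j))"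
    using kap_prime_power[OF assms] by (auto simp: fun_eq_iff a_power simp del: power_Suc of_nat_Suc)
  moreover have "(\<lambda>j. a p ^ Suc j / of_nat (Suc j)) sums (- Ln (1 - a p))"
  proof -
    have "(\<lambda>n. (-1) ^ Suc n / of_nat n * (- a p) ^ n) sums Ln (1 - a p)"
      using Ln_series[of "- a p"] norm_a_prime[OF assms] by simp
    then have "(\<lambda>n. (-1) ^ Suc (Suc n) / of_nat (Suc n) * (- a p) ^ Suc n) sums Ln (1 - a p)"
      by (subst sums_Suc_iff) simp
    from sums_minus[OF this] have "(\<lambda>n. - ((-1) ^ Suc (Suc n) / of_nat (Suc n) * (- a p) ^ Suc n)) sums - Ln (1 - a p)" .
    moreover have "- ((-1) ^ Suc (Suc n) / of_nat (Suc n) * (- a p) ^ Suc n) = a p ^ Suc n / of_nat (Suc n)" for n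
    proof -
      have pw: "(- a p) ^ Suc n = (-1) ^ Suc n * a p ^ Suc n" by (rule power_minus)
      have sg: "(-1::complex) ^ Suc (Suc n) * (-1) ^ Suc n = -1"
        by (simp flip: power_add mult_2)
      have "- ((-1) ^ Suc (Suc n) / of_nat (Suc n) * (- a p) ^ Suc n) = - ((((-1) ^ Suc (Suc n) * (-1) ^ Suc n) * a p ^ Suc n) / of_nat (Suc n))"
        unfolding pw by (simp only: times_divide_eq_left mult.assoc)
      then show ?thesis unfolding sg by simp
    qed
    ultimately show ?thesis by (simp only:)
  qed
  ultimately have "infsum (?f \<circ> (\<lambda>j. p ^ Suc j)) UNIV = - Ln (1 - a p)"
    using sums_unique2 by metis
  then show ?thesis unfolding eq infsum_reindex[OF inj] .
qed

lemma log_finite: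
  assumes "finite P" "\<And>p. p \<in> P \<Longrightarrow> prime p"
  shows "infsum (\<lambda>n. of_real (kap n) * a n) {n. primepow n \<and> aprimedivisor n \<in> P} = (\<Sum>p\<in>P. - Ln (1 - a p))"
  using assms
proof (induction P rule: finite_induct)
  case (insert p P)
  have "{n. primepow n \<and> aprimedivisor n \<in> insert p P} = {n. primepow n \<and> aprimedivisor n = p} \<union> {n. primepow n \<and> aprimedivisor n \<in> P}"
    by auto
  moreover have "infsum (\<lambda>n. of_real (kap n) * a n) ({n. primepow n \<and> aprimedivisor n = p} \<union> {n. primepow n \<and> aprimedivisor n \<in> P})
      = infsum (\<lambda>n. of_real (kap n) * a n) {n. primepow n \<and> aprimedivisor n = p}
        + infsum (\<lambda>n. of_real (kap n) * a n) {n. primepow n \<and> aprimedivisor n \<in> P}"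
    using insert(2) by (intro infsum_Un_disjoint log_summable_on) auto
  ultimately show ?case using insert log_single[of p] by simp
qed simp

text \<open>Sieve by the primes up to K. The sifted sum tends to a 1 = 1, so the products of 1 - a p
  tend to the reciprocal of the sum of a. The same products are exponentials of minus the truncated
  sums of \<open>kap\<close> times a.\<close>

theorem exp_log_eq: "exp (infsum (\<lambda>n. of_real (kap n) * a n) UNIV) = infsum a UNIV"
proof -
  let ?f = "\<lambda>n. of_real (kap n) * a n"
  define P where "P K = {p. prime p \<and> p \<le> K}" for K :: nat
  have P: "finite (P K)" "\<And>p. p \<in> P K \<Longrightarrow> prime p" for K unfolding P_def by auto
  define C where "C K = {n. n > 0 \<and> (\<forall>p\<in>P K. \<not> p dvd n)}" for K
  have "(\<lambda>K. infsum a (UNIV - (C K - {1}))) \<longlonglongrightarrow> infsum a UNIV"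
  proof (rule infsum_tail_tendsto[OF asum])
    fix K show "{..K} \<subseteq> UNIV - (C K - {1})"
    proof
      fix n assume n: "n \<in> {..K}"
      have "n \<notin> C K" if "n > 1"
      proof -
        obtain p where p: "prime p" "p dvd n" using prime_factor_nat[of n] \<open>n > 1\<close> by auto
        then have "p \<le> n" using that by (intro dvd_imp_le) auto
        then have "p \<in> P K" using n p by (auto simp: P_def)
        then show ?thesis using p by (auto simp: C_def)
      qed
      moreover have "0 \<notin> C K" by (simp add: C_def)
      ultimately show "n \<in> UNIV - (C K - {1})" by (cases "n = 0"; cases "n = 1") auto
    qed
  qed
  moreover have "infsum a (UNIV - (C K - {1})) = infsum a UNIV + 1 - infsum a (C K)" for K
  proof -
    have "1 \<in> C K" by (auto simp: C_def P_def)
    then have "infsum a (C K - {1}) = infsum a (C K) - infsum a {1}"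
      by (intro infsum_Diff a_summable_on) auto
    then show ?thesis using infsum_Diff[OF a_summable_on a_summable_on, of "C K - {1}" UNIV] a1 by simp
  qed
  ultimately have "(\<lambda>K. infsum a UNIV + 1 - infsum a (C K)) \<longlonglongrightarrow> infsum a UNIV" by simp
  from tendsto_diff[OF tendsto_const[of "infsum a UNIV + 1"] this]
  have 1: "(\<lambda>K. infsum a UNIV * (\<Prod>p\<in>P K. 1 - a p)) \<longlonglongrightarrow> 1"
    using sieve[OF P] unfolding C_def by simp
  \<comment> \<open>Numbers that are not prime powers, where \<open>kap\<close> is 0, are kept in
    the truncation so that it contains {..K}.\<close>
  have "(\<lambda>K. infsum ?f {n. primepow n \<longrightarrow> aprimedivisor n \<in> P K}) \<longlonglongrightarrow> infsum ?f UNIV"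
  proof (rule infsum_tail_tendsto[OF log_summable])
    fix K show "{..K} \<subseteq> {n. primepow n \<longrightarrow> aprimedivisor n \<in> P K}"
    proof (intro subsetI CollectI impI)
      fix n assume n: "n \<in> {..K}" "primepow n"
      then have "n > 0" by (intro primepow_gt_0_nat)
      moreover have "prime (aprimedivisor n)" "aprimedivisor n dvd n"
        using n(2) primepow_gt_Suc_0[OF n(2)] by (auto intro!: prime_aprimedivisor' aprimedivisor_dvd')
      ultimately show "aprimedivisor n \<in> P K" using n(1) dvd_imp_le[of "aprimedivisor n" n] by (auto simp: P_def)
    qed
  qed
  moreover have "infsum ?f {n. primepow n \<longrightarrow> aprimedivisor n \<in> P K} = (\<Sum>p\<in>P K. - Ln (1 - a p))" for K
  proof -
    have "infsum ?f {n. primepow n \<longrightarrow> aprimedivisor n \<in> P K} = infsum ?f {n. primepow n \<and> aprimedivisor n \<in> P K}"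
      by (intro infsum_cong_neutral) (auto simp: kap_def mangoldt_def)
    then show ?thesis using log_finite[OF P(1)[of K] P(2)[of _ K]] by simp
  qed
  ultimately have "(\<lambda>K. exp (- (\<Sum>p\<in>P K. - Ln (1 - a p)))) \<longlonglongrightarrow> exp (- infsum ?f UNIV)"
    by (intro tendsto_intros) auto
  moreover have "exp (- (\<Sum>p\<in>P K. - Ln (1 - a p))) = (\<Prod>p\<in>P K. 1 - a p)" for K
  proof -
    have "exp (\<Sum>p\<in>P K. Ln (1 - a p)) = (\<Prod>p\<in>P K. exp (Ln (1 - a p)))" by (rule exp_sum[OF P(1)])
    also have "\<dots> = (\<Prod>p\<in>P K. 1 - a p)"
    proof (intro prod.cong refl)
      fix p assume "p \<in> P K"
      then have "norm (a p) < 1" using P norm_a_prime by blast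
      then have "1 - a p \<noteq> 0" by auto
      then show "exp (Ln (1 - a p)) = 1 - a p" by (rule exp_Ln)
    qed
    finally show ?thesis by (simp add: sum_negf)
  qed
  ultimately have 2: "(\<lambda>K. \<Prod>p\<in>P K. 1 - a p) \<longlonglongrightarrow> exp (- infsum ?f UNIV)" by simp
  have "infsum a UNIV * exp (- infsum ?f UNIV) = 1"
    using LIMSEQ_unique[OF tendsto_mult[OF tendsto_const 2] 1] .
  then show ?thesis by (simp add: exp_minus divide_simps)
qed

end

section \<open>Dirichlet series and the zeta function for Re s > 1\<close>

lemma nat_powr_exp: "n > 0 \<Longrightarrow> of_nat n powr (s :: complex) = exp (s * of_real (ln (real n)))"
  using Ln_of_real[of "real n"] by (simp add: powr_def)

lemma nat_mult_powr: "of_nat (m * n) powr (s :: complex) = of_nat m powr s * of_nat n powr s"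
proof (cases "m = 0 \<or> n = 0")
  case False
  then have "ln (real (m * n)) = ln (real m) + ln (real n)" by (simp add: ln_mult)
  then show ?thesis using False by (simp add: nat_powr_exp exp_add[symmetric] algebra_simps del: of_nat_mult)
qed auto

lemma multiplicative_series_dirichlet:
  assumes "\<And>m n. chi (m * n) = chi m * chi n" "chi 1 = 1" "\<And>n. norm (chi n) \<le> 1" "Re s > 1"
  shows "multiplicative_series (\<lambda>n. chi n * of_nat n powr (-s))"
proof
  have "summable (\<lambda>n. norm (chi (Suc n) * of_nat (Suc n) powr (-s)))"
    by (rule dirichlet_summable[of chi 1]) (use assms in auto)
  then show "summable (\<lambda>n. norm (chi n * of_nat n powr (-s)))"
    by (subst (asm) summable_Suc_iff)
  show "chi (m * n) * of_nat (m * n) powr (-s) = chi m * of_nat m powr (-s) * (chi n * of_nat n powr (-s))" for m n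
    by (simp only: assms(1) nat_mult_powr mult_ac)
qed (use assms in auto)

definition zeta_series :: "complex \<Rightarrow> complex" where "zeta_series s = infsum (\<lambda>n. of_nat n powr (-s)) UNIV"

lemma taylor_rem_1: "taylor_rem 1 n s = of_nat (Suc n) powr (-s) - (of_nat n powr (-s) + (-s) * of_nat n powr (-s - 1))"
  by (simp add: taylor_rem_def falling_def)

text \<open>Compare with the telescoping sum of the differences of n^(1 - s) / (1 - s), which
  contributes 1/(s - 1). The difference of the terms is a Taylor remainder of n^(1 - s) beyond the
  linear term. The factor 1 - s of its coefficient cancels the denominator, so the bound is uniform
  as Re s tends to 1.\<close>

lemma zeta_series_bound:
  assumes "Re s > 1"
  shows "norm (zeta_series s) \<le> 1 / norm (s - 1) + norm s * (\<Sum>n. (1 + real n) powr (-2))"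
proof -
  have s1: "s \<noteq> 1" using assms by auto
  interpret ms: multiplicative_series "\<lambda>n. 1 * of_nat n powr (-s)"
    using multiplicative_series_dirichlet[of "\<lambda>_. 1" s] assms by simp
  have "(\<lambda>n. of_nat n powr (-s)) sums zeta_series s"
    unfolding zeta_series_def using ms.a_summable_on by (intro has_sum_imp_sums has_sum_infsum) simp
  then have z: "(\<lambda>n. of_nat (Suc n) powr (-s)) sums zeta_series s"
    by (subst sums_Suc_iff) simp
  let ?p = "\<lambda>n. of_nat (Suc n) powr (1 - s) / (1 - s)"
  have "(\<lambda>n. norm (?p n)) \<longlonglongrightarrow> 0"
  proof -
    have "(\<lambda>n. real (Suc n) powr (1 - Re s) / norm (1 - s)) \<longlonglongrightarrow> 0 / norm (1 - s)"
      using assms by (intro tendsto_divide tendsto_const tendsto_neg_powr filterlim_compose[OF filterlim_real_sequentially filterlim_Suc]) (use s1 in auto)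
    then show ?thesis by (simp add: norm_divide norm_nat_powr del: of_nat_Suc)
  qed
  then have "?p \<longlonglongrightarrow> 0" by (rule tendsto_norm_zero_cancel)
  from telescope_sums[OF this] have tele: "(\<lambda>n. ?p (Suc n) - ?p n) sums (0 - 1 / (1 - s))" by simp
  have eq: "of_nat (Suc n) powr (-s) - (?p (Suc n) - ?p n) = - taylor_rem 1 (Suc n) (s - 1) / (1 - s)" for n
  proof -
    have "taylor_rem 1 (Suc n) (s - 1) = of_nat (Suc (Suc n)) powr (1 - s) - (of_nat (Suc n) powr (1 - s) + (1 - s) * of_nat (Suc n) powr (-s))"
      unfolding taylor_rem_1 by simp
    then show ?thesis using s1 by (simp add: divide_simps del: of_nat_Suc)
  qed
  have d: "(\<lambda>n. of_nat (Suc n) powr (-s) - (?p (Suc n) - ?p n)) sums (zeta_series s - (0 - 1 / (1 - s)))"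
    by (rule sums_diff[OF z tele])
  have b: "norm (of_nat (Suc n) powr (-s) - (?p (Suc n) - ?p n)) \<le> norm s * (1 + real n) powr (-2)" for n
  proof -
    have "norm (taylor_rem 1 (Suc n) (s - 1)) \<le> norm (falling (s - 1) (Suc 1)) * real (Suc n) powr (- Re (s - 1) - real 1 - 1)"
      by (rule taylor_rem_bound) (use assms in auto)
    also have "\<dots> = norm (falling (s - 1) 2) * real (Suc n) powr (- Re (s - 1) - 2)"
      by (simp only: Suc_1 of_nat_1 diff_diff_eq one_add_one)
    also have "norm (falling (s - 1) 2) = norm (1 - s) * norm s"
      by (simp add: falling_def numeral_2_eq_2 norm_mult norm_minus_commute)
    also have "real (Suc n) powr (- Re (s - 1) - 2) \<le> (1 + real n) powr (-2)"
      using assms by (auto intro!: powr_mono simp: add.commute)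
    finally have "norm (taylor_rem 1 (Suc n) (s - 1)) \<le> norm (1 - s) * norm s * (1 + real n) powr (-2)"
      by (simp add: mult_left_mono)
    then show ?thesis unfolding eq norm_divide norm_minus_cancel using s1 by (simp add: divide_le_eq mult_ac)
  qed
  have sm: "summable (\<lambda>n. norm s * (1 + real n) powr (-2))" by (intro summable_mult summable_Suc_powr) auto
  have "norm (zeta_series s - (0 - 1 / (1 - s))) \<le> (\<Sum>n. norm s * (1 + real n) powr (-2))"
    using norm_suminf_le[OF b sm] sums_unique[OF d] by simp
  also have "\<dots> = norm s * (\<Sum>n. (1 + real n) powr (-2))" by (intro suminf_mult summable_Suc_powr) auto
  finally have "norm (zeta_series s - (0 - 1 / (1 - s))) \<le> norm s * (\<Sum>n. (1 + real n) powr (-2))" .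
  moreover have "norm (zeta_series s) \<le> norm (zeta_series s - (0 - 1 / (1 - s))) + norm (0 - 1 / (1 - s))"
    using norm_triangle_ineq[of "zeta_series s - (0 - 1 / (1 - s))" "0 - 1 / (1 - s)"] by simp
  moreover have "norm (0 - 1 / (1 - s)) = 1 / norm (s - 1)" by (simp add: norm_divide norm_minus_commute)
  ultimately show ?thesis by linarith
qed


text \<open>Nonprincipal real characters modulo q, kept real-valued; \<open>nonpr\<close> is the
  usable form of being nonprincipal. Reality simplifies the 3-4-1 inequality and makes the divisor
  sums at s = 1 nonnegative.\<close>

locale real_char =
  fixes q :: nat and c :: "nat \<Rightarrow> real"
  assumes q: "q > 0" and per: "c (n + q) = c n" and mult: "c (m * n) = c m * c n"
    and vals: "c n = -1 \<or> c n = 0 \<or> c n = 1" and nz: "c n \<noteq> 0 \<longleftrightarrow> coprime n q"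
    and nonpr: "\<exists>m. c m = -1"
begin

definition chi :: "nat \<Rightarrow> complex" where "chi n = of_real (c n)"

definition L :: "complex \<Rightarrow> complex" where "L = dirichlet_L q chi"

lemma dirichlet_chi: "dirichlet_character q chi"
  unfolding dirichlet_character_def chi_def using q per mult nz by auto

lemma nonprincipal_chi: "chi \<noteq> principal_character q"
proof
  assume *: "chi = principal_character q"
  obtain m where "c m = -1" using nonpr by blast
  then have "chi m = -1" by (simp add: chi_def)
  then show False unfolding * by (auto simp: principal_character_def split: if_splits)
qed

lemma c1: "c 1 = 1"
proof -
  have "c 1 \<noteq> 0" using nz[of 1] by simp
  then show ?thesis using mult[of 1 1] vals[of 1] by auto
qed

lemma c0: "c 0 = 0"
proof (rule ccontr)
  assume "c 0 \<noteq> 0"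
  moreover obtain m where "c m = -1" using nonpr by blast
  ultimately show False using mult[of 0 m] by auto
qed

lemma norm_chi_le: "norm (chi n) \<le> 1"
  using vals[of n] by (auto simp: chi_def)

lemma ms: "Re s > 1 \<Longrightarrow> multiplicative_series (\<lambda>n. chi n * of_nat n powr (-s))"
  by (rule multiplicative_series_dirichlet) (use c1 norm_chi_le in \<open>auto simp: chi_def mult\<close>)

definition logL :: "complex \<Rightarrow> complex" where
  "logL s = infsum (\<lambda>n. of_real (kap n) * (chi n * of_nat n powr (-s))) UNIV"

lemma L_exp:
  assumes "Re s > 1"
  shows "L s = exp (logL s)"
proof -
  interpret ms: multiplicative_series "\<lambda>n. chi n * of_nat n powr (-s)" by (rule ms[OF assms])
  have "(\<lambda>n. chi n * of_nat n powr (-s)) sums infsum (\<lambda>n. chi n * of_nat n powr (-s)) UNIV"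
    by (intro has_sum_imp_sums has_sum_infsum ms.a_summable_on)
  moreover have "(\<lambda>n. chi n * of_nat n powr (-s)) sums L s"
    using dirichlet_L_spec(2)[OF dirichlet_chi nonprincipal_chi assms] unfolding L_def
    by (subst (asm) sums_Suc_iff) simp
  ultimately have "L s = infsum (\<lambda>n. chi n * of_nat n powr (-s)) UNIV" by (rule sums_unique2[symmetric])
  then show ?thesis unfolding logL_def ms.exp_log_eq by simp
qed

lemma L_holomorphic: "L holomorphic_on A"
  unfolding L_def using dirichlet_L_spec(1)[OF dirichlet_chi nonprincipal_chi] by (rule holomorphic_on_subset) auto

text \<open>For real chi the square of chi is 1 off the primes dividing q, so zeta itself can take
  the place of the L-function of the square. Termwise the exponent is a nonnegative multiple of 3 +
  4 c x + (2 x^2 - 1), which is 2 (1 + c x)^2 for c = 1 or -1 and 2 + 2 x^2 for c = 0.\<close>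

lemma three_four_one:
  assumes "\<sigma> > 1"
  shows "1 \<le> norm (zeta_series (of_real \<sigma>)) ^ 3 * norm (L (Complex \<sigma> t)) ^ 4 * norm (zeta_series (Complex \<sigma> (2 * t)))"
proof -
  have ms1: "multiplicative_series (\<lambda>n. 1 * of_nat n powr (-s))" if "Re s > 1" for s
    using multiplicative_series_dirichlet[of "\<lambda>_. 1" s] that by simp
  interpret m0: multiplicative_series "\<lambda>n. 1 * of_nat n powr (-of_real \<sigma>)" by (rule ms1) (use assms in auto)
  interpret m1: multiplicative_series "\<lambda>n. chi n * of_nat n powr (-Complex \<sigma> t)" by (rule ms) (use assms in auto)
  interpret m2: multiplicative_series "\<lambda>n. 1 * of_nat n powr (-Complex \<sigma> (2 * t))" by (rule ms1) (use assms in auto)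
  let ?f0 = "\<lambda>n. of_real (kap n) * (1 * of_nat n powr (-of_real \<sigma>)) :: complex"
  let ?f1 = "\<lambda>n. of_real (kap n) * (chi n * of_nat n powr (-Complex \<sigma> t))"
  let ?f2 = "\<lambda>n. of_real (kap n) * (1 * of_nat n powr (-Complex \<sigma> (2 * t)))"
  let ?g = "\<lambda>n. 3 * ?f0 n + 4 * ?f1 n + ?f2 n"
  have sum_g: "?g summable_on UNIV"
    by (intro summable_on_add summable_on_cmult_right m0.log_summable_on m1.log_summable_on m2.log_summable_on)
  have inf_g: "infsum ?g UNIV = 3 * infsum ?f0 UNIV + 4 * infsum ?f1 UNIV + infsum ?f2 UNIV"
    by (subst infsum_add, intro summable_on_add summable_on_cmult_right m0.log_summable_on m1.log_summable_on, rule m2.log_summable_on,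
        subst infsum_add, intro summable_on_cmult_right m0.log_summable_on, intro summable_on_cmult_right m1.log_summable_on)
       (simp only: infsum_cmult_right')
  have "Re (infsum ?g UNIV) = infsum (\<lambda>n. Re (?g n)) UNIV" using infsum_Re[OF sum_g] by simp
  also have "\<dots> \<ge> 0"
  proof (rule infsum_nonneg)
    fix n :: nat
    show "Re (?g n) \<ge> 0"
    proof (cases "n > 0")
      case True
      define x where "x = cos (t * ln (real n))"
      define e where "e = exp (- \<sigma> * ln (real n))"
      have p: "of_nat n powr (- Complex \<sigma> u) = of_real e * cis (- u * ln (real n))" for u
      proof -
        have eq: "- Complex \<sigma> u * of_real (ln (real n)) = of_real (- \<sigma> * ln (real n)) + \<i> * of_real (- u * ln (real n))"
          by (simp add: complex_eq_iff)
        show ?thesis by (simp only: nat_powr_exp[OF True] eq exp_add exp_of_real cis_conv_exp e_def)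
      qed
      have p0: "of_nat n powr (- of_real \<sigma>) = (of_real e :: complex)"
        using p[of 0] by (simp add: Complex_eq)
      have c2: "cos (2 * t * ln (real n)) = 2 * x\<^sup>2 - 1"
        using cos_double_cos[of "t * ln (real n)"] by (simp add: x_def mult.assoc)
      define C1 where "C1 = cis (- t * ln (real n))"
      define C2 where "C2 = cis (- (2 * t) * ln (real n))"
      have r: "Re C1 = x" "Re C2 = 2 * x\<^sup>2 - 1"
        using c2 by (simp_all add: C1_def C2_def x_def)
      have "Re (?g n) = kap n * e * (3 + 4 * c n * x + (2 * x\<^sup>2 - 1))"
        unfolding p[of t, folded C1_def] p[of "2 * t", folded C2_def] p0 chi_def
        by (simp add: r algebra_simps)
      moreover have "3 + 4 * c n * x + (2 * x\<^sup>2 - 1) \<ge> 0"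
      proof -
        have "0 \<le> 2 * (1 + x)\<^sup>2" "0 \<le> 2 * (1 - x)\<^sup>2" "0 \<le> x\<^sup>2" by auto
        then show ?thesis using vals[of n] by (auto simp: power2_eq_square algebra_simps)
      qed
      ultimately show ?thesis using kap_nonneg[of n] by (simp add: e_def)
    qed (simp add: kap_def)
  qed
  finally have "norm (exp (infsum ?g UNIV)) \<ge> 1" by (simp add: norm_exp)
  also have "exp (infsum ?g UNIV) = exp (infsum ?f0 UNIV) ^ 3 * exp (infsum ?f1 UNIV) ^ 4 * exp (infsum ?f2 UNIV)"
    unfolding inf_g by (simp add: exp_add exp_of_nat_mult[symmetric] exp_double)
  also have "exp (infsum ?f0 UNIV) = zeta_series (of_real \<sigma>)" unfolding m0.exp_log_eq zeta_series_def by simp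
  also have "exp (infsum ?f1 UNIV) = L (Complex \<sigma> t)" using L_exp[of "Complex \<sigma> t"] assms by (simp add: logL_def)
  also have "exp (infsum ?f2 UNIV) = zeta_series (Complex \<sigma> (2 * t))" unfolding m2.exp_log_eq zeta_series_def by simp
  finally show ?thesis by (simp add: norm_mult norm_power)
qed

lemma L_nonzero_line1:
  assumes "t \<noteq> 0"
  shows "L (Complex 1 t) \<noteq> 0"
proof
  assume zero: "L (Complex 1 t) = 0"
  define Z where "Z = (\<Sum>n. (1 + real n) powr (-2))"
  have Z0: "Z \<ge> 0" unfolding Z_def by (intro suminf_nonneg summable_Suc_powr) auto
  define x where "x = Complex 1 t"
  obtain D where D: "(L has_field_derivative D) (at x)"
    using L_holomorphic[of UNIV] holomorphic_on_imp_differentiable_at[of L UNIV x] by (auto simp: field_differentiable_def)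
  have lim0: "((\<lambda>h. L (x + h) / h) \<longlongrightarrow> D) (at 0)"
    using D zero unfolding DERIV_def x_def by simp
  have "filterlim (\<lambda>h::real. of_real h :: complex) (at 0) (at_right 0)"
    unfolding filterlim_at by (auto intro!: tendsto_eq_intros simp: eventually_at_filter)
  from filterlim_compose[OF lim0 this]
  have lim1: "((\<lambda>h::real. L (x + of_real h) / of_real h) \<longlongrightarrow> D) (at_right 0)" by simp
  have "isCont L x" using D by (rule DERIV_isCont)
  then have "(L \<longlongrightarrow> L x) (at x)" by (simp add: isCont_def)
  have lim2: "((\<lambda>h::real. L (x + of_real h)) \<longlongrightarrow> 0) (at_right 0)"
  proof -
    have "((\<lambda>h::real. L (x + of_real h) / of_real h * of_real h) \<longlongrightarrow> D * of_real 0) (at_right 0)"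
      by (intro tendsto_mult lim1 tendsto_of_real tendsto_ident_at)
    moreover have "\<forall>\<^sub>F h::real in at_right 0. L (x + of_real h) / of_real h * of_real h = L (x + of_real h)"
      by (auto simp: eventually_at_filter)
    ultimately show ?thesis using Lim_transform_eventually by fastforce
  qed
  define K where "K = 1 / (2 * \<bar>t\<bar>) + (2 + 2 * \<bar>t\<bar>) * Z"
  \<comment> \<open>Three quotients L/h are set against the cube of zeta(1 + h), of size 1/h^3. The
    fourth factor L is left over and tends to 0. K bounds zeta near 1 + 2it, away from the pole
    because t is not 0.\<close>
  have "((\<lambda>h. (1 + 2 * Z * h) ^ 3 * norm (L (x + of_real h) / of_real h) ^ 3 * norm (L (x + of_real h)) * K)
      \<longlongrightarrow> (1 + 2 * Z * 0) ^ 3 * norm D ^ 3 * norm (0::complex) * K) (at_right 0)"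
    by (intro tendsto_intros lim1 lim2)
  moreover have "\<forall>\<^sub>F h in at_right (0::real). 1 \<le> (1 + 2 * Z * h) ^ 3 * norm (L (x + of_real h) / of_real h) ^ 3 * norm (L (x + of_real h)) * K"
  proof -
    have "\<forall>\<^sub>F h in at_right (0::real). h \<in> {0<..<1}" by (rule eventually_at_right_real) simp
    then show ?thesis
    proof eventually_elim
      case (elim h)
      then have h: "0 < h" "h < 1" by auto
      have Lx: "L (Complex (1 + h) t) = L (x + of_real h)" unfolding x_def by (simp add: Complex_eq add_ac)
      have z1: "norm (zeta_series (of_real (1 + h))) \<le> (1 + 2 * Z * h) / h"
      proof -
        have "norm (zeta_series (of_real (1 + h))) \<le> 1 / norm (of_real (1 + h) - 1 :: complex) + norm (of_real (1 + h) :: complex) * Z"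
          unfolding Z_def by (rule zeta_series_bound) (use h in auto)
        also have "norm (of_real (1 + h) - 1 :: complex) = h" using h by simp
        also have "norm (of_real (1 + h) :: complex) = 1 + h" using h by (simp only: norm_of_real)
        also have "1 / h + (1 + h) * Z \<le> 1 / h + 2 * Z" using h Z0 by (intro add_left_mono mult_right_mono) auto
        also have "\<dots> = (1 + 2 * Z * h) / h" using h by (simp add: field_simps)
        finally show ?thesis .
      qed
      have z2: "norm (zeta_series (Complex (1 + h) (2 * t))) \<le> K"
      proof -
        have "norm (zeta_series (Complex (1 + h) (2 * t))) \<le> 1 / norm (Complex (1 + h) (2 * t) - 1) + norm (Complex (1 + h) (2 * t)) * Z"
          unfolding Z_def by (rule zeta_series_bound) (use h in auto)
        also have "1 / norm (Complex (1 + h) (2 * t) - 1) \<le> 1 / (2 * \<bar>t\<bar>)"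
          using abs_Im_le_cmod[of "Complex (1 + h) (2 * t) - 1"] assms by (intro divide_left_mono mult_pos_pos) (auto simp: abs_mult complex_eq_iff)
        also have "norm (Complex (1 + h) (2 * t)) \<le> 2 + 2 * \<bar>t\<bar>"
          using cmod_le[of "Complex (1 + h) (2 * t)"] h by (simp add: abs_mult)
        finally show ?thesis unfolding K_def using Z0 by (simp add: mult_right_mono)
      qed
      have "1 \<le> norm (zeta_series (of_real (1 + h))) ^ 3 * norm (L (Complex (1 + h) t)) ^ 4 * norm (zeta_series (Complex (1 + h) (2 * t)))"
        by (rule three_four_one) (use h in auto)
      also have "\<dots> \<le> ((1 + 2 * Z * h) / h) ^ 3 * norm (L (x + of_real h)) ^ 4 * K"
        unfolding Lx using z1 z2 h Z0 by (intro mult_mono power_mono) (auto simp: Lx)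
      also have "\<dots> = (1 + 2 * Z * h) ^ 3 * norm (L (x + of_real h) / of_real h) ^ 3 * norm (L (x + of_real h)) * K"
        using h by (simp add: norm_divide power_divide eval_nat_numeral)
      finally show ?case .
    qed
  qed
  ultimately have "1 \<le> (1 + 2 * Z * 0) ^ 3 * norm D ^ 3 * norm (0::complex) * K"
    by (intro tendsto_lowerbound[where F="at_right (0::real)"]) auto
  then show False by simp
qed

section \<open>Nonvanishing at 1, through the coefficients r of zeta(s) L(s)\<close>

definition r :: "nat \<Rightarrow> real" where "r N = (\<Sum>d | d dvd N. c d)"

lemma c_power: "c (m ^ k) = c m ^ k"
  by (induction k) (use c1 in \<open>auto simp: mult\<close>)

lemma r_prime_power_mult:
  assumes "prime p" "\<not> p dvd m" "m > 0"
  shows "r (p ^ e * m) = r m * (\<Sum>i\<le>e. c p ^ i)"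
proof (induction e)
  case (Suc e)
  have p0: "p > 0" using assms(1) prime_gt_0_nat by blast
  have cop: "coprime (p ^ k) m" for k using assms by (simp add: prime_imp_coprime)
  have split: "{d. d dvd p ^ Suc e * m} = {d. d dvd p ^ e * m} \<union> (\<lambda>d. p ^ Suc e * d) ` {d. d dvd m}"
  proof (intro equalityI subsetI)
    fix d assume "d \<in> {d. d dvd p ^ Suc e * m}"
    then have d: "d dvd p ^ Suc e * m" by simp
    then obtain x y where xy: "d = x * y" "x dvd p ^ Suc e" "y dvd m" by (rule dvd_productE)
    then obtain k where k: "k \<le> Suc e" "x = p ^ k" using divides_primepow_nat[OF assms(1), of x "Suc e"] by blast
    show "d \<in> {d. d dvd p ^ e * m} \<union> (\<lambda>d. p ^ Suc e * d) ` {d. d dvd m}"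
    proof (cases "k = Suc e")
      case False
      then have "x dvd p ^ e" using k by (simp add: le_imp_power_dvd)
      then show ?thesis using xy by (auto intro: mult_dvd_mono)
    qed (use k xy in auto)
  qed (auto intro: dvd_mult_right simp: mult.assoc)
  have disj: "{d. d dvd p ^ e * m} \<inter> (\<lambda>d. p ^ Suc e * d) ` {d. d dvd m} = {}"
  proof -
    have False if "p ^ Suc e * d dvd p ^ e * m" for d
    proof -
      have "p ^ e * p dvd p ^ e * m" using that by (metis dvd_mult_left power_Suc2)
      then have "p dvd m" using p0 by simp
      then show False using assms by simp
    qed
    then show ?thesis by (auto simp del: power_Suc)
  qed
  have fin: "finite {d. d dvd p ^ e * m}" "finite {d. d dvd m}" using p0 assms by auto
  have "r (p ^ Suc e * m) = r (p ^ e * m) + (\<Sum>d\<in>(\<lambda>d. p ^ Suc e * d) ` {d. d dvd m}. c d)"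
    unfolding r_def split using fin disj by (intro sum.union_disjoint) auto
  also have "(\<Sum>d\<in>(\<lambda>d. p ^ Suc e * d) ` {d. d dvd m}. c d) = (\<Sum>d | d dvd m. c p ^ Suc e * c d)"
    using p0 by (subst sum.reindex) (auto simp: inj_on_def mult c_power)
  also have "\<dots> = c p ^ Suc e * r m" by (simp add: r_def sum_distrib_left)
  finally show ?case using Suc by (simp add: algebra_simps)
qed simp

lemma geometric_char_sum:
  assumes "x = -1 \<or> x = 0 \<or> x = (1::real)"
  shows "(\<Sum>i\<le>e. x ^ i) \<ge> 0" "even e \<Longrightarrow> (\<Sum>i\<le>e. x ^ i) \<ge> 1"
proof -
  have "(\<Sum>i\<le>e. (-1::real) ^ i) = (if even e then 1 else 0)" by (induction e) auto
  moreover have "(\<Sum>i\<le>e. (0::real) ^ i) = 1" by (induction e) auto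
  ultimately show "(\<Sum>i\<le>e. x ^ i) \<ge> 0" "even e \<Longrightarrow> (\<Sum>i\<le>e. x ^ i) \<ge> 1" using assms by auto
qed

lemma prime_power_split:
  assumes "N > 1"
  obtains p e m where "prime p" "\<not> p dvd m" "m > 0" "m < N" "N = p ^ e * (m::nat)"
proof -
  obtain p where p: "prime p" "p dvd N" using prime_factor_nat[of N] assms by auto
  define e where "e = multiplicity p N"
  define m where "m = N div p ^ e"
  have m: "N = p ^ e * m" "\<not> p dvd m"
    using multiplicity_decompose[of N p] multiplicity_dvd[of p N] p assms prime_gt_1_nat[OF p(1)]
    unfolding e_def m_def by auto
  have "e > 0" using p assms unfolding e_def by (simp add: prime_multiplicity_gt_zero_iff)
  then have "1 < p ^ e" using prime_gt_1_nat[OF p(1)] by (intro one_less_power) auto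
  moreover have "m > 0" using m assms by (cases "m = 0") auto
  ultimately have "m < N" using m by simp
  then show ?thesis using that p m \<open>m > 0\<close> by blast
qed

lemma r_nonneg: "N > 0 \<Longrightarrow> r N \<ge> 0"
proof (induction N rule: less_induct)
  case (less N)
  show ?case
  proof (cases "N = 1")
    case True
    then show ?thesis using c1 by (simp add: r_def)
  next
    case False
    then have "N > 1" using less.prems by simp
    then obtain p e m where "prime p" "\<not> p dvd m" "m > 0" "m < N" "N = p ^ e * m"
      by (rule prime_power_split)
    then show ?thesis using less.IH[of m] r_prime_power_mult[of p m e] geometric_char_sum(1)[OF vals[of p]] by simp
  qed
qed

text \<open>All exponents are even, so each local sum of powers of -1, 0 or 1 is at least 1.\<close>

lemma r_square: "k > 0 \<Longrightarrow> r (k\<^sup>2) \<ge> 1"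
proof (induction k rule: less_induct)
  case (less k)
  show ?case
  proof (cases "k = 1")
    case True
    then show ?thesis using c1 by (simp add: r_def)
  next
    case False
    then have "k > 1" using less.prems by simp
    then obtain p e m where pm: "prime p" "\<not> p dvd m" "m > 0" "m < k" "k = p ^ e * m"
      by (rule prime_power_split)
    have "k\<^sup>2 = p ^ (2 * e) * m\<^sup>2" using pm by (simp add: power_mult_distrib power_mult[symmetric] mult.commute)
    moreover have "\<not> p dvd m\<^sup>2" using pm prime_dvd_power by blast
    ultimately have "r (k\<^sup>2) = r (m\<^sup>2) * (\<Sum>i\<le>2 * e. c p ^ i)" using r_prime_power_mult[of p "m\<^sup>2" "2 * e"] pm by simp
    moreover have "r (m\<^sup>2) \<ge> 1" using less.IH pm by blast
    moreover have "(\<Sum>i\<le>2 * e. c p ^ i) \<ge> 1" by (rule geometric_char_sum(2)[OF vals]) simp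
    ultimately show ?thesis using mult_mono[of 1 "r (m\<^sup>2)" 1 "\<Sum>i\<le>2 * e. c p ^ i"] by simp
  qed
qed

text \<open>
  Monsky's argument for \<open>L(1, \<chi>) \<noteq> 0\<close>: otherwise the Lambert series \<open>\<Sum> r(N) x\<^sup>N\<close> stays bounded as \<open>x \<rightarrow> 1\<close>,
  while \<open>r \<ge> 0\<close> and \<open>r(k\<^sup>2) \<ge> 1\<close>.
\<close>

lemma lambert_identity:
  assumes "0 < x" "x < (1::real)"
  shows "\<bar>(\<Sum>n=1..M. c n * (x ^ n / (1 - x ^ n))) - (\<Sum>N=1..M. r N * x ^ N)\<bar> \<le> real M * x ^ M / (1 - x)"
proof -
  have xn: "0 < 1 - x ^ n" "1 - x ^ n \<ge> 1 - x" if "n \<ge> 1" for n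
  proof -
    have "x ^ n \<le> x ^ 1" using that assms by (intro power_decreasing) auto
    then show "0 < 1 - x ^ n" "1 - x ^ n \<ge> 1 - x" using assms by auto
  qed
  have geo: "x ^ n / (1 - x ^ n) = (\<Sum>k=1..m. x ^ (n * k)) + x ^ (n * Suc m) / (1 - x ^ n)" if "n \<ge> 1" for n m
  proof (induction m)
    case (Suc m)
    have "x ^ (n * Suc m) / (1 - x ^ n) = x ^ (n * Suc m) + x ^ (n * Suc (Suc m)) / (1 - x ^ n)"
      using xn[OF that] by (simp add: field_simps power_add)
    then show ?case using Suc by simp
  qed simp
  have "(\<Sum>N=1..M. r N * x ^ N) = (\<Sum>N=1..M. \<Sum>n=1..M. if n dvd N then c n * x ^ N else 0)"
  proof (intro sum.cong refl)
    fix N assume N: "N \<in> {1..M}"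
    have "r N * x ^ N = (\<Sum>n | n dvd N. c n * x ^ N)" by (simp add: r_def sum_distrib_right)
    also have "\<dots> = (\<Sum>n=1..M. if n dvd N then c n * x ^ N else 0)"
    proof (intro sum.mono_neutral_cong_left)
      show "{n. n dvd N} \<subseteq> {1..M}"
      proof
        fix n assume "n \<in> {n. n dvd N}"
        then have "n dvd N" by simp
        moreover from this have "n \<le> N" using N by (intro dvd_imp_le) auto
        moreover have "n \<noteq> 0" using \<open>n dvd N\<close> N by auto
        ultimately show "n \<in> {1..M}" using N by auto
      qed
    qed auto
    finally show "r N * x ^ N = (\<Sum>n=1..M. if n dvd N then c n * x ^ N else 0)" .
  qed
  also have "\<dots> = (\<Sum>n=1..M. \<Sum>N=1..M. if n dvd N then c n * x ^ N else 0)" by (rule sum.swap)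
  also have "\<dots> = (\<Sum>n=1..M. c n * (\<Sum>k=1..M div n. x ^ (n * k)))"
  proof (intro sum.cong refl)
    fix n assume n: "n \<in> {1..M}"
    have "(\<Sum>N=1..M. if n dvd N then c n * x ^ N else 0) = (\<Sum>N | N \<in> {1..M} \<and> n dvd N. c n * x ^ N)"
      by (intro sum.mono_neutral_cong_right) auto
    also have "{N. N \<in> {1..M} \<and> n dvd N} = (\<lambda>k. n * k) ` {1..M div n}"
    proof (intro equalityI subsetI)
      fix N assume N: "N \<in> {N. N \<in> {1..M} \<and> n dvd N}"
      then obtain k where k: "N = n * k" by blast
      have "k \<ge> 1" using N k by (cases k) auto
      moreover have "k \<le> M div n" using N k n by (simp add: less_eq_div_iff_mult_less_eq mult.commute)
      ultimately show "N \<in> (\<lambda>k. n * k) ` {1..M div n}" using k by auto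
    next
      fix N assume "N \<in> (\<lambda>k. n * k) ` {1..M div n}"
      then obtain k where k': "N = n * k" "k \<in> {1..M div n}" by (rule imageE)
      then have k: "N = n * k" "1 \<le> k" "k \<le> M div n" by simp_all
      then have "n * k \<le> M" using n by (simp add: less_eq_div_iff_mult_less_eq mult.commute)
      then show "N \<in> {N. N \<in> {1..M} \<and> n dvd N}" using k n by auto
    qed
    also have "(\<Sum>N\<in>(\<lambda>k. n * k) ` {1..M div n}. c n * x ^ N) = (\<Sum>k=1..M div n. c n * x ^ (n * k))"
      using n by (subst sum.reindex) (auto simp: inj_on_def)
    finally show "(\<Sum>N=1..M. if n dvd N then c n * x ^ N else 0) = c n * (\<Sum>k=1..M div n. x ^ (n * k))"
      by (simp add: sum_distrib_left)
  qed
  finally have "(\<Sum>n=1..M. c n * (x ^ n / (1 - x ^ n))) - (\<Sum>N=1..M. r N * x ^ N)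
      = (\<Sum>n=1..M. c n * (x ^ n / (1 - x ^ n) - (\<Sum>k=1..M div n. x ^ (n * k))))"
    by (simp add: sum_subtractf algebra_simps)
  also have "\<bar>\<dots>\<bar> \<le> (\<Sum>n=1..M. \<bar>c n * (x ^ n / (1 - x ^ n) - (\<Sum>k=1..M div n. x ^ (n * k)))\<bar>)" by (rule sum_abs)
  also have "\<dots> \<le> (\<Sum>n=1..M. x ^ M / (1 - x))"
  proof (intro sum_mono)
    fix n assume n: "n \<in> {1..M}"
    \<comment> \<open>The inner sum stops at k = M div n, so the tail starts at an exponent of at
      least M.\<close>
    have "M \<le> n * Suc (M div n)" using dividend_less_times_div[of n M] n by (simp add: algebra_simps)
    then have "x ^ (n * Suc (M div n)) \<le> x ^ M" using assms by (intro power_decreasing) auto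
    then have "x ^ (n * Suc (M div n)) / (1 - x ^ n) \<le> x ^ M / (1 - x)"
      using xn[of n] n assms by (intro frac_le) auto
    moreover have "0 \<le> x ^ (n * Suc (M div n)) / (1 - x ^ n)" using xn[of n] n assms by (intro divide_nonneg_nonneg) auto
    moreover have "x ^ n / (1 - x ^ n) - (\<Sum>k=1..M div n. x ^ (n * k)) = x ^ (n * Suc (M div n)) / (1 - x ^ n)"
      using geo[of n "M div n"] n by simp
    moreover have "\<bar>c n\<bar> \<le> 1" using vals[of n] by auto
    ultimately have E: "0 \<le> x ^ n / (1 - x ^ n) - (\<Sum>k=1..M div n. x ^ (n * k))"
        "x ^ n / (1 - x ^ n) - (\<Sum>k=1..M div n. x ^ (n * k)) \<le> x ^ M / (1 - x)" "\<bar>c n\<bar> \<le> 1"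
      by (simp_all only:)
    have "\<bar>c n\<bar> * \<bar>x ^ n / (1 - x ^ n) - (\<Sum>k=1..M div n. x ^ (n * k))\<bar> \<le> 1 * (x ^ M / (1 - x))"
      by (rule mult_mono) (use E in linarith)+
    then show "\<bar>c n * (x ^ n / (1 - x ^ n) - (\<Sum>k=1..M div n. x ^ (n * k)))\<bar> \<le> x ^ M / (1 - x)"
      by (simp only: abs_mult mult_1)
  qed
  also have "\<dots> = real M * x ^ M / (1 - x)" by simp
  finally show ?thesis .
qed

text \<open>Monotonicity lets Abel summation bound the sum of c n times these weights. With 1 - x^n
  = (1 - x) A n, where A n = 1 + ... + x^(n - 1), the claim reduces to n (n + 1) x^n <= A n A (n +
  1). This follows from A m >= m x^((m - 1)/2), obtained by pairing the terms i and m - 1 - i in the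
  inequality of arithmetic and geometric means.\<close>

lemma lambert_weights_decreasing:
  assumes "0 < x" "x < (1::real)" "n \<ge> 1"
  shows "1 / (real (Suc n) * (1 - x)) - x ^ Suc n / (1 - x ^ Suc n) \<le> 1 / (real n * (1 - x)) - x ^ n / (1 - x ^ n)"
proof -
  define A where "A m = (\<Sum>i<m. x ^ i)" for m
  have A: "1 - x ^ m = (1 - x) * A m" for m unfolding A_def by (rule one_diff_power_eq)
  have Apos: "A m > 0" if "m \<ge> 1" for m unfolding A_def using that assms by (intro sum_pos) (auto simp: lessThan_empty_iff)
  define y where "y = sqrt x"
  have y: "y > 0" "y\<^sup>2 = x" using assms by (auto simp: y_def)
  have amgm: "real m * y ^ (m - 1) \<le> A m" for m
  proof -
    have "2 * A m = (\<Sum>i<m. x ^ i + x ^ (m - Suc i))"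
      unfolding A_def sum.distrib using sum.nat_diff_reindex[of "\<lambda>i. x ^ i" m] by simp
    also have "\<dots> \<ge> (\<Sum>i<m. 2 * y ^ (m - 1))"
    proof (intro sum_mono)
      fix i assume i: "i \<in> {..<m}"
      have e: "x ^ i = (y ^ i)\<^sup>2" "x ^ (m - Suc i) = (y ^ (m - Suc i))\<^sup>2"
        unfolding y(2)[symmetric] by (simp_all add: power_mult[symmetric] mult.commute)
      have "0 \<le> (y ^ i - y ^ (m - Suc i))\<^sup>2" by simp
      then have "2 * (y ^ i * y ^ (m - Suc i)) \<le> x ^ i + x ^ (m - Suc i)" unfolding e by (simp add: power2_eq_square algebra_simps)
      moreover have "y ^ i * y ^ (m - Suc i) = y ^ (m - 1)" using i by (simp flip: power_add)
      ultimately show "2 * y ^ (m - 1) \<le> x ^ i + x ^ (m - Suc i)" by linarith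
    qed
    finally show ?thesis by simp
  qed
  have n: "real n > 0" using assms by simp
  have S: "A (Suc n) = A n + x ^ n" by (simp add: A_def)
  have "(real n * y ^ (n - 1)) * (real (Suc n) * y ^ n) \<le> A n * A (Suc n)"
    using amgm[of n] amgm[of "Suc n"] assms y Apos[of n] by (intro mult_mono) auto
  moreover have "real n * real (Suc n) * x ^ n \<le> (real n * y ^ (n - 1)) * (real (Suc n) * y ^ n)"
  proof -
    have "y ^ n \<le> y ^ (n - 1)" using assms y by (intro power_decreasing) (auto simp: y_def)
    then have "y ^ n * y ^ n \<le> y ^ (n - 1) * y ^ n" using y by (intro mult_right_mono) auto
    moreover have "x ^ n = y ^ n * y ^ n" unfolding y(2)[symmetric] by (simp add: power2_eq_square power_mult_distrib)
    ultimately have "x ^ n \<le> y ^ (n - 1) * y ^ n" by simp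
    then have "real n * real (Suc n) * x ^ n \<le> real n * real (Suc n) * (y ^ (n - 1) * y ^ n)" by (intro mult_left_mono) auto
    then show ?thesis by (simp only: mult_ac)
  qed
  ultimately have key: "real n * real (Suc n) * x ^ n \<le> A n * A (Suc n)" by linarith
  have "x ^ n / A n - x ^ Suc n / A (Suc n) = x ^ n * (A (Suc n) - x * A n) / (A n * A (Suc n))"
    using Apos[of n] Apos[of "Suc n"] assms by (simp add: field_simps)
  also have "A (Suc n) - x * A n = 1" using A[of n] S by (simp add: algebra_simps)
  also have "x ^ n * 1 / (A n * A (Suc n)) \<le> 1 / (real n * real (Suc n))"
    using key Apos[of n] Apos[of "Suc n"] assms by (simp add: divide_simps mult_ac del: of_nat_Suc)
  also have "1 / (real n * real (Suc n)) = 1 / real n - 1 / real (Suc n)" using n by (simp add: field_simps)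
  finally have "(x ^ n / A n - x ^ Suc n / A (Suc n)) / (1 - x) \<le> (1 / real n - 1 / real (Suc n)) / (1 - x)"
    using assms by (intro divide_right_mono) auto
  moreover have "(x ^ n / A n - x ^ Suc n / A (Suc n)) / (1 - x) = x ^ n / (1 - x ^ n) - x ^ Suc n / (1 - x ^ Suc n)"
    unfolding A[of n] A[of "Suc n"] by (simp only: diff_divide_distrib divide_divide_eq_left mult.commute)
  moreover have "(1 / real n - 1 / real (Suc n)) / (1 - x) = 1 / (real n * (1 - x)) - 1 / (real (Suc n) * (1 - x))"
    by (simp only: diff_divide_distrib divide_divide_eq_left)
  ultimately show ?thesis by linarith
qed

lemma abel_decreasing_bound:
  fixes b :: "nat \<Rightarrow> real"
  assumes "\<And>n. n \<ge> 1 \<Longrightarrow> b (Suc n) \<le> b n" "\<And>n. n \<ge> 1 \<Longrightarrow> b n \<ge> 0"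
    and "\<And>n. \<bar>\<Sum>i=1..n. c i\<bar> \<le> B" and "M \<ge> 1"
  shows "\<bar>\<Sum>n=1..M. c n * b n\<bar> \<le> B * b 1"
proof -
  let ?T = "\<lambda>n. \<Sum>i=1..n. c i"
  have "\<bar>(\<Sum>n=1..M. c n * b n) - ?T M * b M\<bar> \<le> B * (b 1 - b M)"
    using \<open>M \<ge> 1\<close>
  proof (induction M rule: dec_induct)
    case (step n)
    have "\<bar>?T n * (b n - b (Suc n))\<bar> \<le> B * (b n - b (Suc n))"
      unfolding abs_mult using assms(1)[of n] assms(3)[of n] step by (intro mult_mono) auto
    moreover have "(\<Sum>n=1..Suc n. c n * b n) - ?T (Suc n) * b (Suc n) = ((\<Sum>n=1..n. c n * b n) - ?T n * b n) + ?T n * (b n - b (Suc n))"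
      by (simp add: algebra_simps)
    ultimately show ?case using step.IH by (simp add: algebra_simps)
  qed simp
  moreover have "\<bar>?T M * b M\<bar> \<le> B * b M"
    unfolding abs_mult using assms(2)[of M] assms(3)[of M] \<open>M \<ge> 1\<close> by (intro mult_mono) auto
  ultimately show ?thesis unfolding right_diff_distrib by linarith
qed

lemma char_sum_bound: "\<bar>\<Sum>i=1..n. c i\<bar> \<le> real q"
proof -
  have "(\<Sum>i\<le>n. chi i) = of_real (\<Sum>i\<le>n. c i)" by (simp add: chi_def)
  also have "(\<Sum>i\<le>n. c i) = (\<Sum>i=1..n. c i)" by (intro sum.mono_neutral_right) (auto simp: c0 not_less_eq_eq)
  finally have "norm (of_real (\<Sum>i=1..n. c i) :: complex) \<le> real q"
    using dirichlet_L_abel(2)[OF dirichlet_chi nonprincipal_chi, of 1 n] by simp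
  then show ?thesis by (simp only: norm_of_real)
qed

text \<open>Abel summation at s = 1 shows that the ordered series of c n / n converges to L 1. Its
  vanishing removes the main term 1/(n (1 - x)) of the Lambert weights.\<close>

lemma L_one_limit:
  assumes "L 1 = 0"
  shows "(\<lambda>M. \<Sum>n=1..M. c n / real n) \<longlonglongrightarrow> 0"
proof -
  let ?T = "\<lambda>n. \<Sum>i=1..n. c i"
  have T: "(\<Sum>i\<le>n. chi i) = of_real (?T n)" for n
  proof -
    have "(\<Sum>i\<le>n. c i) = ?T n" by (intro sum.mono_neutral_right) (auto simp: c0 not_less_eq_eq)
    then show ?thesis by (simp add: chi_def flip: of_real_sum)
  qed
  have "(\<lambda>n. (\<Sum>i\<le>Suc n. chi i) * (of_nat (Suc n) powr (-1) - of_nat (Suc (Suc n)) powr (-1))) sums L 1"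
    unfolding L_def using dirichlet_L_abel(1)[OF dirichlet_chi nonprincipal_chi, of 1] by simp
  moreover have "(\<Sum>i\<le>Suc n. chi i) * (of_nat (Suc n) powr (-1) - of_nat (Suc (Suc n)) powr (-1)) =
      of_real (?T (Suc n) * (1 / real (Suc n) - 1 / real (Suc (Suc n))))" for n
    unfolding T by (simp add: powr_minus divide_inverse del: sum.cl_ivl_Suc)
  ultimately have "(\<lambda>n. of_real (?T (Suc n) * (1 / real (Suc n) - 1 / real (Suc (Suc n)))) :: complex) sums of_real 0"
    using assms by simp
  then have s: "(\<lambda>n. ?T (Suc n) * (1 / real (Suc n) - 1 / real (Suc (Suc n)))) sums 0"
    by (simp only: sums_of_real_iff)
  have eq: "(\<Sum>n=1..M. c n / real n) = (\<Sum>n<M. ?T (Suc n) * (1 / real (Suc n) - 1 / real (Suc (Suc n)))) + ?T M / real (Suc M)" for M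
    by (induction M) (auto simp: algebra_simps add_divide_distrib)
  have "(\<lambda>M. ?T M / real (Suc M)) \<longlonglongrightarrow> 0"
  proof (rule Lim_null_comparison)
    show "\<forall>\<^sub>F M in sequentially. norm (?T M / real (Suc M)) \<le> real q / real (Suc M)"
      using char_sum_bound by (intro always_eventually allI) (auto intro!: divide_right_mono simp: abs_divide simp del: of_nat_Suc)
    show "(\<lambda>M. real q / real (Suc M)) \<longlonglongrightarrow> 0"
      by real_asymp
  qed
  from tendsto_add[OF s[unfolded sums_def] this] show ?thesis unfolding eq by simp
qed

lemma L_one_nonzero: "L 1 \<noteq> 0"
proof
  assume zero: "L 1 = 0"
  note lim = L_one_limit[OF zero]
  have main: "(\<Sum>k=1..K. x ^ (k\<^sup>2)) \<le> real q" if x: "0 < x" "x < (1::real)" for x K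
  proof -
    \<comment> \<open>The two errors that vanish as M grows: the partial sum of c n / n, which tends
      to 0 by \<open>lim\<close>, and the truncation error of
      \<open>lambert_identity\<close>.\<close>
    define e where "e M = \<bar>\<Sum>n=1..M. c n / real n\<bar> / (1 - x) + real M * x ^ M / (1 - x)" for M
    have "e \<longlonglongrightarrow> \<bar>0\<bar> / (1 - x) + 0 / (1 - x)"
      unfolding e_def using x by (intro tendsto_intros lim powser_times_n_limit_0) auto
    then have e0: "e \<longlonglongrightarrow> 0" by simp
    have bd: "(\<Sum>k=1..K. x ^ (k\<^sup>2)) \<le> real q + e M" if M: "M \<ge> K\<^sup>2 + 1" for M
    proof -
      define b where "b n = 1 / (real n * (1 - x)) - x ^ n / (1 - x ^ n)" for n
      have bdec: "b (Suc n) \<le> b n" if "n \<ge> 1" for n unfolding b_def by (rule lambert_weights_decreasing[OF x that])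
      have blim: "b \<longlonglongrightarrow> 0"
      proof -
        have "(\<lambda>n. 1 / real n * (1 / (1 - x)) - x ^ n / (1 - x ^ n)) \<longlonglongrightarrow> 0 * (1 / (1 - x)) - 0 / (1 - 0)"
          using x by (intro tendsto_intros LIMSEQ_power_zero lim_1_over_n) auto
        then show ?thesis unfolding b_def by simp
      qed
      have bnn: "b n \<ge> 0" if n: "n \<ge> 1" for n
      proof -
        have "b m \<le> b n" if "m \<ge> n" for m using that
        proof (induction m rule: dec_induct)
          case (step k)
          then show ?case using bdec[of k] n by linarith
        qed simp
        then show ?thesis using LIMSEQ_le_const2[OF blim, of "b n"] by blast
      qed
      \<comment> \<open>The pole of the Lambert weight at x = 1 is compensated: b 1 = 1 for every x,
        so the bound q is uniform in x.\<close>
      have b1: "b 1 = 1" using x by (simp add: b_def diff_divide_distrib[symmetric])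
      have "\<bar>\<Sum>n=1..M. c n * b n\<bar> \<le> real q * b 1"
        by (rule abel_decreasing_bound[of b "real q" M, OF bdec bnn char_sum_bound]) (use M in auto)
      then have "\<bar>\<Sum>n=1..M. c n * b n\<bar> \<le> real q" by (simp only: b1 mult_1_right)
      moreover have "(\<Sum>n=1..M. c n * b n) = (\<Sum>n=1..M. c n / real n) / (1 - x) - (\<Sum>n=1..M. c n * (x ^ n / (1 - x ^ n)))"
        unfolding b_def by (simp add: right_diff_distrib sum_subtractf sum_divide_distrib)
      moreover have "(\<Sum>n=1..M. c n / real n) / (1 - x) \<le> \<bar>\<Sum>n=1..M. c n / real n\<bar> / (1 - x)"
        using x by (intro divide_right_mono) auto
      ultimately have 1: "(\<Sum>n=1..M. c n * (x ^ n / (1 - x ^ n))) \<le> real q + \<bar>\<Sum>n=1..M. c n / real n\<bar> / (1 - x)"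
        by linarith
      have "(\<Sum>k=1..K. x ^ (k\<^sup>2)) \<le> (\<Sum>k=1..K. r (k\<^sup>2) * x ^ (k\<^sup>2))"
        using x r_square by (intro sum_mono) auto
      also have "\<dots> = (\<Sum>N\<in>(\<lambda>k. k\<^sup>2) ` {1..K}. r N * x ^ N)"
        by (subst sum.reindex) (auto simp: inj_on_def)
      also have "\<dots> \<le> (\<Sum>N=1..M. r N * x ^ N)"
      proof (rule sum_mono2)
        show "(\<lambda>k. k\<^sup>2) ` {1..K} \<subseteq> {1..M}"
        proof
          fix N assume "N \<in> (\<lambda>k. k\<^sup>2) ` {1..K}"
          then obtain k where k: "N = k\<^sup>2" "k \<in> {1..K}" by (rule imageE)
          then have "k\<^sup>2 \<le> K\<^sup>2" by (intro power_mono) auto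
          moreover have "k\<^sup>2 \<ge> 1" using k by (simp add: one_le_power)
          ultimately have "1 \<le> k\<^sup>2" "k\<^sup>2 \<le> M" using M by linarith+
          then show "N \<in> {1..M}" by (simp only: k(1) atLeastAtMost_iff)
        qed
      qed (use x r_nonneg in auto)
      also have "\<dots> \<le> (\<Sum>n=1..M. c n * (x ^ n / (1 - x ^ n))) + real M * x ^ M / (1 - x)"
        using lambert_identity[OF x, of M] by linarith
      finally show ?thesis using 1 unfolding e_def by linarith
    qed
    have "(\<lambda>M. real q + e M) \<longlonglongrightarrow> real q + 0" by (intro tendsto_intros e0)
    then show ?thesis using bd LIMSEQ_le_const[of "\<lambda>M. real q + e M" "real q" "\<Sum>k=1..K. x ^ (k\<^sup>2)"] by auto
  qed
  \<comment> \<open>Letting x tend to 1 in a sum of q + 1 terms gives q + 1 <= q.\<close>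
  define K where "K = q + 1"
  have "((\<lambda>x::real. \<Sum>k=1..K. x ^ (k\<^sup>2)) \<longlongrightarrow> (\<Sum>k=1..K. 1 ^ (k\<^sup>2))) (at_left 1)"
    by (intro tendsto_intros)
  moreover have "\<forall>\<^sub>F x::real in at_left 1. (\<Sum>k=1..K. x ^ (k\<^sup>2)) \<le> real q"
  proof -
    have "\<forall>\<^sub>F x in at_left (1::real). x \<in> {0<..<1}" by (rule eventually_at_left_real) simp
    then show ?thesis by eventually_elim (use main in auto)
  qed
  ultimately have "(\<Sum>k=1..K. (1::real) ^ (k\<^sup>2)) \<le> real q"
    by (intro tendsto_upperbound[where F="at_left (1::real)"]) auto
  then show False by (simp add: K_def)
qed

text \<open>\<open>GRH\<close> speaks only of the open strip, whereas the discs used below reach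
  from Re s = 1/2 to far beyond 1. So the line Re s = 1 has to be settled unconditionally, and Re s
  > 1 by the Euler product.\<close>

theorem L_nonzero:
  assumes GRH "Re s > 1/2"
  shows "L s \<noteq> 0"
proof -
  consider "Re s > 1" | "Re s = 1" | "Re s < 1" by linarith
  then show ?thesis
  proof cases
    case 1
    then show ?thesis using L_exp by simp
  next
    case 2
    then have "s = Complex 1 (Im s)" by (simp add: complex_eq_iff)
    then show ?thesis using L_nonzero_line1[of "Im s"] L_one_nonzero by (cases "Im s = 0") (auto simp: one_complex.code)
  next
    case 3
    then show ?thesis using assms dirichlet_chi unfolding GRH_def L_def by force
  qed
qed

end

section \<open>Taylor coefficients of log L under GRH\<close>

text \<open>The map taking w to w / (2 A - w) fixes 0 and sends the half plane Re w < A into the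
  unit disc, so the Schwarz lemma applies to its composition with g.\<close>

lemma borel_caratheodory:
  assumes hol: "g holomorphic_on ball 0 R" and g0: "g 0 = 0" and R: "R > 0"
    and re: "\<And>u. norm u < R \<Longrightarrow> Re (g u) < A" and u: "norm u < R"
  shows "norm (g u) \<le> 2 * A * norm u / (R - norm u)"
proof -
  have A: "A > 0" using re[of 0] g0 R by simp
  define \<phi> where "\<phi> z = g (of_real R * z) / (2 * of_real A - g (of_real R * z))" for z
  have inR: "norm (of_real R * z) < R" if "norm z < 1" for z :: complex using that R by (simp add: norm_mult)
  have less: "norm (g w) < norm (2 * of_real A - g w)" if "norm w < R" for w
  proof -
    have "(norm (2 * of_real A - g w))\<^sup>2 - (norm (g w))\<^sup>2 = 4 * A * (A - Re (g w))"
      unfolding cmod_power2 by (simp add: power2_eq_square algebra_simps)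
    also have "\<dots> > 0" using A re[OF that] by simp
    finally show ?thesis by (meson diff_gt_0_iff_gt norm_ge_zero power2_less_imp_less)
  qed
  have nz: "2 * of_real A - g w \<noteq> 0" if "norm w < R" for w
    using less[OF that] norm_ge_zero[of "g w"] by (metis norm_zero not_less)
  have comp: "(\<lambda>z. g (of_real R * z)) holomorphic_on ball 0 1"
  proof -
    have "g \<circ> (\<lambda>z. of_real R * z) holomorphic_on ball 0 1"
      by (rule holomorphic_on_compose_gen[OF _ hol]) (use inR in \<open>auto intro!: holomorphic_intros\<close>)
    then show ?thesis by (simp add: o_def)
  qed
  have "norm (\<phi> (u / of_real R)) \<le> norm (u / of_real R)"
  proof (rule Schwarz_Lemma(1))
    show "\<phi> holomorphic_on ball 0 1"
      unfolding \<phi>_def using nz inR by (intro holomorphic_intros comp) auto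
    show "\<phi> 0 = 0" by (simp add: \<phi>_def g0)
    show "norm (\<phi> z) < 1" if "norm z < 1" for z
      using less[OF inR[OF that]] nz[OF inR[OF that]] by (simp add: \<phi>_def norm_divide divide_less_eq)
    show "norm (u / of_real R) < 1" using u R by (simp add: norm_divide)
  qed
  then have "norm (g u) / norm (2 * of_real A - g u) \<le> norm u / R"
    using R by (simp add: \<phi>_def norm_divide)
  then have "norm (g u) \<le> norm u / R * norm (2 * of_real A - g u)"
    using nz[OF u] by (simp add: divide_le_eq)
  also have "\<dots> \<le> norm u / R * (2 * A + norm (g u))"
    using A R norm_triangle_ineq4[of "2 * of_real A" "g u"] by (intro mult_left_mono) (auto simp: norm_mult)
  finally have "norm (g u) * R \<le> norm u * (2 * A + norm (g u))" using R by (simp add: field_simps)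
  then show ?thesis using u by (simp add: field_simps)
qed

lemma ln_power_le:
  assumes "n \<ge> 1" shows "(ln (real n)) ^ k \<le> fact k * real n"
proof -
  have "(\<lambda>j. ln (real n) ^ j / fact j) sums exp (ln (real n))"
    using exp_converges[of "ln (real n)"] by (simp add: field_simps)
  then have "(\<Sum>j\<in>{k}. ln (real n) ^ j / fact j) \<le> exp (ln (real n))"
    using sum_le_suminf[of "\<lambda>j. ln (real n) ^ j / fact j" "{k}"] assms by (simp add: sums_iff)
  then show ?thesis using assms by (simp add: divide_le_eq mult.commute)
qed

lemma kap_ln_power_summable:
  assumes "\<sigma> > 2"
  shows "summable (\<lambda>n. kap n * ln (real n) ^ k * real n powr (-\<sigma>))"
proof (rule summable_comparison_test'[of "\<lambda>n. fact k * real n powr (1 - \<sigma>)" 1])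
  show "summable (\<lambda>n. fact k * real n powr (1 - \<sigma>))"
    using assms by (intro summable_mult) (simp add: summable_real_powr_iff)
  fix n :: nat assume n: "1 \<le> n"
  have "kap n * (ln (real n)) ^ k * real n powr (-\<sigma>) \<le> 1 * (fact k * real n) * real n powr (-\<sigma>)"
    using n kap_le_1[of n] kap_nonneg[of n] ln_power_le[OF n] by (intro mult_right_mono mult_mono) auto
  also have "\<dots> = fact k * real n powr (1 - \<sigma>)" using n by (simp add: powr_diff powr_minus divide_inverse)
  finally show "norm (kap n * ln (real n) ^ k * real n powr (-\<sigma>)) \<le> fact k * real n powr (1 - \<sigma>)"
    using n kap_nonneg[of n] by simp
qed

context real_char
begin

text \<open>Write m^(-u) as exp(-u ln m), expand and interchange. The double sum of norms is
  dominated by the sum of m^(norm u - \<sigma>), whence the radius \<sigma> - 1.\<close>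

lemma logL_power_series:
  fixes \<sigma> :: real
  assumes "\<sigma> > 1" "norm u < \<sigma> - 1"
  shows "(\<lambda>k. infsum (\<lambda>m. of_real (kap m * c m) * of_nat m powr (- of_real \<sigma>) * (- of_real (ln (real m))) ^ k) UNIV / fact k * u ^ k)
           sums logL (of_real \<sigma> + u)"
proof -
  let ?a = "\<lambda>m. of_real (kap m * c m) * of_nat m powr (- of_real \<sigma>) :: complex"
  define f where "f = (\<lambda>(m, k). ?a m * ((- u * of_real (ln (real m))) ^ k /\<^sub>R fact k))"
  have expo: "((\<lambda>k. ?a m * ((- u * of_real (ln (real m))) ^ k /\<^sub>R fact k)) has_sum (?a m * exp (- u * of_real (ln (real m))))) UNIV" for m
    by (intro has_sum_cmult_right norm_summable_imp_has_sum summable_norm_exp exp_converges)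
  have expn: "((\<lambda>k. norm (?a m * ((- u * of_real (ln (real m))) ^ k /\<^sub>R fact k))) has_sum (norm (?a m) * exp (norm u * \<bar>ln (real m)\<bar>))) UNIV" for m
  proof -
    have "((\<lambda>k. norm (?a m) * ((norm u * \<bar>ln (real m)\<bar>) ^ k /\<^sub>R fact k)) has_sum (norm (?a m) * exp (norm u * \<bar>ln (real m)\<bar>))) UNIV"
      by (intro has_sum_cmult_right norm_summable_imp_has_sum summable_norm_exp exp_converges)
    then show ?thesis by (simp add: norm_mult norm_power power_mult_distrib mult_ac)
  qed
  have abs_m: "(\<lambda>m. norm (?a m) * exp (norm u * \<bar>ln (real m)\<bar>)) summable_on UNIV"
  proof -
    have "summable (\<lambda>m. norm (norm (?a m) * exp (norm u * \<bar>ln (real m)\<bar>)))"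
    proof (rule summable_comparison_test'[of "\<lambda>m. real m powr (norm u - \<sigma>)" 1])
      show "summable (\<lambda>m. real m powr (norm u - \<sigma>))" using assms by (simp add: summable_real_powr_iff)
      fix m :: nat assume m: "1 \<le> m"
      have "\<bar>kap m * c m\<bar> \<le> 1" using kap_nonneg[of m] kap_le_1[of m] vals[of m] by (auto simp: abs_mult)
      then have "norm (?a m) \<le> real m powr (-\<sigma>)"
        using m mult_right_mono[of "\<bar>kap m * c m\<bar>" 1 "real m powr (-\<sigma>)"] by (simp add: norm_mult norm_nat_powr abs_mult)
      moreover have "exp (norm u * \<bar>ln (real m)\<bar>) = real m powr norm u" using m by (simp add: powr_def)
      ultimately have "norm (?a m) * exp (norm u * \<bar>ln (real m)\<bar>) \<le> real m powr (-\<sigma>) * real m powr norm u"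
        by (intro mult_mono) auto
      also have "\<dots> = real m powr (norm u - \<sigma>)" by (simp flip: powr_add add: add.commute)
      finally show "norm (norm (norm (?a m) * exp (norm u * \<bar>ln (real m)\<bar>))) \<le> real m powr (norm u - \<sigma>)" by simp
    qed
    then show ?thesis by (intro norm_summable_imp_summable_on) simp
  qed
  have "(\<lambda>x. norm (f x)) summable_on (UNIV \<times> UNIV)"
  proof (rule iffD2[OF Infinite_Sum.abs_summable_on_Sigma_iff], intro conjI ballI)
    show "(\<lambda>k. norm (f (m, k))) summable_on UNIV" for m
      unfolding f_def prod.case using expn[of m] by (rule has_sum_imp_summable)
    have "infsum (\<lambda>k. norm (f (m, k))) UNIV = norm (?a m) * exp (norm u * \<bar>ln (real m)\<bar>)" for m
      unfolding f_def prod.case using expn[of m] by (rule infsumI)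
    then show "(\<lambda>m. norm (infsum (\<lambda>k. norm (f (m, k))) UNIV)) summable_on UNIV"
      using abs_m by simp
  qed
  then have fsum: "f summable_on (UNIV \<times> UNIV)" by (rule abs_summable_summable)
  then have fsum': "(\<lambda>(m, k). f (m, k)) summable_on (UNIV \<times> UNIV)" by simp
  have fsw: "(\<lambda>(k, m). f (m, k)) summable_on (UNIV \<times> UNIV)"
    using fsum' by (subst (asm) summable_on_swap) simp
  have inner: "infsum (\<lambda>m. f (m, k)) UNIV = infsum (\<lambda>m. ?a m * (- of_real (ln (real m))) ^ k) UNIV / fact k * u ^ k" for k
  proof -
    have "f (m, k) = (u ^ k / fact k) * (?a m * (- of_real (ln (real m))) ^ k)" for m
    proof -
      have "(- u * of_real (ln (real m))) ^ k = u ^ k * (- of_real (ln (real m))) ^ k"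
        unfolding power_mult_distrib[symmetric] by simp
      then show ?thesis unfolding f_def by (simp add: scaleR_conv_of_real field_simps)
    qed
    then have "infsum (\<lambda>m. f (m, k)) UNIV = infsum (\<lambda>m. (u ^ k / fact k) * (?a m * (- of_real (ln (real m))) ^ k)) UNIV" by simp
    also have "\<dots> = (u ^ k / fact k) * infsum (\<lambda>m. ?a m * (- of_real (ln (real m))) ^ k) UNIV"
      by (rule infsum_cmult_right')
    finally show ?thesis by simp
  qed
  have "(\<lambda>k. infsum (\<lambda>m. f (m, k)) UNIV) summable_on UNIV"
    using summable_on_Sigma_banach[OF fsw] by simp
  then have "(\<lambda>k. infsum (\<lambda>m. f (m, k)) UNIV) sums infsum (\<lambda>k. infsum (\<lambda>m. f (m, k)) UNIV) UNIV"
    by (intro has_sum_imp_sums has_sum_infsum)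
  also have "infsum (\<lambda>k. infsum (\<lambda>m. f (m, k)) UNIV) UNIV = infsum (\<lambda>m. infsum (\<lambda>k. f (m, k)) UNIV) UNIV"
    using infsum_swap_banach[OF fsw] by simp
  also have "\<dots> = infsum (\<lambda>m. of_real (kap m) * (chi m * of_nat m powr (-(of_real \<sigma> + u)))) UNIV"
  proof (rule infsum_cong)
    fix m :: nat
    have "infsum (\<lambda>k. f (m, k)) UNIV = ?a m * exp (- u * of_real (ln (real m)))"
      unfolding f_def prod.case using expo[of m] by (rule infsumI)
    also have "\<dots> = of_real (kap m) * (chi m * of_nat m powr (-(of_real \<sigma> + u)))"
    proof (cases "m > 0")
      case True
      have "of_nat m powr (-(of_real \<sigma> + u)) = of_nat m powr (- of_real \<sigma>) * exp (- u * of_real (ln (real m)))"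
        unfolding nat_powr_exp[OF True] exp_add[symmetric] by (simp add: algebra_simps)
      then show ?thesis by (simp add: chi_def)
    qed simp
    finally show "infsum (\<lambda>k. f (m, k)) UNIV = of_real (kap m) * (chi m * of_nat m powr (-(of_real \<sigma> + u)))" .
  qed
  also have "\<dots> = logL (of_real \<sigma> + u)" by (simp add: logL_def)
  finally show ?thesis unfolding inner .
qed

lemma norm_logL_le:
  assumes "\<sigma> \<ge> 2"
  shows "norm (logL (of_real \<sigma>)) \<le> (\<Sum>n. (1 + real n) powr (-3/2))"
proof -
  interpret ms: multiplicative_series "\<lambda>n. chi n * of_nat n powr (-of_real \<sigma>)" by (rule ms) (use assms in auto)
  let ?f = "\<lambda>n. of_real (kap n) * (chi n * of_nat n powr (-of_real \<sigma>))"
  have sm: "summable (\<lambda>n. (1 + real n) powr (-3/2))" by (intro summable_Suc_powr) auto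
  have "?f sums logL (of_real \<sigma>)" unfolding logL_def
    by (intro has_sum_imp_sums has_sum_infsum ms.log_summable_on)
  then have S: "(\<lambda>n. ?f (Suc n)) sums logL (of_real \<sigma>)" by (subst sums_Suc_iff) simp
  have B: "norm (?f (Suc n)) \<le> (1 + real n) powr (-3/2)" for n
  proof -
    have "norm (?f (Suc n)) = \<bar>kap (Suc n)\<bar> * (norm (chi (Suc n)) * (1 + real n) powr (-\<sigma>))"
      by (simp add: norm_mult norm_Suc_powr)
    also have "\<dots> \<le> 1 * (1 * (1 + real n) powr (-3/2))"
      using kap_nonneg[of "Suc n"] kap_le_1[of "Suc n"] norm_chi_le[of "Suc n"] assms
      by (intro mult_mono powr_mono) auto
    finally show ?thesis by simp
  qed
  have "norm (\<Sum>n. ?f (Suc n)) \<le> (\<Sum>n. (1 + real n) powr (-3/2))" by (rule norm_suminf_le[OF B sm])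
  then show ?thesis using sums_unique[OF S] by simp
qed

text \<open>The sum is, up to sign, the k-th derivative of log L at \<sigma>. Absolute convergence
  alone gives powers of a radius below \<sigma> - 1 in the denominator. Nonvanishing under GRH
  enlarges it to \<sigma> - 1/2 - \<epsilon>, and the k-th power of the quotient of the radii is the
  square-root saving.\<close>

theorem GRH_log_coefficient_bound:
  assumes GRH and \<sigma>: "\<sigma> \<ge> 3" and k: "k \<ge> 1" and \<epsilon>: "0 < \<epsilon>" "\<epsilon> < 1/2"
  defines "Z \<equiv> (\<Sum>n. (1 + real n) powr (-3/2))"
  shows "\<bar>\<Sum>m. kap m * c m * ln (real m) ^ k * real m powr (-\<sigma>)\<bar>
    \<le> fact k * (4 * \<sigma> / \<epsilon> * (ln (2 * real q * \<sigma> * Z) + Z + 1)) / (\<sigma> - 1/2 - \<epsilon>) ^ k"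
proof -
  have smZ: "summable (\<lambda>n. (1 + real n) powr (-3/2))" by (intro summable_Suc_powr) auto
  have Z1: "Z \<ge> 1"
  proof -
    have "(\<Sum>n\<in>{0}. (1 + real n) powr (-3/2)) \<le> Z" unfolding Z_def by (intro sum_le_suminf smZ) auto
    then show ?thesis by simp
  qed
  define R where "R = \<sigma> - 1/2"
  define \<rho> where "\<rho> = R - \<epsilon>"
  have R: "R > 0" "\<rho> > 0" "\<rho> < R" using \<sigma> \<epsilon> by (auto simp: R_def \<rho>_def)
  have half: "Re s > 1/2" if "norm (s - of_real \<sigma>) < R" for s
    using abs_Re_le_cmod[of "s - of_real \<sigma>"] that unfolding R_def by (simp add: abs_le_iff)
  obtain G where G: "G holomorphic_on ball (of_real \<sigma>) R" and LG: "\<And>s. s \<in> ball (of_real \<sigma>) R \<Longrightarrow> L s = exp (G s)"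
  proof (rule contractible_imp_holomorphic_log[of L "ball (of_real \<sigma>) R"])
    show "L s \<noteq> 0" if "s \<in> ball (of_real \<sigma>) R" for s
      using L_nonzero[OF \<open>GRH\<close> half[of s]] that by (simp add: dist_norm norm_minus_commute)
  qed (auto intro: L_holomorphic convex_imp_contractible)
  \<comment> \<open>Subtracting the value at the centre makes g independent of the branch G and
    gives g 0 = 0 for Borel-Caratheodory.\<close>
  define g where "g u = G (of_real \<sigma> + u) - G (of_real \<sigma>)" for u
  have ginR: "of_real \<sigma> + u \<in> ball (of_real \<sigma>) R \<longleftrightarrow> norm u < R" for u :: complex by (simp add: dist_norm)
  have ghol: "g holomorphic_on ball 0 R"
  proof -
    have "G \<circ> (\<lambda>u. of_real \<sigma> + u) holomorphic_on ball 0 R"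
      by (rule holomorphic_on_compose_gen[OF _ G]) (use ginR in \<open>auto intro!: holomorphic_intros\<close>)
    then show ?thesis unfolding g_def by (auto intro!: holomorphic_intros simp: o_def)
  qed
  \<comment> \<open>ln (2 q \<sigma> Z) bounds ln |L| on the disc, Z bounds the modulus of ln |L| at
    the centre, and 1 makes the inequality strict.\<close>
  define A where "A = ln (2 * real q * \<sigma> * Z) + Z + 1"
  have re: "Re (g u) < A" if u: "norm u < R" for u
  proof -
    let ?s = "of_real \<sigma> + u"
    have "norm (L ?s) \<le> real q * norm ?s * Z"
      unfolding L_def Z_def using half[of ?s] u by (intro dirichlet_L_bound[OF dirichlet_chi nonprincipal_chi]) auto
    also have "norm ?s \<le> 2 * \<sigma>" using norm_triangle_ineq[of "of_real \<sigma>" u] u \<sigma> unfolding R_def by simp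
    finally have Lle: "norm (L ?s) \<le> 2 * real q * \<sigma> * Z" using q Z1 by (simp add: mult_left_mono mult_right_mono mult_ac)
    have "norm (L ?s) = exp (Re (G ?s))" using LG[of ?s] ginR u by (simp add: norm_exp)
    then have "Re (G ?s) = ln (norm (L ?s))" by simp
    also have "\<dots> \<le> ln (2 * real q * \<sigma> * Z)"
      using Lle \<open>norm (L ?s) = exp (Re (G ?s))\<close> by (intro ln_mono) auto
    finally have 1: "Re (G ?s) \<le> ln (2 * real q * \<sigma> * Z)" .
    have "exp (Re (G (of_real \<sigma>))) = norm (L (of_real \<sigma>))" using LG[of "of_real \<sigma>"] R by (simp add: norm_exp)
    also have "\<dots> = exp (Re (logL (of_real \<sigma>)))" using L_exp[of "of_real \<sigma>"] \<sigma> by (simp add: norm_exp)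
    finally have "Re (G (of_real \<sigma>)) = Re (logL (of_real \<sigma>))" by simp
    moreover have "\<bar>Re (logL (of_real \<sigma>))\<bar> \<le> Z"
      using abs_Re_le_cmod[of "logL (of_real \<sigma>)"] norm_logL_le[of \<sigma>] \<sigma> unfolding Z_def by linarith
    ultimately show ?thesis using 1 unfolding g_def A_def by simp
  qed
  have A0: "A > 0" using re[of 0] R by (simp add: g_def)
  have bc: "norm (g u) \<le> 2 * A * \<sigma> / \<epsilon>" if "norm u \<le> \<rho>" for u
  proof -
    have "norm (g u) \<le> 2 * A * norm u / (R - norm u)"
      by (rule borel_caratheodory[OF ghol _ R(1) re]) (use that R in \<open>auto simp: g_def\<close>)
    also have "\<dots> \<le> 2 * A * \<sigma> / \<epsilon>"
      using that R A0 \<epsilon> \<sigma> by (intro frac_le mult_left_mono) (auto simp: \<rho>_def R_def)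
    finally show ?thesis .
  qed
  have cauchy: "norm ((deriv ^^ k) g 0) \<le> fact k * (2 * A * \<sigma> / \<epsilon>) / \<rho> ^ k"
  proof (rule Cauchy_inequality)
    show "g holomorphic_on ball 0 \<rho>" by (rule holomorphic_on_subset[OF ghol]) (use R in auto)
    show "continuous_on (cball 0 \<rho>) g"
      by (rule holomorphic_on_imp_continuous_on, rule holomorphic_on_subset[OF ghol]) (use R in auto)
  qed (use R bc in auto)
  let ?h = "\<lambda>k. infsum (\<lambda>m. of_real (kap m * c m) * of_nat m powr (- of_real \<sigma>) * (- of_real (ln (real m))) ^ k) UNIV :: complex"
  have ser: "(\<lambda>k. ?h k / fact k * u ^ k) sums logL (of_real \<sigma> + u)" if "norm u < \<sigma> - 1" for u
    using logL_power_series[of \<sigma> u] that \<sigma> by simp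
  have lhol: "(\<lambda>u. logL (of_real \<sigma> + u)) holomorphic_on ball 0 (\<sigma> - 1)"
    by (rule power_series_holomorphic[of _ _ "\<lambda>k. ?h k / fact k"]) (use ser in \<open>auto simp: dist_norm\<close>)
  \<comment> \<open>G and \<open>logL\<close> are both logarithms of L on the smaller disc. So exp
    of their normalised difference d is 1, d has derivative 0, and d vanishes at the centre.\<close>
  have geq: "g u = logL (of_real \<sigma> + u) - logL (of_real \<sigma>)" if u: "norm u < \<sigma> - 1" for u
  proof -
    define d where "d u = g u - (logL (of_real \<sigma> + u) - logL (of_real \<sigma>))" for u
    have sub: "ball 0 (\<sigma> - 1) \<subseteq> ball (0::complex) R" by (auto simp: R_def)
    have dhol: "d holomorphic_on ball 0 (\<sigma> - 1)"
      unfolding d_def using holomorphic_on_subset[OF ghol sub] lhol by (intro holomorphic_intros)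
    have e1: "exp (d v) = 1" if v: "norm v < \<sigma> - 1" for v
    proof -
      have s1: "Re (of_real \<sigma> + v) > 1" using abs_Re_le_cmod[of v] v by (simp add: abs_le_iff)
      have vR: "of_real \<sigma> + v \<in> ball (of_real \<sigma>) R" "of_real \<sigma> \<in> ball (of_real \<sigma> :: complex) R"
        using v R by (auto simp: dist_norm R_def)
      have "exp (d v) = (exp (G (of_real \<sigma> + v)) / exp (logL (of_real \<sigma> + v))) * (exp (logL (of_real \<sigma>)) / exp (G (of_real \<sigma>)))"
        unfolding d_def g_def by (simp add: exp_diff exp_add)
      also have "\<dots> = 1"
        using LG[OF vR(1)] LG[OF vR(2)] L_exp[OF s1] L_exp[of "of_real \<sigma>"] \<sigma> by simp
      finally show ?thesis .
    qed
    have "\<exists>cc. \<forall>v\<in>ball 0 (\<sigma> - 1). d v = cc"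
    proof (rule has_field_derivative_zero_constant)
      fix v :: complex assume v: "v \<in> ball 0 (\<sigma> - 1)"
      have dd: "(d has_field_derivative deriv d v) (at v)"
        using holomorphic_derivI[OF dhol _ v] by simp
      then have "((\<lambda>v. exp (d v)) has_field_derivative exp (d v) * deriv d v) (at v)"
        by (auto intro!: derivative_eq_intros)
      moreover have "((\<lambda>v. exp (d v)) has_field_derivative 0) (at v)"
        by (rule has_field_derivative_transform_within_open[of "\<lambda>_. 1" _ _ "ball 0 (\<sigma> - 1)"]) (use v e1 in auto)
      ultimately have "exp (d v) * deriv d v = 0" by (rule DERIV_unique)
      then show "(d has_field_derivative 0) (at v within ball 0 (\<sigma> - 1))"
        using dd by (auto intro: has_field_derivative_at_within)
    qed auto
    moreover have "d 0 = 0" by (simp add: d_def g_def)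
    ultimately have "d u = 0" using u \<sigma> by force
    then show ?thesis by (simp add: d_def)
  qed
  define F where "F = Abs_fps (\<lambda>k. if k = 0 then 0 else ?h k / fact k)"
  have "g has_fps_expansion F"
  proof (rule has_fps_expansionI)
    have "\<forall>\<^sub>F u in nhds (0::complex). u \<in> ball 0 (\<sigma> - 1)"
      using \<sigma> by (intro eventually_nhds_in_open) auto
    then show "\<forall>\<^sub>F u in nhds 0. (\<lambda>k. fps_nth F k * u ^ k) sums g u"
    proof eventually_elim
      case (elim u)
      then have u: "norm u < \<sigma> - 1" by simp
      have "(\<lambda>k. ?h k / fact k * 0 ^ k) sums logL (of_real \<sigma>)" using ser[of 0] \<sigma> by simp
      then have "(\<lambda>k. ?h k / fact k * u ^ k - ?h k / fact k * 0 ^ k) sums g u"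
        using sums_diff[OF ser[OF u]] geq[OF u] by simp
      moreover have "?h k / fact k * u ^ k - ?h k / fact k * 0 ^ k = fps_nth F k * u ^ k" for k
        by (cases k) (auto simp: F_def)
      ultimately show ?case by simp
    qed
  qed
  then have "fps_nth F k = (deriv ^^ k) g 0 / fact k" by (rule fps_nth_fps_expansion)
  then have hk: "?h k = (deriv ^^ k) g 0" using k by (simp add: F_def)
  let ?t = "\<lambda>m. kap m * c m * ln (real m) ^ k * real m powr (-\<sigma>)"
  have sumt: "summable (\<lambda>m. norm (?t m))"
  proof (rule summable_comparison_test'[OF kap_ln_power_summable[of \<sigma> k], of 0])
    show "norm (norm (?t m)) \<le> kap m * ln (real m) ^ k * real m powr (-\<sigma>)" if "m \<ge> 0" for m
    proof (cases "m = 0")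
      case False
      then have "ln (real m) \<ge> 0" by simp
      then show ?thesis using kap_nonneg[of m] vals[of m] by (auto simp: abs_mult)
    qed simp
  qed (use \<sigma> in auto)
  have "?h k = infsum (\<lambda>m. of_real ((-1) ^ k * ?t m)) UNIV"
  proof (rule infsum_cong)
    fix m :: nat
    have "of_nat m powr (- of_real \<sigma> :: complex) = of_real (real m powr (-\<sigma>))"
      using powr_of_real[of "real m" "-\<sigma>"] by simp
    then show "of_real (kap m * c m) * of_nat m powr (- of_real \<sigma>) * (- of_real (ln (real m))) ^ k = complex_of_real ((-1) ^ k * ?t m)"
      by (simp add: power_minus[of "of_real (ln (real m))"])
  qed
  also have "\<dots> = of_real ((-1) ^ k * (\<Sum>m. ?t m))"
  proof (rule infsumI, rule norm_summable_imp_has_sum)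
    show "summable (\<lambda>m. norm (complex_of_real ((-1) ^ k * ?t m)))"
      using sumt by (simp add: norm_mult norm_power abs_mult power_abs)
    show "(\<lambda>m. complex_of_real ((-1) ^ k * ?t m)) sums of_real ((-1) ^ k * (\<Sum>m. ?t m))"
      unfolding sums_of_real_iff by (intro sums_mult summable_sums summable_norm_cancel[OF sumt])
  qed
  finally have "norm (?h k) = \<bar>\<Sum>m. ?t m\<bar>" by (simp add: abs_mult power_abs del: of_real_mult)
  then have "\<bar>\<Sum>m. ?t m\<bar> \<le> fact k * (2 * A * \<sigma> / \<epsilon>) / \<rho> ^ k" using cauchy hk by simp
  also have "\<dots> \<le> fact k * (4 * \<sigma> / \<epsilon> * A) / \<rho> ^ k"
    using R A0 \<sigma> \<epsilon> by (intro divide_right_mono mult_left_mono) (auto simp: field_simps)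
  finally show ?thesis unfolding A_def \<rho>_def R_def by (simp add: diff_diff_eq)
qed

end

section \<open>The Kronecker symbol as a real character\<close>

lemma Legendre_values: "Legendre a p = -1 \<or> Legendre a p = 0 \<or> Legendre a p = 1"
  by (simp add: Legendre_def)

lemma Legendre_eq_0_iff: "Legendre a (int p) = 0 \<longleftrightarrow> int p dvd a"
  by (auto simp: Legendre_def cong_0_iff)

lemma Legendre_cong: "[a = b] (mod p) \<Longrightarrow> Legendre a p = Legendre b p"
proof -
  assume ab: "[a = b] (mod p)"
  then have "[a = 0] (mod p) \<longleftrightarrow> [b = 0] (mod p)" using cong_trans cong_sym by blast
  moreover have "QuadRes p a \<longleftrightarrow> QuadRes p b" unfolding QuadRes_def using ab cong_trans cong_sym by blast
  ultimately show ?thesis by (simp add: Legendre_def)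
qed

text \<open>Euler's criterion gives a congruence modulo p between numbers of absolute value at most
  1. Their difference is at most 2 < p in absolute value, hence 0.\<close>

lemma Legendre_mult:
  assumes "prime p" "2 < p"
  shows "Legendre (a * b) (int p) = Legendre a (int p) * Legendre b (int p)"
proof -
  note ec = euler_criterion[OF assms]
  have "[Legendre a (int p) * Legendre b (int p) = a ^ ((p - 1) div 2) * b ^ ((p - 1) div 2)] (mod int p)"
    by (intro cong_mult ec)
  also have "a ^ ((p - 1) div 2) * b ^ ((p - 1) div 2) = (a * b) ^ ((p - 1) div 2)" by (simp add: power_mult_distrib)
  also have "[(a * b) ^ ((p - 1) div 2) = Legendre (a * b) (int p)] (mod int p)" by (rule cong_sym[OF ec])
  finally have "int p dvd Legendre a (int p) * Legendre b (int p) - Legendre (a * b) (int p)"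
    by (simp add: cong_iff_dvd_diff)
  moreover have "\<bar>Legendre a (int p) * Legendre b (int p) - Legendre (a * b) (int p)\<bar> < int p"
    using Legendre_values[of a "int p"] Legendre_values[of b "int p"] Legendre_values[of "a * b" "int p"] assms by auto
  ultimately have "Legendre a (int p) * Legendre b (int p) - Legendre (a * b) (int p) = 0"
    using zdvd_not_zless by (metis abs_dvd_iff dvd_abs_iff zero_less_abs_iff)
  then show ?thesis by simp
qed

lemma Legendre_1: "prime p \<Longrightarrow> Legendre 1 (int p) = 1"
proof -
  assume p: "prime p"
  then have "\<not> int p dvd 1" using prime_gt_1_nat[of p] by simp
  moreover have "QuadRes (int p) 1" unfolding QuadRes_def by (intro exI[of _ 1]) auto
  ultimately show ?thesis by (simp add: Legendre_def cong_0_iff)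
qed

text \<open>Squaring on the nonzero residues identifies 1 and p - 1, so it is not injective and, the
  set being finite, misses some residue.\<close>

lemma nonresidue_exists:
  assumes "prime p" "2 < p"
  shows "\<exists>a. Legendre a (int p) = -1"
proof -
  define f where "f y = y\<^sup>2 mod p" for y :: nat
  have sub: "f ` {1..<p} \<subseteq> {1..<p}"
  proof
    fix z assume "z \<in> f ` {1..<p}"
    then obtain y where y: "z = f y" "y \<in> {1..<p}" by blast
    have "\<not> p dvd y\<^sup>2" using y(2) assms by (auto simp: prime_dvd_power_iff dest: dvd_imp_le)
    then have "z > 0" using y by (simp add: f_def dvd_eq_mod_eq_0)
    then show "z \<in> {1..<p}" using y assms by (auto simp: f_def)
  qed
  have "\<not> inj_on f {1..<p}"
  proof
    assume inj: "inj_on f {1..<p}"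
    have "[(p - 1)\<^sup>2 = 1] (mod p)"
    proof -
      have "int (p - 1) = int p - 1" using assms by simp
      then have "int ((p - 1)\<^sup>2) - 1 = int p * (int p - 2)" by (simp only: of_nat_power) (simp add: power2_eq_square algebra_simps)
      then have "[int ((p - 1)\<^sup>2) = int 1] (mod int p)" by (simp add: cong_iff_dvd_diff)
      then show ?thesis by (simp only: cong_int_iff)
    qed
    then have "f (p - 1) = f 1" by (simp add: f_def cong_def)
    then have "p - 1 = 1" using inj assms by (auto simp: inj_on_def)
    then show False using assms by simp
  qed
  then have "f ` {1..<p} \<noteq> {1..<p}" using eq_card_imp_inj_on[of "{1..<p}" f] by fastforce
  then obtain a where a: "a \<in> {1..<p}" "a \<notin> f ` {1..<p}" using sub by blast
  have "\<not> QuadRes (int p) (int a)"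
  proof
    assume "QuadRes (int p) (int a)"
    then obtain y where y: "[y\<^sup>2 = int a] (mod int p)" by (auto simp: QuadRes_def)
    define z where "z = nat (y mod int p)"
    have p0: "int p > 0" using assms by simp
    have z: "int z = y mod int p" unfolding z_def using p0 by simp
    have "[int (z\<^sup>2) = int a] (mod int p)"
      using y unfolding of_nat_power z by (simp add: cong_def power_mod)
    then have "[z\<^sup>2 = a] (mod p)" by (simp only: cong_int_iff)
    then have fz: "f z = a" using a(1) by (simp add: f_def cong_def)
    have "z < p" using z p0 pos_mod_bound[OF p0, of y] by linarith
    moreover have "z \<noteq> 0" using fz a(1) by (intro notI) (simp add: f_def)
    ultimately have "a \<in> f ` {1..<p}" using fz by force
    then show False using a by simp
  qed
  moreover have "\<not> [int a = 0] (mod int p)" using a(1) by (auto simp: cong_0_iff dest: zdvd_imp_le)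
  ultimately have "Legendre (int a) (int p) = -1" by (simp add: Legendre_def)
  then show ?thesis by blast
qed

section \<open>The Kronecker symbol as a function of either argument\<close>

lemma kronecker_odd:
  assumes "odd n"
  shows "kronecker d n = (\<Prod>p\<in>prime_factors n. Legendre d (int p) ^ multiplicity p n)"
proof -
  have "n \<noteq> 0" using odd_pos[of n] assms by simp
  have "kronecker_prime d p = Legendre d (int p)" if "p \<in> prime_factors n" for p
  proof -
    have "p \<noteq> 2" using that assms by auto
    then show ?thesis by (simp add: kronecker_prime_def)
  qed
  then show ?thesis using \<open>n \<noteq> 0\<close> by (simp add: kronecker_def)
qed

lemma kronecker_mult_right:
  assumes "m > 0" "n > 0"
  shows "kronecker d (m * n) = kronecker d m * kronecker d n"
proof -
  let ?P = "prime_factors (m * n)"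
  have k: "kronecker d k = (\<Prod>p\<in>?P. kronecker_prime d p ^ multiplicity p k)" if "k > 0" "k dvd m * n" for k
  proof -
    have "prime_factors k \<subseteq> ?P" using that assms by (intro dvd_prime_factors) auto
    then have "(\<Prod>p\<in>prime_factors k. kronecker_prime d p ^ multiplicity p k) = (\<Prod>p\<in>?P. kronecker_prime d p ^ multiplicity p k)"
    proof (intro prod.mono_neutral_left)
      show "\<forall>p\<in>?P - prime_factors k. kronecker_prime d p ^ multiplicity p k = 1"
      proof
        fix p assume "p \<in> ?P - prime_factors k"
        then have "\<not> p dvd k" using that by (auto simp: prime_factors_dvd)
        then show "kronecker_prime d p ^ multiplicity p k = 1" by (simp add: not_dvd_imp_multiplicity_0)
      qed
    qed auto
    then show ?thesis using that by (simp add: kronecker_def)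
  qed
  have "multiplicity p (m * n) = multiplicity p m + multiplicity p n" if "p \<in> ?P" for p
    using that assms by (intro prime_elem_multiplicity_mult_distrib) auto
  then have "kronecker d (m * n) = (\<Prod>p\<in>?P. kronecker_prime d p ^ multiplicity p m * kronecker_prime d p ^ multiplicity p n)"
    using k[of "m * n"] assms by (simp add: power_add)
  also have "\<dots> = kronecker d m * kronecker d n"
    using k[of m] k[of n] assms by (simp add: prod.distrib)
  finally show ?thesis .
qed

lemma kronecker_even:
  assumes "even d" "even n" "n > 0"
  shows "kronecker d n = 0"
proof -
  have "2 \<in> prime_factors n" using assms by (simp add: prime_factors_dvd)
  moreover have "multiplicity 2 n > 0" using assms by (simp add: prime_multiplicity_gt_zero_iff)
  ultimately show ?thesis using assms by (auto simp: kronecker_def kronecker_prime_def)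
qed

lemma kronecker_values: "kronecker d n = -1 \<or> kronecker d n = 0 \<or> kronecker d n = 1"
proof (cases "n = 0")
  case False
  have *: "x ^ k = -1 \<or> x ^ k = 0 \<or> x ^ k = 1" if "x = -1 \<or> x = 0 \<or> x = (1::int)" for x k
    using that by (cases "even k"; cases "k = 0") (auto simp: power_0_left)
  have "(\<Prod>p\<in>P. kronecker_prime d p ^ multiplicity p n) = -1 \<or> (\<Prod>p\<in>P. kronecker_prime d p ^ multiplicity p n) = 0 \<or> (\<Prod>p\<in>P. kronecker_prime d p ^ multiplicity p n) = 1"
    if "finite P" for P using that
  proof (induction P rule: finite_induct)
    case (insert p P)
    have "kronecker_prime d p = -1 \<or> kronecker_prime d p = 0 \<or> kronecker_prime d p = 1"
      using Legendre_values[of d "int p"] by (auto simp: kronecker_prime_def)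
    then show ?case using insert *[of "kronecker_prime d p" "multiplicity p n"] by auto
  qed simp
  then show ?thesis using False by (simp add: kronecker_def)
qed (simp add: kronecker_def)

lemma kronecker_mult_left:
  assumes "odd n"
  shows "kronecker (d * e) n = kronecker d n * kronecker e n"
proof -
  have "Legendre (d * e) (int p) = Legendre d (int p) * Legendre e (int p)" if "p \<in> prime_factors n" for p
  proof (rule Legendre_mult)
    show p: "prime p" using that by auto
    have "p \<noteq> 2" using that assms by auto
    then show "2 < p" using prime_ge_2_nat[OF p] by simp
  qed
  then show ?thesis using assms by (simp add: kronecker_odd power_mult_distrib prod.distrib)
qed

lemma kronecker_periodic:
  assumes "odd n" "[d = e] (mod int n)"
  shows "kronecker d n = kronecker e n"
proof -
  have "Legendre d (int p) = Legendre e (int p)" if "p \<in> prime_factors n" for p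
  proof (rule Legendre_cong)
    have "int p dvd int n" using that by auto
    then show "[d = e] (mod int p)" using assms(2) by (rule cong_dvd_modulus[rotated])
  qed
  then show ?thesis using assms by (simp add: kronecker_odd)
qed

lemma kronecker_nonzero_iff:
  assumes "odd n"
  shows "kronecker (int m) n \<noteq> 0 \<longleftrightarrow> coprime m n"
proof -
  have n0: "n \<noteq> 0" using odd_pos[of n] assms by simp
  have "kronecker (int m) n = 0 \<longleftrightarrow> (\<exists>p\<in>prime_factors n. Legendre (int m) (int p) ^ multiplicity p n = 0)"
    unfolding kronecker_odd[OF assms] by simp
  also have "\<dots> \<longleftrightarrow> (\<exists>p\<in>prime_factors n. p dvd m)"
    using n0 by (auto simp: Legendre_eq_0_iff prime_factors_multiplicity)
  also have "\<dots> \<longleftrightarrow> \<not> coprime m n"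
  proof
    assume "\<not> coprime m n"
    then have "gcd m n \<noteq> 1" using coprime_iff_gcd_eq_1[of m n] by blast
    from prime_factor_nat[OF this] obtain p where p: "prime p" "p dvd gcd m n" by (elim exE conjE)
    have "p dvd m" using p(2) by (rule dvd_trans) simp
    moreover have "p dvd n" using p(2) by (rule dvd_trans) simp
    ultimately show "\<exists>p\<in>prime_factors n. p dvd m" using n0 p(1) by (auto simp: prime_factors_dvd)
  next
    assume "\<exists>p\<in>prime_factors n. p dvd m"
    then obtain p where p: "p \<in> prime_factors n" "p dvd m" by (elim bexE)
    then have "prime p" "p dvd n" by auto
    with p(2) show "\<not> coprime m n" using coprime_common_divisor[of m n p] not_prime_unit[of p] by blast
  qed
  finally show ?thesis by blast
qed

text \<open>A nonsquare n has a prime p of odd multiplicity. Choose x to be a nonresidue modulo p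
  and 1 modulo the part of n prime to p: the factor at p is an odd power of -1 and all others are
  1.\<close>

lemma kronecker_nonprincipal:
  assumes "odd n" "\<not> is_square n"
  shows "\<exists>m. kronecker (int m) n = -1"
proof -
  have n0: "n > 0" using odd_pos[of n] assms by simp
  obtain p where p: "prime p" "odd (multiplicity p n)"
    using assms(2) n0 is_nth_power_conv_multiplicity_nat[of 2 n] by auto
  define e where "e = multiplicity p n"
  define m where "m = n div p ^ e"
  have nm: "n = p ^ e * m" unfolding e_def m_def using multiplicity_dvd[of p n] by simp
  have pm: "\<not> p dvd m" unfolding m_def e_def using n0 p prime_gt_1_nat[OF p(1)] by (intro multiplicity_decompose) auto
  have pn: "p dvd n" using p(2) by (metis dvd_0_right even_zero not_dvd_imp_multiplicity_0)
  have "p \<noteq> 2" using pn assms(1) by auto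
  then have p2: "2 < p" using prime_ge_2_nat[OF p(1)] by simp
  obtain a where a: "Legendre a (int p) = -1" using nonresidue_exists[OF p(1) p2] by blast
  define a' where "a' = nat (a mod int p)"
  have a': "[int a' = a] (mod int p)" unfolding a'_def using p2 by (simp add: cong_def)
  have "coprime p m" using p pm by (simp add: prime_imp_coprime)
  then obtain x where x: "[x = a'] (mod p)" "[x = 1] (mod m)"
    using binary_chinese_remainder_nat by blast
  have "[int x = a] (mod int p)" using x(1) a' cong_trans by (metis cong_int_iff)
  then have xp: "Legendre (int x) (int p) = -1" using a Legendre_cong by metis
  have xr: "Legendre (int x) (int r) = 1" if "r \<in> prime_factors n" "r \<noteq> p" for r
  proof -
    have r: "prime r" "r dvd n" using that by auto
    then have "r dvd m" using that(2) p(1) unfolding nm by (metis prime_dvd_mult_iff prime_dvd_power primes_dvd_imp_eq)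
    then have "[x = 1] (mod r)" using x(2) by (rule cong_dvd_modulus_nat[rotated])
    then have "[int x = 1] (mod int r)" by (metis cong_int_iff of_nat_1)
    then show ?thesis using Legendre_cong[of "int x" 1 "int r"] Legendre_1[OF r(1)] by simp
  qed
  have "p \<in> prime_factors n" using p(1) pn n0 by (simp add: prime_factors_dvd)
  then have "kronecker (int x) n = Legendre (int x) (int p) ^ multiplicity p n * (\<Prod>r\<in>prime_factors n - {p}. Legendre (int x) (int r) ^ multiplicity r n)"
    unfolding kronecker_odd[OF assms(1)] by (intro prod.remove) auto
  also have "(\<Prod>r\<in>prime_factors n - {p}. Legendre (int x) (int r) ^ multiplicity r n) = 1"
    using xr by (intro prod.neutral) auto
  finally have "kronecker (int x) n = -1" using xp p(2) by simp
  then show ?thesis by blast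
qed

text \<open>The variable is the upper argument, where periodicity modulo n is immediate. A sum of
  the symbol over primes in the upper argument is thus directly a character sum modulo n, without
  reciprocity.\<close>

lemma real_char_kronecker:
  assumes "odd n" "\<not> is_square n"
  shows "real_char n (\<lambda>m. of_int (kronecker (int m) n))"
proof
  show "n > 0" using odd_pos[of n] assms by simp
  show "real_of_int (kronecker (int (m + n)) n) = real_of_int (kronecker (int m) n)" for m
    using kronecker_periodic[OF assms(1), of "int (m + n)" "int m"] by (simp add: cong_def)
  show "real_of_int (kronecker (int (m * k)) n) = real_of_int (kronecker (int m) n) * real_of_int (kronecker (int k) n)" for m k
    by (simp add: kronecker_mult_left[OF assms(1)])
  show "real_of_int (kronecker (int m) n) = -1 \<or> real_of_int (kronecker (int m) n) = 0 \<or> real_of_int (kronecker (int m) n) = 1" for m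
    using kronecker_values[of "int m" n] by auto
  show "(real_of_int (kronecker (int m) n) \<noteq> 0) = coprime m n" for m
    using kronecker_nonzero_iff[OF assms(1), of m] by simp
  show "\<exists>m. real_of_int (kronecker (int m) n) = -1"
  proof -
    obtain m where "kronecker (int m) n = -1" using kronecker_nonprincipal[OF assms] by blast
    then show ?thesis by (intro exI[of _ m]) simp
  qed
qed

text \<open>8 p is 4 (2 p), and 2 p is 2 modulo 4 for every odd p, whatever its residue modulo 4. So
  the primes are subject to no congruence condition.\<close>

lemma fundamental_discriminant_8p:
  assumes "prime p" "p \<noteq> 2"
  shows "fundamental_discriminant (8 * int p)"
proof -
  have "odd p" using assms primes_dvd_imp_eq two_is_prime_nat by blast
  have sq2: "squarefree (2::int)" "squarefree (int p)"
    using squarefree_prime_elem[of "int p"] squarefree_prime_elem[of "2::int"] assms by auto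
  have "coprime 2 (int p)" using \<open>odd p\<close> by simp
  then have "squarefree (2 * int p)" using sq2 by (intro squarefree_mult_coprime)
  moreover have "2 * int p mod 4 = 2" using \<open>odd p\<close> by presburger
  ultimately show ?thesis unfolding fundamental_discriminant_def by (intro disjI2 exI[of _ "2 * int p"]) auto
qed

section \<open>Weights on the primes\<close>

text \<open>The induction step is (1 + 1/n)^(n + 1) >= e. The factor e n lost against (n/e)^n will
  be a power of ln x, harmless beside powers of x.\<close>

lemma fact_le_stirling:
  assumes "n \<ge> 1"
  shows "(fact n :: real) \<le> exp 1 * real n * (real n / exp 1) ^ n"
  using assms
proof (induction n rule: dec_induct)
  case (step n)
  have n: "real n > 0" using step by simp
  have "1 / real (Suc n) \<le> ln (real (Suc n) / real n)"
  proof -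
    have "ln (real n / real (Suc n)) \<le> real n / real (Suc n) - 1" using n by (intro ln_le_minus_one) auto
    then show ?thesis using n by (simp add: ln_div field_simps)
  qed
  then have "1 \<le> real (Suc n) * ln (real (Suc n) / real n)" using n by (simp add: field_simps)
  then have "exp 1 \<le> exp (real (Suc n) * ln (real (Suc n) / real n))" by simp
  also have "\<dots> = (real (Suc n) / real n) ^ Suc n" using n by (simp add: exp_of_nat_mult del: of_nat_Suc power_Suc)
  finally have "exp 1 * real n ^ Suc n \<le> real (Suc n) ^ Suc n"
    using n by (simp add: power_divide field_simps del: of_nat_Suc power_Suc)
  then have key: "exp 1 * (real n * real n ^ n) \<le> real (Suc n) ^ Suc n" by simp
  have "fact (Suc n) = real (Suc n) * fact n" by simp
  also have "\<dots> \<le> real (Suc n) * (exp 1 * real n * (real n / exp 1) ^ n)" using step by (intro mult_left_mono) auto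
  also have "\<dots> = real (Suc n) * (exp 1 * (real n * real n ^ n)) / exp 1 ^ n" by (simp add: power_divide)
  also have "\<dots> \<le> real (Suc n) * real (Suc n) ^ Suc n / exp 1 ^ n"
    using key by (intro divide_right_mono mult_left_mono) auto
  also have "\<dots> = exp 1 * real (Suc n) * (real (Suc n) / exp 1) ^ Suc n"
    by (simp add: power_divide del: of_nat_Suc)
  finally show ?case .
qed simp

text \<open>Concavity: compare with tangents at 1 + t1/2 and 1 - t1/2. A bound linear in |t| is
  wanted because t stands for (ln m - u0)/u0 and the weights have to decay like a power of m far
  from their peak.\<close>

lemma ln_one_plus_upper:
  fixes t t1 :: real
  assumes "t > -1" "0 < t1" "t1 \<le> 1" "\<bar>t\<bar> \<ge> t1"
  shows "ln (1 + t) - t \<le> - t1 * \<bar>t\<bar> / 8"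
proof -
  have tangent: "ln (1 + t) \<le> (t - a) / (1 + a) + a" if "a > -1" for a
  proof -
    have "ln ((1 + t) / (1 + a)) \<le> (1 + t) / (1 + a) - 1" using assms that by (intro ln_le_minus_one) auto
    moreover have "ln (1 + a) \<le> a" using ln_le_minus_one[of "1 + a"] that by simp
    moreover have "ln ((1 + t) / (1 + a)) = ln (1 + t) - ln (1 + a)" using assms that by (simp add: ln_div)
    moreover have "(1 + t) / (1 + a) - 1 = (t - a) / (1 + a)" using that by (simp add: field_simps)
    ultimately show ?thesis by linarith
  qed
  have frac: "(t - a) / (1 + a) + a - t = - ((t - a) * a / (1 + a))" if "a > -1" for a
    using that by (simp add: field_simps)
  show ?thesis
  proof (cases "t \<ge> 0")
    case True
    define a where "a = t1 / 2"
    have a: "a > 0" "a \<le> 1" "t \<ge> 2 * a" using assms True by (auto simp: a_def)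
    have "(t / 2) * a / 2 \<le> (t - a) * a / (1 + a)"
      using a by (intro frac_le mult_right_mono) auto
    moreover have "ln (1 + t) - t \<le> - ((t - a) * a / (1 + a))" using tangent[of a] frac[of a] a by linarith
    moreover have "(t / 2) * a / 2 = t1 * \<bar>t\<bar> / 8" using True by (simp add: a_def)
    ultimately show ?thesis by linarith
  next
    case False
    define a where "a = t1 / 2"
    have a: "a > 0" "a \<le> 1/2" "t \<le> - 2 * a" using assms False by (auto simp: a_def)
    have "(- t / 2) * a \<le> (- t - a) * a / (1 - a)"
    proof -
      have "(- t / 2) * a / 1 \<le> (- t - a) * a / (1 - a)"
        using a by (intro frac_le mult_right_mono) auto
      then show ?thesis by simp
    qed
    moreover have "t1 * \<bar>t\<bar> / 8 \<le> (- t / 2) * a" using False assms by (simp add: a_def)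
    moreover have "ln (1 + t) - t \<le> - ((t - - a) * - a / (1 + - a))" using tangent[of "-a"] frac[of "-a"] a by linarith
    moreover have "(t - - a) * - a / (1 + - a) = (- t - a) * a / (1 - a)" by (simp add: algebra_simps)
    ultimately show ?thesis by linarith
  qed
qed

lemma card_fiber_ge:
  assumes "finite I" "finite V" "V \<noteq> {}" "f ` I \<subseteq> V"
  shows "\<exists>v\<in>V. real (card {i\<in>I. f i = v}) \<ge> real (card I) / real (card V)"
proof (rule ccontr)
  assume *: "\<not> ?thesis"
  have cV: "real (card V) > 0" using assms by (simp add: card_gt_0_iff)
  have "I = (\<Union>v\<in>V. {i\<in>I. f i = v})" using assms(4) by auto
  then have "card I \<le> (\<Sum>v\<in>V. card {i\<in>I. f i = v})"
    using card_UN_le[OF assms(2), of "\<lambda>v. {i\<in>I. f i = v}"] by simp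
  then have "real (card I) \<le> (\<Sum>v\<in>V. real (card {i\<in>I. f i = v}))" by (metis of_nat_le_iff of_nat_sum)
  also have "\<dots> < (\<Sum>v\<in>V. real (card I) / real (card V))"
    using assms * by (intro sum_strict_mono) auto
  also have "\<dots> = real (card I)" using cV by simp
  finally show False by simp
qed

lemma card_real_interval_le:
  fixes a b :: real
  assumes "0 \<le> a" "a \<le> b"
  shows "real (card {n::nat. a < real n \<and> real n \<le> b}) \<le> b - a + 1"
proof -
  have "{n::nat. a < real n \<and> real n \<le> b} \<subseteq> {nat \<lfloor>a\<rfloor><..nat \<lfloor>b\<rfloor>}"
    using assms by (auto simp: le_nat_floor) linarith
  then have "card {n::nat. a < real n \<and> real n \<le> b} \<le> nat \<lfloor>b\<rfloor> - nat \<lfloor>a\<rfloor>"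
    using card_mono[of "{nat \<lfloor>a\<rfloor><..nat \<lfloor>b\<rfloor>}"] by simp
  also have "real \<dots> \<le> b - a + 1" using assms by linarith
  finally show ?thesis by simp
qed

text \<open>The weight \<open>(ln m) ^ k * m powr (-\<sigma>)\<close> with \<open>\<sigma> = 1 + k / u\<^sub>0\<close> equals \<open>\<phi> (ln m) / m\<close>, where \<open>\<phi>\<close> peaks at \<open>u\<^sub>0\<close>.\<close>

lemma gamma_weight:
  fixes u0 :: real
  assumes "m \<ge> 2" "u0 > 0"
  shows "ln (real m) ^ k * real m powr (- (1 + real k / u0))
     = (u0 / exp 1) ^ k * exp (real k * (ln (1 + (ln (real m) - u0) / u0) - (ln (real m) - u0) / u0)) / real m"
proof -
  define u where "u = ln (real m)"
  have u: "u > 0" using assms by (simp add: u_def)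
  have m: "real m = exp u" using assms by (simp add: u_def)
  have eq1: "1 + (u - u0) / u0 = u / u0" using assms by (simp add: field_simps)
  have "real k * (ln (1 + (u - u0) / u0) - (u - u0) / u0) = real k * ln (u / u0) + (- real k * (u - u0) / u0)"
    unfolding eq1 by (simp add: right_diff_distrib minus_divide_left)
  then have "exp (real k * (ln (1 + (u - u0) / u0) - (u - u0) / u0)) = exp (real k * ln (u / u0)) * exp (- real k * (u - u0) / u0)"
    by (simp only: exp_add)
  also have "exp (real k * ln (u / u0)) = (u / u0) ^ k" using u assms by (simp add: exp_of_nat_mult)
  also have "- real k * (u - u0) / u0 = real k - real k / u0 * u" using assms by (simp add: field_simps)
  finally have 1: "exp (real k * (ln (1 + (u - u0) / u0) - (u - u0) / u0)) = (u / u0) ^ k * (exp (real k) * exp (- real k / u0 * u))"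
    by (simp add: exp_diff exp_minus divide_inverse)
  have "real m powr (- (1 + real k / u0)) = exp (- real k / u0 * u) / real m"
    unfolding powr_def m using assms by (simp add: algebra_simps exp_diff exp_minus divide_inverse flip: exp_add)
  then have "ln (real m) ^ k * real m powr (- (1 + real k / u0)) = u ^ k * exp (- real k / u0 * u) / real m"
    by (simp add: u_def)
  moreover have "u ^ k = (u0 / exp 1) ^ k * (u / u0) ^ k * exp (real k)"
  proof -
    have "exp (real k) = exp 1 ^ k" using exp_of_nat_mult[of k "1::real"] by simp
    then have "(u0 / exp 1) ^ k * (u / u0) ^ k * exp (real k) = (u0 / exp 1 * (u / u0) * exp 1) ^ k"
      by (simp only: power_mult_distrib)
    then show ?thesis using assms by simp
  qed
  ultimately show ?thesis unfolding u_def[symmetric] 1 by simp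
qed

text \<open>Put l = ln x and place the peak u0 at a prime around which many primes cluster, so that
  the total weight W is at least the peak height \<Phi> divided by a power of l. Against this, the
  character sum over all m is at most \<Phi> x^(-1/2 + \<epsilon>/2) times a power of l, the m
  outside the dyadic window are suppressed by exp(-l^4/32), and proper prime powers contribute about
  \<Phi> x^(-1/2) l. The bound x^3 on n enters through ln n <= 3 l.\<close>

theorem GRH_prime_weights:
  assumes GRH and \<epsilon>: "0 < \<epsilon>" "\<epsilon> < 1/2"
  shows "\<forall>\<^sub>F x :: real in at_top. \<exists>w. (\<forall>p. w p \<ge> 0) \<and> (\<Sum>p | prime p \<and> x < real p \<and> real p \<le> 2 * x. w p) = (1::real) \<and>
     (\<forall>n. odd n \<and> \<not> is_square n \<and> real n \<le> x ^ 3 \<longrightarrow>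
        \<bar>\<Sum>p | prime p \<and> x < real p \<and> real p \<le> 2 * x. w p * of_int (kronecker (int p) n)\<bar> \<le> x powr (-1/2 + \<epsilon>))"
proof -
  define Z where "Z = (\<Sum>n. (1 + real n) powr (-3/2))"
  define Z2 where "Z2 = (\<Sum>n. real n powr (-2))"
  have smZ: "summable (\<lambda>n. (1 + real n) powr (-3/2))" by (intro summable_Suc_powr) auto
  have smZ2: "summable (\<lambda>n. real n powr (-2))" by (simp add: summable_real_powr_iff)
  have Z1: "Z \<ge> 1"
  proof -
    have "(\<Sum>n\<in>{0}. (1 + real n) powr (-3/2)) \<le> Z" unfolding Z_def by (intro sum_le_suminf smZ) auto
    then show ?thesis by simp
  qed
  have Z20: "Z2 \<ge> 0" unfolding Z2_def by (intro suminf_nonneg smZ2) auto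
  have "\<forall>\<^sub>F l :: real in at_top. l \<ge> 4 \<and> l \<ge> Z2 \<and> l \<ge> 24 / \<epsilon> \<and> l \<ge> ln 2 + ln Z + Z + 1
     \<and> exp l / (4 * l) - 4 * exp l / l\<^sup>2 - 2 \<ge> exp l / (8 * l)
     \<and> ln (3 * l ^ 9) + 4 * l \<le> l\<^sup>2
     \<and> 16 * l * (l ^ 4 + 1) * exp 4 * (2 * exp l * exp (1 - l ^ 4 / 32) * l) \<le> 1 / 3 * exp (- l)"
    by (intro eventually_conj eventually_ge_at_top) (real_asymp+)
  moreover have "\<forall>\<^sub>F l :: real in at_top. 16 * l * (l ^ 4 + 1) * exp 4 * (sqrt 2 * (l + 1) / ln 2) \<le> 1 / 3 * exp (\<epsilon> * l)"
    using \<epsilon> by real_asymp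
  moreover have "\<forall>\<^sub>F l :: real in at_top. 16 * l * (l ^ 4 + 1) * exp 4 * (exp 1 * (2 * l ^ 10) * (l * l ^ 9 * l\<^sup>2) * exp 1) \<le> 1 / 3 * exp (\<epsilon> / 2 * l)"
    using \<epsilon> by real_asymp
  ultimately have "\<forall>\<^sub>F l :: real in at_top. l \<ge> 4 \<and> l \<ge> Z2 \<and> l \<ge> 24 / \<epsilon> \<and> l \<ge> ln 2 + ln Z + Z + 1
     \<and> exp l / (4 * l) - 4 * exp l / l\<^sup>2 - 2 \<ge> exp l / (8 * l)
     \<and> ln (3 * l ^ 9) + 4 * l \<le> l\<^sup>2
     \<and> 16 * l * (l ^ 4 + 1) * exp 4 * (2 * exp l * exp (1 - l ^ 4 / 32) * l) \<le> 1 / 3 * exp (- l)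
     \<and> 16 * l * (l ^ 4 + 1) * exp 4 * (sqrt 2 * (l + 1) / ln 2) \<le> 1 / 3 * exp (\<epsilon> * l)
     \<and> 16 * l * (l ^ 4 + 1) * exp 4 * (exp 1 * (2 * l ^ 10) * (l * l ^ 9 * l\<^sup>2) * exp 1) \<le> 1 / 3 * exp (\<epsilon> / 2 * l)"
    by eventually_elim blast
  then have "\<forall>\<^sub>F x :: real in at_top. ln x \<ge> 4 \<and> ln x \<ge> Z2 \<and> ln x \<ge> 24 / \<epsilon> \<and> ln x \<ge> ln 2 + ln Z + Z + 1
     \<and> exp (ln x) / (4 * ln x) - 4 * exp (ln x) / (ln x)\<^sup>2 - 2 \<ge> exp (ln x) / (8 * ln x)
     \<and> ln (3 * (ln x) ^ 9) + 4 * ln x \<le> (ln x)\<^sup>2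
     \<and> 16 * ln x * ((ln x) ^ 4 + 1) * exp 4 * (2 * exp (ln x) * exp (1 - (ln x) ^ 4 / 32) * ln x) \<le> 1 / 3 * exp (- ln x)
     \<and> 16 * ln x * ((ln x) ^ 4 + 1) * exp 4 * (sqrt 2 * (ln x + 1) / ln 2) \<le> 1 / 3 * exp (\<epsilon> * ln x)
     \<and> 16 * ln x * ((ln x) ^ 4 + 1) * exp 4 * (exp 1 * (2 * (ln x) ^ 10) * (ln x * (ln x) ^ 9 * (ln x)\<^sup>2) * exp 1) \<le> 1 / 3 * exp (\<epsilon> / 2 * ln x)"
    by (rule eventually_compose_filterlim[OF _ ln_at_top])
  then show ?thesis using chebyshev_dyadic eventually_gt_at_top[of 1]
  proof eventually_elim
    case (elim x)
    define l where "l = ln x"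
    note nums = elim(1)[folded l_def]
    have x1: "x > 1" by fact
    have xl: "exp l = x" using x1 by (simp add: l_def)
    have l4: "l \<ge> 4" using nums by blast
    define P where "P = {p. prime p \<and> x < real p \<and> real p \<le> 2 * x}"
    have finW: "finite {n::nat. x < real n \<and> real n \<le> 2 * x}"
      by (rule finite_subset[of _ "{..nat \<lfloor>2 * x\<rfloor>}"]) (auto simp: le_nat_floor)
    have finP: "finite P" unfolding P_def by (rule finite_subset[OF _ finW]) auto
    \<comment> \<open>h keeps u0 away from the ends of the dyadic window; l0 is the width of the
      cells among which the primes are distributed by the pigeonhole principle.\<close>
    define h where "h = 1 / l\<^sup>2"
    define l0 where "l0 = 1 / l ^ 4"
    have h: "h > 0" "h \<le> 1/2" using l4 power_mono[of 4 l 2] by (auto simp: h_def field_simps)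
    have l0: "l0 > 0" using l4 by (simp add: l0_def)
    define I where "I = {p\<in>P. l + h \<le> ln (real p) \<and> ln (real p) \<le> l + ln 2 - h}"
    have finI: "finite I" using finP by (simp add: I_def)
    have cardI: "real (card I) \<ge> x / (8 * l)"
    proof -
      define A where "A = {n::nat. x < real n \<and> real n \<le> x * exp h}"
      define B where "B = {n::nat. 2 * x * exp (-h) < real n \<and> real n \<le> 2 * x}"
      have sub: "P \<subseteq> I \<union> (A \<union> B)"
      proof
        fix p assume p: "p \<in> P"
        then have pp: "real p > 0" using x1 by (auto simp: P_def)
        show "p \<in> I \<union> (A \<union> B)"
        proof (cases "ln (real p) < l + h")
          case True
          then have "exp (ln (real p)) \<le> exp (l + h)" by simp
          then have "p \<in> A" using p pp by (simp add: A_def P_def exp_add xl)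
          then show ?thesis by simp
        next
          case False
          show ?thesis
          proof (cases "ln (real p) > l + ln 2 - h")
            case True
            then have "exp (ln (real p)) > exp (l + ln 2 - h)" by simp
            then have "p \<in> B" using p pp by (simp add: B_def P_def exp_add exp_diff exp_minus xl divide_inverse mult.commute)
            then show ?thesis by simp
          qed (use False p in \<open>auto simp: I_def\<close>)
        qed
      qed
      have e1: "exp h \<le> 1 + 2 * h" using exp_bound[of h] h mult_right_mono[of h 1 h] unfolding power2_eq_square by linarith
      have e2: "exp (-h) \<ge> 1 - h" using exp_ge_add_one_self[of "-h"] by simp
      have fA: "finite A" "finite B"
      proof -
        show "finite A" unfolding A_def by (rule finite_subset[of _ "{..nat \<lfloor>x * exp h\<rfloor>}"]) (auto simp: le_nat_floor)
        show "finite B" unfolding B_def by (rule finite_subset[of _ "{..nat \<lfloor>2 * x\<rfloor>}"]) (auto simp: le_nat_floor)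
      qed
      have "real (card A) \<le> x * exp h - x + 1" unfolding A_def using x1 h by (intro card_real_interval_le) auto
      also have "\<dots> \<le> 2 * h * x + 1" using mult_left_mono[OF e1, of x] x1 by (simp add: algebra_simps)
      finally have cA: "real (card A) \<le> 2 * h * x + 1" .
      have "real (card B) \<le> 2 * x - 2 * x * exp (-h) + 1" unfolding B_def using x1 h by (intro card_real_interval_le) auto
      also have "\<dots> \<le> 2 * h * x + 1" using mult_left_mono[OF e2, of "2 * x"] x1 by (simp add: algebra_simps)
      finally have cB: "real (card B) \<le> 2 * h * x + 1" .
      have "card P \<le> card (I \<union> (A \<union> B))" using finI fA by (intro card_mono sub) auto
      also have "\<dots> \<le> card I + (card A + card B)" by (meson card_Un_le add_left_mono order_trans)
      finally have "real (card P) \<le> real (card I) + 4 * h * x + 2" using cA cB by linarith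
      moreover have "real (card P) \<ge> x / (4 * l)" using elim(2) unfolding P_def l_def .
      moreover have "exp l / (4 * l) - 4 * exp l / l\<^sup>2 - 2 \<ge> exp l / (8 * l)" using nums by blast
      ultimately show ?thesis unfolding xl h_def by (simp add: algebra_simps)
    qed
    define V where "V = {..nat \<lfloor>l ^ 4\<rfloor>}"
    have "\<exists>v\<in>V. real (card {p\<in>I. nat \<lfloor>(ln (real p) - l) / l0\<rfloor> = v}) \<ge> real (card I) / real (card V)"
    proof (rule card_fiber_ge[OF finI])
      show "(\<lambda>p. nat \<lfloor>(ln (real p) - l) / l0\<rfloor>) ` I \<subseteq> V"
      proof (rule image_subsetI)
        fix p assume "p \<in> I"
        then have "ln (real p) - l \<le> 1" using h ln_2_less_1 by (auto simp: I_def)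
        then have "(ln (real p) - l) / l0 \<le> l ^ 4" unfolding l0_def using l4 by (simp add: mult_left_le)
        then show "nat \<lfloor>(ln (real p) - l) / l0\<rfloor> \<in> V" unfolding V_def by (simp add: nat_mono floor_mono)
      qed
    qed (auto simp: V_def)
    then obtain v where v: "real (card {p\<in>I. nat \<lfloor>(ln (real p) - l) / l0\<rfloor> = v}) \<ge> real (card I) / real (card V)" by blast
    define S where "S = {p\<in>I. nat \<lfloor>(ln (real p) - l) / l0\<rfloor> = v}"
    have cardS: "real (card S) \<ge> x / (8 * l * (l ^ 4 + 1))"
    proof -
      have "real (card V) \<le> l ^ 4 + 1" using l4 unfolding V_def by (simp add: of_nat_nat)
      moreover have "card V > 0" unfolding V_def by (simp only: card_atMost zero_less_Suc)
      then have "real (card V) > 0" by (simp only: of_nat_0_less_iff)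
      ultimately have "x / (8 * l) / (l ^ 4 + 1) \<le> real (card I) / real (card V)"
        using cardI x1 l4 by (intro frac_le) auto
      then show ?thesis using v unfolding S_def by (simp add: mult.assoc)
    qed
    have Spos: "x / (8 * l * (l ^ 4 + 1)) > 0" using x1 l4 by (intro divide_pos_pos mult_pos_pos add_pos_pos) auto
    then have "card S > 0" using cardS by linarith
    then obtain p0 where p0: "p0 \<in> S" by (metis card_gt_0_iff ex_in_conv)
    define u0 where "u0 = ln (real p0)"
    have u0: "l + h \<le> u0" "u0 \<le> l + ln 2 - h" using p0 by (auto simp: S_def I_def u0_def)
    have u0l: "l \<le> u0" "u0 \<le> 2 * l" using u0 h l4 ln_2_less_1 by linarith+
    have u0p: "u0 > 0" using u0l l4 by linarith
    have Sclose: "\<bar>ln (real p) - u0\<bar> \<le> l0" if "p \<in> S" for p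
    proof -
      have nn: "(ln (real p) - l) / l0 \<ge> 0" "(u0 - l) / l0 \<ge> 0" using that u0 h l0 by (auto simp: S_def I_def)
      have "nat \<lfloor>(ln (real p) - l) / l0\<rfloor> = nat \<lfloor>(u0 - l) / l0\<rfloor>" using that p0 by (auto simp: S_def u0_def)
      then have "\<bar>(ln (real p) - l) / l0 - (u0 - l) / l0\<bar> \<le> 1" using nn by linarith
      moreover have "(ln (real p) - l) / l0 - (u0 - l) / l0 = (ln (real p) - u0) / l0" by (simp add: diff_divide_distrib)
      ultimately show ?thesis using l0 by (simp add: abs_divide)
    qed
    \<comment> \<open>The size l^10 balances two demands. Within a cell \<tau> is at most l^(-5), so
      k \<tau>^2 stays bounded. At distance h = l^(-2) from the peak the loss in the exponent is of
      order k h^2 / u0^2, that is l^4.\<close>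
    define k where "k = nat \<lceil>l ^ 10\<rceil>"
    have l10: "l ^ 10 \<ge> 1" using l4 by (intro one_le_power) auto
    have k: "l ^ 10 \<le> real k" "real k \<le> 2 * l ^ 10" "k \<ge> 1" using l10 unfolding k_def by linarith+
    define \<sigma> where "\<sigma> = 1 + real k / u0"
    define \<Phi> where "\<Phi> = (u0 / exp 1) ^ k"
    have \<Phi>: "\<Phi> > 0" using u0p by (simp add: \<Phi>_def)
    define w0 where "w0 m = ln (real m) ^ k * real m powr (-\<sigma>)" for m
    define \<tau> where "\<tau> m = (ln (real m) - u0) / u0" for m :: nat
    have w0: "w0 m = \<Phi> * exp (real k * (ln (1 + \<tau> m) - \<tau> m)) / real m" if "m \<ge> 2" for m
      unfolding w0_def \<sigma>_def \<Phi>_def \<tau>_def by (rule gamma_weight[OF that u0p])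
    have \<tau>1: "\<tau> m > -1" if "m \<ge> 2" for m
    proof -
      have "1 + \<tau> m = ln (real m) / u0" using u0p by (simp add: \<tau>_def field_simps)
      also have "\<dots> > 0" using that u0p by simp
      finally show ?thesis by simp
    qed
    have w0nn: "w0 m \<ge> 0" for m
    proof (cases "m = 0")
      case False
      then show ?thesis by (simp add: w0_def)
    qed (simp add: w0_def)
    have w0le: "w0 m \<le> \<Phi> / real m" if "m \<ge> 2" for m
    proof -
      have "ln (1 + \<tau> m) - \<tau> m \<le> 0" using ln_le_minus_one[of "1 + \<tau> m"] \<tau>1[OF that] by simp
      then have "exp (real k * (ln (1 + \<tau> m) - \<tau> m)) \<le> 1" by (simp add: mult_nonneg_nonpos)
      then show ?thesis unfolding w0[OF that] using \<Phi> by (intro divide_right_mono) (auto simp: mult_left_le)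
    qed
    \<comment> \<open>Collects 8 l (l^4 + 1) from \<open>cardS\<close>, 2 from p <= 2 x, and e^4
      from the decay of the weight within the cell.\<close>
    define D where "D = 16 * l * (l ^ 4 + 1) * exp 4"
    have D: "D > 0" unfolding D_def using l4 by (intro mult_pos_pos add_pos_pos) auto
    define W where "W = (\<Sum>p\<in>P. w0 p)"
    have W: "W \<ge> \<Phi> / D"
    proof -
      have "\<Phi> * exp (-4) / (2 * x) \<le> w0 p" if p: "p \<in> S" for p
      proof -
        have pP: "x < real p" "real p \<le> 2 * x" "p \<ge> 2" using p prime_ge_2_nat by (auto simp: S_def I_def P_def)
        have "\<bar>\<tau> p\<bar> \<le> l0 / l" unfolding \<tau>_def abs_divide using Sclose[OF p] u0l u0p l4 by (intro frac_le) auto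
        also have "l0 / l = 1 / l ^ 5" unfolding l0_def by (simp add: eval_nat_numeral)
        finally have t5: "\<bar>\<tau> p\<bar> \<le> 1 / l ^ 5" .
        have "l ^ 5 \<ge> 4 ^ 5" using l4 by (intro power_mono) auto
        then have "1 / l ^ 5 \<le> 1 / 2" using l4 by (intro divide_left_mono) auto
        then have "\<bar>ln (1 + \<tau> p) - \<tau> p\<bar> \<le> 2 * (\<tau> p)\<^sup>2" using t5 by (intro abs_ln_one_plus_x_minus_x_bound) linarith
        moreover have "(\<tau> p)\<^sup>2 \<le> (1 / l ^ 5)\<^sup>2" using t5 by (metis abs_ge_zero power2_abs power_mono)
        ultimately have "- (2 * (1 / l ^ 5)\<^sup>2) \<le> ln (1 + \<tau> p) - \<tau> p" by linarith
        then have "real k * - (2 * (1 / l ^ 5)\<^sup>2) \<le> real k * (ln (1 + \<tau> p) - \<tau> p)" by (intro mult_left_mono) auto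
        moreover have "real k * (2 * (1 / l ^ 5)\<^sup>2) \<le> 4"
        proof -
          have "real k * (2 * (1 / l ^ 5)\<^sup>2) \<le> (2 * l ^ 10) * (2 * (1 / l ^ 5)\<^sup>2)" using k by (intro mult_right_mono) auto
          also have "\<dots> = 4" using l4 by (simp add: power_divide flip: power_mult)
          finally show ?thesis .
        qed
        ultimately have "-4 \<le> real k * (ln (1 + \<tau> p) - \<tau> p)" by linarith
        then show ?thesis unfolding w0[OF pP(3)] using pP x1 \<Phi> by (intro frac_le mult_left_mono) auto
      qed
      then have "real (card S) * (\<Phi> * exp (-4) / (2 * x)) \<le> (\<Sum>p\<in>S. w0 p)" by (intro sum_bounded_below) auto
      also have "\<dots> \<le> W" unfolding W_def using finP w0nn by (intro sum_mono2) (auto simp: S_def I_def)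
      finally have "real (card S) * (\<Phi> * exp (-4) / (2 * x)) \<le> W" .
      moreover have "x / (8 * l * (l ^ 4 + 1)) * (\<Phi> * exp (-4) / (2 * x)) \<le> real (card S) * (\<Phi> * exp (-4) / (2 * x))"
        using cardS \<Phi> x1 by (intro mult_right_mono) auto
      moreover have "x / (8 * l * (l ^ 4 + 1)) * (\<Phi> * exp (-4) / (2 * x)) = \<Phi> / D"
        unfolding D_def using x1 by (simp add: exp_minus field_simps)
      ultimately show ?thesis by linarith
    qed
    have Wpos: "W > 0" using W \<Phi> D by (meson divide_pos_pos less_le_trans)
    have bound: "\<bar>\<Sum>p\<in>P. w0 p * of_int (kronecker (int p) n)\<bar> \<le> W * x powr (-1/2 + \<epsilon>)"
      if n: "odd n" "\<not> is_square n" "real n \<le> x ^ 3" for n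
    proof -
      interpret rc: real_char n "\<lambda>m. of_int (kronecker (int m) n)" by (rule real_char_kronecker[OF n(1,2)])
      let ?c = "\<lambda>m. of_int (kronecker (int m) n) :: real"
      have cle: "\<bar>?c m\<bar> \<le> 1" for m using rc.vals[of m] by auto
      define t where "t m = kap m * ?c m * ln (real m) ^ k * real m powr (-\<sigma>)" for m
      have t_w0: "t m = kap m * ?c m * w0 m" for m by (simp add: t_def w0_def)
      have tle: "\<bar>t m\<bar> \<le> w0 m" for m
      proof -
        have "\<bar>kap m * ?c m\<bar> \<le> 1 * 1" unfolding abs_mult using kap_nonneg[of m] kap_le_1[of m] cle[of m] by (intro mult_mono) auto
        then have "\<bar>kap m * ?c m\<bar> * w0 m \<le> 1 * w0 m" using w0nn[of m] by (intro mult_right_mono) auto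
        then show ?thesis unfolding t_w0 abs_mult using w0nn[of m] by simp
      qed
      \<comment> \<open>Half of \<epsilon> goes to Borel-Caratheodory, the other half pays for the
        powers of l.\<close>
      define \<epsilon>1 where "\<epsilon>1 = \<epsilon> / 2"
      have \<epsilon>1: "0 < \<epsilon>1" "\<epsilon>1 < 1/2" using \<epsilon> by (auto simp: \<epsilon>1_def)
      have l9: "l ^ 9 \<ge> 4 ^ 9" using l4 by (intro power_mono) auto
      have l19: "l \<le> l ^ 9" using l4 power_increasing[of 1 9 l] by simp
      have \<sigma>_low: "\<sigma> - 1 \<ge> l ^ 9 / 2"
      proof -
        have "l ^ 10 / (2 * l) \<le> real k / u0" using k u0l u0p by (intro frac_le) auto
        moreover have "l ^ 10 / (2 * l) = l ^ 9 / 2" using l4 by (simp add: eval_nat_numeral)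
        ultimately show ?thesis by (simp add: \<sigma>_def)
      qed
      have \<sigma>_up: "\<sigma> \<le> 3 * l ^ 9"
      proof -
        have "real k / u0 \<le> (2 * l ^ 10) / l" using k u0l l4 by (intro frac_le) auto
        moreover have "(2 * l ^ 10) / l = 2 * l ^ 9" using l4 by (simp add: eval_nat_numeral)
        ultimately show ?thesis using l9 by (simp add: \<sigma>_def)
      qed
      have \<sigma>3: "\<sigma> \<ge> 3" using \<sigma>_low l9 by simp
      define K where "K = 4 * \<sigma> / \<epsilon>1 * (ln (2 * real n * \<sigma> * Z) + Z + 1)"
      have n1: "real n \<ge> 1" using rc.q by simp
      have Kle: "K \<le> l * l ^ 9 * l\<^sup>2"
      proof -
        have "ln (2 * real n * \<sigma> * Z) = ln 2 + ln (real n) + ln \<sigma> + ln Z"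
          using n1 \<sigma>3 Z1 by (simp add: ln_mult)
        moreover have "ln (real n) \<le> 3 * l"
        proof -
          have "ln (real n) \<le> ln (x ^ 3)" using n(3) n1 by (intro ln_mono) auto
          then show ?thesis using x1 by (simp add: ln_realpow l_def)
        qed
        moreover have "ln \<sigma> \<le> ln (3 * l ^ 9)" using \<sigma>_up \<sigma>3 by (intro ln_mono) auto
        moreover have "l \<ge> ln 2 + ln Z + Z + 1" "ln (3 * l ^ 9) + 4 * l \<le> l\<^sup>2" using nums by blast+
        ultimately have 1: "ln (2 * real n * \<sigma> * Z) + Z + 1 \<le> l\<^sup>2" by linarith
        have "24 / \<epsilon> \<le> l" using nums by blast
        then have "24 / \<epsilon> * l ^ 9 \<le> l * l ^ 9" using l4 by (intro mult_right_mono) auto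
        moreover have "4 * \<sigma> / \<epsilon>1 \<le> 24 / \<epsilon> * l ^ 9" using \<sigma>_up \<epsilon> by (simp add: \<epsilon>1_def field_simps)
        ultimately have 2: "4 * \<sigma> / \<epsilon>1 \<le> l * l ^ 9" by linarith
        have "K \<le> 4 * \<sigma> / \<epsilon>1 * l\<^sup>2" unfolding K_def using 1 \<sigma>3 \<epsilon>1 by (intro mult_left_mono) auto
        also have "\<dots> \<le> l * l ^ 9 * l\<^sup>2" using 2 by (intro mult_right_mono) auto
        finally show ?thesis .
      qed
      have full: "\<bar>\<Sum>m. t m\<bar> \<le> fact k * K / (\<sigma> - 1/2 - \<epsilon>1) ^ k"
        unfolding t_def K_def Z_def by (rule rc.GRH_log_coefficient_bound[OF \<open>GRH\<close> \<sigma>3 k(3) \<epsilon>1])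
      define B where "B = exp 1 * (2 * l ^ 10) * (l * l ^ 9 * l\<^sup>2) * exp 1"
      have fullE: "\<bar>\<Sum>m. t m\<bar> \<le> \<Phi> * (B * exp (- (1/2 - \<epsilon>1) * l))"
      proof -
        define s where "s = \<sigma> - 1/2 - \<epsilon>1"
        have s: "s > 0" using \<sigma>3 \<epsilon>1 by (simp add: s_def)
        define \<rho> where "\<rho> = (\<sigma> - 1) / s"
        have ku: "real k = (\<sigma> - 1) * u0" using u0p by (simp add: \<sigma>_def)
        \<comment> \<open>Since k = (\<sigma> - 1) u0, the k-th power of the quotient of the two
          radii is about exp(-(1/2 - \<epsilon>1) u0), and hence of size x^(-1/2 +
          \<epsilon>1).\<close>
        have \<rho>k: "\<rho> ^ k \<le> exp (- (1/2 - \<epsilon>1) * (l - 1))"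
        proof -
          have \<rho>0: "\<rho> \<ge> 0" using \<sigma>3 s by (simp add: \<rho>_def)
          have "\<rho> \<le> exp (\<rho> - 1)" using exp_ge_add_one_self[of "\<rho> - 1"] by simp
          then have "\<rho> ^ k \<le> exp (\<rho> - 1) ^ k" using \<rho>0 by (intro power_mono) auto
          also have "\<dots> = exp (real k * (\<rho> - 1))" by (simp add: exp_of_nat_mult)
          also have "\<dots> \<le> exp (- (1/2 - \<epsilon>1) * (l - 1))"
          proof -
            have "\<rho> - 1 = - (1/2 - \<epsilon>1) / s" using s by (simp add: \<rho>_def s_def field_simps)
            then have "real k * (\<rho> - 1) = - (1/2 - \<epsilon>1) * (real k / s)" by simp
            moreover have "(l - 1) * s \<le> real k"
            proof -
              have "(l - 1) * s \<le> (l - 1) * (\<sigma> - 1/2)" using l4 \<epsilon>1 by (intro mult_left_mono) (auto simp: s_def)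
              also have "\<dots> = (\<sigma> - 1) * l + (l / 2 - (\<sigma> - 1/2))" by (simp add: field_simps)
              also have "\<dots> \<le> (\<sigma> - 1) * l" using \<sigma>_low l19 by linarith
              also have "\<dots> \<le> (\<sigma> - 1) * u0" using u0l \<sigma>3 by (intro mult_left_mono) auto
              finally show ?thesis by (simp add: ku)
            qed
            then have "l - 1 \<le> real k / s" using s by (simp add: pos_le_divide_eq)
            then have "(1/2 - \<epsilon>1) * (l - 1) \<le> (1/2 - \<epsilon>1) * (real k / s)" using \<epsilon>1 by (intro mult_left_mono) auto
            ultimately have "real k * (\<rho> - 1) \<le> - (1/2 - \<epsilon>1) * (l - 1)"
              unfolding mult_minus_left by linarith
            then show ?thesis by simp
          qed
          finally show ?thesis .
        qed
        have "fact k * K / s ^ k \<le> fact k * (l * l ^ 9 * l\<^sup>2) / s ^ k"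
          using Kle s by (intro divide_right_mono mult_left_mono) auto
        also have "\<dots> \<le> (exp 1 * real k * (real k / exp 1) ^ k) * (l * l ^ 9 * l\<^sup>2) / s ^ k"
          using fact_le_stirling[OF k(3)] s l4 by (intro divide_right_mono mult_right_mono) auto
        also have "\<dots> = \<Phi> * (exp 1 * real k * (l * l ^ 9 * l\<^sup>2) * \<rho> ^ k)"
          unfolding \<Phi>_def \<rho>_def ku by (simp add: power_divide power_mult_distrib)
        also have "\<dots> \<le> \<Phi> * (exp 1 * (2 * l ^ 10) * (l * l ^ 9 * l\<^sup>2) * (exp 1 * exp (- (1/2 - \<epsilon>1) * l)))"
        proof -
          have "exp (- (1/2 - \<epsilon>1) * (l - 1)) \<le> exp 1 * exp (- (1/2 - \<epsilon>1) * l)"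
            using \<epsilon>1 unfolding exp_add[symmetric] by (simp add: field_simps)
          then have "\<rho> ^ k \<le> exp 1 * exp (- (1/2 - \<epsilon>1) * l)" using \<rho>k by linarith
          moreover have "\<rho> ^ k \<ge> 0" using \<sigma>3 s by (simp add: \<rho>_def)
          ultimately show ?thesis using k \<Phi> l4 by (intro mult_left_mono mult_mono) auto
        qed
        finally show ?thesis using full unfolding s_def B_def by (simp add: mult.assoc)
      qed
      define Win where "Win = {m::nat. x < real m \<and> real m \<le> 2 * x}"
      define C2 where "C2 = \<Phi> * exp (1 - l ^ 4 / 32) * (2 * x)"
      have tail: "\<bar>t m\<bar> \<le> C2 * real m powr (-2)" if m: "m \<notin> Win" for m
      proof (cases "m \<ge> 2")
        case True
        define d where "d = \<bar>ln (real m) - u0\<bar>"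
        have dh: "d \<ge> h"
        proof (cases "real m \<le> x")
          case True
          then have "ln (real m) \<le> l" using \<open>m \<ge> 2\<close> unfolding l_def by (intro ln_mono) auto
          then show ?thesis using u0 by (simp add: d_def)
        next
          case False
          then have "real m \<ge> 2 * x" using m by (simp add: Win_def)
          then have "ln (2 * x) \<le> ln (real m)" using x1 by (intro ln_mono) auto
          then have "l + ln 2 \<le> ln (real m)" using x1 by (simp add: ln_mult l_def)
          then show ?thesis using u0 by (simp add: d_def)
        qed
        define \<beta> where "\<beta> = real k * h / (8 * u0\<^sup>2)"
        have \<beta>: "\<beta> \<ge> l ^ 6 / 32"
        proof -
          have "u0\<^sup>2 \<le> (2 * l)\<^sup>2" using u0l u0p by (intro power_mono) auto
          then have "l ^ 10 * h / (8 * (2 * l)\<^sup>2) \<le> \<beta>"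
            unfolding \<beta>_def using k h u0p by (intro frac_le mult_right_mono) auto
          moreover have "l ^ 10 * h / (8 * (2 * l)\<^sup>2) = l ^ 6 / 32" using l4 by (simp add: h_def eval_nat_numeral)
          ultimately show ?thesis by simp
        qed
        have l6: "l ^ 6 \<ge> 4 ^ 6" using l4 by (intro power_mono) auto
        have "ln (1 + \<tau> m) - \<tau> m \<le> - (h / u0) * \<bar>\<tau> m\<bar> / 8"
        proof (rule ln_one_plus_upper[OF \<tau>1[OF True]])
          show "0 < h / u0" "h / u0 \<le> 1" using h u0p u0l l4 by auto
          show "h / u0 \<le> \<bar>\<tau> m\<bar>" using dh u0p by (simp add: \<tau>_def abs_divide d_def divide_right_mono)
        qed
        then have "real k * (ln (1 + \<tau> m) - \<tau> m) \<le> real k * (- (h / u0) * \<bar>\<tau> m\<bar> / 8)" by (intro mult_left_mono) auto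
        also have "\<dots> = - \<beta> * d" using u0p by (simp add: \<beta>_def \<tau>_def d_def abs_divide power2_eq_square)
        \<comment> \<open>One copy of d is split off: exp(-d) <= exp u0 / m supplies a second power
          of 1/m and makes the tail summable. The rest of the exponent yields exp(1 -
          l^4/32).\<close>
        also have "\<dots> \<le> - (l ^ 6 / 32 - 1) * h - d"
        proof -
          have "(l ^ 6 / 32 - 1) * h \<le> (\<beta> - 1) * d" using \<beta> dh h l6 by (intro mult_mono) auto
          then show ?thesis by (simp add: algebra_simps)
        qed
        also have "\<dots> \<le> 1 - l ^ 4 / 32 + (u0 - ln (real m))"
        proof -
          have "l ^ 6 / 32 * h = l ^ 4 / 32" using l4 by (simp add: h_def eval_nat_numeral)
          moreover have "- d \<le> u0 - ln (real m)" by (simp add: d_def)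
          ultimately show ?thesis using h by (simp add: algebra_simps)
        qed
        finally have "exp (real k * (ln (1 + \<tau> m) - \<tau> m)) \<le> exp (1 - l ^ 4 / 32 + (u0 - ln (real m)))" by simp
        also have "\<dots> = exp (1 - l ^ 4 / 32) * (exp u0 / real m)" using True by (simp add: exp_add exp_diff)
        also have "\<dots> \<le> exp (1 - l ^ 4 / 32) * ((2 * x) / real m)"
        proof -
          have "exp u0 \<le> exp (l + ln 2)" using u0 h by simp
          also have "\<dots> = 2 * x" by (simp add: exp_add xl)
          finally show ?thesis by (intro mult_left_mono divide_right_mono) auto
        qed
        finally have ex: "exp (real k * (ln (1 + \<tau> m) - \<tau> m)) \<le> exp (1 - l ^ 4 / 32) * ((2 * x) / real m)" .
        have "\<bar>t m\<bar> \<le> w0 m" by (rule tle)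
        also have "\<dots> \<le> \<Phi> * (exp (1 - l ^ 4 / 32) * ((2 * x) / real m)) / real m"
          unfolding w0[OF True] using ex \<Phi> by (intro divide_right_mono mult_left_mono) auto
        also have "\<dots> = C2 * real m powr (-2)"
        proof -
          have "real m powr (-2) = 1 / (real m * real m)"
            using True by (simp add: powr_minus_divide power2_eq_square)
          then show ?thesis by (simp add: C2_def)
        qed
        finally show ?thesis .
      next
        case False
        then have "m = 0 \<or> m = 1" by auto
        then have "t m = 0" by (auto simp: t_def kap_def)
        then show ?thesis using \<Phi> x1 by (simp add: C2_def)
      qed
      have sumt: "summable t"
      proof (rule summable_comparison_test'[OF kap_ln_power_summable[of \<sigma> k], of 0])
        show "norm (t m) \<le> kap m * ln (real m) ^ k * real m powr (-\<sigma>)" if "m \<ge> 0" for m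
        proof (cases "m = 0")
          case False
          then have "ln (real m) \<ge> 0" by simp
          then have "\<bar>t m\<bar> = kap m * \<bar>?c m\<bar> * ln (real m) ^ k * real m powr (-\<sigma>)"
            using kap_nonneg[of m] by (simp add: t_def abs_mult)
          also have "\<dots> \<le> kap m * 1 * ln (real m) ^ k * real m powr (-\<sigma>)"
            using kap_nonneg[of m] cle[of m] \<open>ln (real m) \<ge> 0\<close> by (intro mult_right_mono mult_left_mono) auto
          finally show ?thesis by simp
        qed (simp add: t_def kap_def)
      qed (use \<sigma>3 in auto)
      have finWin: "finite Win" unfolding Win_def by (rule finW)
      have s1: "(\<lambda>m. if m \<in> Win then t m else 0) sums (\<Sum>m\<in>Win. t m)"
        using sums_If_finite_set[OF finWin, of t] .
      have s2: "(\<lambda>m. t m - (if m \<in> Win then t m else 0)) sums ((\<Sum>m. t m) - (\<Sum>m\<in>Win. t m))"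
        by (intro sums_diff summable_sums sumt s1)
      have "norm (\<Sum>m. t m - (if m \<in> Win then t m else 0)) \<le> (\<Sum>m. C2 * real m powr (-2))"
      proof (rule norm_suminf_le)
        show "norm (t m - (if m \<in> Win then t m else 0)) \<le> C2 * real m powr (-2)" for m
          using tail[of m] \<Phi> x1 by (auto simp: C2_def)
      qed (intro summable_mult smZ2)
      also have "\<dots> = C2 * Z2" unfolding Z2_def by (intro suminf_mult smZ2)
      also have "\<dots> \<le> C2 * l" using nums \<Phi> x1 by (intro mult_left_mono) (auto simp: C2_def)
      finally have tail_total: "\<bar>(\<Sum>m. t m) - (\<Sum>m\<in>Win. t m)\<bar> \<le> C2 * l"
        using sums_unique[OF s2] by simp
      \<comment> \<open>The sum over m contains the proper prime powers; only about sqrt x times ln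
        x of them lie in the window.\<close>
      define Q where "Q = {m\<in>Win. primepow m \<and> \<not> prime m}"
      have PW: "P = {m\<in>Win. prime m}" by (auto simp: P_def Win_def)
      have "(\<Sum>m\<in>Win. t m) = (\<Sum>m\<in>P \<union> Q. t m)"
      proof (rule sum.mono_neutral_right[OF finWin])
        show "P \<union> Q \<subseteq> Win" by (auto simp: PW Q_def)
        show "\<forall>m\<in>Win - (P \<union> Q). t m = 0"
          by (auto simp: PW Q_def t_def kap_def mangoldt_def)
      qed
      also have "\<dots> = (\<Sum>m\<in>P. t m) + (\<Sum>m\<in>Q. t m)"
        using finP finWin by (intro sum.union_disjoint) (auto simp: PW Q_def)
      also have "(\<Sum>m\<in>P. t m) = (\<Sum>p\<in>P. w0 p * ?c p)"
        by (intro sum.cong refl) (auto simp: t_w0 kap_prime P_def)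
      finally have split: "(\<Sum>m\<in>Win. t m) = (\<Sum>p\<in>P. w0 p * ?c p) + (\<Sum>m\<in>Q. t m)" .
      have Qb: "\<bar>\<Sum>m\<in>Q. t m\<bar> \<le> \<Phi> * (sqrt 2 * (l + 1) / ln 2 * exp (- l / 2))"
      proof -
        define N where "N = nat \<lfloor>2 * x\<rfloor>"
        have N: "real N \<le> 2 * x" "N \<ge> 2" using x1 unfolding N_def by linarith+
        have "Q \<subseteq> {d. d \<le> N \<and> primepow d \<and> \<not> prime d}" by (auto simp: Q_def Win_def N_def le_nat_floor)
        then have "card Q \<le> card {d. d \<le> N \<and> primepow d \<and> \<not> prime d}" by (intro card_mono) auto
        then have "real (card Q) \<le> sqrt (real N) * (ln (real N) / ln 2)"
          using card_nonprime_primepow[OF N(2)] by linarith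
        also have "\<dots> \<le> sqrt (2 * x) * (ln (2 * x) / ln 2)"
          using N by (intro mult_mono divide_right_mono ln_mono) auto
        also have "ln (2 * x) = l + ln 2" using x1 by (simp add: ln_mult l_def)
        also have "sqrt (2 * x) * ((l + ln 2) / ln 2) \<le> sqrt (2 * x) * ((l + 1) / ln 2)"
          using ln_2_less_1 x1 by (intro mult_left_mono divide_right_mono) auto
        finally have cQ: "real (card Q) \<le> sqrt (2 * x) * ((l + 1) / ln 2)" .
        have "\<bar>\<Sum>m\<in>Q. t m\<bar> \<le> (\<Sum>m\<in>Q. \<bar>t m\<bar>)" by (rule sum_abs)
        also have "\<dots> \<le> real (card Q) * (\<Phi> / x)"
        proof (rule sum_bounded_above)
          fix m assume m: "m \<in> Q"
          then have xm: "x < real m" by (simp add: Q_def Win_def)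
          then have "m \<ge> 2" using x1 by linarith
          have "\<bar>t m\<bar> \<le> \<Phi> / real m" using tle[of m] w0le[OF \<open>m \<ge> 2\<close>] by linarith
          also have "\<dots> \<le> \<Phi> / x" using xm x1 \<Phi> by (intro divide_left_mono) auto
          finally show "\<bar>t m\<bar> \<le> \<Phi> / x" .
        qed
        also have "\<dots> \<le> (sqrt (2 * x) * ((l + 1) / ln 2)) * (\<Phi> / x)" using cQ \<Phi> x1 by (intro mult_right_mono) auto
        also have "\<dots> = \<Phi> * (sqrt 2 * (l + 1) / ln 2 * (sqrt x / x))" by (simp add: real_sqrt_mult)
        also have "sqrt x / x = exp (- l / 2)"
        proof -
          have "sqrt x = exp (l / 2)" using x1 xl by (metis exp_half_le2 exp_ge_zero real_sqrt_unique exp_double power2_eq_square mult_2 field_sum_of_halves exp_add)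
          then show ?thesis by (simp add: xl[symmetric] exp_diff[symmetric])
        qed
        finally show ?thesis .
      qed
      have xe: "x powr (-1/2 + \<epsilon>) = exp ((-1/2 + \<epsilon>) * l)" using x1 by (simp add: powr_def l_def)
      \<comment> \<open>A third of the target, one for each error: the full sum, the tail and the
        prime powers.\<close>
      define G where "G = \<Phi> / D * (1/3 * exp ((-1/2 + \<epsilon>) * l))"
      have T1: "\<Phi> * (B * exp (- (1/2 - \<epsilon>1) * l)) \<le> G"
      proof -
        have "D * B \<le> 1 / 3 * exp (\<epsilon> / 2 * l)" using nums unfolding D_def B_def by blast
        then have "D * B * exp (- (1/2 - \<epsilon>1) * l) \<le> 1 / 3 * exp (\<epsilon> / 2 * l) * exp (- (1/2 - \<epsilon>1) * l)" by (intro mult_right_mono) auto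
        also have "\<dots> = 1 / 3 * exp ((-1/2 + \<epsilon>) * l)" by (simp add: \<epsilon>1_def algebra_simps flip: exp_add)
        finally have "\<Phi> / D * (D * B * exp (- (1/2 - \<epsilon>1) * l)) \<le> G" unfolding G_def using \<Phi> D by (intro mult_left_mono) auto
        then show ?thesis using D by simp
      qed
      have T2: "C2 * l \<le> G"
      proof -
        have "D * (2 * exp l * exp (1 - l ^ 4 / 32) * l) \<le> 1 / 3 * exp (- l)" using nums unfolding D_def by blast
        also have "\<dots> \<le> 1 / 3 * exp ((-1/2 + \<epsilon>) * l)" proof -
          have "0 \<le> \<epsilon> * l" using \<epsilon> l4 by simp
          then show ?thesis using l4 by (simp add: algebra_simps)
        qed
        finally have "\<Phi> / D * (D * (2 * exp l * exp (1 - l ^ 4 / 32) * l)) \<le> G" unfolding G_def using \<Phi> D by (intro mult_left_mono) auto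
        then show ?thesis using D by (simp add: C2_def xl mult_ac)
      qed
      have T3: "\<Phi> * (sqrt 2 * (l + 1) / ln 2 * exp (- l / 2)) \<le> G"
      proof -
        have "D * (sqrt 2 * (l + 1) / ln 2) \<le> 1 / 3 * exp (\<epsilon> * l)" using nums unfolding D_def by blast
        then have "D * (sqrt 2 * (l + 1) / ln 2) * exp (- l / 2) \<le> 1 / 3 * exp (\<epsilon> * l) * exp (- l / 2)" by (intro mult_right_mono) auto
        also have "\<dots> = 1 / 3 * exp ((-1/2 + \<epsilon>) * l)" by (simp add: algebra_simps flip: exp_add)
        finally have "\<Phi> / D * (D * (sqrt 2 * (l + 1) / ln 2) * exp (- l / 2)) \<le> G" unfolding G_def using \<Phi> D by (intro mult_left_mono) auto
        then show ?thesis using D by simp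
      qed
      have "\<bar>\<Sum>p\<in>P. w0 p * ?c p\<bar> \<le> 3 * G" using split tail_total fullE Qb T1 T2 T3 by linarith
      also have "3 * G = \<Phi> / D * x powr (-1/2 + \<epsilon>)" unfolding G_def xe by simp
      also have "\<dots> \<le> W * x powr (-1/2 + \<epsilon>)" using W by (intro mult_right_mono) auto
      finally show ?thesis .
    qed
    define w where "w p = w0 p / W" for p
    show ?case unfolding P_def[symmetric]
    proof (intro exI[of _ w] conjI allI impI)
      show "w p \<ge> 0" for p using w0nn Wpos by (simp add: w_def)
      show "(\<Sum>p\<in>P. w p) = 1" unfolding w_def sum_divide_distrib[symmetric] using Wpos by (simp add: W_def)
      fix n assume n: "odd n \<and> \<not> is_square n \<and> real n \<le> x ^ 3"
      have "(\<Sum>p\<in>P. w p * of_int (kronecker (int p) n)) = (\<Sum>p\<in>P. w0 p * of_int (kronecker (int p) n)) / W"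
        unfolding w_def by (simp add: sum_divide_distrib)
      then show "\<bar>\<Sum>p\<in>P. w p * of_int (kronecker (int p) n)\<bar> \<le> x powr (-1/2 + \<epsilon>)"
        using bound[of n] n Wpos by (simp add: abs_divide divide_le_eq mult.commute)
    qed
  qed
qed

section \<open>The resonance inequality\<close>

lemma class_F_props:
  assumes "f \<in> class_F"
  shows "\<And>m n. m > 0 \<Longrightarrow> n > 0 \<Longrightarrow> f (m * n) = f m * f n" "\<And>k. k > 0 \<Longrightarrow> cmod (f k) = 1"
    "\<And>m n. m > 0 \<Longrightarrow> n > 0 \<Longrightarrow> is_square (m * n) \<Longrightarrow> Re (f n * cnj (f m)) \<ge> 0"
  using assms unfolding class_F_def completely_multiplicative_def by auto

text \<open>The multiplicities of a prime in a and in b are at most 1 and have even sum.\<close>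

lemma squarefree_product_square_imp_eq:
  fixes a b :: nat
  assumes "squarefree a" "squarefree b" "is_square (a * b)" "a > 0" "b > 0"
  shows "a = b"
proof (rule multiplicity_eq_nat)
  show "multiplicity p a = multiplicity p b" if p: "prime p" for p
  proof -
    have "even (multiplicity p (a * b))"
      using assms(3-5) p is_nth_power_conv_multiplicity_nat[of 2 "a * b"] by auto
    moreover have "multiplicity p (a * b) = multiplicity p a + multiplicity p b"
      using p assms by (intro prime_elem_multiplicity_mult_distrib) auto
    moreover have "multiplicity p a \<le> 1" "multiplicity p b \<le> 1"
      using assms p squarefree_factorial_semiring'[of a] squarefree_factorial_semiring'[of b]
      by (auto simp: prime_factors_multiplicity not_less_eq_eq)
    ultimately show ?thesis by presburger
  qed
qed (use assms in auto)

text \<open>P holds the primes behind the discriminants, and E is the error that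
  \<open>GRH_prime_weights\<close> supplies. Primes above M and N divide no a and no n, so the
  symbol at squares is exactly 1. Q covers all arguments a n b m.\<close>

locale resonance =
  fixes P :: "nat set" and w :: "nat \<Rightarrow> real" and E Q :: real and f :: "nat \<Rightarrow> complex"
    and r :: "nat \<Rightarrow> real" and M N :: nat
  assumes finP: "finite P" and primeP: "p \<in> P \<Longrightarrow> prime p" and largeP: "p \<in> P \<Longrightarrow> p > M \<and> p > N \<and> p > 2"
    and wnn: "w p \<ge> 0" and wsum: "(\<Sum>p\<in>P. w p) = 1" and E0: "E \<ge> 0"
    and mean: "odd n \<Longrightarrow> \<not> is_square n \<Longrightarrow> real n \<le> Q \<Longrightarrow> \<bar>\<Sum>p\<in>P. w p * of_int (kronecker (int p) n)\<bar> \<le> E"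
    and f: "f \<in> class_F" and rnn: "r a \<ge> 0"
    and rsupp: "r a \<noteq> 0 \<Longrightarrow> a > 0 \<and> odd a \<and> squarefree a"
    and Q: "(real M * real N)\<^sup>2 \<le> Q" and N: "N > 0"
begin

definition h :: "nat \<Rightarrow> nat \<Rightarrow> real" where "h p n = of_int (kronecker (8 * int p) n)"

definition W :: "nat \<Rightarrow> real" where "W n = (\<Sum>p\<in>P. w p * h p n)"

lemma h_mult: "m > 0 \<Longrightarrow> n > 0 \<Longrightarrow> h p (m * n) = h p m * h p n"
  by (simp add: h_def kronecker_mult_right)

lemma h_even: "even n \<Longrightarrow> n > 0 \<Longrightarrow> h p n = 0"
  by (simp add: h_def kronecker_even)

lemma W_square:
  assumes "odd n" "\<And>p. p \<in> P \<Longrightarrow> \<not> p dvd n"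
  shows "W (n * n) = 1"
proof -
  have "n > 0" using assms by (simp add: odd_pos)
  have "h p (n * n) = 1" if p: "p \<in> P" for p
  proof -
    have "coprime p n" using primeP[OF p] assms(2)[OF p] by (simp add: prime_imp_coprime)
    then have "coprime (8 * p) n" using assms(1) coprime_power_left_iff[of 2 3 n] by simp
    then have "kronecker (int (8 * p)) n \<noteq> 0" using kronecker_nonzero_iff[OF assms(1)] by blast
    then have "h p n = 1 \<or> h p n = -1" using kronecker_values[of "8 * int p" n] by (auto simp: h_def)
    then show ?thesis using h_mult[OF \<open>n > 0\<close> \<open>n > 0\<close>, of p] by auto
  qed
  then show ?thesis using wsum by (simp add: W_def)
qed

lemma W_nonsquare:
  assumes "odd n" "\<not> is_square n" "real n \<le> Q"
  shows "\<bar>W n\<bar> \<le> E"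
proof -
  have "W n = of_int (kronecker 8 n) * (\<Sum>p\<in>P. w p * of_int (kronecker (int p) n))"
    unfolding W_def h_def kronecker_mult_left[OF assms(1)] by (simp add: sum_distrib_left mult_ac)
  moreover have "\<bar>real_of_int (kronecker 8 n)\<bar> \<le> 1" using kronecker_values[of 8 n] by auto
  ultimately show ?thesis using mean[OF assms] mult_mono[of "\<bar>real_of_int (kronecker 8 n)\<bar>" 1 "\<bar>\<Sum>p\<in>P. w p * of_int (kronecker (int p) n)\<bar>" E]
    by (simp add: abs_mult)
qed

lemma second_moment:
  fixes c :: "'i \<Rightarrow> complex" and k :: "'i \<Rightarrow> nat"
  assumes "finite I" "\<And>i. i \<in> I \<Longrightarrow> k i > 0"
  shows "(\<Sum>p\<in>P. w p * (cmod (\<Sum>i\<in>I. c i * of_real (h p (k i))))\<^sup>2) = (\<Sum>i\<in>I. \<Sum>j\<in>I. Re (c i * cnj (c j)) * W (k i * k j))"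
proof -
  have "(cmod (\<Sum>i\<in>I. c i * of_real (h p (k i))))\<^sup>2 = (\<Sum>i\<in>I. \<Sum>j\<in>I. Re (c i * cnj (c j)) * h p (k i * k j))" for p
  proof -
    let ?z = "\<Sum>i\<in>I. c i * of_real (h p (k i))"
    have "(cmod ?z)\<^sup>2 = Re (?z * cnj ?z)" by (metis Re_complex_of_real complex_norm_square)
    also have "?z * cnj ?z = (\<Sum>i\<in>I. \<Sum>j\<in>I. of_real (h p (k i) * h p (k j)) * (c i * cnj (c j)))"
      unfolding cnj_sum sum_product by (intro sum.cong refl) (simp add: mult_ac)
    also have "Re \<dots> = (\<Sum>i\<in>I. \<Sum>j\<in>I. Re (c i * cnj (c j)) * (h p (k i) * h p (k j)))"
      by (simp add: Re_sum mult.commute)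
    also have "\<dots> = (\<Sum>i\<in>I. \<Sum>j\<in>I. Re (c i * cnj (c j)) * h p (k i * k j))"
      using assms(2) h_mult by (intro sum.cong refl) simp
    finally show ?thesis .
  qed
  then have "(\<Sum>p\<in>P. w p * (cmod (\<Sum>i\<in>I. c i * of_real (h p (k i))))\<^sup>2) = (\<Sum>p\<in>P. \<Sum>i\<in>I. \<Sum>j\<in>I. Re (c i * cnj (c j)) * (w p * h p (k i * k j)))"
    by (simp add: sum_distrib_left mult_ac)
  also have "\<dots> = (\<Sum>i\<in>I. \<Sum>p\<in>P. \<Sum>j\<in>I. Re (c i * cnj (c j)) * (w p * h p (k i * k j)))" by (rule sum.swap)
  also have "\<dots> = (\<Sum>i\<in>I. \<Sum>j\<in>I. \<Sum>p\<in>P. Re (c i * cnj (c j)) * (w p * h p (k i * k j)))"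
    by (rule sum.cong[OF refl], rule sum.swap)
  finally show ?thesis by (simp add: W_def sum_distrib_left)
qed

definition r2 :: real where "r2 = (\<Sum>a=1..M. (r a)\<^sup>2)"

lemma sum_r_square: "(\<Sum>a=1..M. r a)\<^sup>2 \<le> real M * r2"
  using sum_square_le_card[of "{1..M}" r] by (simp add: r2_def)

lemma small_not_dvd:
  assumes "p \<in> P" "0 < a" "a \<le> M" "0 < n" "n \<le> N"
  shows "\<not> p dvd a * n"
proof
  assume "p dvd a * n"
  then have "p dvd a \<or> p dvd n" using primeP[OF assms(1)] prime_dvd_mult_iff by blast
  then have "p \<le> a \<or> p \<le> n" using assms by (auto dest: dvd_imp_le)
  then show False using largeP[OF assms(1)] assms by auto
qed

definition R :: "nat \<Rightarrow> complex" where "R p = (\<Sum>a=1..M. of_real (r a) * f a * of_real (h p a))"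

definition S :: "nat \<Rightarrow> complex" where "S p = (\<Sum>n=1..N. f n * of_real (h p n))"

text \<open>Squarefree a and b have a square product only for a = b, so the diagonal contributes
  \<open>r2\<close>. The rest is at most E times the squared sum of r, hence E M \<open>r2\<close>
  by Cauchy-Schwarz.\<close>

lemma denominator: "(\<Sum>p\<in>P. w p * (cmod (R p))\<^sup>2) \<le> (1 + E * real M) * r2"
proof -
  let ?c = "\<lambda>a. of_real (r a) * f a"
  have "(\<Sum>p\<in>P. w p * (cmod (R p))\<^sup>2) = (\<Sum>a=1..M. \<Sum>b=1..M. Re (?c a * cnj (?c b)) * W (a * b))"
    unfolding R_def by (rule second_moment) auto
  also have "\<dots> \<le> (\<Sum>a=1..M. \<Sum>b=1..M. (if a = b then (r a)\<^sup>2 else 0) + E * (r a * r b))"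
  proof (intro sum_mono)
    fix a b assume ab: "a \<in> {1..M}" "b \<in> {1..M}"
    have re: "\<bar>Re (?c a * cnj (?c b))\<bar> \<le> r a * r b"
    proof -
      have "\<bar>Re (?c a * cnj (?c b))\<bar> \<le> cmod (?c a * cnj (?c b))" by (rule abs_Re_le_cmod)
      also have "\<dots> = r a * r b" using ab rnn class_F_props(2)[OF f] by (simp add: norm_mult)
      finally show ?thesis .
    qed
    show "Re (?c a * cnj (?c b)) * W (a * b) \<le> (if a = b then (r a)\<^sup>2 else 0) + E * (r a * r b)"
    proof (cases "r a = 0 \<or> r b = 0")
      case False
      then have s: "a > 0" "odd a" "squarefree a" "b > 0" "odd b" "squarefree b" using rsupp by auto
      show ?thesis
      proof (cases "a = b")
        case True
        have "W (a * a) = 1" using s ab N small_not_dvd[of _ a 1] by (intro W_square) auto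
        then have "Re (?c a * cnj (?c b)) * W (a * b) \<le> r a * r b" using re True by simp
        also have "\<dots> \<le> (r a)\<^sup>2 + E * (r a * r b)" using True E0 rnn by (simp add: power2_eq_square)
        finally show ?thesis using True by simp
      next
        case neq: False
        then have "\<not> is_square (a * b)" using squarefree_product_square_imp_eq s by blast
        moreover have "real (a * b) \<le> Q"
        proof -
          have "real a * real b \<le> (real M * real N) * (real M * real N)"
            using ab N by (intro mult_mono) (auto intro: order_trans[OF _ mult_left_mono[of 1 "real N" "real M"], simplified])
          then show ?thesis using Q by (simp add: power2_eq_square)
        qed
        ultimately have "\<bar>W (a * b)\<bar> \<le> E" using s by (intro W_nonsquare) auto
        then have "\<bar>Re (?c a * cnj (?c b))\<bar> * \<bar>W (a * b)\<bar> \<le> r a * r b * E" using re rnn by (intro mult_mono) auto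
        then show ?thesis using neq by (simp add: abs_mult[symmetric] mult.commute abs_le_iff)
      qed
    qed (use rnn E0 in auto)
  qed
  also have "\<dots> = r2 + E * (\<Sum>a=1..M. r a)\<^sup>2"
    unfolding power2_eq_square[of "\<Sum>a=1..M. r a"] sum_product
    by (simp add: sum.distrib r2_def sum_distrib_left mult.commute)
  also have "\<dots> \<le> r2 + E * (real M * r2)" using sum_r_square E0 by (intro add_left_mono mult_left_mono)
  finally show ?thesis by (simp add: algebra_simps)
qed

definition T :: real where
  "T = (\<Sum>a=1..M. \<Sum>b=1..M. r a * r b * real (card {(m, n). m \<in> {1..N} \<and> n \<in> {1..N} \<and> odd m \<and> odd n \<and> a * n = b * m}))"

text \<open>Twisting the resonator by \<open>f\<close> makes every term with \<open>a n b m\<close> a square nonnegative, which is all that is used of \<open>class_F\<close>.\<close>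

lemma numerator: "T - E * real M * (real N)\<^sup>2 * r2 \<le> (\<Sum>p\<in>P. w p * (cmod (R p * S p))\<^sup>2)"
proof -
  \<comment> \<open>The symbol of 8 p vanishes at even n, so only odd n survive and \<open>W\<close>
    is evaluated at odd arguments, where the mean value bound holds.\<close>
  define Od where "Od = {n\<in>{1..N}. odd n}"
  define I where "I = {1..M} \<times> Od"
  have finI: "finite I" by (simp add: I_def Od_def)
  define c where "c = (\<lambda>(a, n). of_real (r a) * f a * f n)"
  define k where "k = (\<lambda>(a, n). a * n :: nat)"
  define \<rho> where "\<rho> = (\<lambda>(a, n::nat). r a)"
  have RS: "R p * S p = (\<Sum>i\<in>I. c i * of_real (h p (k i)))" for p
  proof -
    have "S p = (\<Sum>n\<in>Od. f n * of_real (h p n))"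
      unfolding S_def Od_def by (intro sum.mono_neutral_right) (auto simp: h_even)
    then have "R p * S p = (\<Sum>a=1..M. \<Sum>n\<in>Od. (of_real (r a) * f a * of_real (h p a)) * (f n * of_real (h p n)))"
      unfolding R_def by (simp only: sum_product)
    also have "\<dots> = (\<Sum>a=1..M. \<Sum>n\<in>Od. c (a, n) * of_real (h p (k (a, n))))"
      by (intro sum.cong refl) (auto simp: c_def k_def h_mult Od_def mult_ac)
    finally show ?thesis unfolding I_def by (simp add: sum.cartesian_product case_prod_unfold)
  qed
  have "(\<Sum>p\<in>P. w p * (cmod (R p * S p))\<^sup>2) = (\<Sum>i\<in>I. \<Sum>j\<in>I. Re (c i * cnj (c j)) * W (k i * k j))"
    unfolding RS by (rule second_moment[OF finI]) (auto simp: I_def Od_def k_def)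
  also have "\<dots> \<ge> (\<Sum>i\<in>I. \<Sum>j\<in>I. (if k i = k j then \<rho> i * \<rho> j else 0) - E * (\<rho> i * \<rho> j))"
  proof (intro sum_mono)
    fix i j assume ij: "i \<in> I" "j \<in> I"
    obtain a n b m where i: "i = (a, n)" and j: "j = (b, m)" by (metis surj_pair)
    have am: "a \<in> {1..M}" "b \<in> {1..M}" "n \<in> {1..N}" "m \<in> {1..N}" "odd n" "odd m" "a > 0" "b > 0" "n > 0" "m > 0"
      using ij by (auto simp: i j I_def Od_def)
    have rr: "\<rho> i * \<rho> j = r a * r b" "\<rho> i * \<rho> j \<ge> 0" using rnn by (auto simp: \<rho>_def i j)
    have cc: "c i * cnj (c j) = of_real (r a * r b) * (f (a * n) * cnj (f (b * m)))"
      using am class_F_props(1)[OF f] by (simp add: c_def i j mult_ac)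
    then have Rc: "Re (c i * cnj (c j)) = r a * r b * Re (f (a * n) * cnj (f (b * m)))" by simp
    show "(if k i = k j then \<rho> i * \<rho> j else 0) - E * (\<rho> i * \<rho> j) \<le> Re (c i * cnj (c j)) * W (k i * k j)"
    proof (cases "r a = 0 \<or> r b = 0")
      case True
      then show ?thesis unfolding rr Rc by auto
    next
      case False
      then have odds: "odd a" "odd b" using rsupp by auto
      have kk: "k i = a * n" "k j = b * m" by (auto simp: k_def i j)
      have nd: "\<not> p dvd a * n * (b * m)" if "p \<in> P" for p
        using small_not_dvd[OF that, of a n] small_not_dvd[OF that, of b m] am primeP[OF that] by (auto simp: prime_dvd_mult_iff)
      show ?thesis
      proof (cases "is_square (a * n * (b * m))")
        case True
        then obtain s where s: "a * n * (b * m) = s\<^sup>2" by (auto simp: is_nth_power_def)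
        have s': "a * n * (b * m) = s * s" using s by (simp add: power2_eq_square)
        have "odd (s * s)" using am odds unfolding s'[symmetric] by simp
        then have "odd s" by simp
        moreover have "\<not> p dvd s" if "p \<in> P" for p using nd[OF that] unfolding s' by (metis dvd_mult)
        ultimately have W1: "W (a * n * (b * m)) = 1" unfolding s' by (rule W_square)
        have "Re (f (a * n) * cnj (f (b * m))) \<ge> 0"
          using class_F_props(3)[OF f, of "b * m" "a * n"] am True by (simp add: mult.commute)
        moreover have "Re (f (a * n) * cnj (f (b * m))) = 1" if "a * n = b * m"
        proof -
          have "f (a * n) * cnj (f (a * n)) = of_real ((cmod (f (a * n)))\<^sup>2)" by (rule complex_norm_square[symmetric])
          also have "cmod (f (a * n)) = 1" using class_F_props(2)[OF f, of "a * n"] am by simp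
          finally show ?thesis using that by simp
        qed
        ultimately have "(if k i = k j then \<rho> i * \<rho> j else 0) \<le> Re (c i * cnj (c j)) * W (k i * k j)"
          unfolding kk W1 Rc using rr by auto
        moreover have "E * (\<rho> i * \<rho> j) \<ge> 0" using E0 rr by simp
        ultimately show ?thesis by linarith
      next
        case False
        then have neq: "k i \<noteq> k j" unfolding kk by (auto simp: is_nth_power_def power2_eq_square)
        have "real (a * n * (b * m)) \<le> Q"
        proof -
          have "real a * real n * (real b * real m) \<le> (real M * real N) * (real M * real N)"
            using am by (intro mult_mono) auto
          then show ?thesis using Q by (simp add: power2_eq_square)
        qed
        then have "\<bar>W (a * n * (b * m))\<bar> \<le> E" using False am odds by (intro W_nonsquare) auto
        moreover have "\<bar>Re (c i * cnj (c j))\<bar> \<le> \<rho> i * \<rho> j"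
        proof -
          have "\<bar>Re (f (a * n) * cnj (f (b * m)))\<bar> \<le> cmod (f (a * n) * cnj (f (b * m)))" by (rule abs_Re_le_cmod)
          also have "\<dots> = 1" using class_F_props(2)[OF f] am by (simp add: norm_mult)
          finally have "r a * r b * \<bar>Re (f (a * n) * cnj (f (b * m)))\<bar> \<le> r a * r b * 1" using rnn by (intro mult_left_mono) auto
          then show ?thesis unfolding Rc rr using rnn by (simp add: abs_mult)
        qed
        ultimately have "\<bar>Re (c i * cnj (c j))\<bar> * \<bar>W (k i * k j)\<bar> \<le> (\<rho> i * \<rho> j) * E"
          unfolding kk using rr by (intro mult_mono) auto
        then have "\<bar>Re (c i * cnj (c j)) * W (k i * k j)\<bar> \<le> E * (\<rho> i * \<rho> j)" by (simp only: abs_mult mult.commute)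
        then show ?thesis using neq by (simp add: abs_le_iff)
      qed
    qed
  qed
  also have "(\<Sum>i\<in>I. \<Sum>j\<in>I. (if k i = k j then \<rho> i * \<rho> j else 0) - E * (\<rho> i * \<rho> j)) = (\<Sum>i\<in>I. \<Sum>j\<in>I. if k i = k j then \<rho> i * \<rho> j else 0) - E * (\<Sum>i\<in>I. \<rho> i)\<^sup>2"
    unfolding power2_eq_square sum_product by (simp add: sum_subtractf sum_distrib_left)
  finally have 1: "(\<Sum>i\<in>I. \<Sum>j\<in>I. if k i = k j then \<rho> i * \<rho> j else 0) - E * (\<Sum>i\<in>I. \<rho> i)\<^sup>2 \<le> (\<Sum>p\<in>P. w p * (cmod (R p * S p))\<^sup>2)" .
  have "(\<Sum>i\<in>I. \<Sum>j\<in>I. if k i = k j then \<rho> i * \<rho> j else 0) = T"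
  proof -
    have "(\<Sum>i\<in>I. \<Sum>j\<in>I. if k i = k j then \<rho> i * \<rho> j else 0) = (\<Sum>a=1..M. \<Sum>n\<in>Od. \<Sum>b=1..M. \<Sum>m\<in>Od. if a * n = b * m then r a * r b else 0)"
    proof -
      have *: "(\<Sum>i\<in>I. g i) = (\<Sum>a=1..M. \<Sum>n\<in>Od. g (a, n))" for g :: "nat \<times> nat \<Rightarrow> real"
        unfolding I_def by (simp add: sum.cartesian_product)
      show ?thesis unfolding * by (simp only: k_def \<rho>_def prod.case)
    qed
    also have "\<dots> = (\<Sum>a=1..M. \<Sum>b=1..M. \<Sum>n\<in>Od. \<Sum>m\<in>Od. if a * n = b * m then r a * r b else 0)"
      by (rule sum.cong[OF refl], rule sum.swap)
    also have "\<dots> = T"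
      unfolding T_def
    proof (rule sum.cong[OF refl], rule sum.cong[OF refl])
      fix a b
      let ?C = "{(m, n). m \<in> {1..N} \<and> n \<in> {1..N} \<and> odd m \<and> odd n \<and> a * n = b * m}"
      have "(\<Sum>n\<in>Od. \<Sum>m\<in>Od. if a * n = b * m then r a * r b else 0) = (\<Sum>m\<in>Od. \<Sum>n\<in>Od. if a * n = b * m then r a * r b else 0)"
        by (rule sum.swap)
      also have "\<dots> = (\<Sum>z\<in>Od \<times> Od. if a * snd z = b * fst z then r a * r b else 0)"
        by (simp add: sum.cartesian_product case_prod_unfold)
      also have "\<dots> = (\<Sum>z\<in>?C. r a * r b)"
        by (rule sum.mono_neutral_cong_right) (auto simp: Od_def)
      finally show "(\<Sum>n\<in>Od. \<Sum>m\<in>Od. if a * n = b * m then r a * r b else 0) = r a * r b * real (card ?C)" by (simp add: mult.commute)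
    qed
    finally show ?thesis .
  qed
  moreover have "(\<Sum>i\<in>I. \<rho> i)\<^sup>2 \<le> real M * (real N)\<^sup>2 * r2"
  proof -
    have "(\<Sum>i\<in>I. \<rho> i) = real (card Od) * (\<Sum>a=1..M. r a)"
    proof -
      have "(\<Sum>i\<in>I. \<rho> i) = (\<Sum>a=1..M. \<Sum>n\<in>Od. \<rho> (a, n))"
        unfolding I_def by (simp add: sum.cartesian_product)
      then show ?thesis by (simp add: \<rho>_def sum_distrib_left)
    qed
    then have "(\<Sum>i\<in>I. \<rho> i)\<^sup>2 = (real (card Od))\<^sup>2 * (\<Sum>a=1..M. r a)\<^sup>2" by (simp add: power_mult_distrib)
    also have "\<dots> \<le> (real N)\<^sup>2 * (real M * r2)"
    proof (intro mult_mono sum_r_square power_mono)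
      have "card Od \<le> card {1..N}" unfolding Od_def by (intro card_mono) auto
      then show "real (card Od) \<le> real N" by simp
    qed auto
    finally show ?thesis by (simp add: mult_ac)
  qed
  then have "E * (\<Sum>i\<in>I. \<rho> i)\<^sup>2 \<le> E * (real M * (real N)\<^sup>2 * r2)" using E0 by (intro mult_left_mono)
  ultimately show ?thesis using 1 by (simp add: mult.assoc)
qed

theorem resonance_inequality:
  assumes "\<And>p. p \<in> P \<Longrightarrow> (cmod (S p))\<^sup>2 \<le> V" "V \<ge> 0"
  shows "T - E * real M * (real N)\<^sup>2 * r2 \<le> V * ((1 + E * real M) * r2)"
proof -
  have "(\<Sum>p\<in>P. w p * (cmod (R p * S p))\<^sup>2) \<le> (\<Sum>p\<in>P. V * (w p * (cmod (R p))\<^sup>2))"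
  proof (rule sum_mono)
    fix p assume "p \<in> P"
    then have "w p * (cmod (R p))\<^sup>2 * (cmod (S p))\<^sup>2 \<le> w p * (cmod (R p))\<^sup>2 * V" using assms wnn by (intro mult_left_mono) auto
    then show "w p * (cmod (R p * S p))\<^sup>2 \<le> V * (w p * (cmod (R p))\<^sup>2)" by (simp add: norm_mult power_mult_distrib mult_ac)
  qed
  also have "\<dots> = V * (\<Sum>p\<in>P. w p * (cmod (R p))\<^sup>2)" by (simp add: sum_distrib_left)
  also have "\<dots> \<le> V * ((1 + E * real M) * r2)" using denominator assms(2) by (intro mult_left_mono)
  finally show ?thesis using numerator by linarith
qed

end

text \<open>Each \<eta> = 1/(n + 2) has a threshold X0 n. Let k X be the largest n <= X whose
  threshold is at most X: it tends to infinity, and 1/(k X + 2) is the function sought. The 2 keeps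
  \<eta> below 1. Since N and f are quantified inside P, the resulting o(1) is uniform in
  them.\<close>

lemma eventually_diagonal:
  fixes P :: "real \<Rightarrow> real \<Rightarrow> bool"
  assumes "\<And>\<eta>. 0 < \<eta> \<Longrightarrow> \<eta> < 1 \<Longrightarrow> \<forall>\<^sub>F X in at_top. P \<eta> X"
  shows "\<exists>e. (e \<longlongrightarrow> 0) at_top \<and> (\<forall>\<^sub>F X in at_top. P (e X) X)"
proof -
  have "\<exists>X0. \<forall>X\<ge>X0. P (1 / (real n + 2)) X" for n :: nat
    using assms[of "1 / (real n + 2)"] by (simp add: eventually_at_top_linorder)
  then obtain X0 where X0: "\<And>n X. X \<ge> X0 n \<Longrightarrow> P (1 / (real n + 2)) X" by metis
  define A where "A X = {n. n \<le> nat \<lfloor>X\<rfloor> \<and> X0 n \<le> X}" for X :: real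
  define k where "k X = Max (A X)" for X
  have finA: "finite (A X)" for X unfolding A_def by (rule finite_subset[of _ "{..nat \<lfloor>X\<rfloor>}"]) auto
  have memA: "n \<in> A X" if "X \<ge> max (real n) (X0 n)" for n X
    using that by (auto simp: A_def le_nat_floor)
  have "\<forall>\<^sub>F X in at_top. k X \<ge> n" for n
    using eventually_ge_at_top[of "max (real n) (X0 n)"]
    by eventually_elim (auto simp only: k_def intro!: Max_ge finA memA)
  then have "filterlim k at_top at_top" by (simp add: filterlim_at_top)
  then have "filterlim (\<lambda>X. real (k X)) at_top at_top"
    by (rule filterlim_compose[OF filterlim_real_sequentially])
  then have "((\<lambda>X. 1 / (real (k X) + 2)) \<longlongrightarrow> 0) at_top"
    by (rule filterlim_compose[rotated]) real_asymp
  moreover have "\<forall>\<^sub>F X in at_top. P (1 / (real (k X) + 2)) X"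
    using eventually_ge_at_top[of "max (real 0) (X0 0)"]
  proof eventually_elim
    case (elim X)
    have "k X \<in> A X" unfolding k_def using finA memA[OF elim] by (intro Max_in) auto
    then show ?case by (intro X0) (simp add: A_def)
  qed
  ultimately show ?thesis by blast
qed

text \<open>E M N <= 1/2 limits the error in the numerator to half of the main term and makes 1 + E
  M at most 2, so N' A / 2 <= 2 B^2. In the application N' is the real length and N its integer
  part.\<close>

lemma resonance_bound:
  assumes "resonance P w E Q f r M N" "E * real M * real N \<le> 1 / 2" "real N \<le> N'" "A \<ge> 1"
    and "N' * A * (\<Sum>a=1..M. (r a)\<^sup>2) \<le> resonance.T r M N" "r 1 = 1" "M \<ge> 1"
    and "\<And>p. p \<in> P \<Longrightarrow> cmod (\<Sum>n=1..N. f n * of_int (kronecker (8 * int p) n)) \<le> B" "B \<ge> 0"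
  shows "sqrt N' * sqrt A / 2 \<le> B"
proof -
  interpret resonance P w E Q f r M N by fact
  have "(r 1)\<^sup>2 \<le> r2" unfolding r2_def using assms(7) by (intro member_le_sum) auto
  then have r2: "r2 > 0" using assms(6) by simp
  have N': "N' \<ge> 0" using assms(3) by linarith
  have "(cmod (S p))\<^sup>2 \<le> B\<^sup>2" if "p \<in> P" for p
    using assms(8)[OF that] by (intro power_mono) (auto simp: S_def h_def)
  then have "T - E * real M * (real N)\<^sup>2 * r2 \<le> B\<^sup>2 * ((1 + E * real M) * r2)"
    by (rule resonance_inequality) auto
  moreover have "E * real M * (real N)\<^sup>2 * r2 \<le> N' * A / 2 * r2"
  proof (rule mult_right_mono)
    have "E * real M * (real N)\<^sup>2 = (E * real M * real N) * real N" by (simp add: power2_eq_square)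
    also have "\<dots> \<le> (1 / 2) * N'" using assms(2,3) E0 by (intro mult_mono) auto
    also have "\<dots> \<le> N' * A / 2" using assms(4) N' mult_left_mono[of 1 A N'] by simp
    finally show "E * real M * (real N)\<^sup>2 \<le> N' * A / 2" .
  qed (use r2 in simp)
  moreover have "B\<^sup>2 * ((1 + E * real M) * r2) \<le> B\<^sup>2 * (2 * r2)"
  proof -
    have "E * real M * 1 \<le> E * real M * real N" using N E0 by (intro mult_left_mono) auto
    then have "1 + E * real M \<le> 2" using assms(2) by linarith
    then show ?thesis using r2 by (intro mult_left_mono mult_right_mono) auto
  qed
  moreover have "N' * A * r2 \<le> T" using assms(5) unfolding r2_def .
  ultimately have "N' * A * r2 - N' * A / 2 * r2 \<le> B\<^sup>2 * (2 * r2)" by linarith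
  then have "(N' * A / 4) * r2 \<le> B\<^sup>2 * r2" by (simp add: algebra_simps)
  then have "N' * A / 4 \<le> B\<^sup>2" using r2 by simp
  then have "sqrt (N' * A / 4) \<le> B" using assms(9) by (metis real_sqrt_le_mono real_sqrt_abs abs_of_nonneg)
  then show ?thesis by (simp add: real_sqrt_mult real_sqrt_divide)
qed

lemma large_character_sums:
  fixes \<delta> \<eta> :: real
  assumes GRH and \<delta>: "0 < \<delta>" and \<eta>: "0 < \<eta>" "\<eta> < 1"
  shows "\<forall>\<^sub>F X :: real in at_top. \<forall>N :: real. \<forall>f \<in> class_F.
       0 < N \<and> exp (ln X powr (1 / 2 + \<delta>)) \<le> N \<and> N \<le> X powr (1 / 4 - \<delta>) \<longrightarrow>
       Max ((\<lambda>d. cmod (\<Sum>n = 1..nat \<lfloor>N\<rfloor>. f n * of_int (kronecker d n))) `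
            {d. fundamental_discriminant d \<and> X < \<bar>real_of_int d\<bar> \<and> \<bar>real_of_int d\<bar> \<le> 2 * X})
         \<ge> sqrt N * exp ((sqrt 2 / 2 - \<eta>) * sqrt (ln (X / N ^ 4) / ln (ln (X / N ^ 4))))"
proof -
  define \<epsilon> where "\<epsilon> = \<eta> / 2"
  define \<epsilon>2 where "\<epsilon>2 = \<eta> / 8"
  \<comment> \<open>Just below 1/2, so that M N <= X^\<beta> is outweighed by the error E of size
    X^(-1/2 + \<epsilon>2/2).\<close>
  define \<beta> where "\<beta> = 1 / 2 - \<epsilon>2"
  have \<epsilon>: "0 < \<epsilon>" "0 < \<epsilon>2" "\<epsilon>2 < 1 / 8" "\<beta> > 0" "\<beta> < 1 / 2" using \<eta> by (auto simp: \<epsilon>_def \<epsilon>2_def \<beta>_def)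
  \<comment> \<open>1 - \<epsilon>/2 is half of the exponent 2 - \<epsilon> of the resonator, and
    sqrt \<beta> comes from l = \<beta> \<Lambda>. Their product tends to sqrt 2 / 2 with \<eta>;
    half of \<eta> is kept in reserve.\<close>
  have const: "sqrt 2 / 2 - \<eta> / 2 \<le> (1 - \<epsilon> / 2) * sqrt \<beta>"
  proof -
    have s2: "sqrt 2 / 2 \<le> 1" using real_sqrt_le_mono[of 2 4] by simp
    have "(1 - 2 * \<epsilon>2)\<^sup>2 \<le> 1 - 2 * \<epsilon>2" unfolding power2_eq_square using \<epsilon> by (intro mult_left_le) auto
    then have "((1 - 2 * \<epsilon>2) * (sqrt 2 / 2))\<^sup>2 \<le> \<beta>" by (simp add: power_mult_distrib power_divide \<beta>_def)
    then have s: "(1 - 2 * \<epsilon>2) * (sqrt 2 / 2) \<le> sqrt \<beta>" by (rule real_le_rsqrt)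
    have "(sqrt 2 / 2) * (\<eta> / 2) \<le> \<eta> / 2" using s2 \<eta> by (intro mult_left_le_one_le) auto
    then have "sqrt 2 / 2 - \<eta> / 2 \<le> (1 - \<eta> / 2) * (sqrt 2 / 2)" by (simp add: algebra_simps)
    also have "\<dots> \<le> ((1 - \<epsilon> / 2) * (1 - 2 * \<epsilon>2)) * (sqrt 2 / 2)"
    proof (rule mult_right_mono)
      have "(1 - \<epsilon> / 2) * (1 - 2 * \<epsilon>2) = 1 - \<epsilon> / 2 - 2 * \<epsilon>2 + \<epsilon> * \<epsilon>2" by (simp add: algebra_simps)
      moreover have "\<epsilon> * \<epsilon>2 \<ge> 0" using \<epsilon> by simp
      ultimately show "1 - \<eta> / 2 \<le> (1 - \<epsilon> / 2) * (1 - 2 * \<epsilon>2)" by (simp add: \<epsilon>_def \<epsilon>2_def)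
    qed simp
    also have "\<dots> \<le> (1 - \<epsilon> / 2) * sqrt \<beta>" unfolding mult.assoc using s \<eta> by (intro mult_left_mono) (auto simp: \<epsilon>_def)
    finally show ?thesis .
  qed
  obtain l0 where l0: "\<forall>l\<ge>l0. \<forall>N. N \<ge> 1 \<and> ln N \<ge> l powr (1/2 + \<delta>) \<longrightarrow>
    (\<exists>r. (\<forall>a. r a \<ge> 0) \<and> r 1 = (1::real) \<and> (\<forall>a. r a \<noteq> 0 \<longrightarrow> a > 0 \<and> odd a \<and> squarefree a \<and> real a \<le> exp l) \<and>
      N * exp ((2 - \<epsilon>) * sqrt (l / ln l)) * (\<Sum>a=1..nat \<lfloor>exp l\<rfloor>. (r a)\<^sup>2) \<le>
      (\<Sum>a=1..nat \<lfloor>exp l\<rfloor>. \<Sum>b=1..nat \<lfloor>exp l\<rfloor>. r a * r b *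
       real (card {(m, n). m \<in> {1..nat \<lfloor>N\<rfloor>} \<and> n \<in> {1..nat \<lfloor>N\<rfloor>} \<and> odd m \<and> odd n \<and> a * n = b * m})))"
    using gcd_sum_resonator[OF \<epsilon>(1) \<delta>] unfolding eventually_at_top_linorder by (elim exE)
  have "\<forall>\<^sub>F t :: real in at_top. exp (- (\<eta> / 2 * sqrt (t / ln t))) \<le> 1 / 2" using \<eta> by real_asymp
  then obtain t0 where t0: "\<And>t. t \<ge> t0 \<Longrightarrow> exp (- (\<eta> / 2 * sqrt (t / ln t))) \<le> 1 / 2"
    unfolding eventually_at_top_linorder by blast
  have lim8: "filterlim (\<lambda>X :: real. X / 8) at_top at_top" by real_asymp
  have weights: "\<forall>\<^sub>F X in at_top. \<exists>w. (\<forall>p. w p \<ge> 0) \<and> (\<Sum>p | prime p \<and> X / 8 < real p \<and> real p \<le> 2 * (X / 8). w p) = (1::real) \<and>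
     (\<forall>n. odd n \<and> \<not> is_square n \<and> real n \<le> (X / 8) ^ 3 \<longrightarrow>
        \<bar>\<Sum>p | prime p \<and> X / 8 < real p \<and> real p \<le> 2 * (X / 8). w p * of_int (kronecker (int p) n)\<bar> \<le> (X / 8) powr (-1/2 + \<epsilon>2 / 2))"
    using eventually_compose_filterlim[OF GRH_prime_weights[OF \<open>GRH\<close>, of "\<epsilon>2 / 2"] lim8] \<epsilon> by simp
  have a1: "\<forall>\<^sub>F X :: real in at_top. X powr \<beta> \<le> X / 8" unfolding \<beta>_def using \<epsilon>(2,3) by real_asymp
  have a2: "\<forall>\<^sub>F X :: real in at_top. (X / 8) powr (-1/2 + \<epsilon>2 / 2) * X powr \<beta> \<le> 1 / 2" unfolding \<beta>_def using \<epsilon>(2,3) by real_asymp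
  have a3: "\<forall>\<^sub>F X :: real in at_top. (X powr \<beta>)\<^sup>2 \<le> (X / 8) ^ 3" unfolding \<beta>_def using \<epsilon>(2,3) by real_asymp
  \<comment> \<open>For every admissible N, \<Lambda> = ln (X / N^4) is at least 4 \<delta> ln X. So
    one threshold for X takes care of those for \<Lambda> and l, uniformly in N.\<close>
  have a4: "\<forall>\<^sub>F X :: real in at_top. max t0 (max l0 2 / \<beta>) \<le> 4 * \<delta> * ln X" using \<delta> by real_asymp
  show ?thesis
    using weights a1 a2 a3 a4 eventually_ge_at_top[of 16]
  proof eventually_elim
    case (elim X)
    define P where "P = {p. prime p \<and> X / 8 < real p \<and> real p \<le> 2 * (X / 8)}"
    define E where "E = (X / 8) powr (-1/2 + \<epsilon>2 / 2)"
    obtain w where w: "\<And>p. w p \<ge> 0" "(\<Sum>p\<in>P. w p) = (1::real)"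
      "\<And>n. odd n \<Longrightarrow> \<not> is_square n \<Longrightarrow> real n \<le> (X / 8) ^ 3 \<Longrightarrow> \<bar>\<Sum>p\<in>P. w p * of_int (kronecker (int p) n)\<bar> \<le> E"
      using elim(1) unfolding P_def E_def by blast
    have finP: "finite P" unfolding P_def
      by (rule finite_subset[of _ "{..nat \<lfloor>2 * (X / 8)\<rfloor>}"]) (auto simp: le_nat_floor)
    have X: "X \<ge> 16" by fact
    have lnX: "ln X \<ge> 0" using X by simp
    show ?case
    proof (intro allI ballI impI, elim conjE)
      fix N f assume f: "f \<in> class_F" and N0: "0 < N" and Nlow: "exp (ln X powr (1 / 2 + \<delta>)) \<le> N"
        and Nup: "N \<le> X powr (1 / 4 - \<delta>)"
      define \<Lambda> where "\<Lambda> = ln (X / N ^ 4)"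
      have \<Lambda>: "\<Lambda> = ln X - 4 * ln N" using X N0 by (simp add: \<Lambda>_def ln_div ln_realpow)
      have lnN: "ln X powr (1/2 + \<delta>) \<le> ln N" using ln_mono[OF Nlow] N0 by simp
      then have lnN0: "ln N \<ge> 0" by (rule order_trans[rotated]) simp
      then have N1: "N \<ge> 1" using N0 by simp
      have "ln N \<le> ln (X powr (1 / 4 - \<delta>))" using Nup N0 by (intro ln_mono)
      also have "\<dots> = (1 / 4 - \<delta>) * ln X" using X by (simp add: ln_powr)
      finally have "4 * \<delta> * ln X \<le> \<Lambda>" unfolding \<Lambda> by (simp add: algebra_simps)
      then have \<Lambda>t: "\<Lambda> \<ge> t0" "\<Lambda> \<ge> max l0 2 / \<beta>" using elim(5) by simp_all
      define l where "l = \<beta> * \<Lambda>"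
      have ll: "l \<ge> l0" "l \<ge> 2" using \<Lambda>t(2) \<epsilon>(4) by (auto simp: l_def pos_divide_le_eq mult.commute)
      have \<Lambda>0: "\<Lambda> > 0" using ll(2) \<epsilon>(4) unfolding l_def by (metis less_le_trans zero_less_mult_pos zero_less_numeral)
      have l\<Lambda>: "l \<le> \<Lambda>" unfolding l_def using \<Lambda>0 \<epsilon>(5) by (simp add: mult_left_le_one_le)
      have "\<Lambda> \<le> ln X" unfolding \<Lambda> using lnN0 by simp
      then have "l powr (1/2 + \<delta>) \<le> ln X powr (1/2 + \<delta>)" using l\<Lambda> ll \<delta> by (intro powr_mono2) auto
      then have lN: "l powr (1/2 + \<delta>) \<le> ln N" using lnN by linarith
      define M where "M = nat \<lfloor>exp l\<rfloor>"
      define n where "n = nat \<lfloor>N\<rfloor>"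
      obtain r where r: "\<forall>a. r a \<ge> 0" "r 1 = (1::real)" "\<forall>a. r a \<noteq> 0 \<longrightarrow> a > 0 \<and> odd a \<and> squarefree a \<and> real a \<le> exp l"
        and rT: "N * exp ((2 - \<epsilon>) * sqrt (l / ln l)) * (\<Sum>a=1..M. (r a)\<^sup>2) \<le>
          (\<Sum>a=1..M. \<Sum>b=1..M. r a * r b *
            real (card {(m, n'). m \<in> {1..n} \<and> n' \<in> {1..n} \<and> odd m \<and> odd n' \<and> a * n' = b * m}))"
        using l0[THEN spec, THEN mp, OF ll(1), THEN spec, THEN mp, OF conjI[OF N1 lN]] unfolding M_def n_def by (elim exE conjE)
      have M1: "M \<ge> 1" "real M \<le> exp l" using ll(2) by (auto simp: M_def le_nat_floor)
      have n1: "n \<ge> 1" "real n \<le> N" using N1 by (auto simp: n_def le_nat_floor)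
      have "real M * real n \<le> exp l * exp (ln N)" using M1 n1 N0 by (intro mult_mono) auto
      also have "\<dots> = exp (l + ln N)" by (simp add: exp_add)
      \<comment> \<open>The 4 \<beta> ln N subtracted in l outweighs ln N because 4 \<beta> >=
        1.\<close>
      also have "l + ln N \<le> \<beta> * ln X"
      proof -
        have "1 * ln N \<le> (4 * \<beta>) * ln N" using lnN0 \<epsilon>(3) by (intro mult_right_mono) (auto simp: \<beta>_def)
        then show ?thesis unfolding l_def \<Lambda> by (simp add: algebra_simps)
      qed
      also have "exp (\<beta> * ln X) = X powr \<beta>" using X by (simp add: powr_def)
      finally have Mn: "real M * real n \<le> X powr \<beta>" by simp
      have E0: "E \<ge> 0" by (simp add: E_def)
      have "real M * 1 \<le> real M * real n" "1 * real n \<le> real M * real n"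
        using M1 n1 by (auto intro!: mult_mono)
      then have small: "real M \<le> X / 8" "real n \<le> X / 8" using Mn elim(2) by linarith+
      interpret resonance P w E "(X / 8) ^ 3" f r M n
      proof
        fix p assume p: "p \<in> P"
        then have "real p > X / 8" by (simp add: P_def)
        then have "real p > real M" "real p > real n" "real p > real 2" using small X by simp_all
        then show "p > M \<and> p > n \<and> p > 2" unfolding of_nat_less_iff by blast
        show "prime p" using p by (simp add: P_def)
      next
        have "(real M * real n)\<^sup>2 \<le> (X powr \<beta>)\<^sup>2" using Mn by (intro power_mono) auto
        then show "(real M * real n)\<^sup>2 \<le> (X / 8) ^ 3" using elim(4) by linarith
      qed (use finP w E0 f r n1 in auto)
      define G where "G = (\<lambda>d. cmod (\<Sum>n = 1..n. f n * of_int (kronecker d n)))"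
      define D where "D = {d. fundamental_discriminant d \<and> X < \<bar>real_of_int d\<bar> \<and> \<bar>real_of_int d\<bar> \<le> 2 * X}"
      have finD: "finite D"
      proof (rule finite_subset)
        show "D \<subseteq> {-\<lfloor>2 * X\<rfloor>..\<lfloor>2 * X\<rfloor>}" unfolding D_def by (safe; unfold atLeastAtMost_iff; linarith)
      qed simp
      have DP: "8 * int p \<in> D" if p: "p \<in> P" for p
        using p largeP[OF p] fundamental_discriminant_8p[of p] by (simp add: D_def P_def)
      have GB: "G (8 * int p) \<le> Max (G ` D)" if "p \<in> P" for p
        using DP[OF that] finD by (intro Max_ge) auto
      obtain p where p: "p \<in> P" using wsum by fastforce
      have "0 \<le> G (8 * int p)" by (simp add: G_def)
      then have B0: "0 \<le> Max (G ` D)" using GB[OF p] by linarith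
      have lnl: "ln l > 0" using ll by simp
      define Y where "Y = sqrt (\<Lambda> / ln \<Lambda>)"
      have Y0: "Y \<ge> 0" using l\<Lambda> ll by (simp add: Y_def)
      have "sqrt N * sqrt (exp ((2 - \<epsilon>) * sqrt (l / ln l))) / 2 \<le> Max (G ` D)"
      proof (rule resonance_bound[OF resonance_axioms _ n1(2) _ _ r(2) M1(1) _ B0])
        have "E * (real M * real n) \<le> E * X powr \<beta>" using Mn E0 by (intro mult_left_mono)
        then show "E * real M * real n \<le> 1 / 2" using elim(3) unfolding E_def by (simp add: mult.assoc)
        show "1 \<le> exp ((2 - \<epsilon>) * sqrt (l / ln l))" using \<eta> ll lnl by (simp add: \<epsilon>_def)
        show "N * exp ((2 - \<epsilon>) * sqrt (l / ln l)) * (\<Sum>a = 1..M. (r a)\<^sup>2) \<le> T" unfolding T_def by (rule rT)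
        show "cmod (\<Sum>n = 1..n. f n * of_int (kronecker (8 * int p) n)) \<le> Max (G ` D)" if "p \<in> P" for p
          using GB[OF that] unfolding G_def .
      qed
      \<comment> \<open>The reserve exp(-\<eta> Y / 2) pays for the factor 1/2 of
        \<open>resonance_bound\<close>; sqrt(l / ln l) is at least sqrt \<beta> times Y since ln l
        <= ln \<Lambda>.\<close>
      moreover have "exp ((sqrt 2 / 2 - \<eta>) * Y) \<le> sqrt (exp ((2 - \<epsilon>) * sqrt (l / ln l))) / 2"
      proof -
        have "sqrt \<beta> * Y = sqrt (l / ln \<Lambda>)" by (simp add: Y_def l_def real_sqrt_mult[symmetric])
        also have "\<dots> \<le> sqrt (l / ln l)" using ll l\<Lambda> lnl by (intro real_sqrt_le_mono divide_left_mono ln_mono mult_pos_pos) auto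
        finally have sY: "sqrt \<beta> * Y \<le> sqrt (l / ln l)" .
        have "(sqrt 2 / 2 - \<eta> / 2) * Y \<le> ((1 - \<epsilon> / 2) * sqrt \<beta>) * Y" using const Y0 by (intro mult_right_mono)
        also have "\<dots> \<le> (1 - \<epsilon> / 2) * sqrt (l / ln l)" unfolding mult.assoc using sY \<eta> by (intro mult_left_mono) (auto simp: \<epsilon>_def)
        finally have e: "(sqrt 2 / 2 - \<eta> / 2) * Y \<le> (1 - \<epsilon> / 2) * sqrt (l / ln l)" .
        have "sqrt (exp ((2 - \<epsilon>) * sqrt (l / ln l))) = exp ((1 - \<epsilon> / 2) * sqrt (l / ln l))"
          by (rule real_sqrt_unique) (auto simp: power2_eq_square algebra_simps simp flip: exp_add)
        moreover have "exp ((sqrt 2 / 2 - \<eta>) * Y) = exp ((sqrt 2 / 2 - \<eta> / 2) * Y) * exp (- (\<eta> / 2 * Y))"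
          by (simp add: algebra_simps flip: exp_add)
        moreover have "\<dots> \<le> exp ((1 - \<epsilon> / 2) * sqrt (l / ln l)) * (1 / 2)"
          using e t0[OF \<Lambda>t(1)] unfolding Y_def by (intro mult_mono) auto
        ultimately show ?thesis by simp
      qed
      then have "sqrt N * exp ((sqrt 2 / 2 - \<eta>) * Y) \<le> sqrt N * (sqrt (exp ((2 - \<epsilon>) * sqrt (l / ln l))) / 2)"
        using N0 by (intro mult_left_mono) auto
      ultimately have "sqrt N * exp ((sqrt 2 / 2 - \<eta>) * Y) \<le> Max (G ` D)" by simp
      then show "sqrt N * exp ((sqrt 2 / 2 - \<eta>) * sqrt (ln (X / N ^ 4) / ln (ln (X / N ^ 4)))) \<le>
        Max ((\<lambda>d. cmod (\<Sum>n = 1..nat \<lfloor>N\<rfloor>. f n * of_int (kronecker d n))) `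
            {d. fundamental_discriminant d \<and> X < \<bar>real_of_int d\<bar> \<and> \<bar>real_of_int d\<bar> \<le> 2 * X})"
        unfolding Y_def \<Lambda>_def G_def D_def n_def .
    qed
  qed
qed

theorem theorem1p1:
  fixes \<delta> :: real
  assumes GRH
    and "0 < \<delta>" "\<delta> < 1 / 100"
  shows "\<exists>\<epsilon> :: real \<Rightarrow> real. (\<epsilon> \<longlongrightarrow> 0) at_top \<and>
    (\<forall>\<^sub>F X :: real in at_top. \<forall>N :: real. \<forall>f \<in> class_F.
       0 < N \<and> exp (ln X powr (1 / 2 + \<delta>)) \<le> N \<and> N \<le> X powr (1 / 4 - \<delta>) \<longrightarrow>
       Max ((\<lambda>d. cmod (\<Sum>n = 1..nat \<lfloor>N\<rfloor>. f n * of_int (kronecker d n))) `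
            {d. fundamental_discriminant d \<and> X < \<bar>real_of_int d\<bar> \<and> \<bar>real_of_int d\<bar> \<le> 2 * X})
         \<ge> sqrt N * exp ((sqrt 2 / 2 + \<epsilon> X) * sqrt (ln (X / N ^ 4) / ln (ln (X / N ^ 4)))))"
proof -
  have "\<exists>e. (e \<longlongrightarrow> 0) at_top \<and> (\<forall>\<^sub>F X :: real in at_top. \<forall>N :: real. \<forall>f \<in> class_F.
       0 < N \<and> exp (ln X powr (1 / 2 + \<delta>)) \<le> N \<and> N \<le> X powr (1 / 4 - \<delta>) \<longrightarrow>
       Max ((\<lambda>d. cmod (\<Sum>n = 1..nat \<lfloor>N\<rfloor>. f n * of_int (kronecker d n))) `
            {d. fundamental_discriminant d \<and> X < \<bar>real_of_int d\<bar> \<and> \<bar>real_of_int d\<bar> \<le> 2 * X})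
         \<ge> sqrt N * exp ((sqrt 2 / 2 - e X) * sqrt (ln (X / N ^ 4) / ln (ln (X / N ^ 4)))))"
    by (rule eventually_diagonal) (rule large_character_sums[OF assms(1,2)])
  then obtain e where e: "(e \<longlongrightarrow> 0) at_top" and large: "\<forall>\<^sub>F X :: real in at_top. \<forall>N :: real. \<forall>f \<in> class_F.
       0 < N \<and> exp (ln X powr (1 / 2 + \<delta>)) \<le> N \<and> N \<le> X powr (1 / 4 - \<delta>) \<longrightarrow>
       Max ((\<lambda>d. cmod (\<Sum>n = 1..nat \<lfloor>N\<rfloor>. f n * of_int (kronecker d n))) `
            {d. fundamental_discriminant d \<and> X < \<bar>real_of_int d\<bar> \<and> \<bar>real_of_int d\<bar> \<le> 2 * X})
         \<ge> sqrt N * exp ((sqrt 2 / 2 - e X) * sqrt (ln (X / N ^ 4) / ln (ln (X / N ^ 4))))"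
    by (elim exE conjE)
  have "((\<lambda>X. - e X) \<longlongrightarrow> 0) at_top" using tendsto_minus[OF e] by simp
  moreover have "sqrt 2 / 2 - e X = sqrt 2 / 2 + - e X" for X by simp
  ultimately show ?thesis using large by (intro exI[of _ "\<lambda>X. - e X"] conjI) (simp_all only:)
qed

end
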